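(* Let $\gamma>0$, $0<r\le1$, and let $\Lambda^{(2)}_*$ be the multiplier operator associated with $\lambda^{(2),*}_{m,n}=e^{-\gamma(m+n)^r}$, $m,n\in\mathbb{N}$. Let $1\le p\le\infty$ and $2\le q\le\infty$. Then for all $k\in\mathbb{N}$ $$d_k(\Lambda^{(2)}_*U_p,L^q)\ll e^{-\mathcal{R}_*k^{r/(2d-1)}}k^{(1-r/(2d-1))(1/p-1/2)_+}\begin{cases}q^{1/2},&q<\infty,\\(\ln k)^{1/2},&q=\infty,\end{cases}$$ where $\mathcal{R}_*=\gamma\big((2d-1)!/2\big)^{r/(2d-1)}$.
   Context: $\mathbb{N}=\{0,1,2,\dots\}$; $d\ge2$ is a fixed integer. $(a)_+=a$ if $a>0$ and $(a)_+=0$ if $a\le0$. The notation $a_k\ll b_k$ means that there is a constant $C>0$, independent of $k$, with $a_k\le Cb_k$; here it is understood for $k\ge2$. $\Omega_d$ is the unit sphere of $\mathbb{C}^d$ with surface measure $\sigma_d$ (the Lebesgue surface measure of $S^{2d-1}\subset\mathbb{R}^{2d}$ under $\mathbb{C}^d\cong\mathbb{R}^{2d}$). $L^p=L^p(\Omega_d)$ is the usual space of complex-valued functions, with closed unit ball $U_p$. $\mathcal{H}_{m,n}$ is the space of restrictions to $\Omega_d$ of polynomials in $z,\bar z$ homogeneous of degree $m$ in $z$ and degree $n$ in $\bar z$ and in the kernel of $4\sum_j\partial^2/\partial z_j\partial\bar z_j$. Let $Z_w^{(m,n)}$ be the reproducing kernel of $\mathcal{H}_{m,n}$ at $w\in\Omega_d$,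 and $(\varphi*\widetilde Z^{(m,n)})(w)=\int_{\Omega_d}\varphi\,\overline{Z_w^{(m,n)}}\,d\sigma_d$ (the orthogonal projection onto $\mathcal{H}_{m,n}$ on $L^2$). The multiplier operator $\Lambda$ associated with $\{\lambda_{m,n}\}$ sends $\varphi$ to the function $\Lambda\varphi$ with formal expansion $\Lambda\varphi\sim\sum_{m,n}\lambda_{m,n}\varphi*\widetilde Z^{(m,n)}$. Kolmogorov width: $d_n(A,X)=\inf_{X_n}\sup_{x\in A}\inf_{y\in X_n}\|x-y\|_X$, $X_n$ ranging over the subspaces of $X$ of dimension $n$. *)

theory Defs
  imports "HOL-Analysis.Analysis" "HOL-Probability.Essential_Supremum"
begin

section \<open>The unit sphere and its surface measure\<close>

text \<open>
  Surface measure via polar coordinates: a Borel set \<open>A\<close> of the unit sphere of an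
  \<open>N\<close>-dimensional Euclidean space has measure \<open>N\<close> times the volume of the cone
  \<open>{x. 0 < norm x \<le> 1 \<and> x / norm x \<in> A}\<close>.  It is not normalised.
  For \<open>complex ^ 'd\<close> the real dimension \<open>N\<close> is \<open>2 * CARD('d)\<close>, and \<open>sphere 0 1\<close> is the
  unit sphere of complex \<open>d\<close>-space.
\<close>

definition sphere_measure :: "'a::euclidean_space measure" where
  "sphere_measure =
     scale_measure (of_nat DIM('a))
       (distr (restrict_space lborel (cball 0 1 - {0}))
              (restrict_space borel (sphere 0 1))
              (\<lambda>x. x /\<^sub>R norm x))"


section \<open>Lebesgue spaces and Kolmogorov widths\<close>

text \<open>
  Elements of \<open>L\<^sup>p\<close> are represented by measurable functions, without passing to the quotient
  modulo null functions.  The exponent ranges over \<open>ennreal\<close>, with \<open>\<infinity>\<close> included.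
\<close>

definition Lp_norm :: "'a measure \<Rightarrow> ennreal \<Rightarrow> ('a \<Rightarrow> complex) \<Rightarrow> ennreal" where
  "Lp_norm M p f =
     (if p = \<infinity> then esssup M (\<lambda>x. ennreal (norm (f x)))
      else let I = (\<integral>\<^sup>+ x. ennreal (norm (f x) powr enn2real p) \<partial>M)
           in if I = \<infinity> then \<infinity> else ennreal (enn2real I powr (1 / enn2real p)))"

definition Lp_space :: "'a measure \<Rightarrow> ennreal \<Rightarrow> ('a \<Rightarrow> complex) set" where
  "Lp_space M p = {f \<in> borel_measurable M. Lp_norm M p f < \<infinity>}"

definition Lp_unit_ball :: "'a measure \<Rightarrow> ennreal \<Rightarrow> ('a \<Rightarrow> complex) set" where
  "Lp_unit_ball M p = {f \<in> borel_measurable M. Lp_norm M p f \<le> 1}"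

text \<open>
  The \<open>n\<close>-dimensional complex subspaces of \<open>L\<^sup>p\<close>, each given as the span of \<open>n\<close> functions.
  Linear independence is required modulo null functions, so that the dimension is
  the one of the subspace of the quotient space.
\<close>

definition Lp_subspaces :: "'a measure \<Rightarrow> ennreal \<Rightarrow> nat \<Rightarrow> ('a \<Rightarrow> complex) set set" where
  "Lp_subspaces M p n =
     {X. \<exists>b :: nat \<Rightarrow> 'a \<Rightarrow> complex.
           (\<forall>i<n. b i \<in> Lp_space M p) \<and>
           (\<forall>c :: nat \<Rightarrow> complex. (AE x in M. (\<Sum>i<n. c i * b i x) = 0) \<longrightarrow> (\<forall>i<n. c i = 0)) \<and>
           X = range (\<lambda>(c :: nat \<Rightarrow> complex) x. \<Sum>i<n. c i * b i x)}"

definition kolmogorov_width ::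
  "nat \<Rightarrow> ('a \<Rightarrow> complex) set \<Rightarrow> 'a measure \<Rightarrow> ennreal \<Rightarrow> ennreal" where
  "kolmogorov_width n A M q =
     (INF X\<in>Lp_subspaces M q n. SUP f\<in>A. INF g\<in>X. Lp_norm M q (\<lambda>x. f x - g x))"


section \<open>Spherical harmonics of bidegree \<open>(m, n)\<close>\<close>

definition bihomogeneous_polys :: "nat \<Rightarrow> nat \<Rightarrow> (complex ^ 'd \<Rightarrow> complex) set" where
  "bihomogeneous_polys m n =
     {P. \<exists>c :: ('d::finite \<Rightarrow> nat) \<Rightarrow> ('d \<Rightarrow> nat) \<Rightarrow> complex.
           P = (\<lambda>z. \<Sum>\<alpha> | (\<Sum>j\<in>UNIV. \<alpha> j) = m. \<Sum>\<beta> | (\<Sum>j\<in>UNIV. \<beta> j) = n.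
                  c \<alpha> \<beta> * (\<Prod>j\<in>UNIV. (z $ j) ^ \<alpha> j) * (\<Prod>j\<in>UNIV. cnj (z $ j) ^ \<beta> j))}"

definition directional_deriv ::
  "complex ^ 'd \<Rightarrow> (complex ^ 'd \<Rightarrow> complex) \<Rightarrow> complex ^ 'd::finite \<Rightarrow> complex" where
  "directional_deriv v f z = vector_derivative (\<lambda>t::real. f (z + t *\<^sub>R v)) (at 0)"

definition wirtinger_z :: "'d \<Rightarrow> (complex ^ 'd \<Rightarrow> complex) \<Rightarrow> complex ^ 'd::finite \<Rightarrow> complex" where
  "wirtinger_z j f z =
     (directional_deriv (axis j 1) f z - \<i> * directional_deriv (axis j \<i>) f z) / 2"

definition wirtinger_cnj :: "'d \<Rightarrow> (complex ^ 'd \<Rightarrow> complex) \<Rightarrow> complex ^ 'd::finite \<Rightarrow> complex" where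
  "wirtinger_cnj j f z =
     (directional_deriv (axis j 1) f z + \<i> * directional_deriv (axis j \<i>) f z) / 2"

definition complex_laplacian :: "(complex ^ 'd \<Rightarrow> complex) \<Rightarrow> complex ^ 'd::finite \<Rightarrow> complex" where
  "complex_laplacian f z = 4 * (\<Sum>j\<in>UNIV. wirtinger_z j (wirtinger_cnj j f) z)"

text \<open>Functions on the sphere are extended by \<open>0\<close>, so that restrictions are unique as functions.\<close>

definition sphere_harmonics :: "nat \<Rightarrow> nat \<Rightarrow> (complex ^ 'd::finite \<Rightarrow> complex) set" where
  "sphere_harmonics m n =
     {f. \<exists>P\<in>bihomogeneous_polys m n. (\<forall>z. complex_laplacian P z = 0) \<and>
           f = (\<lambda>z. if z \<in> sphere 0 1 then P z else 0)}"

definition reproducing_kernel ::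
  "nat \<Rightarrow> nat \<Rightarrow> complex ^ 'd \<Rightarrow> (complex ^ 'd::finite \<Rightarrow> complex)" where
  "reproducing_kernel m n w =
     (THE Z. Z \<in> sphere_harmonics m n \<and>
        (\<forall>f\<in>sphere_harmonics m n. f w = (\<integral>z. f z * cnj (Z z) \<partial>sphere_measure)))"

definition harmonic_component ::
  "nat \<Rightarrow> nat \<Rightarrow> (complex ^ 'd::finite \<Rightarrow> complex) \<Rightarrow> complex ^ 'd \<Rightarrow> complex" where
  "harmonic_component m n \<phi> w = (\<integral>z. \<phi> z * cnj (reproducing_kernel m n w z) \<partial>sphere_measure)"


section \<open>Multiplier operators\<close>

text \<open>
  That a function has the formal expansion \<open>\<Sum>m n. lam m n * (\<phi> * Z\<^sup>(\<^sup>m\<^sup>,\<^sup>n\<^sup>))\<close> means that its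
  component of every bidegree \<open>(m, n)\<close> is the corresponding term.  This determines an integrable
  function up to a null set, and the operator picks a representative.  Where no integrable
  function has the given expansion the value is unspecified.
\<close>

definition has_multiplier_expansion ::
  "(nat \<Rightarrow> nat \<Rightarrow> complex) \<Rightarrow> (complex ^ 'd::finite \<Rightarrow> complex) \<Rightarrow> (complex ^ 'd \<Rightarrow> complex) \<Rightarrow> bool"
where
  "has_multiplier_expansion lam \<phi> \<psi> \<longleftrightarrow>
     (\<forall>m n. \<forall>w\<in>sphere 0 1. harmonic_component m n \<psi> w = lam m n * harmonic_component m n \<phi> w)"

definition multiplier_operator ::
  "(nat \<Rightarrow> nat \<Rightarrow> complex) \<Rightarrow> (complex ^ 'd::finite \<Rightarrow> complex) \<Rightarrow> (complex ^ 'd \<Rightarrow> complex)" where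
  "multiplier_operator lam \<phi> =
     (SOME \<psi>. \<psi> \<in> Lp_space sphere_measure 1 \<and> has_multiplier_expansion lam \<phi> \<psi>)"

definition exp_multiplier :: "real \<Rightarrow> real \<Rightarrow> nat \<Rightarrow> nat \<Rightarrow> complex" where
  "exp_multiplier \<gamma> r m n = of_real (exp (- \<gamma> * real (m + n) powr r))"

definition pos_part :: "real \<Rightarrow> real" where
  "pos_part a = (if a > 0 then a else 0)"

definition rate_const :: "nat \<Rightarrow> real \<Rightarrow> real \<Rightarrow> real" where
  "rate_const d \<gamma> r = \<gamma> * (fact (2 * d - 1) / 2) powr (r / real (2 * d - 1))"

end

theory Submission
  imports Defs
begin

text \<open>
  Let \<open>D = 2 d - 1\<close> be the dimension of the sphere and call \<open>m + n\<close> the level of the bidegree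
  \<open>(m, n)\<close>. The harmonics of level \<open>l\<close> have an orthonormal basis of about \<open>2 l^(D-1) / (D-1)!\<close>
  functions, so those of level at most \<open>N\<close> span a space of dimension about \<open>2 N^D / D!\<close>. The
  rate in the theorem is the multiplier at the level \<open>N\<close> for which this dimension is \<open>k\<close>, and
  the approximation has three parts.

  Levels up to \<open>N\<close> are reproduced exactly. Here \<open>N\<close> is chosen a little too small, so that about
  \<open>M = N^(D-r)\<close> of the \<open>k\<close> dimensions remain free, while \<open>exp (-\<gamma> N^r)\<close> is still of the right
  order (\<open>choice_of_degree\<close>).

  In the block of levels between \<open>N\<close> and \<open>2 N\<close> each multiplier is split into two equal factors.
  One factor maps the unit ball of \<open>L^p\<close> into a Euclidean ball of coefficients: a function is
  truncated at height \<open>M^(1/p)\<close>, Bessel's inequality treats the bounded part and duality the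
  integrable part, which produces the power \<open>(1/p - 1/2)\<close> of \<open>M\<close> (\<open>unit_ball_split\<close>,
  \<open>weighted_coefficients\<close>). The other factor maps the Euclidean ball into \<open>L^q\<close>, and there the
  free dimensions are spent on a random subspace: by an inequality of Pajor and Tomczak-Jaegermann
  the error is of the order of the mean norm of a random sign vector, divided by the square root of
  the dimension (\<open>random_sign_subspace\<close>). The mean norm is controlled by Khinchine's inequality in an
  even exponent \<open>2 s\<close> at least \<open>q\<close>, which costs the factor \<open>q^(1/2)\<close> (\<open>row_average_moment\<close>,
  \<open>block_approximation\<close>). All this is uniform because the squares of the basis functions of one
  level add up to a constant on the sphere (\<open>level_diag\<close>).

  Levels beyond \<open>2 N\<close> are dropped; doubling \<open>N\<close> gains enough in the exponential to absorb the
  dimension of these levels (\<open>stretched_exp_double\<close>).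

  For \<open>q = \<infinity>\<close> the exponent \<open>s\<close> is of order \<open>ln k\<close>. The error in the block is a polynomial of
  degree \<open>2 N\<close>, and its maximum exceeds its \<open>L^(2s)\<close> norm at most by the root of order \<open>2 s\<close> of a
  power of \<open>k\<close>, hence by a bounded factor (\<open>nikolskii\<close>).

  The multiplier operator chooses some integrable function with the prescribed components. It agrees
  almost everywhere with the series over the levels, since an integrable function orthogonal to all
  harmonics vanishes (\<open>orthogonal_to_all_zero\<close>, \<open>multiplier_operator_AE\<close>).
\<close>

type_synonym 'd cfun = "complex ^ 'd => complex"

abbreviation spint :: "('a::euclidean_space => 'b::{banach,second_countable_topology}) => 'b" where
  "spint f \<equiv> integral\<^sup>L sphere_measure f"

section \<open>Averages over random signs\<close>

definition average :: "'a set => ('a => real) => real" where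
  "average S f = (\<Sum>x\<in>S. f x) / real (card S)"

text \<open>The value \<open>0\<close> off \<open>A\<close> keeps the set of sign vectors finite, so
  that plain averages over it make sense.\<close>
definition sign_vectors :: "'i set => ('i => real) set" where
  "sign_vectors A = {g. (\<forall>a\<in>A. g a = 1 \<or> g a = -1) \<and> (\<forall>a. a \<notin> A --> g a = 0)}"

lemma average_mono: "(\<And>x. x \<in> S ==> f x <= g x) ==> average S f <= average S g"
  unfolding average_def by (intro divide_right_mono sum_mono) auto

lemma average_add: "average S (\<lambda>x. f x + g x) = average S f + average S g"
  unfolding average_def by (simp add: sum.distrib add_divide_distrib)

lemma average_diff: "average S (\<lambda>x. f x - g x) = average S f - average S g"
  unfolding average_def by (simp add: sum_subtractf diff_divide_distrib)

lemma average_mult: "average S (\<lambda>x. c * f x) = c * average S f"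
  unfolding average_def by (simp add: sum_distrib_left)

lemma average_const: "finite S ==> S ~= {} ==> average S (\<lambda>_. c) = c" unfolding average_def by simp

lemma average_commute:
  "average S (\<lambda>x. average T (\<lambda>y. f x y)) = average T (\<lambda>y. average S (\<lambda>x. f x y))"
  unfolding average_def by (simp add: sum_divide_distrib[symmetric] sum.swap[of _ T])

lemma sign_vectors_empty: "sign_vectors {} = {\<lambda>_. 0}" by (auto simp: sign_vectors_def)

lemma sign_vectors_insert:
  assumes "j \<notin> A"
  shows "sign_vectors (insert j A)
  = (\<lambda>g. g(j := 1)) ` sign_vectors A \<union> (\<lambda>g. g(j := -1)) ` sign_vectors A"
proof (intro equalityI subsetI)
  fix g assume g: "g \<in> sign_vectors (insert j A)"
  have "g(j := 0) \<in> sign_vectors A" using g assms by (auto simp: sign_vectors_def)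
  moreover have "g = (g(j := 0))(j := 1) \<or> g = (g(j := 0))(j := -1)"
  using g by (auto simp: sign_vectors_def fun_eq_iff)
  ultimately show "g \<in> (\<lambda>g. g(j := 1)) ` sign_vectors A \<union> (\<lambda>g. g(j := -1)) ` sign_vectors A"
  by blast
next
  fix g assume "g \<in> (\<lambda>g. g(j := 1)) ` sign_vectors A \<union> (\<lambda>g. g(j := -1)) ` sign_vectors A"
  then obtain h c where "h \<in> sign_vectors A" "c = 1 \<or> c = -1" "g = h(j := c)" by blast
  then show "g \<in> sign_vectors (insert j A)" using assms by (simp add: sign_vectors_def)
qed

lemma sign_vectors_inj:
  assumes "j \<notin> A" shows "inj_on (\<lambda>g. g(j := c)) (sign_vectors A)"
proof (rule inj_onI)
  fix g h assume gh: "g \<in> sign_vectors A" "h \<in> sign_vectors A" "g(j := c) = h(j := c)"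
  have "g j = 0" "h j = 0" using gh assms by (auto simp: sign_vectors_def)
  then show "g = h" using gh(3) by (metis fun_upd_triv fun_upd_upd)
qed

lemma finite_sign_vectors: "finite A ==> finite (sign_vectors A)"
  by (induction A rule: finite_induct) (auto simp: sign_vectors_empty sign_vectors_insert)

lemma sign_vectors_nonempty: "sign_vectors A ~= {}"
proof -
  have "(\<lambda>a. if a \<in> A then 1 else 0) \<in> sign_vectors A" by (auto simp: sign_vectors_def)
  then show ?thesis by blast
qed

lemma average_sign_insert:
  assumes "finite A" "j \<notin> A"
  shows "average (sign_vectors (insert j A)) f
  = (average (sign_vectors A) (\<lambda>g. f (g(j := 1))) + average (sign_vectors A) (\<lambda>g. f (g(j := -1)))) / 2"
proof -
  let ?S = "sign_vectors A"
  have fin: "finite ?S" by (rule finite_sign_vectors[OF assms(1)])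
  have disj: "(\<lambda>g. g(j := 1::real)) ` ?S \<inter> (\<lambda>g. g(j := -1)) ` ?S = {}"
  using one_neq_neg_one by (auto dest!: fun_cong[of _ _ j])
  have c: "card (sign_vectors (insert j A)) = 2 * card ?S"
  using assms(2) fin disj by (simp add: sign_vectors_insert card_Un_disjoint card_image sign_vectors_inj)
  have s: "(\<Sum>g\<in>sign_vectors (insert j A). f g)
   = (\<Sum>g\<in>?S. f (g(j := 1))) + (\<Sum>g\<in>?S. f (g(j := -1)))" using assms(2) fin disj
  by (simp add: sign_vectors_insert sum.union_disjoint sum.reindex sign_vectors_inj)
  have "real (card ?S) > 0" using fin sign_vectors_nonempty by (simp add: card_gt_0_iff)
  then show ?thesis unfolding average_def c s by (simp add: field_simps)
qed

lemma average_sign_uminus: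
  "average (sign_vectors A) (\<lambda>g. f (\<lambda>a. - g a)) = average (sign_vectors A) f"
proof -
  have "bij_betw (\<lambda>g a. - g a) (sign_vectors A) (sign_vectors A)"
  by (rule bij_betw_byWitness[where f' = "\<lambda>g a. - g a"]) (auto simp: sign_vectors_def)
  from sum.reindex_bij_betw[OF this, of f] show ?thesis by (simp add: average_def)
qed

lemma sign_pairing_insert:
  fixes y :: "'i => real"
  assumes "finite A" "j \<notin> A"
  shows "(\<Sum>a\<in>insert j A. (g(j := c)) a * y a) = c * y j + (\<Sum>a\<in>A. g a * y a)"
proof -
  have "(\<Sum>a\<in>A. (g(j := c)) a * y a) = (\<Sum>a\<in>A. g a * y a)" using assms by (intro sum.cong) auto
  then show ?thesis using assms by simp
qed

lemma average_sign_square: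
  fixes y :: "'i => real"
  assumes "finite A"
  shows "average (sign_vectors A) (\<lambda>g. (\<Sum>a\<in>A. g a * y a)\<^sup>2) = (\<Sum>a\<in>A. (y a)\<^sup>2)"
  using assms
proof (induction A rule: finite_induct)
  case empty
  then show ?case by (simp add: sign_vectors_empty average_def)
next
  case (insert j A)
  have *: "average (sign_vectors (insert j A)) (\<lambda>g. (\<Sum>a\<in>insert j A. g a * y a)\<^sup>2)
  = average (sign_vectors A) (\<lambda>g. (y j)\<^sup>2 + (\<Sum>a\<in>A. g a * y a)\<^sup>2)"
  proof -
  have "(y j + s)\<^sup>2 + (- y j + s)\<^sup>2 = 2 * ((y j)\<^sup>2 + s\<^sup>2)" for s
   by (simp add: power2_eq_square algebra_simps)
  then show ?thesis unfolding average_sign_insert[OF insert(1,2)] sign_pairing_insert[OF insert(1,2)]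
    average_add[symmetric] by (simp only: mult_1 mult_minus1 average_mult)
  qed
  show ?case unfolding * average_add insert.IH using insert
  by (simp add: average_const finite_sign_vectors sign_vectors_nonempty)
qed

lemma average_sign_fourth:
  fixes y :: "'i => real"
  assumes "finite A"
  shows "average (sign_vectors A) (\<lambda>g. (\<Sum>a\<in>A. g a * y a) ^ 4) <= 3 * (\<Sum>a\<in>A. (y a)\<^sup>2)\<^sup>2"
  using assms
proof (induction A rule: finite_induct)
  case empty
  then show ?case by (simp add: sign_vectors_empty average_def)
next
  case (insert j A)
  let ?av = "average (sign_vectors A)" and ?S = "\<lambda>g. \<Sum>a\<in>A. g a * y a"
  have id: "(v + s) ^ 4 + (- v + s) ^ 4 = 2 * s ^ 4 + 12 * v\<^sup>2 * s\<^sup>2 + 2 * v ^ 4" for v s :: real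
  by (simp add: eval_nat_numeral algebra_simps)
  have "average (sign_vectors (insert j A)) (\<lambda>g. (\<Sum>a\<in>insert j A. g a * y a) ^ 4)
  = ?av (\<lambda>g. (y j + ?S g) ^ 4 + (- y j + ?S g) ^ 4) / 2"
  unfolding average_sign_insert[OF insert(1,2)] sign_pairing_insert[OF insert(1,2)] average_add by simp
  also have "... = ?av (\<lambda>g. 2 * (?S g) ^ 4 + (12 * (y j)\<^sup>2) * (?S g)\<^sup>2 + 2 * (y j) ^ 4) / 2"
  unfolding id ..
  also have "... = ?av (\<lambda>g. (?S g) ^ 4) + 6 * (y j)\<^sup>2 * (\<Sum>a\<in>A. (y a)\<^sup>2) + (y j) ^ 4"
  unfolding average_add average_mult average_sign_square[OF insert(1)]
  using insert by (simp add: average_const finite_sign_vectors sign_vectors_nonempty)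
  also have "... <= 3 * (\<Sum>a\<in>A. (y a)\<^sup>2)\<^sup>2 + 6 * (y j)\<^sup>2 * (\<Sum>a\<in>A. (y a)\<^sup>2) + 3 * (y j) ^ 4"
  proof -
  have "y j ^ 4 <= 3 * y j ^ 4" by simp
  with insert.IH show ?thesis by linarith
  qed
  also have "... = 3 * (\<Sum>a\<in>insert j A. (y a)\<^sup>2)\<^sup>2"
  using insert by (simp add: power2_sum algebra_simps power2_eq_square eval_nat_numeral)
  finally show ?case .
qed

text \<open>Khinchine's lower bound, with a constant far from optimal: integrate
  \<open>\<bar>u\<bar> >= u^2 - u^4 / 6\<close>, applied to the normalised sum, and use that the
  fourth moment is at most three times the squared second moment.\<close>
lemma average_sign_lower:
  fixes y :: "'i => real"
  assumes "finite A"
  shows "sqrt (\<Sum>a\<in>A. (y a)\<^sup>2) / 2 <= average (sign_vectors A) (\<lambda>g. \<bar>\<Sum>a\<in>A. g a * y a\<bar>)"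
proof (cases "(\<Sum>a\<in>A. (y a)\<^sup>2) = 0")
  case True
  have "average (sign_vectors A) (\<lambda>g. 0) <= average (sign_vectors A) (\<lambda>g. \<bar>\<Sum>a\<in>A. g a * y a\<bar>)"
  by (rule average_mono) simp
  then show ?thesis unfolding True by (simp add: average_def)
next
  case False
  define V where "V = (\<Sum>a\<in>A. (y a)\<^sup>2)"
  have V: "V > 0" using False sum_nonneg[of A "\<lambda>a. (y a)\<^sup>2"] by (auto simp: V_def less_le)
  define r where "r = sqrt V"
  have r: "r > 0" "r\<^sup>2 = V" using V by (auto simp: r_def)
  have unit: "u\<^sup>2 - u ^ 4 / 6 <= u" if "u >= 0" for u :: real
  proof -
  have "u * (6 - 6 * u + u ^ 3) >= 0"
  proof -
   (* 7/5 is close to sqrt 2, where u^3 - 6 u is smallest for u >= 0. *)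
   have "(u - 7/5)\<^sup>2 * (u + 14/5) >= 0" using that by simp
   then have "u ^ 3 - 147/25 * u + 686/125 >= 0" by (simp add: eval_nat_numeral field_simps)
   moreover have "u <= 4 \<or> u >= 4" by auto
   ultimately have "6 - 6 * u + u ^ 3 >= 0"
   proof (cases "u <= 4")
    case True
    then show ?thesis using \<open>u ^ 3 - 147/25 * u + 686/125 >= 0\<close> by (simp add: field_simps)
   next
    case False
    then have "u * u * u >= 4 * 4 * u" by (intro mult_right_mono mult_mono) auto
    moreover have "u ^ 3 = u * u * u" by (simp add: eval_nat_numeral)
    ultimately show ?thesis using False by linarith
   qed
   then show ?thesis using that by simp
  qed
  then show ?thesis by (simp add: eval_nat_numeral algebra_simps)
  qed
  have pt: "s\<^sup>2 / r - s ^ 4 / (6 * r ^ 3) <= \<bar>s\<bar>" for s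
  proof -
  have "r * ((\<bar>s\<bar> / r)\<^sup>2 - (\<bar>s\<bar> / r) ^ 4 / 6) <= r * (\<bar>s\<bar> / r)"
   using r unit[of "\<bar>s\<bar> / r"] by (intro mult_left_mono) auto
  moreover have "r * ((\<bar>s\<bar> / r)\<^sup>2 - (\<bar>s\<bar> / r) ^ 4 / 6) = s\<^sup>2 / r - s ^ 4 / (6 * r ^ 3)"
   using r(1) by (simp add: power_divide eval_nat_numeral field_simps)
  ultimately show ?thesis using r by simp
  qed
  let ?av = "average (sign_vectors A)" and ?S = "\<lambda>g. \<Sum>a\<in>A. g a * y a"
  have "r / 2 = (1 / r) * V - (1 / (6 * r ^ 3)) * (3 * V\<^sup>2)"
  using r by (simp add: r(2)[symmetric] power2_eq_square eval_nat_numeral field_simps)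
  also have "... <= (1 / r) * V - (1 / (6 * r ^ 3)) * ?av (\<lambda>g. (?S g) ^ 4)"
  using average_sign_fourth[OF assms, of y] r unfolding V_def by (intro diff_left_mono mult_left_mono) auto
  also have "... = ?av (\<lambda>g. (1 / r) * (?S g)\<^sup>2 - (1 / (6 * r ^ 3)) * (?S g) ^ 4)"
  unfolding average_diff average_mult average_sign_square[OF assms] V_def ..
  also have "... <= ?av (\<lambda>g. \<bar>?S g\<bar>)" by (rule average_mono) (use pt in simp)
  finally show ?thesis unfolding r_def V_def .
qed

lemma cosh_le_exp_square: "cosh (x::real) <= exp (x\<^sup>2 / 2)"
proof -
  have fact: "(2::real) ^ n * fact n <= fact (2 * n)" for n
  proof (induction n)
  case (Suc n)
  have "(2::real) ^ Suc n * fact (Suc n) = (2 * real (Suc n)) * (2 ^ n * fact n)" by simp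
  also have "... <= (2 * real (Suc n)) * fact (2 * n)" using Suc by (intro mult_left_mono) auto
  also have "... <= (2 * real (Suc n)) * (real (2 * n + 1) * fact (2 * n))"
   by (intro mult_left_mono) (simp_all add: mult_ge1_I)
  also have "... = fact (2 * Suc n)" by (simp add: algebra_simps)
  finally show ?case .
  qed simp
  have c: "(\<lambda>n. if even n then x ^ n /\<^sub>R fact n else 0) sums cosh x" by (rule cosh_converges)
  have c': "(\<lambda>n. x ^ (2 * n) /\<^sub>R fact (2 * n)) sums cosh x"
  proof -
  have "strict_mono (\<lambda>n::nat. 2 * n)" by (simp add: strict_mono_def)
  from sums_mono_reindex[OF this, of "\<lambda>n. if even n then x ^ n /\<^sub>R fact n else 0" "cosh x"]
  moreover have "(if even n then x ^ n /\<^sub>R fact n else 0) = 0" if "n \<notin> range (\<lambda>n. 2 * n)" for n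
   using that by (auto elim!: evenE)
  ultimately have "(\<lambda>n. if even (2 * n) then x ^ (2 * n) /\<^sub>R fact (2 * n) else 0) sums cosh x"
   using c by simp
  then show ?thesis by simp
  qed
  have e: "(\<lambda>n. (x\<^sup>2 / 2) ^ n /\<^sub>R fact n) sums exp (x\<^sup>2 / 2)" by (rule exp_converges)
  show ?thesis
  proof (rule sums_le[OF _ c' e])
  fix n
  have "x ^ (2 * n) / fact (2 * n) <= x ^ (2 * n) / (2 ^ n * fact n)"
   using fact[of n] by (intro divide_left_mono) auto
  moreover have "(x\<^sup>2 / 2) ^ n /\<^sub>R fact n = x ^ (2 * n) / (2 ^ n * fact n)"
   unfolding power_divide power_mult[symmetric] by (simp add: divide_inverse)
  moreover have "x ^ (2 * n) /\<^sub>R fact (2 * n) = x ^ (2 * n) / fact (2 * n)"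
   by (simp only: real_scaleR_def divide_inverse mult.commute)
  ultimately show "x ^ (2 * n) /\<^sub>R fact (2 * n) <= (x\<^sup>2 / 2) ^ n /\<^sub>R fact n" by linarith
  qed
qed

lemma power_div_fact_le_exp:
  fixes x :: real
  assumes "x >= 0" shows "x ^ n / fact n <= exp x"
proof -
  have s: "(\<lambda>n. x ^ n /\<^sub>R fact n) sums exp x" by (rule exp_converges)
  have "(\<Sum>i\<in>{n}. x ^ i /\<^sub>R fact i) <= (\<Sum>i. x ^ i /\<^sub>R fact i)"
  using s assms by (intro sum_le_suminf) (auto simp: sums_iff)
  then show ?thesis using s by (simp add: sums_iff field_simps)
qed

lemma average_sign_exp:
  fixes y :: "'i => real"
  assumes "finite A"
  shows "average (sign_vectors A) (\<lambda>g. exp (\<Sum>a\<in>A. g a * y a)) <= exp ((\<Sum>a\<in>A. (y a)\<^sup>2) / 2)"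
  using assms
proof (induction A rule: finite_induct)
  case empty
  then show ?case by (simp add: sign_vectors_empty average_def)
next
  case (insert j A)
  let ?av = "average (sign_vectors A)" and ?S = "\<lambda>g. \<Sum>a\<in>A. g a * y a"
  have "average (sign_vectors (insert j A)) (\<lambda>g. exp (\<Sum>a\<in>insert j A. g a * y a))
   = cosh (y j) * ?av (\<lambda>g. exp (?S g))"
  unfolding average_sign_insert[OF insert(1,2)] sign_pairing_insert[OF insert(1,2)] exp_add
   average_mult cosh_def by (simp add: field_simps)
  also have "... <= exp ((y j)\<^sup>2 / 2) * exp ((\<Sum>a\<in>A. (y a)\<^sup>2) / 2)"
  using insert.IH cosh_le_exp_square[of "y j"]
  by (intro mult_mono) (auto simp: average_def intro!: divide_nonneg_nonneg sum_nonneg)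
  also have "... = exp ((\<Sum>a\<in>insert j A. (y a)\<^sup>2) / 2)"
  using insert by (simp add: exp_add[symmetric] add_divide_distrib)
  finally show ?case .
qed

text \<open>The mean over \<open>k\<close> independent sign vectors, which form the rows of
  \<open>G\<close>. The recursion replaces the product measure by iterated averages.\<close>
primrec row_average :: "'i set => nat => ((nat => 'i => real) => real) => real" where
  "row_average A 0 f = f (\<lambda>_ _. 0)"
| "row_average A (Suc k) f = average (sign_vectors A) (\<lambda>g. row_average A k (\<lambda>G. f (G(k := g))))"

lemma row_average_mono: "(\<And>G. f G <= h G) ==> row_average A k f <= row_average A k h"
  by (induction k arbitrary: f h) (auto intro!: average_mono)

lemma row_average_add: "row_average A k (\<lambda>G. f G + h G) = row_average A k f + row_average A k h"
  by (induction k arbitrary: f h) (auto simp: average_add)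

lemma row_average_mult: "row_average A k (\<lambda>G. c * f G) = c * row_average A k f"
  by (induction k arbitrary: f) (auto simp: average_mult)

lemma row_average_const: "finite A ==> row_average A k (\<lambda>_. c) = c"
  by (induction k) (auto simp: average_const finite_sign_vectors sign_vectors_nonempty)

lemma row_average_commute:
  "row_average A k (\<lambda>G. average S (\<lambda>x. f x G)) = average S (\<lambda>x. row_average A k (f x))"
  by (induction k arbitrary: f) (auto simp: average_commute[of _ S])

lemma exists_average_ge:
  assumes "finite S" "S ~= {}" shows "\<exists>x\<in>S. f x <= average S f"
proof (rule ccontr)
  assume "\<not> ?thesis"
  then have "(\<Sum>x\<in>S. average S f) < (\<Sum>x\<in>S. f x)" using assms by (intro sum_strict_mono) auto
  then show False using assms by (simp add: average_def)
qed

lemma exists_row_average_ge: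
  assumes "finite A" shows "\<exists>G. f G <= row_average A k f"
proof (induction k arbitrary: f)
  case (Suc k)
  obtain g where g: "row_average A k (\<lambda>G. f (G(k := g))) <= row_average A (Suc k) f"
  using exists_average_ge[OF finite_sign_vectors[OF assms] sign_vectors_nonempty] by fastforce
  then show ?case using Suc.IH[of "\<lambda>G. f (G(k := g))"] order_trans by blast
qed auto

lemma row_average_exp:
  assumes "finite A"
  shows "row_average A k (\<lambda>G. exp (\<Sum>i<k. \<Sum>a\<in>A. G i a * y a)) <= exp (real k * (\<Sum>a\<in>A. (y a)\<^sup>2) / 2)"
proof (induction k)
  case (Suc k)
  let ?V = "\<Sum>a\<in>A. (y a)\<^sup>2"
  have eq: "(\<Sum>i<Suc k. \<Sum>a\<in>A. (G(k := g)) i a * y a)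
   = (\<Sum>a\<in>A. g a * y a) + (\<Sum>i<k. \<Sum>a\<in>A. G i a * y a)" for G g by simp
  have "row_average A (Suc k) (\<lambda>G. exp (\<Sum>i<Suc k. \<Sum>a\<in>A. G i a * y a))
  = average (sign_vectors A) (\<lambda>g. row_average A k (\<lambda>G. exp (\<Sum>i<k. \<Sum>a\<in>A. G i a * y a)) * exp (\<Sum>a\<in>A. g a * y a))"
  unfolding row_average.simps eq exp_add row_average_mult by (simp add: mult.commute)
  also have "... = row_average A k (\<lambda>G. exp (\<Sum>i<k. \<Sum>a\<in>A. G i a * y a))
   * average (sign_vectors A) (\<lambda>g. exp (\<Sum>a\<in>A. g a * y a))" by (rule average_mult)
  also have "... <= exp (real k * ?V / 2) * exp (?V / 2)" using Suc average_sign_exp[OF assms, of y]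
  by (intro mult_mono) (auto simp: average_def intro!: divide_nonneg_nonneg sum_nonneg)
  also have "... = exp (real (Suc k) * ?V / 2)" by (simp add: exp_add[symmetric] field_simps)
  finally show ?case .
qed simp

text \<open>Khinchine's upper bound in even exponents, with its growth in \<open>s\<close> explicit:
  a moment of order \<open>2 s\<close> is bounded by an exponential moment, at the scale that balances
  the two.\<close>
lemma row_average_moment:
  fixes y :: "'i => real"
  assumes "finite A" "s >= 1"
  shows "row_average A k (\<lambda>G. (\<Sum>i<k. \<Sum>a\<in>A. G i a * y a) ^ (2 * s))
  <= 2 * (6 * real s * (real k * (\<Sum>a\<in>A. (y a)\<^sup>2))) ^ s"
proof -
  define V where "V = real k * (\<Sum>a\<in>A. (y a)\<^sup>2)"
  have V0: "V >= 0" unfolding V_def by (intro mult_nonneg_nonneg sum_nonneg) auto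
  let ?S = "\<lambda>G. \<Sum>i<k. \<Sum>a\<in>A. G i a * y a"
  show ?thesis
  proof (cases "V = 0")
  case True
  have "?S G = 0" for G
  proof (cases "k = 0")
   case False
   then have "(\<Sum>a\<in>A. (y a)\<^sup>2) = 0" using True by (auto simp: V_def)
   then have "\<forall>a\<in>A. y a = 0" using assms(1) by (subst (asm) sum_nonneg_eq_0_iff) auto
   then show ?thesis by simp
  qed simp
  then have "row_average A k (\<lambda>G. (?S G) ^ (2 * s)) = row_average A k (\<lambda>_. 0)"
   using assms by (simp add: zero_power)
  also have "... = 0" by (rule row_average_const[OF assms(1)])
  finally show ?thesis using V0 unfolding V_def[symmetric] by simp
  next
  case False
  then have V: "V > 0" using V0 by simp
  define t where "t = sqrt (2 * real s / V)"
  have t: "t > 0" "t\<^sup>2 = 2 * real s / V" using V assms by (auto simp: t_def)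
  have pt: "x ^ (2 * s) <= fact (2 * s) / t ^ (2 * s) * (exp (t * x) + exp (- (t * x)))" for x
  proof -
   have "(t * \<bar>x\<bar>) ^ (2 * s) / fact (2 * s) <= exp (t * \<bar>x\<bar>)"
    using t by (intro power_div_fact_le_exp) simp
   also have "... <= exp (t * x) + exp (- (t * x))" by (cases "x >= 0") auto
   finally have "(t * x) ^ (2 * s) / fact (2 * s) <= exp (t * x) + exp (- (t * x))"
    unfolding power_mult_distrib by (simp only: power_even_abs even_mult_iff even_numeral simp_thms)
   then have "t ^ (2 * s) * x ^ (2 * s) <= fact (2 * s) * (exp (t * x) + exp (- (t * x)))"
    unfolding power_mult_distrib by (simp add: divide_le_eq mult.commute)
   then show ?thesis using t by (simp add: le_divide_eq mult.commute)
  qed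
  have e1: "row_average A k (\<lambda>G. exp (c * ?S G)) <= exp (c\<^sup>2 * V / 2)" for c
   using row_average_exp[OF assms(1), where y = "\<lambda>a. c * y a" and k = k]
   by (simp add: V_def sum_distrib_left power_mult_distrib algebra_simps)
  have "row_average A k (\<lambda>G. (?S G) ^ (2 * s))
    <= row_average A k (\<lambda>G. fact (2 * s) / t ^ (2 * s) * (exp (t * ?S G) + exp (- t * ?S G)))"
   by (rule row_average_mono) (use pt in simp)
  also have "... <= fact (2 * s) / t ^ (2 * s) * (exp (t\<^sup>2 * V / 2) + exp ((- t)\<^sup>2 * V / 2))"
   unfolding row_average_mult row_average_add using t e1[of t] e1[of "- t"]
   by (intro mult_left_mono add_mono) auto
  also have "... = 2 * (fact (2 * s) / t ^ (2 * s)) * exp (real s)" using t V by (simp add: t(2))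
  also have "... <= 2 * ((2 * real s) ^ (2 * s) / t ^ (2 * s)) * exp 1 ^ s"
  proof -
   have "(fact (2 * s) :: real) <= real ((2 * s) ^ (2 * s))"
    using fact_le_power[of "2 * s"] by (metis of_nat_fact of_nat_mono order_refl)
   then show ?thesis using t by (simp add: exp_of_nat_mult[symmetric] divide_right_mono)
  qed
  also have "... = 2 * (2 * exp 1 * real s * V) ^ s"
  proof -
   have "t ^ (2 * s) = (2 * real s / V) ^ s" by (simp only: power_mult t(2))
   moreover have "(2 * real s) ^ (2 * s) = ((2 * real s)\<^sup>2) ^ s" by (simp only: power_mult)
   moreover have "(2 * real s)\<^sup>2 / (2 * real s / V) * exp 1 = 2 * exp 1 * real s * V"
    using V assms by (simp add: power2_eq_square)
   ultimately show ?thesis by (metis (no_types) mult.assoc power_divide power_mult_distrib)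
  qed
  also have "... <= 2 * (6 * real s * V) ^ s"
   using V e_less_272 by (intro mult_left_mono power_mono mult_right_mono) auto
  finally show ?thesis unfolding V_def .
  qed
qed

section \<open>The Hahn-Banach theorem in finitely many coordinates\<close>

definition sublinear :: "(('i => real) => real) => bool" where
  "sublinear p \<longleftrightarrow> (\<forall>x y. p (\<lambda>a. x a + y a) <= p x + p y) \<and> (\<forall>c\<ge>0. \<forall>x. p (\<lambda>a. c * x a) = c * p x)"

lemma sublinear_add: "sublinear p ==> p (\<lambda>a. x a + y a) <= p x + p y"
  unfolding sublinear_def by (drule conjunct1) (drule spec[of _ x], drule spec[of _ y], assumption)

lemma sublinear_scale: "sublinear p ==> c >= 0 ==> p (\<lambda>a. c * x a) = c * p x"
  unfolding sublinear_def by (drule conjunct2) (drule spec[of _ c], drule mp, assumption, drule spec[of _ x], assumption)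

lemma sublinear_zero:
  assumes "sublinear p" shows "p (\<lambda>_. 0) = 0"
  using sublinear_scale[OF assms, of 0 "\<lambda>_. 0"] by simp

lemma sublinear_lower: "sublinear p ==> - p (\<lambda>a. - x a) <= p x"
proof -
  assume p: "sublinear p"
  then have "p (\<lambda>a. x a + - x a) <= p x + p (\<lambda>a. - x a)" by (rule sublinear_add)
  then show ?thesis using sublinear_zero[OF p] by simp
qed

text \<open>The inductive step of the Hahn-Banach argument.\<close>

lemma sublinear_linear_along:
  assumes p: "sublinear p"
  shows "\<exists>p'. sublinear p' \<and> (\<forall>x. p' x <= p x) \<and> p' (\<lambda>a. - v a) = - p v \<and> p' v = p v"
proof -
  have padd: "p (\<lambda>a. x a + y a) <= p x + p y" for x y by (rule sublinear_add[OF p])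
  have pmul: "p (\<lambda>a. c * x a) = c * p x" if "c >= 0" for c x by (rule sublinear_scale[OF p that])
  define F where "F = (\<lambda>x t. p (\<lambda>a. x a + t * v a) - t * p v)"
  define p' where "p' = (\<lambda>x. INF t\<in>{0..}. F x t)"
  have lower: "- p (\<lambda>a. - x a) <= F x t" if "t >= 0" for x t
  proof -
  have "t * p v = p (\<lambda>a. t * v a)" using pmul[OF that, of v] by simp
  also have "... = p (\<lambda>a. (x a + t * v a) + (- x a))" by simp
  also have "... <= p (\<lambda>a. x a + t * v a) + p (\<lambda>a. - x a)" by (rule padd)
  finally show ?thesis by (simp add: F_def)
  qed
  have bdd: "bdd_below (F x ` {0..})" for x using lower by (intro bdd_belowI2) auto
  have p'_le: "p' x <= F x t" if "t >= 0" for x t unfolding p'_def using that by (intro cINF_lower bdd) auto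
  have p'_ge: "c <= p' x" if "\<And>t. t >= 0 ==> c <= F x t" for c x
  unfolding p'_def using that by (intro cINF_greatest) auto
  have le: "p' x <= p x" for x using p'_le[of 0 x] by (simp add: F_def)
  have Fadd: "F (\<lambda>a. x a + y a) (t + u) <= F x t + F y u" for x y t u
  using padd[of "\<lambda>a. x a + t * v a" "\<lambda>a. y a + u * v a"] by (simp add: F_def algebra_simps)
  have add: "p' (\<lambda>a. x a + y a) <= p' x + p' y" for x y
  proof -
  have "p' (\<lambda>a. x a + y a) - F x t <= F y u" if "t >= 0" "u >= 0" for t u
   using p'_le[of "t + u" "\<lambda>a. x a + y a"] Fadd[of x y t u] that by simp
  then have "p' (\<lambda>a. x a + y a) - F x t <= p' y" if "t >= 0" for t using that by (intro p'_ge) auto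
  then have "p' (\<lambda>a. x a + y a) - p' y <= p' x" by (intro p'_ge) (simp add: algebra_simps)
  then show ?thesis by simp
  qed
  have Fmul: "F (\<lambda>a. c * x a) (c * t) = c * F x t" if "c >= 0" for c x t
  using pmul[OF that, of "\<lambda>a. x a + t * v a"] by (simp add: F_def algebra_simps)
  have mul_le: "c * p' x <= p' (\<lambda>a. c * x a)" if "c > 0" for c x
  proof (rule p'_ge)
  fix t :: real assume "t >= 0"
  then have "c * p' x <= c * F x (t / c)" using that by (intro mult_left_mono p'_le) auto
  also have "... = F (\<lambda>a. c * x a) t" using Fmul[of c x "t / c"] that by simp
  finally show "c * p' x <= F (\<lambda>a. c * x a) t" .
  qed
  have zero: "p' (\<lambda>a. 0) = 0"
  proof (rule antisym)
  show "p' (\<lambda>a. 0) <= 0" using le[of "\<lambda>_. 0"] sublinear_zero[OF p] by simp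
  show "0 <= p' (\<lambda>a. 0)" by (rule p'_ge) (use pmul[of _ v] in \<open>simp add: F_def\<close>)
  qed
  have mul: "p' (\<lambda>a. c * x a) = c * p' x" if "c >= 0" for c x
  proof (cases "c = 0")
  case False
  then have c: "c > 0" using that by simp
  have "(1 / c) * p' (\<lambda>a. c * x a) <= p' (\<lambda>a. (1 / c) * (c * x a))"
   using c by (intro mul_le) simp
  then have "p' (\<lambda>a. c * x a) <= c * p' x" using c by (simp add: field_simps)
  then show ?thesis using mul_le[OF c, of x] by simp
  qed (simp add: zero)
  have sub: "sublinear p'" unfolding sublinear_def by (intro conjI allI impI add mul)
  have neg: "p' (\<lambda>a. - v a) <= - p v"
  using p'_le[of 1 "\<lambda>a. - v a"] sublinear_zero[OF p] by (simp add: F_def)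
  have "- p' (\<lambda>a. - v a) <= p' v" by (rule sublinear_lower[OF sub])
  then have "p' (\<lambda>a. - v a) = - p v" "p' v = p v" using neg le[of v] by auto
  then show ?thesis using sub le by blast
qed

lemma hahn_banach_coordinates:
  fixes p :: "('i => real) => real"
  assumes "finite A" and p: "sublinear p" and pA: "\<And>x y. (\<And>a. a \<in> A ==> x a = y a) ==> p x = p y"
  obtains y where "\<And>h. (\<Sum>a\<in>A. y a * h a) <= p h" "(\<Sum>a\<in>A. y a * x a) = p x"
proof -
  define \<delta> where "\<delta> = (\<lambda>(b::'i) a. if a = b then 1 else 0 :: real)"
  have step: "\<exists>p'. sublinear p' \<and> (\<forall>h. p' h <= p h) \<and> p' (\<lambda>a. - x a) = - p x
   \<and> (\<forall>b\<in>B. p' (\<lambda>a. - \<delta> b a) = - p' (\<delta> b))" if "finite B" for B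
  using that
  proof (induction B rule: finite_induct)
  case empty
  obtain p' where "sublinear p'" "\<And>h. p' h <= p h" "p' (\<lambda>a. - x a) = - p x" "p' x = p x"
   using sublinear_linear_along[OF p, of x] by blast
  then show ?case by (intro exI[of _ p']) simp
  next
  case (insert b B)
  then obtain q where q: "sublinear q" "\<And>h. q h <= p h" "q (\<lambda>a. - x a) = - p x"
   "\<And>b. b \<in> B ==> q (\<lambda>a. - \<delta> b a) = - q (\<delta> b)" by blast
  obtain q' where q': "sublinear q'" "\<And>h. q' h <= q h" "q' (\<lambda>a. - \<delta> b a) = - q (\<delta> b)" "q' (\<delta> b) = q (\<delta> b)"
   using sublinear_linear_along[OF q(1), of "\<delta> b"] by blast
  have keep: "q' (\<lambda>a. - v a) = - q' v \<and> q' v = q v" if "q (\<lambda>a. - v a) = - q v" for v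
   using q'(2)[of v] q'(2)[of "\<lambda>a. - v a"] sublinear_lower[OF q'(1), of v] that by linarith
  have "q x = p x" using q(2)[of x] sublinear_lower[OF q(1), of x] q(3) by linarith
  then have "q' (\<lambda>a. - x a) = - p x" using keep[of x] q(3) \<open>q x = p x\<close> by simp
  moreover have "\<forall>c\<in>insert b B. q' (\<lambda>a. - \<delta> c a) = - q' (\<delta> c)"
   using q'(3,4) keep q(4) by auto
  moreover have "q' h <= p h" for h using q'(2)[of h] q(2)[of h] by linarith
  ultimately show ?case using q'(1) by (intro exI[of _ q']) simp
  qed
  from step[OF assms(1)] obtain q where q: "sublinear q" "\<And>h. q h <= p h" "q (\<lambda>a. - x a) = - p x"
   "\<And>b. b \<in> A ==> q (\<lambda>a. - \<delta> b a) = - q (\<delta> b)" by blast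
  have qadd: "q (\<lambda>a. x a + y a) <= q x + q y" for x y by (rule sublinear_add[OF q(1)])
  have qmul: "q (\<lambda>a. c * x a) = c * q x" if "c >= 0" for c x by (rule sublinear_scale[OF q(1) that])
  have qd: "q (\<lambda>a. c * \<delta> b a) = c * q (\<delta> b)" if "b \<in> A" for b c
  proof (cases "c >= 0")
  case False
  then have "q (\<lambda>a. (- c) * (- \<delta> b a)) = (- c) * q (\<lambda>a. - \<delta> b a)" by (intro qmul) auto
  then show ?thesis using q(4)[OF that] by simp
  qed (rule qmul)
  have upper: "q (\<lambda>a. \<Sum>b\<in>B. h b * \<delta> b a) <= (\<Sum>b\<in>B. q (\<delta> b) * h b)" if "finite B" "B \<subseteq> A" for B h
  using that
  proof (induction B rule: finite_induct)
  case empty then show ?case using sublinear_zero[OF q(1)] by simp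
  next
  case (insert b B)
  have "q (\<lambda>a. \<Sum>b\<in>insert b B. h b * \<delta> b a) = q (\<lambda>a. h b * \<delta> b a + (\<Sum>b\<in>B. h b * \<delta> b a))"
   using insert by simp
  also have "... <= q (\<lambda>a. h b * \<delta> b a) + q (\<lambda>a. \<Sum>b\<in>B. h b * \<delta> b a)" by (rule qadd)
  also have "... <= q (\<delta> b) * h b + (\<Sum>b\<in>B. q (\<delta> b) * h b)"
   using insert qd[of b "h b"] by (intro add_mono) (auto simp: mult.commute)
  finally show ?case using insert by simp
  qed
  have qA: "q h = q (\<lambda>a. \<Sum>b\<in>A. h b * \<delta> b a)" for h
  proof -
  have 0: "q z <= 0" if "\<And>a. a \<in> A ==> z a = 0" for z
  proof -
   have "p z = p (\<lambda>_. 0)" using that by (intro pA) auto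
   then show ?thesis using q(2)[of z] sublinear_zero[OF p] by simp
  qed
  let ?h = "\<lambda>a. \<Sum>b\<in>A. h b * \<delta> b a"
  have h: "?h a = h a" if "a \<in> A" for a
  proof -
   have "?h a = (\<Sum>b\<in>A. if a = b then h b else 0)" by (rule sum.cong) (auto simp: \<delta>_def)
   then show ?thesis using that assms(1) by simp
  qed
  have "q h <= q ?h + q (\<lambda>a. h a - ?h a)" using qadd[of ?h "\<lambda>a. h a - ?h a"] by simp
  moreover have "q ?h <= q h + q (\<lambda>a. ?h a - h a)" using qadd[of h "\<lambda>a. ?h a - h a"] by simp
  moreover have "q (\<lambda>a. h a - ?h a) <= 0" by (rule 0) (simp only: h diff_self)
  moreover have "q (\<lambda>a. ?h a - h a) <= 0" by (rule 0) (simp only: h diff_self)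
  ultimately show ?thesis by linarith
  qed
  define y where "y = (\<lambda>b. q (\<delta> b))"
  have le: "q h <= (\<Sum>a\<in>A. y a * h a)" for h
  unfolding y_def qA[of h] by (rule upper[OF assms(1) order_refl])
  have ge: "(\<Sum>a\<in>A. y a * h a) <= q h" for h
  using le[of "\<lambda>a. - h a"] sublinear_lower[OF q(1), of h] by (simp add: sum_negf)
  have "q x = p x" using q(2)[of x] sublinear_lower[OF q(1), of x] q(3) by linarith
  then have "(\<Sum>a\<in>A. y a * x a) = p x" using le[of x] ge[of x] by linarith
  moreover have "(\<Sum>a\<in>A. y a * h a) <= p h" for h using ge[of h] q(2)[of h] by linarith
  ultimately show ?thesis using that[of y] by simp
qed

section \<open>Random subspaces\<close>

text \<open>Khinchine's lower bound replaces the Euclidean norm of \<open>y\<close> by the mean of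
  \<open>\<bar>T h y\<bar>\<close> over a second sign vector \<open>h\<close>. Splitting
  \<open>\<bar>T h y\<bar> - \<bar>T g y\<bar>\<close> in halves decouples the two vectors, and the
  supremum of \<open>F + 2 \<bar>T\<bar>\<close> plus that of \<open>F - 2 \<bar>T\<bar>\<close> is at
  most the supremum of \<open>F + 2 T\<close> plus that of \<open>F - 2 T\<close>; the last two have
  the same average because \<open>-g\<close> is a sign vector when \<open>g\<close> is one.\<close>
lemma average_sup_row:
  fixes K :: "('i => real) set" and F :: "('i => real) => real"
  assumes A: "finite A" and K: "K ~= {}" and F: "bounded (F ` K)"
  and B: "\<And>a. a \<in> A ==> bounded ((\<lambda>y. y a) ` K)"
  shows "average (sign_vectors A) (\<lambda>g. SUP y\<in>K. F y + (sqrt (\<Sum>a\<in>A. (y a)\<^sup>2) / 2 - \<bar>\<Sum>a\<in>A. g a * y a\<bar>))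
  <= average (sign_vectors A) (\<lambda>g. SUP y\<in>K. F y + 2 * (\<Sum>a\<in>A. g a * y a))"
proof -
  let ?S = "sign_vectors A"
  let ?av = "average ?S"
  define T where "T = (\<lambda>g y. \<Sum>a\<in>A. g a * y a :: real)"
  define N where "N = (\<lambda>y. sqrt (\<Sum>a\<in>A. (y a)\<^sup>2) / 2)"
  obtain M where M: "\<And>y. y \<in> K ==> \<bar>F y\<bar> <= M" using F unfolding bounded_iff by auto
  have "\<forall>a\<in>A. \<exists>b. \<forall>y\<in>K. \<bar>y a\<bar> <= b" using B unfolding bounded_iff by auto
  then obtain b where b: "\<And>a y. a \<in> A ==> y \<in> K ==> \<bar>y a\<bar> <= b a" by metis
  have Tb: "\<bar>T g y\<bar> <= (\<Sum>a\<in>A. \<bar>g a\<bar> * b a)" if "y \<in> K" for g y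
  unfolding T_def using b that
  by (intro order_trans[OF sum_abs] sum_mono) (auto simp: abs_mult intro!: mult_left_mono)
  have bdd: "bdd_above ((\<lambda>y. F y + (c * \<bar>T g y\<bar> + d * \<bar>T h y\<bar> + e * T g y)) ` K)" for c d e g h
  proof (rule bdd_aboveI2)
  fix y assume y: "y \<in> K"
  have 1: "c * \<bar>T g y\<bar> <= \<bar>c\<bar> * (\<Sum>a\<in>A. \<bar>g a\<bar> * b a)"
   using Tb[OF y, of g] by (intro mult_mono) auto
  have 2: "d * \<bar>T h y\<bar> <= \<bar>d\<bar> * (\<Sum>a\<in>A. \<bar>h a\<bar> * b a)"
   using Tb[OF y, of h] by (intro mult_mono) auto
  have "e * T g y <= \<bar>e\<bar> * \<bar>T g y\<bar>" by (metis abs_ge_self abs_mult)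
  also have "... <= \<bar>e\<bar> * (\<Sum>a\<in>A. \<bar>g a\<bar> * b a)"
   using Tb[OF y, of g] by (intro mult_mono) auto
  finally show "F y + (c * \<bar>T g y\<bar> + d * \<bar>T h y\<bar> + e * T g y) <= M + (\<bar>c\<bar> * (\<Sum>a\<in>A. \<bar>g a\<bar> * b a)
   + \<bar>d\<bar> * (\<Sum>a\<in>A. \<bar>h a\<bar> * b a) + \<bar>e\<bar> * (\<Sum>a\<in>A. \<bar>g a\<bar> * b a))"
   using 1 2 M[OF y] by linarith
  qed
  define P where "P = (\<lambda>g h. SUP y\<in>K. F y + (\<bar>T h y\<bar> - \<bar>T g y\<bar>))"
  define U where "U = (\<lambda>g. SUP y\<in>K. F y + 2 * \<bar>T g y\<bar>)"
  define V where "V = (\<lambda>g. SUP y\<in>K. F y - 2 * \<bar>T g y\<bar>)"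
  define W where "W = (\<lambda>g. SUP y\<in>K. F y + 2 * T g y)"
  have bP: "bdd_above ((\<lambda>y. F y + (\<bar>T h y\<bar> - \<bar>T g y\<bar>)) ` K)" for g h
  using bdd[of "-1" g 1 h 0] by simp
  have bU: "bdd_above ((\<lambda>y. F y + 2 * \<bar>T g y\<bar>) ` K)" for g using bdd[of 2 g 0 g 0] by simp
  have bV: "bdd_above ((\<lambda>y. F y - 2 * \<bar>T g y\<bar>) ` K)" for g using bdd[of "-2" g 0 g 0] by simp
  have bW: "bdd_above ((\<lambda>y. F y + 2 * T g y) ` K)" for g using bdd[of 0 g 0 g 2] by simp
  have fin: "finite ?S" "?S ~= {}" using A by (simp_all add: finite_sign_vectors sign_vectors_nonempty)
  have s1: "(SUP y\<in>K. F y + (N y - \<bar>T g y\<bar>)) <= ?av (\<lambda>h. P g h)" for g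
  proof (rule cSUP_least[OF K])
  fix y assume y: "y \<in> K"
  have "F y + (N y - \<bar>T g y\<bar>) <= (F y - \<bar>T g y\<bar>) + ?av (\<lambda>h. \<bar>T h y\<bar>)"
   using average_sign_lower[OF A, of y] by (simp add: N_def T_def)
  also have "... = ?av (\<lambda>h. F y - \<bar>T g y\<bar>) + ?av (\<lambda>h. \<bar>T h y\<bar>)"
   using fin by (simp add: average_const)
  also have "... = ?av (\<lambda>h. F y + (\<bar>T h y\<bar> - \<bar>T g y\<bar>))"
   unfolding average_add[symmetric] by (simp add: algebra_simps)
  also have "... <= ?av (\<lambda>h. P g h)" unfolding P_def by (intro average_mono cSUP_upper y bP)
  finally show "F y + (N y - \<bar>T g y\<bar>) <= ?av (\<lambda>h. P g h)" .
  qed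
  have s2: "P g h <= (1/2) * U h + (1/2) * V g" for g h unfolding P_def
  proof (rule cSUP_least[OF K])
  fix y assume y: "y \<in> K"
  have "F y + 2 * \<bar>T h y\<bar> <= U h" "F y - 2 * \<bar>T g y\<bar> <= V g"
   unfolding U_def V_def by (auto intro!: cSUP_upper y bU bV)
  then show "F y + (\<bar>T h y\<bar> - \<bar>T g y\<bar>) <= (1/2) * U h + (1/2) * V g" by simp
  qed
  have s3: "U g + V g <= W g + W (\<lambda>a. - g a)" for g
  proof -
  have Tm: "T (\<lambda>a. - g a) y = - T g y" for y by (simp add: T_def sum_negf)
  have *: "F y + 2 * \<bar>T g y\<bar> + (F z - 2 * \<bar>T g z\<bar>) <= W g + W (\<lambda>a. - g a)" if "y \<in> K" "z \<in> K" for y z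
  proof -
   have "F x + 2 * T g x <= W g" "F x - 2 * T g x <= W (\<lambda>a. - g a)" if "x \<in> K" for x
    using cSUP_upper[OF that bW[of g]] cSUP_upper[OF that bW[of "\<lambda>a. - g a"]] by (auto simp: W_def Tm)
   from this[OF \<open>y \<in> K\<close>] this[OF \<open>z \<in> K\<close>] show ?thesis by (auto simp: abs_if)
  qed
  have "U g <= W g + W (\<lambda>a. - g a) - (F z - 2 * \<bar>T g z\<bar>)" if "z \<in> K" for z
   unfolding U_def using *[OF _ that] by (intro cSUP_least[OF K]) (simp add: algebra_simps)
  then have "V g <= W g + W (\<lambda>a. - g a) - U g"
   unfolding V_def by (intro cSUP_least[OF K]) (simp add: algebra_simps)
  then show ?thesis by simp
  qed
  have "?av (\<lambda>g. SUP y\<in>K. F y + (N y - \<bar>T g y\<bar>)) <= ?av (\<lambda>g. ?av (\<lambda>h. P g h))"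
  by (intro average_mono s1)
  also have "... <= ?av (\<lambda>g. ?av (\<lambda>h. (1/2) * U h + (1/2) * V g))" by (intro average_mono s2)
  also have "... = (1/2) * ?av (\<lambda>g. U g + V g)"
  unfolding average_add average_mult using fin by (simp add: average_const average_add)
  also have "... <= (1/2) * ?av (\<lambda>g. W g + W (\<lambda>a. - g a))"
  by (intro mult_left_mono average_mono s3) simp
  also have "... = ?av W" unfolding average_add average_sign_uminus[of A W] by simp
  finally show ?thesis unfolding W_def N_def T_def .
qed

lemma row_average_sup:
  fixes K :: "('i => real) set" and F :: "('i => real) => real"
  assumes A: "finite A" and K: "K ~= {}" and F: "bounded (F ` K)"
  and B: "\<And>a. a \<in> A ==> bounded ((\<lambda>y. y a) ` K)"
  shows "row_average A k (\<lambda>G. SUP y\<in>K. F y + (\<Sum>i<k. sqrt (\<Sum>a\<in>A. (y a)\<^sup>2) / 2 - \<bar>\<Sum>a\<in>A. G i a * y a\<bar>))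
  <= row_average A k (\<lambda>G. SUP y\<in>K. F y + 2 * (\<Sum>i<k. \<Sum>a\<in>A. G i a * y a))" using F
proof (induction k arbitrary: F)
  case 0
  then show ?case by simp
next
  case (Suc k)
  let ?av = "average (sign_vectors A)"
  define T where "T = (\<lambda>g y. \<Sum>a\<in>A. g a * y a :: real)"
  define N where "N = (\<lambda>y. sqrt (\<Sum>a\<in>A. (y a)\<^sup>2) / 2)"
  obtain M where M: "\<And>y. y \<in> K ==> \<bar>F y\<bar> <= M" using Suc.prems unfolding bounded_iff by auto
  have "\<forall>a\<in>A. \<exists>b. \<forall>y\<in>K. \<bar>y a\<bar> <= b" using B unfolding bounded_iff by auto
  then obtain b where b: "\<And>a y. a \<in> A ==> y \<in> K ==> \<bar>y a\<bar> <= b a" by metis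
  have Tb: "\<bar>T g y\<bar> <= (\<Sum>a\<in>A. \<bar>g a\<bar> * b a)" if "y \<in> K" for g y
  unfolding T_def using b that
  by (intro order_trans[OF sum_abs] sum_mono) (auto simp: abs_mult intro!: mult_left_mono)
  have Nb: "\<bar>N y\<bar> <= sqrt (\<Sum>a\<in>A. (b a)\<^sup>2) / 2" if "y \<in> K" for y
  proof -
  have "(y a)\<^sup>2 <= (b a)\<^sup>2" if "a \<in> A" for a
   using b[OF that \<open>y \<in> K\<close>] by (metis abs_ge_zero power2_abs power_mono)
  then have "(\<Sum>a\<in>A. (y a)\<^sup>2) <= (\<Sum>a\<in>A. (b a)\<^sup>2)" by (rule sum_mono)
  then show ?thesis by (simp add: N_def sum_nonneg)
  qed
  have bd1: "bounded ((\<lambda>y. F y + (N y - \<bar>T g y\<bar>)) ` K)" for g unfolding bounded_iff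
  proof (intro exI ballI, elim imageE)
  fix x y assume x: "x = F y + (N y - \<bar>T g y\<bar>)" and "y \<in> K"
  then show "norm x <= M + (sqrt (\<Sum>a\<in>A. (b a)\<^sup>2) / 2 + (\<Sum>a\<in>A. \<bar>g a\<bar> * b a))"
   using M[of y] Nb[of y] Tb[of y g] unfolding x real_norm_def by linarith
  qed
  have bd2: "bounded ((\<lambda>y. F y + 2 * (\<Sum>i<k. T (G i) y)) ` K)" for G unfolding bounded_iff
  proof (intro exI ballI, elim imageE)
  fix x y assume x: "x = F y + 2 * (\<Sum>i<k. T (G i) y)" and y: "y \<in> K"
  have "\<bar>\<Sum>i<k. T (G i) y\<bar> <= (\<Sum>i<k. \<Sum>a\<in>A. \<bar>G i a\<bar> * b a)"
   using Tb[OF y] by (intro order_trans[OF sum_abs] sum_mono)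
  then show "norm x <= M + 2 * (\<Sum>i<k. \<Sum>a\<in>A. \<bar>G i a\<bar> * b a)"
   using M[OF y] unfolding x real_norm_def by linarith
  qed
  have "row_average A (Suc k) (\<lambda>G. SUP y\<in>K. F y + (\<Sum>i<Suc k. N y - \<bar>T (G i) y\<bar>))
  = ?av (\<lambda>g. row_average A k (\<lambda>G. SUP y\<in>K. (F y + (N y - \<bar>T g y\<bar>)) + (\<Sum>i<k. N y - \<bar>T (G i) y\<bar>)))"
  by (simp add: algebra_simps)
  also have "... <= ?av (\<lambda>g. row_average A k (\<lambda>G. SUP y\<in>K. (F y + (N y - \<bar>T g y\<bar>)) + 2 * (\<Sum>i<k. T (G i) y)))"
  using Suc.IH[OF bd1] by (intro average_mono) (simp add: N_def T_def)
  also have "... = row_average A k (\<lambda>G. ?av (\<lambda>g. SUP y\<in>K. (F y + 2 * (\<Sum>i<k. T (G i) y)) + (N y - \<bar>T g y\<bar>)))"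
  unfolding row_average_commute by (simp add: algebra_simps)
  also have "... <= row_average A k (\<lambda>G. ?av (\<lambda>g. SUP y\<in>K. (F y + 2 * (\<Sum>i<k. T (G i) y)) + 2 * T g y))"
  using average_sup_row[OF A K bd2 B] by (intro row_average_mono) (simp add: N_def T_def)
  also have "... = row_average A (Suc k) (\<lambda>G. SUP y\<in>K. F y + 2 * (\<Sum>i<Suc k. T (G i) y))"
  unfolding row_average_commute by (simp add: algebra_simps)
  finally show ?case unfolding N_def T_def .
qed

text \<open>The Pajor and Tomczak-Jaegermann inequality in dual form. Let \<open>K\<close> be the
  polar body of \<open>p\<close>. On \<open>K\<close> the averaged deviation between \<open>k\<close>
  times the Euclidean norm and the sum of the \<open>\<bar>G i y\<bar>\<close> is controlled by the
  mean norm, so for some \<open>G\<close> every \<open>y \<in> K\<close> orthogonal to all rows is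
  short. By Hahn-Banach the seminorm of \<open>x\<close> modulo the rows is attained at such a
  \<open>y\<close>.\<close>
theorem random_sign_subspace:
  fixes p :: "('i => real) => real"
  assumes A: "finite A" and k: "k > 0"
  and add: "\<And>x y. p (\<lambda>a. x a + y a) <= p x + p y"
  and scale: "\<And>c x. p (\<lambda>a. c * x a) = \<bar>c\<bar> * p x"
  and pA: "\<And>x y. (\<And>a. a \<in> A ==> x a = y a) ==> p x = p y"
  and mean: "row_average A k (\<lambda>G. p (\<lambda>a. \<Sum>i<k. G i a)) <= \<beta>"
  obtains G :: "nat => 'i => real" where
  "\<And>x \<epsilon>. \<epsilon> > 0 ==> \<exists>s. p (\<lambda>a. x a - (\<Sum>i<k. s i * G i a)) <= 4 * \<beta> / real k * sqrt (\<Sum>a\<in>A. (x a)\<^sup>2) + \<epsilon>"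
proof -
  have zero: "p (\<lambda>_. 0) = 0" using scale[of 0 "\<lambda>_. 0"] by simp
  have neg: "p (\<lambda>a. - x a) = p x" for x using scale[of "-1" x] by simp
  have nonneg: "p x >= 0" for x using add[of x "\<lambda>a. - x a"] neg[of x] zero by simp
  (* The polar body of p. *)
  define K where "K = {y. \<forall>h. (\<Sum>a\<in>A. h a * y a) <= p h}"
  have K0: "(\<lambda>_. 0) \<in> K" using nonneg by (simp add: K_def)
  then have Kne: "K ~= {}" by blast
  have Kb: "bounded ((\<lambda>y. y a) ` K)" if "a \<in> A" for a
  proof -
  let ?d = "\<lambda>c b. if b = a then c else 0 :: real"
  have "\<bar>y a\<bar> <= p (?d 1) + p (?d (-1))" if y: "y \<in> K" for y
  proof -
   have "c * y a <= p (?d c)" for c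
   proof -
    have "(\<Sum>b\<in>A. ?d c b * y b) = (\<Sum>b\<in>A. if b = a then c * y a else 0)" by (rule sum.cong) auto
    also have "... = c * y a" using A \<open>a \<in> A\<close> by simp
    finally have "(\<Sum>b\<in>A. ?d c b * y b) = c * y a" .
    moreover from y have "\<forall>h. (\<Sum>a\<in>A. h a * y a) <= p h" unfolding K_def by (rule CollectD)
    from this[rule_format, of "?d c"] have "(\<Sum>b\<in>A. ?d c b * y b) <= p (?d c)" .
    ultimately show ?thesis by linarith
   qed
   from this[of 1] this[of "-1"] show ?thesis
    using nonneg[of "?d 1"] nonneg[of "?d (-1)"] by (simp add: abs_le_iff)
  qed
  then show ?thesis unfolding bounded_iff by auto
  qed
  define N where "N = (\<lambda>y. sqrt (\<Sum>a\<in>A. (y a :: real)\<^sup>2))"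
  have "row_average A k (\<lambda>G. SUP y\<in>K. 0 + (\<Sum>i<k. N y / 2 - \<bar>\<Sum>a\<in>A. G i a * y a\<bar>))
   <= row_average A k (\<lambda>G. SUP y\<in>K. 0 + 2 * (\<Sum>i<k. \<Sum>a\<in>A. G i a * y a))"
  unfolding N_def by (rule row_average_sup[OF A Kne _ Kb]) (auto simp: bounded_iff)
  also have "... <= row_average A k (\<lambda>G. 2 * p (\<lambda>a. \<Sum>i<k. G i a))"
  proof (intro row_average_mono cSUP_least[OF Kne])
  fix G y assume "y \<in> K"
  then have "(\<Sum>a\<in>A. (\<Sum>i<k. G i a) * y a) <= p (\<lambda>a. \<Sum>i<k. G i a)" by (simp add: K_def)
  moreover have "(\<Sum>a\<in>A. (\<Sum>i<k. G i a) * y a) = (\<Sum>i<k. \<Sum>a\<in>A. G i a * y a)"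
   by (simp add: sum_distrib_right sum.swap[of _ A])
  ultimately show "0 + 2 * (\<Sum>i<k. \<Sum>a\<in>A. G i a * y a) <= 2 * p (\<lambda>a. \<Sum>i<k. G i a)" by simp
  qed
  also have "... <= 2 * \<beta>" unfolding row_average_mult using mean by simp
  finally have av: "row_average A k (\<lambda>G. SUP y\<in>K. 0 + (\<Sum>i<k. N y / 2 - \<bar>\<Sum>a\<in>A. G i a * y a\<bar>)) <= 2 * \<beta>" .
  obtain G where G: "(SUP y\<in>K. 0 + (\<Sum>i<k. N y / 2 - \<bar>\<Sum>a\<in>A. G i a * y a\<bar>)) <= 2 * \<beta>"
  using exists_row_average_ge[OF A, of "\<lambda>G. SUP y\<in>K. 0 + (\<Sum>i<k. N y / 2 - \<bar>\<Sum>a\<in>A. G i a * y a\<bar>)" k]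
   order_trans[OF _ av] by blast
  have "\<forall>a\<in>A. \<exists>b. \<forall>y\<in>K. \<bar>y a\<bar> <= b" using Kb unfolding bounded_iff by auto
  then obtain b where b: "\<And>a y. a \<in> A ==> y \<in> K ==> \<bar>y a\<bar> <= b a" by metis
  have key: "N y <= 4 * \<beta> / real k" if y: "y \<in> K" and orth: "\<And>i. i < k ==> (\<Sum>a\<in>A. G i a * y a) = 0" for y
  proof -
  have "bdd_above ((\<lambda>y. 0 + (\<Sum>i<k. N y / 2 - \<bar>\<Sum>a\<in>A. G i a * y a\<bar>)) ` K)"
  proof (rule bdd_aboveI2)
   fix y assume y: "y \<in> K"
   have "(y a)\<^sup>2 <= (b a)\<^sup>2" if "a \<in> A" for a
    using b[OF that y] by (metis abs_ge_zero power2_abs power_mono)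
   then have "N y <= sqrt (\<Sum>a\<in>A. (b a)\<^sup>2)" unfolding N_def by (intro real_sqrt_le_mono sum_mono)
   then show "0 + (\<Sum>i<k. N y / 2 - \<bar>\<Sum>a\<in>A. G i a * y a\<bar>) <= (\<Sum>i<k. sqrt (\<Sum>a\<in>A. (b a)\<^sup>2) / 2)"
    unfolding add_0 by (intro sum_mono) simp
  qed
  from cSUP_upper[OF y this] have "(\<Sum>i<k. N y / 2 - \<bar>\<Sum>a\<in>A. G i a * y a\<bar>) <= 2 * \<beta>"
   using G by linarith
  then have "real k * (N y / 2) <= 2 * \<beta>" using orth by simp
  then show ?thesis using k by (simp add: field_simps)
  qed
  define p' where "p' = (\<lambda>h. INF s. p (\<lambda>a. h a - (\<Sum>i<k. s i * G i a)))"
  have bdd: "bdd_below (range (\<lambda>s. p (\<lambda>a. h a - (\<Sum>i<k. s i * G i a))))" for h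
  using nonneg by (intro bdd_belowI2) auto
  have p'_le: "p' h <= p (\<lambda>a. h a - (\<Sum>i<k. s i * G i a))" for h s
  unfolding p'_def by (rule cINF_lower[OF bdd]) simp
  have p'_ge: "c <= p' h" if "\<And>s. c <= p (\<lambda>a. h a - (\<Sum>i<k. s i * G i a))" for c h
  unfolding p'_def using that by (intro cINF_greatest) auto
  have p'_p: "p' h <= p h" for h using p'_le[of h "\<lambda>_. 0"] by simp
  have p'0: "p' h >= 0" for h by (intro p'_ge nonneg)
  have p'_add: "p' (\<lambda>a. x a + y a) <= p' x + p' y" for x y
  proof -
  let ?f = "\<lambda>s a. \<Sum>i<k. s i * G i a"
  have "p' (\<lambda>a. x a + y a) <= p (\<lambda>a. x a - ?f s a) + p (\<lambda>a. y a - ?f t a)" for s t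
  proof -
   have "p' (\<lambda>a. x a + y a) <= p (\<lambda>a. (x a + y a) - ?f (\<lambda>i. s i + t i) a)" by (rule p'_le)
   also have "(\<lambda>a. (x a + y a) - ?f (\<lambda>i. s i + t i) a) = (\<lambda>a. (x a - ?f s a) + (y a - ?f t a))"
    by (auto simp: fun_eq_iff algebra_simps sum.distrib)
   also have "p \<dots> <= p (\<lambda>a. x a - ?f s a) + p (\<lambda>a. y a - ?f t a)" by (rule add)
   finally show ?thesis .
  qed
  then have "p' (\<lambda>a. x a + y a) - p (\<lambda>a. x a - ?f s a) <= p' y" for s
   by (intro p'_ge) (simp add: algebra_simps)
  then have "p' (\<lambda>a. x a + y a) - p' y <= p' x" by (intro p'_ge) (simp add: algebra_simps)
  then show ?thesis by simp
  qed
  have p'_scale_le: "p' (\<lambda>a. c * x a) <= c * p' x" if "c > 0" for c x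
  proof -
  have "p' (\<lambda>a. c * x a) / c <= p' x"
  proof (rule p'_ge)
   fix s
   have "p' (\<lambda>a. c * x a) <= p (\<lambda>a. c * x a - (\<Sum>i<k. (c * s i) * G i a))" by (rule p'_le)
   also have "(\<lambda>a. c * x a - (\<Sum>i<k. (c * s i) * G i a)) = (\<lambda>a. c * (x a - (\<Sum>i<k. s i * G i a)))"
    by (auto simp: fun_eq_iff algebra_simps sum_distrib_left)
   also have "p \<dots> = c * p (\<lambda>a. x a - (\<Sum>i<k. s i * G i a))" using that by (subst scale) simp
   finally show "p' (\<lambda>a. c * x a) / c <= p (\<lambda>a. x a - (\<Sum>i<k. s i * G i a))"
    using that by (simp add: field_simps)
  qed
  then show ?thesis using that by (simp add: field_simps)
  qed
  have p'_scale: "p' (\<lambda>a. c * x a) = c * p' x" if "c >= 0" for c x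
  proof (cases "c = 0")
  case True
  have "p' (\<lambda>_. 0) = 0" using p'_p[of "\<lambda>_. 0"] p'0[of "\<lambda>_. 0"] zero by simp
  then show ?thesis using True by simp
  next
  case False
  then have c: "c > 0" using that by simp
  have "p' (\<lambda>a. (1/c) * (c * x a)) <= (1/c) * p' (\<lambda>a. c * x a)"
   using c by (intro p'_scale_le) simp
  then have "c * p' x <= p' (\<lambda>a. c * x a)" using c by (simp add: field_simps)
  then show ?thesis using p'_scale_le[OF c, of x] by simp
  qed
  have sub: "sublinear p'" unfolding sublinear_def by (intro conjI allI impI p'_add p'_scale)
  have p'A: "p' x = p' y" if "\<And>a. a \<in> A ==> x a = y a" for x y
  unfolding p'_def by (intro INF_cong refl pA) (use that in simp)
  have p'G: "p' (\<lambda>a. c * G i a) = 0" if "i < k" for i c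
  proof -
  have "(\<Sum>j<k. (if j = i then c else 0) * G j a) = c * G i a" for a
  proof -
   have "(\<Sum>j<k. (if j = i then c else 0) * G j a) = (\<Sum>j<k. if j = i then c * G i a else 0)"
    by (rule sum.cong) auto
   then show ?thesis using that by simp
  qed
  then have "p' (\<lambda>a. c * G i a) <= p (\<lambda>a. 0)"
   using p'_le[of "\<lambda>a. c * G i a" "\<lambda>j. if j = i then c else 0"] by simp
  then show ?thesis using p'0[of "\<lambda>a. c * G i a"] zero by simp
  qed
  have main: "p' x <= 4 * \<beta> / real k * N x" for x
  proof -
  obtain y where y: "\<And>h. (\<Sum>a\<in>A. y a * h a) <= p' h" "(\<Sum>a\<in>A. y a * x a) = p' x"
   using hahn_banach_coordinates[OF A sub p'A, of x] by blast
  have "y \<in> K" unfolding K_def using y(1) p'_p by (auto simp: mult.commute intro: order_trans)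
  moreover have "(\<Sum>a\<in>A. G i a * y a) = 0" if "i < k" for i
  proof -
   have "(\<Sum>a\<in>A. y a * (c * G i a)) <= 0" for c using y(1)[of "\<lambda>a. c * G i a"] p'G[OF that] by simp
   from this[of 1] this[of "-1"] show ?thesis by (simp add: sum_negf mult.commute)
  qed
  ultimately have N: "N y <= 4 * \<beta> / real k" by (rule key)
  have "p' x <= (\<Sum>a\<in>A. \<bar>y a\<bar> * \<bar>x a\<bar>)"
   unfolding y(2)[symmetric] by (intro sum_mono) (metis abs_ge_self abs_mult)
  also have "... <= N y * N x" using L2_set_mult_ineq[of y x A] by (simp add: L2_set_def N_def)
  also have "... <= 4 * \<beta> / real k * N x" using N by (intro mult_right_mono) (auto simp: N_def sum_nonneg)
  finally show ?thesis .
  qed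
  show ?thesis
  proof (rule that[of G])
  fix x and \<epsilon> :: real assume "\<epsilon> > 0"
  then have "p' x < 4 * \<beta> / real k * N x + \<epsilon>" using main[of x] by simp
  then show "\<exists>s. p (\<lambda>a. x a - (\<Sum>i<k. s i * G i a)) <= 4 * \<beta> / real k * sqrt (\<Sum>a\<in>A. (x a)\<^sup>2) + \<epsilon>"
   unfolding p'_def N_def using cINF_less_iff[OF _ bdd] by (auto intro: less_imp_le)
  qed
qed

section \<open>Integration over the sphere\<close>

lemma space_sphere_measure: "space (sphere_measure :: 'a::euclidean_space measure) = sphere 0 1"
  by (simp add: sphere_measure_def space_scale_measure space_restrict_space)

lemma sets_sphere_measure:
  "sets (sphere_measure :: 'a::euclidean_space measure) = sets (restrict_space borel (sphere 0 1))"
  by (simp add: sphere_measure_def)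

lemma borel_measurable_sphere:
  fixes f :: "'a::euclidean_space => 'b::topological_space"
  assumes "f \<in> borel_measurable borel" shows "f \<in> borel_measurable sphere_measure"
proof -
  have "f \<in> borel_measurable (restrict_space borel (sphere 0 1))"
  by (rule measurable_restrict_space1[OF assms])
  then show ?thesis unfolding measurable_cong_sets[OF sets_sphere_measure refl] .
qed

lemma radial_projection_measurable:
  "(\<lambda>x::'a::euclidean_space. x /\<^sub>R norm x)
  \<in> restrict_space lborel (cball 0 1 - {0}) \<rightarrow>\<^sub>M restrict_space borel (sphere 0 1)"
  by (rule measurable_restrict_space2)
  (auto simp: space_restrict_space intro!: measurable_restrict_space1)

lemma radial_projection_borel: "(\<lambda>x::'a::euclidean_space. x /\<^sub>R norm x) \<in> borel_measurable borel"
  by measurable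

text \<open>As a density over the push-forward, the scaled measure is open to the rules for
  integrals.\<close>
lemma sphere_measure_density:
  "(sphere_measure :: 'a::euclidean_space measure)
  = density (distr (restrict_space lborel (cball 0 1 - {0})) (restrict_space borel (sphere 0 1))
       (\<lambda>x. x /\<^sub>R norm x)) (\<lambda>_. ennreal (real DIM('a)))" unfolding sphere_measure_def
  by (rule measure_eqI) (auto simp: emeasure_density_const ennreal_of_nat_eq_real_of_nat)

lemma
  fixes f :: "'a::euclidean_space => complex"
  assumes f: "f \<in> borel_measurable sphere_measure"
  shows integral_sphere_measure: "spint f
   = of_nat DIM('a) * (\<integral>x. indicator (cball 0 1 - {0}) x *\<^sub>R f (x /\<^sub>R norm x) \<partial>lborel)" (is ?A)
  and integrable_sphere_measure: "integrable sphere_measure f \<longleftrightarrow>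
   integrable lborel (\<lambda>x. indicator (cball 0 1 - {0}) x *\<^sub>R f (x /\<^sub>R norm x))" (is ?B)
proof -
  let ?R = "restrict_space lborel (cball 0 1 - {0::'a})"
  let ?T = "restrict_space borel (sphere 0 (1::real)) :: 'a measure"
  have f': "f \<in> borel_measurable ?T" using f measurable_cong_sets[OF sets_sphere_measure refl] by blast
  then have f'': "f \<in> borel_measurable (distr ?R ?T (\<lambda>x. x /\<^sub>R norm x))" by simp
  have sp: "(cball 0 1 - {0::'a}) \<inter> space lborel \<in> sets lborel" by simp
  have "spint f = (\<integral>x. real DIM('a) *\<^sub>R f (x /\<^sub>R norm x) \<partial>?R)"
  unfolding sphere_measure_density
  by (subst integral_density[OF f'']) (auto simp: integral_distr[OF radial_projection_measurable f'])
  also have "... = real DIM('a) *\<^sub>R (\<integral>x. indicator (cball 0 1 - {0}) x *\<^sub>R f (x /\<^sub>R norm x) \<partial>lborel)"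
  by (simp add: integral_restrict_space[OF sp])
  finally show ?A by (simp add: scaleR_conv_of_real)
  let ?D = "distr ?R ?T (\<lambda>x. x /\<^sub>R norm x)"
  have sc: "integrable ?D (\<lambda>x. real DIM('a) *\<^sub>R f x) \<longleftrightarrow> integrable ?D f"
  proof
  assume "integrable ?D (\<lambda>x. real DIM('a) *\<^sub>R f x)"
  then have "integrable ?D (\<lambda>x. (1 / real DIM('a)) *\<^sub>R (real DIM('a) *\<^sub>R f x))"
   by (rule integrable_scaleR_right)
  then show "integrable ?D f" by simp
  qed (rule integrable_scaleR_right)
  have "integrable sphere_measure f \<longleftrightarrow> integrable ?D (\<lambda>x. real DIM('a) *\<^sub>R f x)"
  unfolding sphere_measure_density by (rule integrable_density[OF f'']) auto
  also have "... \<longleftrightarrow> integrable ?R (\<lambda>x. f (x /\<^sub>R norm x))"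
  unfolding sc by (rule integrable_distr_eq[OF radial_projection_measurable f'])
  also have "... \<longleftrightarrow> integrable lborel (\<lambda>x. indicator (cball 0 1 - {0}) x *\<^sub>R f (x /\<^sub>R norm x))"
  by (rule integrable_restrict_space[OF sp])
  finally show ?B .
qed

lemma emeasure_sphere_measure_finite: "emeasure (sphere_measure :: 'a::euclidean_space measure) (sphere 0 1) < \<infinity>"
proof -
  have "emeasure (sphere_measure :: 'a measure) (sphere 0 1)
   = of_nat DIM('a) * emeasure lborel (cball 0 1 - {0::'a})" unfolding sphere_measure_def
  by (simp add: emeasure_distr[OF radial_projection_measurable] emeasure_restrict_space
    space_restrict_space sets_restrict_space_iff)
   (rule arg_cong2[where f = "(*)"], auto intro!: arg_cong2[where f = emeasure])
  also have "... <= of_nat DIM('a) * emeasure lborel (cball 0 (1::real) :: 'a set)"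
  by (intro mult_left_mono emeasure_mono) auto
  also have "... < \<infinity>"
  using emeasure_lborel_cball_finite[of "0::'a" 1] by (simp add: ennreal_mult_less_top of_nat_less_top)
  finally show ?thesis .
qed

interpretation sphere: finite_measure "sphere_measure :: 'a::euclidean_space measure"
proof
  show "emeasure (sphere_measure :: 'a measure) (space sphere_measure) ~= \<infinity>"
  using emeasure_sphere_measure_finite unfolding space_sphere_measure by (simp add: less_top)
qed

lemma integrable_sphere_bounded:
  fixes f :: "'a::euclidean_space => 'b::{banach,second_countable_topology}"
  assumes "f \<in> borel_measurable sphere_measure" "\<And>x. norm x = 1 ==> norm (f x) <= B"
  shows "integrable sphere_measure f"
  using assms by (intro sphere.integrable_const_bound[where B = B] AE_I2) (auto simp: space_sphere_measure)

lemma continuous_bounded_sphere: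
  fixes f :: "'a::euclidean_space => 'b::real_normed_vector"
  assumes "continuous_on UNIV f"
  obtains B where "B >= 0" "\<And>x. norm x = 1 ==> norm (f x) <= B"
proof -
  have "compact (f ` sphere 0 1)" by (intro compact_continuous_image continuous_on_subset[OF assms]) auto
  then obtain B where "\<forall>y\<in>f ` sphere 0 1. norm y <= B" using compact_imp_bounded bounded_iff by metis
  then show ?thesis by (intro that[of "max B 0"]) (auto simp: le_max_iff_disj)
qed

lemma integrable_sphere_continuous:
  fixes f :: "'a::euclidean_space => 'b::{banach,second_countable_topology}"
  assumes "continuous_on UNIV f"
  shows "integrable sphere_measure f"
proof -
  obtain B where "B >= 0" "\<And>x. norm x = 1 ==> norm (f x) <= B"
  using continuous_bounded_sphere[OF assms] by blast
  then show ?thesis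
  using assms by (intro integrable_sphere_bounded borel_measurable_sphere borel_measurable_continuous_onI)
qed

lemma sphere_integral_cong:
  fixes f :: "'a::euclidean_space => 'b::{banach,second_countable_topology}"
  assumes "\<And>x. norm x = 1 ==> f x = g x"
  shows "spint f = spint g" by (rule Bochner_Integration.integral_cong) (auto simp: space_sphere_measure assms)

lemma sphere_integral_pos:
  fixes f :: "'a::euclidean_space => real"
  assumes f: "continuous_on UNIV f" and nn: "\<And>x. norm x = 1 ==> f x >= 0"
  and 0: "spint f = 0" and x: "norm x = 1"
  shows "f x = 0"
proof (rule ccontr)
  assume fx: "f x ~= 0"
  have bm: "f \<in> borel_measurable borel" by (rule borel_measurable_continuous_onI[OF f])
  have "AE y in sphere_measure. f y = 0" using 0 nn integrable_sphere_continuous[OF f]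
  by (subst (asm) integral_nonneg_eq_0_iff_AE) (auto simp: space_sphere_measure)
  then have "AE y in distr (restrict_space lborel (cball 0 1 - {0})) (restrict_space borel (sphere 0 1))
       (\<lambda>x::'a. x /\<^sub>R norm x). f y = 0"
  unfolding sphere_measure_density by (subst (asm) AE_density) auto
  moreover have "{y \<in> space (restrict_space borel (sphere 0 (1::real))). f y = 0} \<in> sets (restrict_space borel (sphere 0 1))"
  using measurable_restrict_space1[OF bm, of "sphere 0 1"] by measurable
  ultimately have "AE y in restrict_space lborel (cball 0 1 - {0}). f (y /\<^sub>R norm y) = 0"
  by (subst (asm) AE_distr_iff[OF radial_projection_measurable])
  then have ae: "AE y in lborel. y \<in> cball 0 1 - {0} --> f (y /\<^sub>R norm y) = 0"
  by (subst (asm) AE_restrict_space_iff) auto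
  define V where "V = {y \<in> ball 0 1 - {0}. f (y /\<^sub>R norm y) ~= 0}"
  have "continuous_on (ball 0 1 - {0}) (\<lambda>y. f (y /\<^sub>R norm y))"
  by (rule continuous_on_compose2[OF f]) (auto intro!: continuous_intros)
  then have "open ((\<lambda>y. f (y /\<^sub>R norm y)) -` (- {0}) \<inter> (ball 0 1 - {0}))"
  by (subst (asm) continuous_on_open_vimage) auto
  moreover have "(\<lambda>y. f (y /\<^sub>R norm y)) -` (- {0}) \<inter> (ball 0 1 - {0}) = V" by (auto simp: V_def)
  ultimately have "open V" by simp
  moreover have "x /\<^sub>R 2 \<in> V" using x fx by (auto simp: V_def)
  ultimately have "\<not> negligible V" using open_not_negligible by blast
  moreover have "AE y in lborel. y \<notin> V" using ae by eventually_elim (auto simp: V_def)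
  then have "V \<in> null_sets lborel" using \<open>open V\<close> by (subst (asm) AE_iff_null) auto
  then have "negligible V" by (simp add: negligible_iff_null_sets null_sets_completionI)
  ultimately show False by blast
qed

lemma sphere_measure_pos: "measure (sphere_measure :: 'a::euclidean_space measure) (sphere 0 1) > 0"
proof (rule ccontr)
  assume "\<not> ?thesis"
  then have "measure (sphere_measure :: 'a measure) (sphere 0 1) = 0"
  by (metis linorder_neqE_linordered_idom measure_nonneg not_less)
  then have "spint (\<lambda>_::'a. 1::real) = 0"
  using space_sphere_measure by (metis lebesgue_integral_const mult_zero_left real_scaleR_def scaleR_zero_left)
  moreover obtain x :: 'a where "norm x = 1" using vector_choose_size[of 1] by auto
  ultimately show False using sphere_integral_pos[of "\<lambda>_::'a. 1" x] by auto
qed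

section \<open>Radial weights\<close>

lemma lborel_integral_scale:
  fixes f :: "'a::euclidean_space => complex"
  assumes [measurable]: "f \<in> borel_measurable borel" and c: "c > 0"
  shows "integral\<^sup>L lborel f = c ^ DIM('a) *\<^sub>R (\<integral>x. f (c *\<^sub>R x) \<partial>lborel)"
proof -
  have "integral\<^sup>L lborel f
  = integral\<^sup>L (density (distr lborel borel (\<lambda>x. 0 + c *\<^sub>R x)) (\<lambda>_. ennreal (\<bar>c\<bar> ^ DIM('a)))) f"
  using lborel_affine[of c "0::'a"] c by simp
  also have "... = c ^ DIM('a) *\<^sub>R (\<integral>x. f (c *\<^sub>R x) \<partial>lborel)"
  using c by (subst integral_density) (auto simp: integral_distr)
  finally show ?thesis .
qed

text \<open>For the indicator of a ball around the origin as weight this is the scaling of Lebesgue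
  measure. A continuous weight is a uniform limit of combinations of such indicators.\<close>
lemma radial_integral_zero:
  fixes g :: "'a::euclidean_space => complex" and h :: "real => real"
  assumes g: "g \<in> borel_measurable borel" and gB: "\<And>x. norm (g x) <= B"
  and hom: "\<And>t x. t > 0 ==> g (t *\<^sub>R x) = g x"
  and h: "continuous_on {0..1} h" and hm: "h \<in> borel_measurable borel"
  and 0: "(\<integral>x. indicator (cball 0 1) x *\<^sub>R g x \<partial>lborel) = 0"
  shows "(\<integral>x. (indicator (cball 0 1) x * h (norm x)) *\<^sub>R g x \<partial>lborel) = 0"
proof -
  note [measurable] = g hm
  have B0: "B >= 0" using gB[of 0] norm_ge_zero order_trans by blast
  have mi: "(\<lambda>x. indicator (cball 0 b) x *\<^sub>R g x) \<in> borel_measurable lborel" for b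
  using g by (intro borel_measurable_scaleR borel_measurable_indicator) auto
  have int: "integrable lborel (\<lambda>x. indicator (cball 0 b) x *\<^sub>R g x)" for b
  proof (rule Bochner_Integration.integrable_bound)
  show "integrable lborel (\<lambda>x. indicator (cball 0 b :: 'a set) x * B)"
   using emeasure_lborel_cball_finite[of "0::'a" b] by (intro integrable_mult_left) simp
  show "AE x in lborel. norm (indicator (cball 0 b) x *\<^sub>R g x) <= norm (indicator (cball 0 b) x * B)"
   using gB B0 by (intro AE_I2) (auto simp: indicator_def)
  show "(\<lambda>x. indicator (cball 0 b) x *\<^sub>R g x) \<in> borel_measurable lborel" by (rule mi)
  qed
  have J: "(\<integral>x. indicator (cball 0 b) x *\<^sub>R g x \<partial>lborel) = 0" if b: "b >= 0" for b
  proof (cases "b = 0")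
  case True
  have "AE x::'a in lborel. x ~= 0" by (rule AE_lborel_singleton)
  then have "AE x in lborel. indicator (cball 0 b) x *\<^sub>R g x = 0"
   by eventually_elim (use True in \<open>auto simp: indicator_def\<close>)
  then show ?thesis by (subst integral_cong_AE[OF mi, where g = "\<lambda>_. 0"]) auto
  next
  case False
  then have b: "b > 0" using that by simp
  have "(\<integral>x. indicator (cball 0 b) x *\<^sub>R g x \<partial>lborel)
   = b ^ DIM('a) *\<^sub>R (\<integral>x. indicator (cball 0 b) (b *\<^sub>R x) *\<^sub>R g (b *\<^sub>R x) \<partial>lborel)"
   by (rule lborel_integral_scale) (use b mi in simp_all)
  also have "(\<lambda>x. indicator (cball 0 b) (b *\<^sub>R x) *\<^sub>R g (b *\<^sub>R x)) = (\<lambda>x. indicator (cball 0 1) x *\<^sub>R g x)"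
   using b hom[OF b] by (auto simp: fun_eq_iff indicator_def mult_le_cancel_left1)
  finally show ?thesis using 0 by simp
  qed
  let ?I = "\<integral>x. (indicator (cball 0 1) x * h (norm x)) *\<^sub>R g x \<partial>lborel"
  let ?V = "measure lborel (cball 0 1 :: 'a set)"
  have "norm ?I <= \<epsilon> * (B * ?V)" if e: "\<epsilon> > 0" for \<epsilon>
  proof -
  have "uniformly_continuous_on {0..1} h" by (rule compact_uniformly_continuous[OF h]) simp
  then obtain \<delta> where d: "\<delta> > 0" "\<And>x y. x \<in> {0..1} ==> y \<in> {0..1} ==> dist y x < \<delta> ==> dist (h y) (h x) < \<epsilon>"
   unfolding uniformly_continuous_on_def using e by metis
  obtain n :: nat where n: "1 / real (Suc n) < \<delta>" using d(1) nat_approx_posE by blast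
  let ?n = "Suc n"
  define step where "step = (\<lambda>x::'a. \<Sum>j<?n. h (real (Suc j) / ?n) *
    (indicator (cball 0 (real (Suc j) / ?n)) x - indicator (cball 0 (real j / ?n)) x))"
  have sz: "(\<integral>x. step x *\<^sub>R g x \<partial>lborel) = 0"
  proof -
   have "(\<lambda>x. step x *\<^sub>R g x) = (\<lambda>x. \<Sum>j<?n. h (real (Suc j) / ?n) *\<^sub>R
    (indicator (cball 0 (real (Suc j) / ?n)) x *\<^sub>R g x - indicator (cball 0 (real j / ?n)) x *\<^sub>R g x))"
    unfolding step_def by (simp add: scaleR_sum_left scaleR_diff_left scaleR_diff_right algebra_simps)
   then have "(\<integral>x. step x *\<^sub>R g x \<partial>lborel) = (\<Sum>j<?n. (\<integral>x. h (real (Suc j) / ?n) *\<^sub>R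
    (indicator (cball 0 (real (Suc j) / ?n)) x *\<^sub>R g x - indicator (cball 0 (real j / ?n)) x *\<^sub>R g x) \<partial>lborel))"
    by (simp only:) (intro Bochner_Integration.integral_sum integrable_scaleR_right Bochner_Integration.integrable_diff int)
   also have "... = 0" by (intro sum.neutral ballI)
     (simp only: integral_scaleR_right Bochner_Integration.integral_diff[OF int int] J
      of_nat_0_le_iff divide_nonneg_nonneg diff_self scaleR_zero_right)
   finally show ?thesis .
  qed
  have step_int: "integrable lborel (\<lambda>x. step x *\<^sub>R g x)"
  proof -
   have "(\<lambda>x. step x *\<^sub>R g x) = (\<lambda>x. \<Sum>j<?n. h (real (Suc j) / ?n) *\<^sub>R
    (indicator (cball 0 (real (Suc j) / ?n)) x *\<^sub>R g x - indicator (cball 0 (real j / ?n)) x *\<^sub>R g x))"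
    unfolding step_def by (simp add: scaleR_sum_left scaleR_diff_left scaleR_diff_right algebra_simps)
   then show ?thesis
    by (simp only:) (intro Bochner_Integration.integrable_sum integrable_scaleR_right Bochner_Integration.integrable_diff int)
  qed
  have close: "\<bar>indicator (cball 0 1) x * h (norm x) - step x\<bar> <= \<epsilon> * indicator (cball 0 1) x" if x: "x ~= 0" for x
  proof (cases "norm x <= 1")
   case False
   then have out: "\<not> norm x <= real j / ?n" if "j <= ?n" for j
    using that by (smt (verit, best) divide_le_eq_1_pos of_nat_0_less_iff of_nat_mono zero_less_Suc)
   have "step x = 0" unfolding step_def
   proof (intro sum.neutral ballI)
    fix j assume "j \<in> {..<?n}"
    then have "\<not> norm x <= real (Suc j) / ?n" "\<not> norm x <= real j / ?n"
     using out[of "Suc j"] out[of j] by auto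
    then have "x \<notin> cball 0 (real (Suc j) / ?n)" "x \<notin> cball 0 (real j / ?n)" by (auto simp del: of_nat_Suc)
    then show "h (real (Suc j) / ?n) *
     (indicator (cball 0 (real (Suc j) / ?n)) x - indicator (cball 0 (real j / ?n)) x) = 0"
     by (simp del: of_nat_Suc)
   qed
   then show ?thesis using False by simp
  next
   case True
   define i where "i = nat \<lceil>norm x * ?n\<rceil> - 1"
   have pos: "norm x * ?n > 0" using x by simp
   then have c1: "\<lceil>norm x * ?n\<rceil> >= 1" by linarith
   then have ic: "real (Suc i) = of_int \<lceil>norm x * ?n\<rceil>" unfolding i_def by (simp add: of_nat_diff)
   have i1: "norm x * ?n <= real (Suc i)" "real i < norm x * ?n" using ic by linarith+
   have "norm x * ?n <= ?n" using True by simp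
   then have i2: "i < ?n" using i1(2) by linarith
   have ind: "indicator (cball 0 (real (Suc j) / ?n)) x - indicator (cball 0 (real j / ?n)) x
     = (if j = i then 1 else 0 :: real)" for j
   proof -
    have a: "norm x <= real m / ?n \<longleftrightarrow> i < m" for m
    proof -
     have "norm x <= real m / ?n \<longleftrightarrow> norm x * ?n <= real m" by (simp add: field_simps)
     also have "... \<longleftrightarrow> i < m" using i1 by linarith
     finally show ?thesis .
    qed
    show ?thesis using a[of j] a[of "Suc j"] by (auto simp: indicator_def)
   qed
   have "step x = (\<Sum>j<?n. if j = i then h (real (Suc i) / ?n) else 0)"
    unfolding step_def ind by (rule sum.cong) auto
   then have st: "step x = h (real (Suc i) / ?n)" using i2 by simp
   have "dist (norm x) (real (Suc i) / ?n) < \<delta>"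
   proof -
    have "norm x <= real (Suc i) / ?n" "real i / ?n < norm x" using i1 by (simp_all add: field_simps)
    moreover have "real (Suc i) / ?n = real i / ?n + 1 / ?n" by (simp add: add_divide_distrib)
    ultimately show ?thesis using n by (simp add: dist_real_def)
   qed
   then have "dist (h (norm x)) (h (real (Suc i) / ?n)) < \<epsilon>" using True i2 by (intro d(2)) auto
   then show ?thesis using True st by (simp add: dist_real_def)
  qed
  have int2: "integrable lborel (\<lambda>x. \<epsilon> * B * indicator (cball 0 1 :: 'a set) x)"
   using emeasure_lborel_cball_finite[of "0::'a" 1] by (intro integrable_mult_right) simp
  have ae: "AE x in lborel. norm ((indicator (cball 0 1) x * h (norm x) - step x) *\<^sub>R g x)
    <= \<epsilon> * B * indicator (cball 0 1 :: 'a set) x"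
  proof -
   have "AE x::'a in lborel. x ~= 0" by (rule AE_lborel_singleton)
   then show ?thesis
   proof eventually_elim
    fix x :: 'a assume "x ~= 0"
    then have "\<bar>indicator (cball 0 1) x * h (norm x) - step x\<bar> * norm (g x) <= (\<epsilon> * indicator (cball 0 1) x) * B"
     by (intro mult_mono close gB) (use e in auto)
    then show "norm ((indicator (cball 0 1) x * h (norm x) - step x) *\<^sub>R g x)
     <= \<epsilon> * B * indicator (cball 0 1 :: 'a set) x" by (simp add: mult_ac)
   qed
  qed
  have meas: "(\<lambda>x. (indicator (cball 0 1) x * h (norm x) - step x) *\<^sub>R g x) \<in> borel_measurable lborel"
  proof -
   have "step \<in> borel_measurable borel" unfolding step_def
    by (intro borel_measurable_sum borel_measurable_times borel_measurable_diff borel_measurable_indicator) auto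
   moreover have "(\<lambda>x::'a. h (norm x)) \<in> borel_measurable borel"
    by (rule measurable_compose[OF _ hm]) simp
   ultimately show ?thesis
    using g by (intro borel_measurable_scaleR borel_measurable_times borel_measurable_diff borel_measurable_indicator) auto
  qed
  have int3: "integrable lborel (\<lambda>x. (indicator (cball 0 1) x * h (norm x) - step x) *\<^sub>R g x)"
   by (rule Bochner_Integration.integrable_bound[OF int2 meas]) (use ae in eventually_elim, auto)
  have "?I = (\<integral>x. (indicator (cball 0 1) x * h (norm x) - step x) *\<^sub>R g x + step x *\<^sub>R g x \<partial>lborel)"
   by (simp add: scaleR_diff_left)
  also have "... = (\<integral>x. (indicator (cball 0 1) x * h (norm x) - step x) *\<^sub>R g x \<partial>lborel)"
   using sz by (subst Bochner_Integration.integral_add[OF int3 step_int]) simp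
  finally have "norm ?I <= (\<integral>x. \<epsilon> * B * indicator (cball 0 1 :: 'a set) x \<partial>lborel)"
   using order_trans[OF Bochner_Integration.integral_norm_bound
     integral_mono_AE[OF integrable_norm[OF int3] int2 ae]] by simp
  then show ?thesis by (simp add: mult_ac)
  qed
  then have "norm ?I <= 0 + e" if "e > 0" for e
  proof -
  have "norm ?I <= (e / (B * ?V + 1)) * (B * ?V)"
   using B0 that by (intro \<open>\<And>\<epsilon>. \<epsilon> > 0 ==> norm ?I <= \<epsilon> * (B * ?V)\<close> divide_pos_pos) (auto intro: add_nonneg_pos)
  also have "... <= e"
  proof -
   have "B * ?V >= 0" using B0 by simp
   then show ?thesis using that by (simp add: field_simps)
  qed
  finally show ?thesis by simp
  qed
  then have "norm ?I <= 0" by (rule field_le_epsilon)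
  then show ?thesis by simp
qed

lemma AE_lborel_nonzero: "AE x::'a::euclidean_space in lborel. x ~= 0" by (rule AE_lborel_singleton)

lemma integrable_lborel_cball_continuous:
  fixes f :: "'a::euclidean_space => 'b::{banach,second_countable_topology}"
  assumes "continuous_on UNIV f"
  shows "integrable lborel (\<lambda>x. indicator (cball 0 1) x *\<^sub>R f x)"
  using borel_integrable_compact[of "cball 0 1" f] continuous_on_subset[OF assms] by auto

lemma integral_radial_weight_pos:
  fixes h :: "real => real"
  assumes h: "continuous_on UNIV h" "\<And>t. 0 <= t ==> t <= 1 ==> h t >= 0" "\<And>t. 0 < t ==> t < 1 ==> h t > 0"
  shows "(\<integral>x. indicator (cball 0 1) x * h (norm x) \<partial>(lborel :: 'a::euclidean_space measure)) > 0"
proof -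
  let ?f = "\<lambda>x::'a. indicator (cball 0 1) x * h (norm x)"
  have cont: "continuous_on UNIV (\<lambda>x::'a. h (norm x))"
  by (rule continuous_on_compose2[OF h(1)]) (auto intro: continuous_intros)
  have int: "integrable lborel ?f" using integrable_lborel_cball_continuous[OF cont] by simp
  have nn: "?f x >= 0" for x using h(2)[of "norm x"] by (auto simp: indicator_def)
  have "integral\<^sup>L lborel ?f ~= 0"
  proof
  assume "integral\<^sup>L lborel ?f = 0"
  then have "AE x in lborel. ?f x = 0" using nn int by (subst (asm) integral_nonneg_eq_0_iff_AE) auto
  then have "AE x in lborel. x \<notin> ball 0 1 - {0::'a}"
  proof eventually_elim
   fix x :: 'a assume "?f x = 0"
   then show "x \<notin> ball 0 1 - {0}" using h(3)[of "norm x"] by (auto simp: indicator_def split: if_splits)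
  qed
  then have "ball 0 1 - {0::'a} \<in> null_sets lborel" by (subst AE_iff_null_sets) auto
  then have "negligible (ball 0 1 - {0::'a})" by (simp add: negligible_iff_null_sets null_sets_completionI)
  moreover have "open (ball 0 1 - {0::'a})" by (intro open_Diff) auto
  moreover obtain z :: 'a where "norm z = 1/2" using vector_choose_size[of "1/2"] by auto
  then have "z \<in> ball 0 1 - {0}" by auto
  ultimately show False using open_not_negligible by blast
  qed
  then show ?thesis using integral_nonneg_AE[of ?f lborel] nn by (simp add: less_le)
qed

text \<open>Integration in polar coordinates, up to a constant. Subtracting from \<open>f\<close> its mean over the sphere
  reduces the claim to the vanishing in \<open>radial_integral_zero\<close>.\<close>

lemma homogeneous_ball_integral:
  fixes h :: "real => real" and s :: nat
  assumes h: "continuous_on UNIV h" "\<And>t. 0 <= t ==> t <= 1 ==> h t >= 0" "\<And>t. 0 < t ==> t < 1 ==> h t > 0"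
  shows "\<exists>c>0. \<forall>f::'a::euclidean_space => complex. continuous_on UNIV f -->
  (\<forall>t x. t > 0 --> f (t *\<^sub>R x) = of_real (t ^ s) * f x) -->
  (\<integral>x. (indicator (cball 0 1) x * h (norm x)) *\<^sub>R f x \<partial>lborel) = of_real c * spint f"
proof -
  let ?\<sigma> = "measure (sphere_measure :: 'a measure) (sphere 0 1)"
  let ?h = "\<lambda>t. h t * t ^ s"
  let ?I = "\<integral>x. indicator (cball 0 1) x * ?h (norm x) \<partial>(lborel :: 'a measure)"
  have I: "?I > 0" by (rule integral_radial_weight_pos) (use h in \<open>auto intro!: continuous_intros\<close>)
  have hc: "continuous_on UNIV (\<lambda>x::'a. ?h (norm x))"
  by (intro continuous_on_mult continuous_on_compose2[OF h(1)] continuous_intros) auto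
  show ?thesis
  proof (intro exI[of _ "?I / ?\<sigma>"] conjI allI impI)
  show "?I / ?\<sigma> > 0" using I sphere_measure_pos[where 'a = 'a] by simp
  fix f :: "'a => complex" assume f: "continuous_on UNIV f"
   and hom: "\<forall>t x. t > 0 --> f (t *\<^sub>R x) = of_real (t ^ s) * f x"
  define a where "a = spint f / of_real ?\<sigma>"
  define g where "g = (\<lambda>x. f (x /\<^sub>R norm x) - a)"
  have fb: "f \<in> borel_measurable borel" by (rule borel_measurable_continuous_onI[OF f])
  have gm: "g \<in> borel_measurable borel"
   unfolding g_def using measurable_compose[OF radial_projection_borel fb] by measurable
  have "compact (f ` cball 0 1)" by (intro compact_continuous_image continuous_on_subset[OF f]) auto
  then obtain B where "\<And>y. y \<in> f ` cball 0 1 ==> norm y <= B"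
   using compact_imp_bounded[of "f ` cball 0 1"] unfolding bounded_iff by blast
  then have B: "norm (f x) <= B" if "norm x <= 1" for x using that by simp
  have gB: "norm (g x) <= B + norm a" for x
  proof -
   have "norm (f (x /\<^sub>R norm x)) <= B" by (rule B) (cases "x = 0"; simp)
   then show ?thesis unfolding g_def by (intro order_trans[OF norm_triangle_ineq4]) simp
  qed
   have hm: "(\<lambda>x::'a. h (norm x)) \<in> borel_measurable borel"
    by (rule borel_measurable_continuous_onI) (rule continuous_on_compose2[OF h(1)], auto intro: continuous_intros)
  have gint: "integrable lborel (\<lambda>x. (indicator (cball 0 1) x * ?h (norm x)) *\<^sub>R g x)"
  proof (rule Bochner_Integration.integrable_bound)
   show "integrable lborel (\<lambda>x::'a. (indicator (cball 0 1) x *\<^sub>R ?h (norm x)) * (B + norm a))"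
    using integrable_lborel_cball_continuous[OF hc] by (intro integrable_mult_left) simp
   show "AE x in lborel. norm ((indicator (cball 0 1) x * ?h (norm x)) *\<^sub>R g x)
     <= norm ((indicator (cball 0 1) x *\<^sub>R ?h (norm x)) * (B + norm a))"
   proof (intro AE_I2)
    fix x :: 'a
    have "norm (g x) <= \<bar>B + norm a\<bar>" using gB[of x] by linarith
    then show "norm ((indicator (cball 0 1) x * ?h (norm x)) *\<^sub>R g x)
     <= norm ((indicator (cball 0 1) x *\<^sub>R ?h (norm x)) * (B + norm a))"
     by (simp add: abs_mult mult_left_mono)
   qed
   show "(\<lambda>x. (indicator (cball 0 1) x * ?h (norm x)) *\<^sub>R g x) \<in> borel_measurable lborel"
    using gm hm by (intro borel_measurable_scaleR borel_measurable_times borel_measurable_indicator borel_measurable_power) auto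
  qed
  have "spint (\<lambda>x. f x - a) = 0"
  proof -
   have "spint (\<lambda>x. f x - a) = spint f - of_real ?\<sigma> * a"
    by (subst Bochner_Integration.integral_diff[OF integrable_sphere_continuous[OF f]])
     (auto simp: space_sphere_measure scaleR_conv_of_real)
   then show ?thesis using sphere_measure_pos[where 'a = 'a] by (simp add: a_def)
  qed
  moreover have "(\<lambda>x. f x - a) \<in> borel_measurable sphere_measure"
   by (intro borel_measurable_sphere borel_measurable_diff fb borel_measurable_const)
  ultimately have z: "(\<integral>x. indicator (cball 0 1 - {0}) x *\<^sub>R g x \<partial>lborel) = 0"
   using integral_sphere_measure[of "\<lambda>x. f x - a"] by (simp add: g_def)
  have "(\<integral>x. indicator (cball 0 1) x *\<^sub>R g x \<partial>lborel) = (\<integral>x. indicator (cball 0 1 - {0}) x *\<^sub>R g x \<partial>lborel)"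
  proof (rule integral_cong_AE)
   show "AE x in lborel. indicator (cball 0 1) x *\<^sub>R g x = indicator (cball 0 1 - {0}) x *\<^sub>R g x"
    using AE_lborel_nonzero by eventually_elim (auto simp: indicator_def)
  qed (use gm in \<open>auto intro!: borel_measurable_scaleR borel_measurable_indicator\<close>)
  then have g0: "(\<integral>x. indicator (cball 0 1) x *\<^sub>R g x \<partial>lborel) = 0" using z by simp
  have hh: "continuous_on UNIV ?h" by (intro continuous_intros h(1))
  have gz: "(\<integral>x. (indicator (cball 0 1) x * ?h (norm x)) *\<^sub>R g x \<partial>lborel) = 0"
  proof (rule radial_integral_zero[OF gm gB _ _ _ g0])
   show "g (t *\<^sub>R x) = g x" if "t > 0" for t x
   proof -
    have "(t *\<^sub>R x) /\<^sub>R norm (t *\<^sub>R x) = x /\<^sub>R norm x"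
     using that by (cases "x = 0") (simp_all add: field_simps)
    then show ?thesis unfolding g_def by metis
   qed
   show "continuous_on {0..1} ?h" by (rule continuous_on_subset[OF hh]) simp
   show "?h \<in> borel_measurable borel" by (rule borel_measurable_continuous_onI[OF hh])
  qed
  have "(\<integral>x. (indicator (cball 0 1) x * h (norm x)) *\<^sub>R f x \<partial>lborel)
   = (\<integral>x. (indicator (cball 0 1) x * ?h (norm x)) *\<^sub>R g x + (indicator (cball 0 1) x *\<^sub>R ?h (norm x)) *\<^sub>R a \<partial>lborel)"
  proof (rule integral_cong_AE)
   show "(\<lambda>x. (indicator (cball 0 1) x * h (norm x)) *\<^sub>R f x) \<in> borel_measurable lborel"
    using fb hm by (intro borel_measurable_scaleR borel_measurable_times borel_measurable_indicator) auto
   show "(\<lambda>x. (indicator (cball 0 1) x * ?h (norm x)) *\<^sub>R g x + (indicator (cball 0 1) x *\<^sub>R ?h (norm x)) *\<^sub>R a) \<in> borel_measurable lborel"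
    using gm hm by (intro borel_measurable_add borel_measurable_scaleR borel_measurable_times borel_measurable_indicator borel_measurable_power) auto
   show "AE x in lborel. (indicator (cball 0 1) x * h (norm x)) *\<^sub>R f x
    = (indicator (cball 0 1) x * ?h (norm x)) *\<^sub>R g x + (indicator (cball 0 1) x *\<^sub>R ?h (norm x)) *\<^sub>R a"
    using AE_lborel_nonzero
   proof eventually_elim
    fix x :: 'a assume "x ~= 0"
    then have "f x = of_real (norm x ^ s) * f (x /\<^sub>R norm x)"
     using hom[rule_format, of "norm x" "x /\<^sub>R norm x"] by simp
    then show "(indicator (cball 0 1) x * h (norm x)) *\<^sub>R f x
    = (indicator (cball 0 1) x * ?h (norm x)) *\<^sub>R g x + (indicator (cball 0 1) x *\<^sub>R ?h (norm x)) *\<^sub>R a"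
     by (simp add: g_def scaleR_conv_of_real algebra_simps)
   qed
  qed
  also have "... = (\<integral>x. (indicator (cball 0 1) x * ?h (norm x)) *\<^sub>R g x \<partial>lborel) + ?I *\<^sub>R a"
   using integrable_lborel_cball_continuous[OF hc]
   by (subst Bochner_Integration.integral_add[OF gint]) (auto intro!: integrable_scaleR_left)
  finally show "(\<integral>x. (indicator (cball 0 1) x * h (norm x)) *\<^sub>R f x \<partial>lborel)
   = of_real (?I / ?\<sigma>) * spint f" unfolding gz by (simp add: a_def scaleR_conv_of_real)
  qed
qed

text \<open>The integrals of the difference quotients vanish by translation invariance, and the
  quotients converge boundedly on a fixed ball.\<close>
lemma integral_directional_derivative_zero:
  fixes F :: "'a::euclidean_space => complex"
  assumes F0: "\<And>x. norm x >= 1 ==> F x = 0"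
  and F': "\<And>x. (F has_derivative F' x) (at x)"
  and cont: "continuous_on UNIV (\<lambda>x. F' x v)"
  shows "(\<integral>x. F' x v \<partial>lborel) = 0"
proof -
  have Fc: "continuous_on UNIV F"
  by (rule has_derivative_continuous_on) (use F' in \<open>auto intro: has_derivative_at_withinI\<close>)
  have Fb: "F \<in> borel_measurable borel" by (rule borel_measurable_continuous_onI[OF Fc])
  have F'0: "F' x v = 0" if "norm x > 1" for x
  proof -
  have "open {y::'a. norm y > 1}" by (intro open_Collect_less continuous_intros)
  then have ev: "eventually (\<lambda>y. F y = 0) (nhds x)"
   unfolding eventually_nhds using that F0 by (intro exI[of _ "{y. norm y > 1}"]) auto
  have "((\<lambda>y. 0) has_derivative F' x) (at x)" using F'[of x] F0[of x] that
   by (rule_tac has_derivative_transform_eventually[of F]) (use ev in \<open>auto simp: eventually_nhds_conv_at\<close>)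
  then have "F' x = (\<lambda>h. 0)" using has_derivative_unique[OF _ has_derivative_const[of 0]] by blast
  then show ?thesis by simp
  qed
  have "compact ((\<lambda>x. F' x v) ` cball 0 1)"
  by (intro compact_continuous_image continuous_on_subset[OF cont]) auto
  then obtain C0 where "\<And>y. y \<in> (\<lambda>x. F' x v) ` cball 0 1 ==> norm y <= C0"
  using compact_imp_bounded[of "(\<lambda>x. F' x v) ` cball 0 1"] unfolding bounded_iff by blast
  then have C0: "norm (F' x v) <= C0" if "norm x <= 1" for x using that by simp
  define C where "C = max C0 0"
  have C: "norm (F' x v) <= C" for x using C0[of x] F'0[of x] by (cases "norm x <= 1") (auto simp: C_def)
  have C_nn: "C >= 0" by (simp add: C_def)
  have mvt: "norm (F (x + t *\<^sub>R v) - F x) <= C * t" if "t >= 0" for x t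
  proof -
  have "norm (F (x + t *\<^sub>R v) - F (x + 0 *\<^sub>R v)) <= C * norm (t - 0)"
  proof (rule differentiable_bound[where S = "{0..t}" and f' = "\<lambda>u d. d *\<^sub>R F' (x + u *\<^sub>R v) v"])
   fix u assume "u \<in> {0..t}"
   have "((\<lambda>u. x + u *\<^sub>R v) has_derivative (\<lambda>d. d *\<^sub>R v)) (at u within {0..t})"
    by (auto intro!: derivative_eq_intros)
   from has_derivative_compose[OF this has_derivative_at_withinI[OF F']]
   have "((\<lambda>u. F (x + u *\<^sub>R v)) has_derivative (\<lambda>d. F' (x + u *\<^sub>R v) (d *\<^sub>R v))) (at u within {0..t})"
    by (simp add: F' has_derivative_compose[OF \<open>((\<lambda>u. x + u *\<^sub>R v) has_derivative _) _\<close>])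
   then show "((\<lambda>u. F (x + u *\<^sub>R v)) has_derivative (\<lambda>d. d *\<^sub>R F' (x + u *\<^sub>R v) v)) (at u within {0..t})"
    using linear_scale[OF has_derivative_linear[OF F']] by simp
   show "onorm (\<lambda>d. d *\<^sub>R F' (x + u *\<^sub>R v) v) <= C"
   proof (rule onorm_le)
    fix d :: real
    show "norm (d *\<^sub>R F' (x + u *\<^sub>R v) v) <= C * norm d"
     using mult_right_mono[OF C[of "x + u *\<^sub>R v"], of "\<bar>d\<bar>"] by (simp add: mult.commute)
   qed
  qed (use that in auto)
  then show ?thesis using that by simp
  qed
  define f where "f = (\<lambda>n x. real (Suc n) *\<^sub>R (F (x + (1 / real (Suc n)) *\<^sub>R v) - F x))"
  have Fint: "integrable lborel F"
  proof -
  have "F = (\<lambda>x. indicator (cball 0 1) x *\<^sub>R F x)" using F0 by (auto simp: fun_eq_iff indicator_def)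
  then show ?thesis using integrable_lborel_cball_continuous[OF Fc] by simp
  qed
  have tr: "integrable lborel (\<lambda>x. F (x + c))" "(\<integral>x. F (x + c) \<partial>lborel) = integral\<^sup>L lborel F" for c
  proof -
  have d: "distr lborel borel ((+) c) = (lborel :: 'a measure)" by (rule lborel_distr_plus)
  have m: "(+) c \<in> measurable lborel borel" by simp
  show "integrable lborel (\<lambda>x. F (x + c))"
   using integrable_distr[OF m, of F] Fint unfolding d by (simp add: add.commute)
  show "(\<integral>x. F (x + c) \<partial>lborel) = integral\<^sup>L lborel F"
   using integral_distr[OF m Fb] unfolding d by (simp add: add.commute)
  qed
  have f0: "integral\<^sup>L lborel (f n) = 0" for n
  unfolding f_def using tr Fint by (simp only: integral_scaleR_right Bochner_Integration.integral_diff tr) simp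
  have "(\<lambda>n. integral\<^sup>L lborel (f n)) \<longlonglongrightarrow> (\<integral>x. F' x v \<partial>lborel)"
  proof (rule integral_dominated_convergence[where w = "\<lambda>x. C * indicator (cball 0 (1 + norm v)) x"])
  show "(\<lambda>x. F' x v) \<in> borel_measurable lborel" using borel_measurable_continuous_onI[OF cont] by simp
  have "(\<lambda>x. F (x + c)) \<in> borel_measurable borel" for c
   using measurable_compose[OF _ Fb, of "\<lambda>x. x + c" borel] by simp
  then show "f n \<in> borel_measurable lborel" for n unfolding f_def using Fb by simp
  show "integrable lborel (\<lambda>x. C * indicator (cball (0::'a) (1 + norm v)) x)"
   using emeasure_lborel_cball_finite[of "0::'a" "1 + norm v"] by (intro integrable_mult_right) simp
  show "AE x in lborel. (\<lambda>n. f n x) \<longlonglongrightarrow> F' x v"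
  proof (intro AE_I2)
   fix x
   have "((\<lambda>u. x + u *\<^sub>R v) has_derivative (\<lambda>d. d *\<^sub>R v)) (at 0)" by (auto intro!: derivative_eq_intros)
   from has_derivative_compose[OF this, of F "F' x"] F'[of x]
   have "((\<lambda>u. F (x + u *\<^sub>R v)) has_derivative (\<lambda>d. F' x (d *\<^sub>R v))) (at 0)" by simp
   then have D: "((\<lambda>u. F (x + u *\<^sub>R v)) has_derivative (\<lambda>d. d *\<^sub>R F' x v)) (at 0)"
    using linear_scale[OF has_derivative_linear[OF F']] by simp
   have "((\<lambda>u. (F (x + u *\<^sub>R v) - F x) /\<^sub>R u - F' x v) \<longlongrightarrow> 0) (at 0)"
   proof (rule Lim_transform_eventually)
    show "((\<lambda>h. sgn h *\<^sub>R ((F (x + h *\<^sub>R v) - F x - h *\<^sub>R F' x v) /\<^sub>R norm h)) \<longlongrightarrow> 0) (at 0)"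
    proof (rule Lim_null_comparison)
     show "((\<lambda>h. norm ((F (x + h *\<^sub>R v) - F x - h *\<^sub>R F' x v) /\<^sub>R norm h)) \<longlongrightarrow> 0) (at 0)"
      using D unfolding has_derivative_at by (simp add: divide_inverse mult.commute)
     show "eventually (\<lambda>h. norm (sgn h *\<^sub>R ((F (x + h *\<^sub>R v) - F x - h *\<^sub>R F' x v) /\<^sub>R norm h))
       <= norm ((F (x + h *\<^sub>R v) - F x - h *\<^sub>R F' x v) /\<^sub>R norm h)) (at 0)"
      by (intro always_eventually allI) (auto simp: sgn_if)
    qed
    show "eventually (\<lambda>h. sgn h *\<^sub>R ((F (x + h *\<^sub>R v) - F x - h *\<^sub>R F' x v) /\<^sub>R norm h)
      = (F (x + h *\<^sub>R v) - F x) /\<^sub>R h - F' x v) (at 0)" unfolding eventually_at_filter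
     by (intro always_eventually allI impI) (auto simp: sgn_if scaleR_diff_right abs_if)
   qed
   then have "((\<lambda>u. (F (x + u *\<^sub>R v) - F x) /\<^sub>R u) \<longlongrightarrow> F' x v) (at 0)"
    by (simp add: LIM_zero_iff)
   moreover have "filterlim (\<lambda>n. 1 / real (Suc n)) (at 0) sequentially"
    using LIMSEQ_Suc[OF lim_1_over_n] by (auto simp: filterlim_at intro!: always_eventually)
   ultimately have "(\<lambda>n. (F (x + (1 / real (Suc n)) *\<^sub>R v) - F x) /\<^sub>R (1 / real (Suc n))) \<longlonglongrightarrow> F' x v"
    by (rule filterlim_compose)
   then show "(\<lambda>n. f n x) \<longlonglongrightarrow> F' x v" by (simp add: f_def)
  qed
  show "AE x in lborel. norm (f n x) <= C * indicator (cball 0 (1 + norm v)) x" for n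
  proof (intro AE_I2)
   fix x
   let ?t = "1 / real (Suc n)"
   show "norm (f n x) <= C * indicator (cball 0 (1 + norm v)) x"
   proof (cases "norm x <= 1 + norm v")
    case True
    have "norm (f n x) = real (Suc n) * norm (F (x + ?t *\<^sub>R v) - F x)" by (simp add: f_def)
    also have "... <= real (Suc n) * (C * ?t)" by (intro mult_left_mono mvt) auto
    also have "... = C" by simp
    finally show ?thesis using True by simp
   next
    case False
    have "norm (?t *\<^sub>R v) <= norm v" using mult_right_mono[of ?t 1 "norm v"] by simp
    moreover have "norm x <= norm (x + ?t *\<^sub>R v) + norm (?t *\<^sub>R v)"
     using norm_triangle_ineq4[of "x + ?t *\<^sub>R v" "?t *\<^sub>R v"] by simp
    ultimately have "norm (x + ?t *\<^sub>R v) >= 1" "norm x >= 1" using False norm_ge_zero[of v] by linarith+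
    then show ?thesis using False by (simp add: f_def F0)
   qed
  qed
  qed
  then have "(\<lambda>n. 0) \<longlonglongrightarrow> (\<integral>x. F' x v \<partial>lborel)" unfolding f0 .
  from LIMSEQ_unique[OF this tendsto_const] show ?thesis .
qed

lemma max0_square_derivative: "((\<lambda>u::real. (max 0 u)\<^sup>2) has_real_derivative 2 * max 0 u) (at u)"
proof -
  consider "u < 0" | "u > 0" | "u = 0" by linarith
  then show ?thesis
  proof cases
  case 1
  have "((\<lambda>u::real. 0) has_real_derivative 0) (at u)" by simp
  then show ?thesis
   using 1 by (rule_tac has_field_derivative_transform_within_open[where f = "\<lambda>u. 0" and S = "{..<0}"]) auto
  next
  case 2
  have "((\<lambda>u::real. u\<^sup>2) has_real_derivative 2 * u) (at u)" by (auto intro!: derivative_eq_intros)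
  then show ?thesis
   using 2 by (rule_tac has_field_derivative_transform_within_open[where f = "\<lambda>u. u\<^sup>2" and S = "{0<..}"]) auto
  next
  case 3
  have "((\<lambda>h::real. (max 0 h)\<^sup>2 / h) \<longlongrightarrow> 0) (at 0)"
  proof (rule Lim_null_comparison)
   show "eventually (\<lambda>h::real. norm ((max 0 h)\<^sup>2 / h) <= \<bar>h\<bar>) (at 0)"
    by (auto simp: eventually_at_filter max_def power2_eq_square)
   show "((\<lambda>h::real. \<bar>h\<bar>) \<longlongrightarrow> 0) (at 0)" by (intro tendsto_rabs_zero tendsto_ident_at)
  qed
  then show ?thesis using 3 by (simp add: has_field_derivative_iff)
  qed
qed

text \<open>The weight \<open>(1 - \<bar>x\<bar>^2)^2\<close> is cut off with a square at the
  boundary, so the product with \<open>G\<close> remains differentiable on the whole space.\<close>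
lemma ball_integration_by_parts:
  fixes G :: "'a::euclidean_space => complex"
  assumes G': "\<And>x. (G has_derivative G' x) (at x)" and cont: "continuous_on UNIV (\<lambda>x. G' x v)"
  shows "(\<integral>x. (indicator (cball 0 1) x * (1 - (norm x)\<^sup>2)\<^sup>2) *\<^sub>R G' x v \<partial>lborel)
  = (\<integral>x. (indicator (cball 0 1) x * (1 - (norm x)\<^sup>2)) *\<^sub>R ((4 * (x \<bullet> v)) *\<^sub>R G x) \<partial>lborel)"
proof -
  have Gc: "continuous_on UNIV G"
  by (rule has_derivative_continuous_on) (use G' in \<open>auto intro: has_derivative_at_withinI\<close>)
  define w where "w = (\<lambda>x::'a. (max 0 (1 - x \<bullet> x))\<^sup>2)"
  define w' where "w' = (\<lambda>x y::'a. - 4 * max 0 (1 - x \<bullet> x) * (x \<bullet> y))"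
  have w: "(w has_derivative w' x) (at x)" for x
  proof -
  have "((\<lambda>x. 1 - x \<bullet> x) has_derivative (\<lambda>y. - (2 * (x \<bullet> y)))) (at x)"
   by (auto intro!: derivative_eq_intros simp: inner_commute)
  from has_derivative_compose[OF this, of "\<lambda>u. (max 0 u)\<^sup>2" "(*) (2 * max 0 (1 - x \<bullet> x))"]
  show ?thesis using max0_square_derivative[of "1 - x \<bullet> x"]
   by (simp add: w_def w'_def has_field_derivative_def algebra_simps)
  qed
  define F where "F = (\<lambda>x. w x *\<^sub>R G x)"
  define F' where "F' = (\<lambda>x y. w x *\<^sub>R G' x y + w' x y *\<^sub>R G x)"
  have F': "(F has_derivative F' x) (at x)" for x
  unfolding F_def F'_def by (rule has_derivative_scaleR[OF w G'])
  have wc: "continuous_on UNIV w" unfolding w_def by (intro continuous_intros)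
  have w'c: "continuous_on UNIV (\<lambda>x. w' x v)" unfolding w'_def by (intro continuous_intros)
  have "(\<integral>x. F' x v \<partial>lborel) = 0"
  proof (rule integral_directional_derivative_zero[OF _ F'])
  show "F x = 0" if "norm x >= 1" for x
  proof -
   have "x \<bullet> x >= 1" using that by (simp add: dot_square_norm)
   then show ?thesis by (simp add: F_def w_def)
  qed
  show "continuous_on UNIV (\<lambda>x. F' x v)" unfolding F'_def by (intro continuous_intros wc w'c cont Gc)
  qed
  moreover have "(\<lambda>x. F' x v) = (\<lambda>x. (indicator (cball 0 1) x * (1 - (norm x)\<^sup>2)\<^sup>2) *\<^sub>R G' x v
   - (indicator (cball 0 1) x * (1 - (norm x)\<^sup>2)) *\<^sub>R ((4 * (x \<bullet> v)) *\<^sub>R G x))"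
  proof
  fix x
  show "F' x v = (indicator (cball 0 1) x * (1 - (norm x)\<^sup>2)\<^sup>2) *\<^sub>R G' x v
   - (indicator (cball 0 1) x * (1 - (norm x)\<^sup>2)) *\<^sub>R ((4 * (x \<bullet> v)) *\<^sub>R G x)"
  proof (cases "norm x <= 1")
   case True
   then have "max 0 (1 - x \<bullet> x) = 1 - (norm x)\<^sup>2" by (simp add: dot_square_norm power_le_one)
   then show ?thesis using True by (simp add: F'_def w_def w'_def)
  next
   case False
   then have "x \<bullet> x >= 1" by (simp add: dot_square_norm)
   then show ?thesis using False by (simp add: F'_def w_def w'_def)
  qed
  qed
  moreover have i: "integrable lborel (\<lambda>x. (indicator (cball 0 1) x * (1 - (norm x)\<^sup>2)\<^sup>2) *\<^sub>R G' x v)"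
   "integrable lborel (\<lambda>x. (indicator (cball 0 1) x * (1 - (norm x)\<^sup>2)) *\<^sub>R ((4 * (x \<bullet> v)) *\<^sub>R G x))"
  unfolding scaleR_scaleR[symmetric] by (intro integrable_lborel_cball_continuous continuous_intros cont Gc)+
  ultimately have "(\<integral>x. (indicator (cball 0 1) x * (1 - (norm x)\<^sup>2)\<^sup>2) *\<^sub>R G' x v \<partial>lborel)
  - (\<integral>x. (indicator (cball 0 1) x * (1 - (norm x)\<^sup>2)) *\<^sub>R ((4 * (x \<bullet> v)) *\<^sub>R G x) \<partial>lborel) = 0"
  using Bochner_Integration.integral_diff[OF i] by metis
  then show ?thesis by simp
qed

section \<open>Wirtinger calculus\<close>

definition diffable :: "'d::finite cfun => bool" where
  "diffable f \<longleftrightarrow> (\<forall>z. f differentiable (at z))"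

lemma diffable_D: "diffable f ==> (f has_derivative frechet_derivative f (at z)) (at z)"
  unfolding diffable_def using frechet_derivative_works by blast

lemma diffable_continuous: "diffable f ==> continuous_on UNIV f" unfolding diffable_def
  by (simp add: continuous_on_eq_continuous_at differentiable_imp_continuous_within)

lemma diffable_const: "diffable (\<lambda>_. c)" by (simp add: diffable_def)

lemma diffable_coord: "diffable (\<lambda>z. z $ k)"
  unfolding diffable_def by (auto intro!: bounded_linear_imp_differentiable bounded_linear_vec_nth)

lemma diffable_cnj: assumes "diffable f" shows "diffable (\<lambda>z. cnj (f z))" unfolding diffable_def
proof
  fix z
  show "(\<lambda>z. cnj (f z)) differentiable at z"
  using bounded_linear.has_derivative[OF bounded_linear_cnj diffable_D[OF assms]] by (rule differentiableI)
qed

lemma diffable_add: "diffable f ==> diffable g ==> diffable (\<lambda>z. f z + g z)" by (simp add: diffable_def)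

lemma diffable_mult: "diffable f ==> diffable g ==> diffable (\<lambda>z. f z * g z)"
  by (simp add: diffable_def)

lemma directional_deriv_eq:
  assumes "(f has_derivative f') (at z)"
  shows "directional_deriv v f z = f' v"
proof -
  have "((\<lambda>t::real. z + t *\<^sub>R v) has_derivative (\<lambda>t. t *\<^sub>R v)) (at 0)" by (auto intro!: derivative_eq_intros)
  from has_derivative_compose[OF this, of f f'] assms
  have "((\<lambda>t. f (z + t *\<^sub>R v)) has_derivative (\<lambda>t. f' (t *\<^sub>R v))) (at 0)" by simp
  then have "((\<lambda>t. f (z + t *\<^sub>R v)) has_vector_derivative f' v) (at 0)"
  unfolding has_vector_derivative_def using linear_scale[OF has_derivative_linear[OF assms]] by simp
  then show ?thesis unfolding directional_deriv_def by (rule vector_derivative_at)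
qed

lemma wirtinger_z_eq:
  "(f has_derivative f') (at z) ==> wirtinger_z j f z = (f' (axis j 1) - \<i> * f' (axis j \<i>)) / 2"
  by (simp add: wirtinger_z_def directional_deriv_eq)

lemma wirtinger_cnj_eq:
  "(f has_derivative f') (at z) ==> wirtinger_cnj j f z = (f' (axis j 1) + \<i> * f' (axis j \<i>)) / 2"
  by (simp add: wirtinger_cnj_def directional_deriv_eq)

lemma wirtinger_const [simp]:
  "wirtinger_z j (\<lambda>_. c) = (\<lambda>_. 0)" "wirtinger_cnj j (\<lambda>_. c) = (\<lambda>_. 0)"
  by (auto simp: fun_eq_iff wirtinger_z_eq[OF has_derivative_const] wirtinger_cnj_eq[OF has_derivative_const])

lemma wirtinger_coord:
  fixes j k :: "'d::finite"
  shows "wirtinger_z j (\<lambda>z. z $ k) = (\<lambda>_. if j = k then 1 else 0)" "wirtinger_cnj j (\<lambda>z. z $ k) = (\<lambda>_. 0)"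
proof -
  have d: "((\<lambda>z::complex^'d. z $ k) has_derivative (\<lambda>v. v $ k)) (at z)" for z
  by (rule bounded_linear_imp_has_derivative[OF bounded_linear_vec_nth])
  show "wirtinger_z j (\<lambda>z. z $ k) = (\<lambda>_. if j = k then 1 else 0)" "wirtinger_cnj j (\<lambda>z. z $ k) = (\<lambda>_. 0)"
  by (auto simp: fun_eq_iff wirtinger_z_eq[OF d] wirtinger_cnj_eq[OF d] axis_def)
qed

lemma wirtinger_cnj_coord:
  fixes j k :: "'d::finite"
  shows "wirtinger_z j (\<lambda>z. cnj (z $ k)) = (\<lambda>_. 0)"
  "wirtinger_cnj j (\<lambda>z. cnj (z $ k)) = (\<lambda>_. if j = k then 1 else 0)"
proof -
  have d: "((\<lambda>z::complex^'d. cnj (z $ k)) has_derivative (\<lambda>v. cnj (v $ k))) (at z)" for z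
  by (rule bounded_linear.has_derivative[OF bounded_linear_cnj])
   (rule bounded_linear_imp_has_derivative[OF bounded_linear_vec_nth])
  show "wirtinger_z j (\<lambda>z. cnj (z $ k)) = (\<lambda>_. 0)"
  "wirtinger_cnj j (\<lambda>z. cnj (z $ k)) = (\<lambda>_. if j = k then 1 else 0)"
  by (auto simp: fun_eq_iff wirtinger_z_eq[OF d] wirtinger_cnj_eq[OF d] axis_def)
qed

lemma wirtinger_add:
  assumes "diffable f" "diffable g"
  shows "wirtinger_z j (\<lambda>z. f z + g z) = (\<lambda>z. wirtinger_z j f z + wirtinger_z j g z)"
  "wirtinger_cnj j (\<lambda>z. f z + g z) = (\<lambda>z. wirtinger_cnj j f z + wirtinger_cnj j g z)"
  using has_derivative_add[OF diffable_D[OF assms(1)] diffable_D[OF assms(2)]]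
  by (auto simp: fun_eq_iff wirtinger_z_eq[OF has_derivative_add[OF diffable_D[OF assms(1)] diffable_D[OF assms(2)]]]
   wirtinger_cnj_eq[OF has_derivative_add[OF diffable_D[OF assms(1)] diffable_D[OF assms(2)]]]
   wirtinger_z_eq[OF diffable_D[OF assms(1)]] wirtinger_z_eq[OF diffable_D[OF assms(2)]]
   wirtinger_cnj_eq[OF diffable_D[OF assms(1)]] wirtinger_cnj_eq[OF diffable_D[OF assms(2)]] field_simps)

lemma wirtinger_mult:
  assumes "diffable f" "diffable g"
  shows "wirtinger_z j (\<lambda>z. f z * g z) = (\<lambda>z. wirtinger_z j f z * g z + f z * wirtinger_z j g z)"
  "wirtinger_cnj j (\<lambda>z. f z * g z) = (\<lambda>z. wirtinger_cnj j f z * g z + f z * wirtinger_cnj j g z)"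
  by (auto simp: fun_eq_iff wirtinger_z_eq[OF has_derivative_mult[OF diffable_D[OF assms(1)] diffable_D[OF assms(2)]]]
   wirtinger_cnj_eq[OF has_derivative_mult[OF diffable_D[OF assms(1)] diffable_D[OF assms(2)]]]
   wirtinger_z_eq[OF diffable_D[OF assms(1)]] wirtinger_z_eq[OF diffable_D[OF assms(2)]]
   wirtinger_cnj_eq[OF diffable_D[OF assms(1)]] wirtinger_cnj_eq[OF diffable_D[OF assms(2)]] field_simps)

lemma wirtinger_of_cnj:
  assumes "diffable f"
  shows "wirtinger_z j (\<lambda>z. cnj (f z)) = (\<lambda>z. cnj (wirtinger_cnj j f z))"
  "wirtinger_cnj j (\<lambda>z. cnj (f z)) = (\<lambda>z. cnj (wirtinger_z j f z))"
  by (auto simp: fun_eq_iff wirtinger_z_eq[OF bounded_linear.has_derivative[OF bounded_linear_cnj diffable_D[OF assms]]]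
   wirtinger_cnj_eq[OF bounded_linear.has_derivative[OF bounded_linear_cnj diffable_D[OF assms]]]
   wirtinger_z_eq[OF diffable_D[OF assms(1)]] wirtinger_cnj_eq[OF diffable_D[OF assms(1)]])

lemma complex_vec_expand: "(v :: complex ^ 'd::finite) = (\<Sum>j\<in>UNIV. Re (v $ j) *\<^sub>R axis j 1 + Im (v $ j) *\<^sub>R axis j \<i>)"
proof -
  have "(\<Sum>j\<in>UNIV. Re (v $ j) *\<^sub>R axis j 1 + Im (v $ j) *\<^sub>R axis j \<i>) $ k = v $ k" for k
  proof -
  have "(\<Sum>j\<in>UNIV. Re (v $ j) *\<^sub>R axis j 1 + Im (v $ j) *\<^sub>R axis j \<i>) $ k
   = (\<Sum>j\<in>UNIV. if j = k then v $ k else 0)"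
   unfolding sum_component by (rule sum.cong) (auto simp: axis_def complex_eq_iff)
  then show ?thesis by simp
  qed
  then show ?thesis by (simp add: vec_eq_iff)
qed

lemma derivative_wirtinger:
  assumes "diffable f"
  shows "(f has_derivative (\<lambda>v. \<Sum>j\<in>UNIV. wirtinger_z j f z * v $ j + wirtinger_cnj j f z * cnj (v $ j))) (at z)"
proof -
  let ?D = "frechet_derivative f (at z)"
  have D: "(f has_derivative ?D) (at z)" by (rule diffable_D[OF assms])
  have lin: "linear ?D" by (rule has_derivative_linear[OF D])
  have "?D v = (\<Sum>j\<in>UNIV. wirtinger_z j f z * v $ j + wirtinger_cnj j f z * cnj (v $ j))" for v
  proof -
  have "?D v = ?D (\<Sum>j\<in>UNIV. Re (v $ j) *\<^sub>R axis j 1 + Im (v $ j) *\<^sub>R axis j \<i>)"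
   using complex_vec_expand[of v] by simp
  also have "... = (\<Sum>j\<in>UNIV. Re (v $ j) *\<^sub>R ?D (axis j 1) + Im (v $ j) *\<^sub>R ?D (axis j \<i>))"
   using lin by (simp add: linear_sum linear_add linear_scale)
  also have "... = (\<Sum>j\<in>UNIV. wirtinger_z j f z * v $ j + wirtinger_cnj j f z * cnj (v $ j))"
  proof (rule sum.cong[OF refl])
   fix j
   let ?a = "?D (axis j 1)" and ?b = "?D (axis j \<i>)" and ?w = "v $ j"
   have w: "?w = of_real (Re ?w) + \<i> * of_real (Im ?w)" "cnj ?w = of_real (Re ?w) - \<i> * of_real (Im ?w)"
    by (auto simp: complex_eq_iff)
   show "Re ?w *\<^sub>R ?a + Im ?w *\<^sub>R ?b = wirtinger_z j f z * ?w + wirtinger_cnj j f z * cnj ?w"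
    unfolding wirtinger_z_eq[OF D] wirtinger_cnj_eq[OF D] w(2)
    by (subst (3) w(1)) (simp add: scaleR_conv_of_real field_simps)
  qed
  finally show ?thesis .
  qed
  then have "?D = (\<lambda>v. \<Sum>j\<in>UNIV. wirtinger_z j f z * v $ j + wirtinger_cnj j f z * cnj (v $ j))" by blast
  with D show ?thesis by simp
qed

section \<open>Bihomogeneous polynomials\<close>

text \<open>Polynomials homogeneous of bidegree \<open>(m, n)\<close>, generated so that identities
  can be proved by induction.\<close>
inductive bipoly :: "nat => nat => 'd::finite cfun => bool" where
  bipoly_const: "bipoly 0 0 (\<lambda>_. c)"
| bipoly_zero: "bipoly m n (\<lambda>_. 0)"
| bipoly_z: "bipoly m n f ==> bipoly (Suc m) n (\<lambda>z. z $ j * f z)"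
| bipoly_cnj: "bipoly m n f ==> bipoly m (Suc n) (\<lambda>z. cnj (z $ j) * f z)"
| bipoly_add: "bipoly m n f ==> bipoly m n g ==> bipoly m n (\<lambda>z. f z + g z)"

lemma bipoly_diffable: "bipoly m n f ==> diffable f" by (induction rule: bipoly.induct)
  (auto intro: diffable_const diffable_add diffable_mult diffable_coord diffable_cnj[OF diffable_coord])

lemma bipoly_continuous: "bipoly m n f ==> continuous_on UNIV f"
  by (rule diffable_continuous[OF bipoly_diffable])

lemma bipoly_mult: "bipoly m n f ==> bipoly m' n' g ==> bipoly (m + m') (n + n') (\<lambda>z. f z * g z)"
proof (induction rule: bipoly.induct)
  case (bipoly_const c)
  from bipoly_const show ?case
  proof (induction rule: bipoly.induct)
  case (bipoly_const c')
  show ?case using bipoly.bipoly_const[of "c * c'"] by simp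
  next
  case (bipoly_z m n f j)
  then show ?case using bipoly.bipoly_z[of _ _ "\<lambda>z. c * f z" j] by (simp add: mult.left_commute)
  next
  case (bipoly_cnj m n f j)
  then show ?case using bipoly.bipoly_cnj[of _ _ "\<lambda>z. c * f z" j] by (simp add: mult.left_commute)
  qed (auto simp: distrib_left intro: bipoly.intros)
next
  case (bipoly_z m n f j)
  then show ?case using bipoly.bipoly_z[of "m + m'" "n + n'" "\<lambda>z. f z * g z" j] by (simp add: mult.assoc)
next
  case (bipoly_cnj m n f j)
  then show ?case using bipoly.bipoly_cnj[of "m + m'" "n + n'" "\<lambda>z. f z * g z" j] by (simp add: mult.assoc)
qed (auto simp: distrib_right intro: bipoly.intros)

lemma bipoly_scale: "bipoly m n f ==> bipoly m n (\<lambda>z. c * f z)"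
  using bipoly_mult[OF bipoly_const, of m n f] by simp

lemma bipoly_uminus: "bipoly m n f ==> bipoly m n (\<lambda>z. - f z)" using bipoly_scale[of m n f "-1"] by simp

lemma bipoly_diff: "bipoly m n f ==> bipoly m n g ==> bipoly m n (\<lambda>z. f z - g z)"
  using bipoly_add[OF _ bipoly_uminus, of m n f g] by simp

lemma bipoly_sum: "(\<And>i. i \<in> I ==> bipoly m n (f i)) ==> bipoly m n (\<lambda>z. \<Sum>i\<in>I. f i z)"
  by (induction I rule: infinite_finite_induct) (auto intro: bipoly_zero bipoly_add)

lemma bipoly_coord: "bipoly 1 0 (\<lambda>z. z $ j)" "bipoly 0 1 (\<lambda>z. cnj (z $ j))"
  using bipoly_z[OF bipoly_const[of 1], of j] bipoly_cnj[OF bipoly_const[of 1], of j] by simp_all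

lemma bipoly_conjugate: "bipoly m n f ==> bipoly n m (\<lambda>z. cnj (f z))"
  by (induction rule: bipoly.induct) (auto intro: bipoly.intros)

lemma bipoly_homogeneous: "bipoly m n f ==> f (t *\<^sub>R z) = of_real (t ^ (m + n)) * f z"
  by (induction rule: bipoly.induct) (auto simp: scaleR_conv_of_real[where 'a = complex] algebra_simps)

lemma bipoly_dz: "bipoly m n f ==> bipoly (m - 1) n (wirtinger_z j f) \<and> (m = 0 --> wirtinger_z j f = (\<lambda>_. 0))"
proof (induction rule: bipoly.induct)
  case (bipoly_z m n f k)
  have eq: "wirtinger_z j (\<lambda>z. z $ k * f z) = (\<lambda>z. (if j = k then 1 else 0) * f z + z $ k * wirtinger_z j f z)"
  by (simp add: wirtinger_mult[OF diffable_coord bipoly_diffable[OF bipoly_z(1)]] wirtinger_coord)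
  have "bipoly m n (\<lambda>z. z $ k * wirtinger_z j f z)"
  using bipoly_z(2) bipoly.bipoly_z[of "m - 1" n "wirtinger_z j f" k] by (cases m) (auto intro: bipoly_zero)
  with bipoly_add[OF bipoly_scale[OF bipoly_z(1), of "if j = k then 1 else 0"]]
  show ?case unfolding eq by simp
next
  case (bipoly_cnj m n f k)
  have eq: "wirtinger_z j (\<lambda>z. cnj (z $ k) * f z) = (\<lambda>z. cnj (z $ k) * wirtinger_z j f z)"
  by (simp add: wirtinger_mult[OF diffable_cnj[OF diffable_coord] bipoly_diffable[OF bipoly_cnj(1)]] wirtinger_cnj_coord)
  show ?case unfolding eq using bipoly_cnj(2) by (auto intro: bipoly.bipoly_cnj)
next
  case (bipoly_add m n f g)
  then show ?case
  by (auto simp: wirtinger_add[OF bipoly_diffable[OF bipoly_add(1)] bipoly_diffable[OF bipoly_add(2)]]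
    intro: bipoly.bipoly_add)
qed (auto intro: bipoly_const bipoly_zero)

lemma wirtinger_cnj_via_conjugate:
  assumes "diffable f" shows "wirtinger_cnj j f = (\<lambda>z. cnj (wirtinger_z j (\<lambda>z. cnj (f z)) z))"
  using wirtinger_of_cnj(1)[OF assms, of j] by (simp add: fun_eq_iff)

lemma bipoly_db:
  assumes "bipoly m n f"
  shows "bipoly m (n - 1) (wirtinger_cnj j f) \<and> (n = 0 --> wirtinger_cnj j f = (\<lambda>_. 0))"
  using bipoly_dz[OF bipoly_conjugate[OF assms], of j]
  unfolding wirtinger_cnj_via_conjugate[OF bipoly_diffable[OF assms], of j] by (auto dest: bipoly_conjugate)

lemma diffable_dz: "bipoly m n f ==> diffable (wirtinger_z j f)"
  and diffable_db: "bipoly m n f ==> diffable (wirtinger_cnj j f)"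
  using bipoly_dz bipoly_db bipoly_diffable by blast+

lemma wirtinger_commute:
  "bipoly m n f ==> wirtinger_z j (wirtinger_cnj k f) = wirtinger_cnj k (wirtinger_z j f)"
proof (induction rule: bipoly.induct)
  case (bipoly_z m n f l)
  note d = bipoly_diffable[OF bipoly_z(1)] diffable_dz[OF bipoly_z(1)] diffable_db[OF bipoly_z(1)]
  show ?case using bipoly_z.IH by (cases "j = l")
   (simp_all add: wirtinger_mult wirtinger_add diffable_coord diffable_mult diffable_const d wirtinger_coord)
next
  case (bipoly_cnj m n f l)
  note d = bipoly_diffable[OF bipoly_cnj(1)] diffable_dz[OF bipoly_cnj(1)] diffable_db[OF bipoly_cnj(1)]
  diffable_cnj[OF diffable_coord]
  show ?case using bipoly_cnj.IH by (cases "k = l")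
   (simp_all add: wirtinger_mult wirtinger_add diffable_mult diffable_const d wirtinger_cnj_coord)
next
  case (bipoly_add m n f g)
  note d = bipoly_diffable[OF bipoly_add(1)] diffable_dz[OF bipoly_add(1)] diffable_db[OF bipoly_add(1)]
  bipoly_diffable[OF bipoly_add(2)] diffable_dz[OF bipoly_add(2)] diffable_db[OF bipoly_add(2)]
  show ?case by (simp add: wirtinger_add d bipoly_add.IH)
qed simp_all

lemma euler_z: "bipoly m n f ==> (\<Sum>j\<in>UNIV. z $ j * wirtinger_z j f z) = of_nat m * f z"
proof (induction rule: bipoly.induct)
  case (bipoly_z m n f l)
  have "(\<Sum>j\<in>UNIV. z $ j * wirtinger_z j (\<lambda>z. z $ l * f z) z)
   = (\<Sum>j\<in>UNIV. (if j = l then z $ l * f z else 0) + z $ l * (z $ j * wirtinger_z j f z))"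
  by (intro sum.cong refl)
   (simp only: wirtinger_mult[OF diffable_coord bipoly_diffable[OF bipoly_z(1)]] wirtinger_coord,
    simp add: algebra_simps)
  also have "... = of_nat (Suc m) * (z $ l * f z)"
  by (simp only: sum.distrib sum_distrib_left[symmetric] bipoly_z.IH) (simp add: algebra_simps)
  finally show ?case .
next
  case (bipoly_cnj m n f l)
  have "(\<Sum>j\<in>UNIV. z $ j * wirtinger_z j (\<lambda>z. cnj (z $ l) * f z) z)
   = (\<Sum>j\<in>UNIV. cnj (z $ l) * (z $ j * wirtinger_z j f z))" by (intro sum.cong refl)
   (simp only: wirtinger_mult[OF diffable_cnj[OF diffable_coord] bipoly_diffable[OF bipoly_cnj(1)]] wirtinger_cnj_coord,
    simp add: algebra_simps)
  also have "... = of_nat m * (cnj (z $ l) * f z)"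
  by (simp only: sum_distrib_left[symmetric] bipoly_cnj.IH) (simp add: algebra_simps)
  finally show ?case .
next
  case (bipoly_add m n f g)
  then show ?case
  by (simp add: wirtinger_add bipoly_diffable[OF bipoly_add(1)] bipoly_diffable[OF bipoly_add(2)] distrib_left sum.distrib)
qed simp_all

lemma euler_cnj:
  assumes "bipoly m n f" shows "(\<Sum>j\<in>UNIV. cnj (z $ j) * wirtinger_cnj j f z) = of_nat n * f z"
proof -
  have "cnj (\<Sum>j\<in>UNIV. z $ j * wirtinger_z j (\<lambda>z. cnj (f z)) z) = cnj (of_nat n * cnj (f z))"
  using euler_z[OF bipoly_conjugate[OF assms], of z] by simp
  then show ?thesis by (simp add: wirtinger_of_cnj[OF bipoly_diffable[OF assms]])
qed

definition nsq :: "'d::finite cfun" where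
  "nsq z = (\<Sum>j\<in>UNIV. z $ j * cnj (z $ j))"

lemma nsq_norm: "nsq z = of_real ((norm z)\<^sup>2)"
proof -
  have "(norm z)\<^sup>2 = (\<Sum>j\<in>UNIV. (norm (z $ j))\<^sup>2)"
  by (simp add: norm_vec_def L2_set_def sum_nonneg)
  then show ?thesis by (simp add: nsq_def complex_norm_square del: of_real_power)
qed

lemma nsq_sphere [simp]: "norm z = 1 ==> nsq z = 1" by (simp add: nsq_norm)

lemma bipoly_nsq: "bipoly 1 1 nsq"
proof -
  have "bipoly 1 1 (\<lambda>z. \<Sum>j\<in>UNIV. z $ j * cnj (z $ j) :: complex)"
  by (intro bipoly_sum) (use bipoly_mult[OF bipoly_coord] in force)
  then show ?thesis unfolding nsq_def[abs_def] .
qed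

lemma bipoly_nsq_mult: "bipoly m n f ==> bipoly (Suc m) (Suc n) (\<lambda>z. nsq z * f z)"
  using bipoly_mult[OF bipoly_nsq] by force

lemma wirtinger_nsq:
  fixes j :: "'d::finite"
  shows "wirtinger_z j nsq = (\<lambda>z. cnj (z $ j))" "wirtinger_cnj j nsq = (\<lambda>z. z $ j)"
proof -
  have "((nsq :: 'd cfun) has_derivative (\<lambda>v. \<Sum>j\<in>UNIV. z $ j * cnj (v $ j) + v $ j * cnj (z $ j))) (at z)" for z
  unfolding nsq_def
  by (intro has_derivative_sum has_derivative_mult bounded_linear.has_derivative[OF bounded_linear_cnj]
    bounded_linear_imp_has_derivative bounded_linear_vec_nth)
  note D = wirtinger_z_eq[OF this] wirtinger_cnj_eq[OF this]
  have s1: "(\<Sum>k\<in>UNIV. z $ k * cnj (axis j c $ k) + axis j c $ k * cnj (z $ k)) = z $ j * cnj c + c * cnj (z $ j)"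
  for z :: "complex^'d" and c
  proof -
  have "(\<Sum>k\<in>UNIV. z $ k * cnj (axis j c $ k) + axis j c $ k * cnj (z $ k))
   = (\<Sum>k\<in>UNIV. if k = j then z $ j * cnj c + c * cnj (z $ j) else 0)"
   by (rule sum.cong) (auto simp: axis_def)
  then show ?thesis by simp
  qed
  show "wirtinger_z j nsq = (\<lambda>z::complex^'d. cnj (z $ j))" "wirtinger_cnj j nsq = (\<lambda>z::complex^'d. z $ j)"
  unfolding fun_eq_iff D s1 by (simp_all add: field_simps)
qed

section \<open>The Laplacian and integration by parts on the sphere\<close>

text \<open>A quarter of the complex Laplacian; the factor \<open>4\<close> would only clutter the
  commutation rules.\<close>
definition Lap :: "'d::finite cfun => 'd cfun" where
  "Lap f z = (\<Sum>j\<in>UNIV. wirtinger_z j (wirtinger_cnj j f) z)"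

lemma complex_laplacian_Lap: "complex_laplacian f z = 4 * Lap f z" by (simp add: complex_laplacian_def Lap_def)

lemma Lap_bipoly: 
  assumes "bipoly m n f"
  shows "bipoly (m - 1) (n - 1) (Lap f)" "m = 0 \<or> n = 0 ==> Lap f = (\<lambda>_. 0)"
proof -
  have b: "bipoly (m - 1) (n - 1) (wirtinger_z j (wirtinger_cnj j f))" for j
  using bipoly_dz bipoly_db[OF assms] by blast
  then show "bipoly (m - 1) (n - 1) (Lap f)" unfolding Lap_def[abs_def] by (intro bipoly_sum)
  have "wirtinger_z j (wirtinger_cnj j f) = (\<lambda>_. 0)" if "m = 0 \<or> n = 0" for j
  using bipoly_db[OF assms, of j] bipoly_dz[of m "n - 1" "wirtinger_cnj j f" j] that by auto
  then show "m = 0 \<or> n = 0 ==> Lap f = (\<lambda>_. 0)" by (simp add: Lap_def[abs_def])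
qed

lemma Lap_add: 
  assumes "bipoly m n f" "bipoly m' n' g"
  shows "Lap (\<lambda>z. f z + g z) = (\<lambda>z. Lap f z + Lap g z)"
  by (simp add: Lap_def[abs_def] wirtinger_add bipoly_diffable[OF assms(1)] bipoly_diffable[OF assms(2)]
   diffable_db[OF assms(1)] diffable_db[OF assms(2)] sum.distrib)

lemma Lap_scale:
  assumes "bipoly m n f"
  shows "Lap (\<lambda>z. c * f z) = (\<lambda>z. c * Lap f z)"
  by (simp add: Lap_def[abs_def] wirtinger_mult diffable_const bipoly_diffable[OF assms]
   diffable_db[OF assms] sum_distrib_left)

lemma Lap_sum:
  assumes "finite I" "\<And>i. i \<in> I ==> bipoly m n (f i)"
  shows "Lap (\<lambda>z. \<Sum>i\<in>I. f i z) = (\<lambda>z. \<Sum>i\<in>I. Lap (f i) z)" using assms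
proof (induction I rule: finite_induct)
  case empty
  then show ?case by (simp add: Lap_def[abs_def])
next
  case (insert i I)
  have "Lap (\<lambda>z. f i z + (\<Sum>i\<in>I. f i z)) = (\<lambda>z. Lap (f i) z + Lap (\<lambda>z. \<Sum>i\<in>I. f i z) z)"
  by (rule Lap_add[of m n _ m n]) (auto intro: bipoly_sum insert.prems)
  then show ?case using insert by simp
qed

lemma Lap_nsq_mult:
  fixes f :: "'d::finite cfun"
  assumes f: "bipoly m n f"
  shows "Lap (\<lambda>z. nsq z * f z) = (\<lambda>z. of_nat (CARD('d) + m + n) * f z + nsq z * Lap f z)"
proof
  fix z :: "complex ^ 'd"
  note d = bipoly_diffable[OF f] diffable_dz[OF f] diffable_db[OF f] bipoly_diffable[OF bipoly_nsq]
  diffable_coord diffable_mult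
  have "wirtinger_z j (wirtinger_cnj j (\<lambda>z. nsq z * f z)) z
   = f z + z $ j * wirtinger_z j f z + cnj (z $ j) * wirtinger_cnj j f z + nsq z * wirtinger_z j (wirtinger_cnj j f) z" for j
  by (simp add: wirtinger_mult wirtinger_add d wirtinger_nsq wirtinger_coord)
  then have "Lap (\<lambda>z. nsq z * f z) z = of_nat CARD('d) * f z + (\<Sum>j\<in>UNIV. z $ j * wirtinger_z j f z)
   + (\<Sum>j\<in>UNIV. cnj (z $ j) * wirtinger_cnj j f z) + nsq z * Lap f z"
  by (simp add: Lap_def sum.distrib sum_distrib_left)
  then show "Lap (\<lambda>z. nsq z * f z) z = of_nat (CARD('d) + m + n) * f z + nsq z * Lap f z"
  by (simp add: euler_z[OF f] euler_cnj[OF f] algebra_simps)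
qed

lemma Lap_conjugate:
  assumes "bipoly m n f"
  shows "Lap (\<lambda>z. cnj (f z)) = (\<lambda>z. cnj (Lap f z))"
proof
  fix z
  have "wirtinger_z j (wirtinger_cnj j (\<lambda>z. cnj (f z))) z = cnj (wirtinger_z j (wirtinger_cnj j f) z)" for j
  by (simp add: wirtinger_of_cnj bipoly_diffable[OF assms] diffable_dz[OF assms] wirtinger_commute[OF assms])
  then show "Lap (\<lambda>z. cnj (f z)) z = cnj (Lap f z)" by (simp add: Lap_def)
qed

abbreviation sint :: "'d::finite cfun => complex" where
  "sint f \<equiv> spint f"

definition ball_integral :: "(real => real) => 'd::finite cfun => complex" where
  "ball_integral h f = (\<integral>x. (indicator (cball 0 1) x * h (norm x)) *\<^sub>R f x \<partial>lborel)"

lemma ball_integral_linear: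
  assumes h: "continuous_on UNIV h" and f: "continuous_on UNIV f" and g: "continuous_on UNIV g"
  shows "ball_integral h (\<lambda>x. a * f x + b * g x) = a * ball_integral h f + b * ball_integral h g"
proof -
  have hc: "continuous_on UNIV (\<lambda>x::complex^'a. h (norm x))"
  by (rule continuous_on_compose2[OF h]) (auto intro: continuous_intros)
  have int: "integrable lborel (\<lambda>x::complex^'a. (indicator (cball 0 1) x * h (norm x)) *\<^sub>R f x)"
  if "continuous_on UNIV f" for f :: "complex^'a => complex" unfolding scaleR_scaleR[symmetric] using that hc
  by (intro integrable_lborel_cball_continuous continuous_intros)
  have "ball_integral h (\<lambda>x. a * f x + b * g x)
  = (\<integral>x. a * ((indicator (cball 0 1) x * h (norm x)) *\<^sub>R f x) + b * ((indicator (cball 0 1) x * h (norm x)) *\<^sub>R g x) \<partial>lborel)"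
  unfolding ball_integral_def by (simp add: algebra_simps)
  also have "... = a * ball_integral h f + b * ball_integral h g" unfolding ball_integral_def
  by (simp only: Bochner_Integration.integral_add[OF integrable_mult_right[OF int[OF f]] integrable_mult_right[OF int[OF g]]]
    integral_mult_right_zero)
  finally show ?thesis .
qed

lemma ball_integral_wirtinger:
  assumes G: "bipoly m n G"
  shows "ball_integral (\<lambda>t. (1 - t\<^sup>2)\<^sup>2) (wirtinger_z j G)
  = 2 * ball_integral (\<lambda>t. 1 - t\<^sup>2) (\<lambda>z. cnj (z $ j) * G z)"
proof -
  define G' where "G' = (\<lambda>z v. \<Sum>j\<in>UNIV. wirtinger_z j G z * v $ j + wirtinger_cnj j G z * cnj (v $ j))"
  have D: "(G has_derivative G' z) (at z)" for z
  unfolding G'_def by (rule derivative_wirtinger[OF bipoly_diffable[OF G]])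
  have cz: "continuous_on UNIV (wirtinger_z k G)" "continuous_on UNIV (wirtinger_cnj k G)" for k
  using diffable_continuous diffable_dz[OF G] diffable_db[OF G] by blast+
  have cG: "continuous_on UNIV G" by (rule bipoly_continuous[OF G])
  have G'c: "continuous_on UNIV (\<lambda>x. G' x v)" for v unfolding G'_def by (intro continuous_intros cz)
  let ?w2 = "\<lambda>t::real. (1 - t\<^sup>2)\<^sup>2" and ?w1 = "\<lambda>t::real. 1 - t\<^sup>2"
  have w: "continuous_on UNIV ?w2" "continuous_on UNIV ?w1" by (intro continuous_intros)+
  have I: "ball_integral ?w2 (\<lambda>z. G' z v) = ball_integral ?w1 (\<lambda>z. (4 * (z \<bullet> v)) *\<^sub>R G z)" for v
  unfolding ball_integral_def by (rule ball_integration_by_parts[OF D G'c])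
  have re: "z \<bullet> axis j 1 = Re (z $ j)" and im: "z \<bullet> axis j \<i> = Im (z $ j)" for z :: "complex^'a"
  by (simp_all add: inner_axis inner_complex_def)
  have "ball_integral ?w2 (wirtinger_z j G)
  = ball_integral ?w2 (\<lambda>z. (1/2) * G' z (axis j 1) + (- \<i> / 2) * G' z (axis j \<i>))"
  by (rule arg_cong[where f = "ball_integral ?w2"])
   (simp add: fun_eq_iff wirtinger_z_eq[OF D] field_simps)
  also have "... = (1/2) * ball_integral ?w1 (\<lambda>z. (4 * Re (z $ j)) *\<^sub>R G z)
   + (- \<i> / 2) * ball_integral ?w1 (\<lambda>z. (4 * Im (z $ j)) *\<^sub>R G z)"
  by (simp only: ball_integral_linear[OF w(1) G'c G'c] I re im)
  also have "... = ball_integral ?w1 (\<lambda>z. (1/2) * ((4 * Re (z $ j)) *\<^sub>R G z) + (- \<i> / 2) * ((4 * Im (z $ j)) *\<^sub>R G z))"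
  by (rule ball_integral_linear[OF w(2), symmetric]) (intro continuous_intros cG)+
  also have "(\<lambda>z. (1/2) * ((4 * Re (z $ j)) *\<^sub>R G z) + (- \<i> / 2) * ((4 * Im (z $ j)) *\<^sub>R G z))
  = (\<lambda>z. 2 * (cnj (z $ j) * G z) + 0 * G z)"
  proof
  fix z
  have "cnj (z $ j) = of_real (Re (z $ j)) - \<i> * of_real (Im (z $ j))" by (simp add: complex_eq_iff)
  then show "(1/2) * ((4 * Re (z $ j)) *\<^sub>R G z) + (- \<i> / 2) * ((4 * Im (z $ j)) *\<^sub>R G z)
   = 2 * (cnj (z $ j) * G z) + 0 * G z" by (simp only: scaleR_conv_of_real) (simp add: algebra_simps)
  qed
  also have "ball_integral ?w1 \<dots> = 2 * ball_integral ?w1 (\<lambda>z. cnj (z $ j) * G z) + 0 * ball_integral ?w1 G"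
  by (rule ball_integral_linear[OF w(2)]) (intro continuous_intros cG)+
  finally show ?thesis by simp
qed

lemma sphere_ibp_z:
  "\<exists>\<kappa>>0. \<forall>m n j (G :: 'd::finite cfun). bipoly m n G --> m + n = s -->
  sint (wirtinger_z j G) = of_real \<kappa> * sint (\<lambda>z. cnj (z $ j) * G z)"
proof -
  let ?w2 = "\<lambda>t::real. (1 - t\<^sup>2)\<^sup>2" and ?w1 = "\<lambda>t::real. 1 - t\<^sup>2"
  have w: "continuous_on UNIV ?w2" "continuous_on UNIV ?w1" by (intro continuous_intros)+
  have pos: "?w1 t > 0" if "0 < t" "t < 1" for t
  using mult_strict_mono[of t 1 t 1] that by (simp add: power2_eq_square)
  have nn: "?w1 t >= 0" if "0 <= t" "t <= 1" for t using that by (simp add: power_le_one)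
  have "\<exists>c>0. \<forall>f::'d cfun. continuous_on UNIV f -->
   (\<forall>t x. t > 0 --> f (t *\<^sub>R x) = of_real (t ^ (s + 1)) * f x) --> ball_integral ?w1 f = of_real c * sint f"
  unfolding ball_integral_def by (rule homogeneous_ball_integral[OF w(2) nn pos])
  then obtain c1 where c1: "c1 > 0" "\<forall>f::'d cfun. continuous_on UNIV f -->
   (\<forall>t x. t > 0 --> f (t *\<^sub>R x) = of_real (t ^ (s + 1)) * f x) --> ball_integral ?w1 f = of_real c1 * sint f"
  by (elim exE conjE)
  have pos2: "?w2 t > 0" if "0 < t" "t < 1" for t using pos[OF that] by simp
  have nn2: "?w2 t >= 0" if "0 <= t" "t <= 1" for t by simp
  have "\<exists>c>0. \<forall>f::'d cfun. continuous_on UNIV f -->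
   (\<forall>t x. t > 0 --> f (t *\<^sub>R x) = of_real (t ^ (s - 1)) * f x) --> ball_integral ?w2 f = of_real c * sint f"
  unfolding ball_integral_def by (rule homogeneous_ball_integral[OF w(1) nn2 pos2])
  then obtain c2 where c2: "c2 > 0" "\<forall>f::'d cfun. continuous_on UNIV f -->
   (\<forall>t x. t > 0 --> f (t *\<^sub>R x) = of_real (t ^ (s - 1)) * f x) --> ball_integral ?w2 f = of_real c2 * sint f"
  by (elim exE conjE)
  show ?thesis
  proof (intro exI[of _ "2 * c1 / c2"] conjI allI impI)
  show "2 * c1 / c2 > 0" using c1 c2 by simp
  fix m n j and G :: "'d cfun" assume G: "bipoly m n G" and s: "m + n = s"
  have "ball_integral ?w1 (\<lambda>z. cnj (z $ j) * G z) = of_real c1 * sint (\<lambda>z. cnj (z $ j) * G z)"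
  proof (rule c1(2)[rule_format])
   note b = bipoly_cnj[OF G, of j]
   show "continuous_on UNIV (\<lambda>z. cnj (z $ j) * G z)" by (rule bipoly_continuous[OF b])
   show "cnj ((t *\<^sub>R x) $ j) * G (t *\<^sub>R x) = of_real (t ^ (s + 1)) * (cnj (x $ j) * G x)" for t x
    using bipoly_homogeneous[OF b, of t x] s by simp
  qed
  moreover have "ball_integral ?w2 (wirtinger_z j G) = of_real c2 * sint (wirtinger_z j G)"
  proof (rule c2(2)[rule_format])
   show "continuous_on UNIV (wirtinger_z j G)" by (rule diffable_continuous[OF diffable_dz[OF G]])
   show "wirtinger_z j G (t *\<^sub>R x) = of_real (t ^ (s - 1)) * wirtinger_z j G x" for t x
   proof (cases "m = 0")
    case True
    then show ?thesis using bipoly_dz[OF G, of j] by simp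
   next
    case False
    then have "m - 1 + n = s - 1" using s by simp
    then show ?thesis using bipoly_homogeneous[of "m - 1" n "wirtinger_z j G" t x] bipoly_dz[OF G, of j] by simp
   qed
  qed
  ultimately show "sint (wirtinger_z j G) = of_real (2 * c1 / c2) * sint (\<lambda>z. cnj (z $ j) * G z)"
   using ball_integral_wirtinger[OF G, of j] c2(1) by (simp add: field_simps)
  qed
qed

lemma sint_cnj: "sint (\<lambda>z. cnj (f z)) = cnj (sint f)" by simp

text \<open>Both sides of the integration by parts in the ball are homogeneous, so polar coordinates
  turn them into integrals over the sphere. The constant depends only on the total degree
  \<open>s\<close>, and this is what the proof of orthogonality needs.\<close>
lemma sphere_ibp:
  "\<exists>\<kappa>>0. \<forall>m n j (G :: 'd::finite cfun). bipoly m n G --> m + n = s -->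
  sint (wirtinger_z j G) = of_real \<kappa> * sint (\<lambda>z. cnj (z $ j) * G z) \<and>
  sint (wirtinger_cnj j G) = of_real \<kappa> * sint (\<lambda>z. z $ j * G z)"
proof -
  obtain \<kappa> where k: "\<kappa> > 0" "\<And>m n j (G :: 'd cfun). bipoly m n G ==> m + n = s ==>
  sint (wirtinger_z j G) = of_real \<kappa> * sint (\<lambda>z. cnj (z $ j) * G z)"
  using sphere_ibp_z[of s] by blast
  show ?thesis
  proof (intro exI[of _ \<kappa>] conjI allI impI)
  fix m n j and G :: "'d cfun" assume G: "bipoly m n G" and s: "m + n = s"
  show "sint (wirtinger_z j G) = of_real \<kappa> * sint (\<lambda>z. cnj (z $ j) * G z)" by (rule k(2)[OF G s])
  have "sint (wirtinger_z j (\<lambda>z. cnj (G z))) = of_real \<kappa> * sint (\<lambda>z. cnj (z $ j) * cnj (G z))"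
   using k(2)[OF bipoly_conjugate[OF G]] s by simp
  then have "cnj (sint (wirtinger_cnj j G)) = cnj (of_real \<kappa> * sint (\<lambda>z. z $ j * G z))"
   unfolding wirtinger_of_cnj[OF bipoly_diffable[OF G]] complex_cnj_mult[symmetric] sint_cnj by simp
  then show "sint (wirtinger_cnj j G) = of_real \<kappa> * sint (\<lambda>z. z $ j * G z)"
   by (simp only: complex_cnj_cancel_iff)
  qed (rule k(1))
qed

lemma integrable_bipoly: "bipoly m n f ==> integrable sphere_measure f"
  by (rule integrable_sphere_continuous[OF bipoly_continuous])

definition harmpoly :: "nat => nat => 'd::finite cfun => bool" where
  "harmpoly m n f \<longleftrightarrow> bipoly m n f \<and> Lap f = (\<lambda>_. 0)"

text \<open>Integrating \<open>\<Sum>j. wirtinger_cnj j Q * wirtinger_z j H\<close> by parts in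
  either factor gives the integral of \<open>Q * H\<close>, once with the factor \<open>b\<close> and
  once with the factor \<open>m\<close> by Euler's identity.\<close>
lemma harmpoly_product_integral:
  fixes Q H :: "'d::finite cfun"
  assumes Q: "harmpoly a b Q" and H: "harmpoly m n H" and ne: "b ~= m"
  shows "sint (\<lambda>z. Q z * H z) = 0"
proof -
  note bQ = Q[unfolded harmpoly_def, THEN conjunct1] and bH = H[unfolded harmpoly_def, THEN conjunct1]
  note dd = bipoly_diffable[OF bQ] bipoly_diffable[OF bH] diffable_dz[OF bH] diffable_db[OF bQ]
  define s where "s = a + b + m + n - 1"
  obtain \<kappa> where k: "\<kappa> > 0" "\<And>m n j (G :: 'd cfun). bipoly m n G ==> m + n = s ==>
  sint (wirtinger_z j G) = of_real \<kappa> * sint (\<lambda>z. cnj (z $ j) * G z) \<and>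
  sint (wirtinger_cnj j G) = of_real \<kappa> * sint (\<lambda>z. z $ j * G z)" using sphere_ibp[of s] by blast
  define T where "T = (\<lambda>z. \<Sum>j\<in>UNIV. wirtinger_cnj j Q z * wirtinger_z j H z)"
  have cont: "continuous_on UNIV (wirtinger_cnj j Q)" "continuous_on UNIV (wirtinger_z j H)"
  "continuous_on UNIV Q" "continuous_on UNIV H"
  "continuous_on UNIV (wirtinger_z j (wirtinger_cnj j Q))" "continuous_on UNIV (wirtinger_cnj j (wirtinger_z j H))" for j
  using dd bipoly_db[OF bQ, of j] bipoly_dz[OF bH, of j]
  by (auto intro: diffable_continuous diffable_dz diffable_db)
  have int: "integrable sphere_measure f" if "continuous_on UNIV f" for f :: "'d cfun"
  by (rule integrable_sphere_continuous[OF that])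
  have 1: "sint T = of_real \<kappa> * of_nat b * sint (\<lambda>z. Q z * H z)"
  proof (cases "b = 0")
  case True
  then have "T = (\<lambda>_. 0)" using bipoly_db[OF bQ] by (auto simp: T_def fun_eq_iff)
  then show ?thesis using True by simp
  next
  case False
  have e: "sint (wirtinger_z j (\<lambda>z. wirtinger_cnj j Q z * H z)) = of_real \<kappa> * sint (\<lambda>z. cnj (z $ j) * (wirtinger_cnj j Q z * H z))" for j
   using k(2)[OF bipoly_mult[OF _ bH], of a "b - 1" "wirtinger_cnj j Q" j] bipoly_db[OF bQ, of j] False
   by (simp add: s_def)
  have "(\<Sum>j\<in>UNIV. sint (wirtinger_z j (\<lambda>z. wirtinger_cnj j Q z * H z)))
   = sint (\<lambda>z. \<Sum>j\<in>UNIV. wirtinger_z j (wirtinger_cnj j Q) z * H z + wirtinger_cnj j Q z * wirtinger_z j H z)"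
   by (subst Bochner_Integration.integral_sum) (auto simp: wirtinger_mult dd intro!: int continuous_intros cont)
  also have "(\<lambda>z. \<Sum>j\<in>UNIV. wirtinger_z j (wirtinger_cnj j Q) z * H z + wirtinger_cnj j Q z * wirtinger_z j H z)
   = (\<lambda>z. Lap Q z * H z + T z)" by (simp add: Lap_def T_def sum.distrib sum_distrib_right)
  also have "... = T" using Q by (simp add: harmpoly_def)
  finally have "sint T = (\<Sum>j\<in>UNIV. of_real \<kappa> * sint (\<lambda>z. cnj (z $ j) * (wirtinger_cnj j Q z * H z)))" by (simp add: e)
  also have "... = of_real \<kappa> * sint (\<lambda>z. \<Sum>j\<in>UNIV. cnj (z $ j) * (wirtinger_cnj j Q z * H z))"
   by (subst Bochner_Integration.integral_sum) (auto simp: sum_distrib_left intro!: int continuous_intros cont)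
  also have "(\<lambda>z. \<Sum>j\<in>UNIV. cnj (z $ j) * (wirtinger_cnj j Q z * H z)) = (\<lambda>z. of_nat b * (Q z * H z))"
   using euler_cnj[OF bQ] by (simp add: sum_distrib_right[symmetric] mult.assoc[symmetric])
  also have "sint \<dots> = of_nat b * sint (\<lambda>z. Q z * H z)" by simp
  finally show ?thesis by (simp add: mult.assoc)
  qed
  have 2: "sint T = of_real \<kappa> * of_nat m * sint (\<lambda>z. Q z * H z)"
  proof (cases "m = 0")
  case True
  then have "T = (\<lambda>_. 0)" using bipoly_dz[OF bH] by (auto simp: T_def fun_eq_iff)
  then show ?thesis using True by simp
  next
  case False
  have e: "sint (wirtinger_cnj j (\<lambda>z. Q z * wirtinger_z j H z)) = of_real \<kappa> * sint (\<lambda>z. z $ j * (Q z * wirtinger_z j H z))" for j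
   using k(2)[OF bipoly_mult[OF bQ], of "m - 1" n "wirtinger_z j H" j] bipoly_dz[OF bH, of j] False
   by (simp add: s_def)
  have "(\<Sum>j\<in>UNIV. sint (wirtinger_cnj j (\<lambda>z. Q z * wirtinger_z j H z)))
   = sint (\<lambda>z. \<Sum>j\<in>UNIV. wirtinger_cnj j Q z * wirtinger_z j H z + Q z * wirtinger_cnj j (wirtinger_z j H) z)"
   by (subst Bochner_Integration.integral_sum) (auto simp: wirtinger_mult dd intro!: int continuous_intros cont)
  also have "(\<lambda>z. \<Sum>j\<in>UNIV. wirtinger_cnj j Q z * wirtinger_z j H z + Q z * wirtinger_cnj j (wirtinger_z j H) z)
   = (\<lambda>z. T z + Q z * Lap H z)"
   by (simp add: Lap_def T_def sum.distrib sum_distrib_left wirtinger_commute[OF bH])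
  also have "... = T" using H by (simp add: harmpoly_def)
  finally have "sint T = (\<Sum>j\<in>UNIV. of_real \<kappa> * sint (\<lambda>z. z $ j * (Q z * wirtinger_z j H z)))" by (simp add: e)
  also have "... = of_real \<kappa> * sint (\<lambda>z. \<Sum>j\<in>UNIV. z $ j * (Q z * wirtinger_z j H z))"
   by (subst Bochner_Integration.integral_sum) (auto simp: sum_distrib_left intro!: int continuous_intros cont)
  also have "(\<lambda>z. \<Sum>j\<in>UNIV. z $ j * (Q z * wirtinger_z j H z)) = (\<lambda>z. of_nat m * (Q z * H z))"
  proof
   fix z
   have "(\<Sum>j\<in>UNIV. z $ j * (Q z * wirtinger_z j H z)) = Q z * (\<Sum>j\<in>UNIV. z $ j * wirtinger_z j H z)"
    by (simp add: sum_distrib_left mult_ac)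
   then show "(\<Sum>j\<in>UNIV. z $ j * (Q z * wirtinger_z j H z)) = of_nat m * (Q z * H z)"
    using euler_z[OF bH] by simp
  qed
  also have "sint \<dots> = of_nat m * sint (\<lambda>z. Q z * H z)" by simp
  finally show ?thesis by (simp add: mult.assoc)
  qed
  show ?thesis
  proof (rule ccontr)
  assume S: "sint (\<lambda>z. Q z * H z) ~= 0"
  have "of_real \<kappa> * of_nat b * sint (\<lambda>z. Q z * H z) = of_real \<kappa> * of_nat m * sint (\<lambda>z. Q z * H z)"
   by (rule trans[OF 1[symmetric] 2])
  then have "of_real \<kappa> * of_nat b = (of_real \<kappa> * of_nat m :: complex)"
   using mult_cancel_right[THEN iffD1] S by blast
  then show False using k(1) ne by simp
  qed
qed

section \<open>Spherical harmonics and their orthogonality\<close>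

definition ip :: "'d::finite cfun => 'd cfun => complex" where
  "ip f g = sint (\<lambda>z. f z * cnj (g z))"

lemma ip_cnj: "ip g f = cnj (ip f g)" unfolding ip_def sint_cnj[symmetric] by (simp add: mult.commute)

lemma ip_cong: "(\<And>z. norm z = 1 ==> f z = f' z) ==> (\<And>z. norm z = 1 ==> g z = g' z) ==> ip f g = ip f' g'"
  unfolding ip_def by (rule sphere_integral_cong) simp

lemma ip_add_left: "continuous_on UNIV f ==> continuous_on UNIV f' ==> continuous_on UNIV g ==>
  ip (\<lambda>z. f z + f' z) g = ip f g + ip f' g" unfolding ip_def distrib_right
  by (intro Bochner_Integration.integral_add integrable_sphere_continuous continuous_intros)

lemma ip_scale_left: "ip (\<lambda>z. c * f z) g = c * ip f g" unfolding ip_def by (simp add: mult.assoc)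

lemma ip_sum_left: "(\<And>i. i \<in> I ==> continuous_on UNIV (f i)) ==> continuous_on UNIV g ==>
  ip (\<lambda>z. \<Sum>i\<in>I. f i z) g = (\<Sum>i\<in>I. ip (f i) g)" unfolding ip_def sum_distrib_right
  by (intro Bochner_Integration.integral_sum integrable_sphere_continuous continuous_intros)

lemma ip_scale_right: "ip f (\<lambda>z. c * g z) = cnj c * ip f g"
proof -
  have "cnj (ip (\<lambda>z. c * g z) f) = cnj c * cnj (ip g f)" by (simp add: ip_scale_left)
  then show ?thesis unfolding ip_cnj[symmetric] .
qed

lemma ip_add_right: "continuous_on UNIV f ==> continuous_on UNIV g' ==> continuous_on UNIV g ==>
  ip f (\<lambda>z. g z + g' z) = ip f g + ip f g'"
proof -
  assume "continuous_on UNIV f" "continuous_on UNIV g'" "continuous_on UNIV g"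
  then have "cnj (ip (\<lambda>z. g z + g' z) f) = cnj (ip g f) + cnj (ip g' f)" by (simp add: ip_add_left)
  then show ?thesis unfolding ip_cnj[symmetric] .
qed

lemma ip_sum_right: "(\<And>i. i \<in> I ==> continuous_on UNIV (f i)) ==> continuous_on UNIV g ==>
  ip g (\<lambda>z. \<Sum>i\<in>I. f i z) = (\<Sum>i\<in>I. ip g (f i))"
proof -
  assume "\<And>i. i \<in> I ==> continuous_on UNIV (f i)" "continuous_on UNIV g"
  then have "cnj (ip (\<lambda>z. \<Sum>i\<in>I. f i z) g) = (\<Sum>i\<in>I. cnj (ip (f i) g))"
  by (simp add: ip_sum_left)
  then show ?thesis unfolding ip_cnj[symmetric] .
qed

lemma ip_self: "ip f f = of_real (spint (\<lambda>z. (norm (f z))\<^sup>2))"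
  unfolding ip_def complex_norm_square[symmetric] of_real_power[symmetric] integral_complex_of_real ..

lemma ip_self_zero:
  assumes "continuous_on UNIV f" "ip f f = 0" "norm z = 1" shows "f z = 0"
proof -
  have "spint (\<lambda>z. (norm (f z))\<^sup>2) = 0" using assms(2) by (simp add: ip_self)
  then have "(norm (f z))\<^sup>2 = 0"
  by (intro sphere_integral_pos[of "\<lambda>z. (norm (f z))\<^sup>2"] continuous_intros assms) auto
  then show ?thesis by simp
qed

lemma harmpoly_bipoly: "harmpoly m n f ==> bipoly m n f" and harmpoly_Lap: "harmpoly m n f ==> Lap f = (\<lambda>_. 0)"
  by (simp_all add: harmpoly_def)

lemma harmpoly_continuous: "harmpoly m n f ==> continuous_on UNIV f"
  by (rule bipoly_continuous[OF harmpoly_bipoly])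

lemma harmpoly_conjugate: "harmpoly m n f ==> harmpoly n m (\<lambda>z. cnj (f z))"
  unfolding harmpoly_def using Lap_conjugate[of m n f] bipoly_conjugate[of m n f] by simp

lemma harmpoly_orthogonal:
  assumes f: "harmpoly m n f" and g: "harmpoly m' n' g" and ne: "(m, n) ~= (m', n')"
  shows "ip f g = 0"
proof (cases "m = m'")
  case False
  have "sint (\<lambda>z. cnj (g z) * f z) = 0"
  by (rule harmpoly_product_integral[OF harmpoly_conjugate[OF g] f]) (use False in simp)
  then show ?thesis by (simp add: ip_def mult.commute)
next
  case True
  have "sint (\<lambda>z. f z * cnj (g z)) = 0"
  by (rule harmpoly_product_integral[OF f harmpoly_conjugate[OF g]]) (use True ne in simp)
  then show ?thesis by (simp add: ip_def)
qed

lemma harmpoly_zero: "harmpoly m n (\<lambda>_. 0)" by (simp add: harmpoly_def bipoly_zero Lap_def[abs_def])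

lemma harmpoly_add: "harmpoly m n f ==> harmpoly m n g ==> harmpoly m n (\<lambda>z. f z + g z)"
  unfolding harmpoly_def using Lap_add[of m n f m n g] bipoly_add[of m n f g] by simp

lemma harmpoly_scale: "harmpoly m n f ==> harmpoly m n (\<lambda>z. c * f z)"
  unfolding harmpoly_def using Lap_scale[of m n f c] bipoly_scale[of m n f c] by simp

lemma harmpoly_sum: "(\<And>i. i \<in> I ==> harmpoly m n (f i)) ==> harmpoly m n (\<lambda>z. \<Sum>i\<in>I. f i z)"
  by (induction I rule: infinite_finite_induct) (auto intro: harmpoly_zero harmpoly_add)

lemma bipoly_nsq_power: "bipoly m n f ==> bipoly (m + i) (n + i) (\<lambda>z. nsq z ^ i * f z)"
proof (induction i)
  case (Suc i)
  show ?case using bipoly_nsq_mult[OF Suc.IH[OF Suc.prems]] by (simp add: mult.assoc)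
qed simp

lemma Lap_nsq_power:
  fixes h :: "'d::finite cfun"
  assumes h: "harmpoly a b h"
  shows "Lap (\<lambda>z. nsq z ^ Suc i * h z) = (\<lambda>z. of_nat (Suc i * (CARD('d) + a + b + i)) * (nsq z ^ i * h z))"
proof (induction i)
  case 0
  then show ?case using Lap_nsq_mult[OF harmpoly_bipoly[OF h]] harmpoly_Lap[OF h] by simp
next
  case (Suc i)
  have "Lap (\<lambda>z. nsq z ^ Suc (Suc i) * h z) = Lap (\<lambda>z. nsq z * (nsq z ^ Suc i * h z))"
  by (simp add: mult.assoc)
  also have "... = (\<lambda>z. of_nat (CARD('d) + (a + Suc i) + (b + Suc i)) * (nsq z ^ Suc i * h z)
   + nsq z * (of_nat (Suc i * (CARD('d) + a + b + i)) * (nsq z ^ i * h z)))"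
  unfolding Lap_nsq_mult[OF bipoly_nsq_power[OF harmpoly_bipoly[OF h]]] Suc.IH ..
  also have "... = (\<lambda>z. of_nat (Suc (Suc i) * (CARD('d) + a + b + Suc i)) * (nsq z ^ Suc i * h z))"
  by (auto simp: fun_eq_iff algebra_simps)
  finally show ?case .
qed

lemma harmonic_decomposition:
  fixes f :: "'d::finite cfun"
  assumes "bipoly m n f"
  shows "\<exists>h. (\<forall>i\<le>min m n. harmpoly (m - i) (n - i) (h i)) \<and> f = (\<lambda>z. \<Sum>i\<le>min m n. nsq z ^ i * h i z)"
  using assms
proof (induction m arbitrary: n f)
  case 0
  then have "harmpoly 0 n f" using Lap_bipoly(2)[OF 0] by (simp add: harmpoly_def)
  then show ?case by (intro exI[of _ "\<lambda>_. f"]) simp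
next
  case (Suc m n)
  show ?case
  proof (cases n)
  case 0
  then have "harmpoly (Suc m) 0 f" using Lap_bipoly(2)[OF Suc.prems] Suc.prems by (simp add: harmpoly_def)
  then show ?thesis using 0 by (intro exI[of _ "\<lambda>_. f"]) simp
  next
  case (Suc n')
  let ?k = "min m n'"
  have "bipoly m n' (Lap f)" using Lap_bipoly(1)[OF Suc.prems] Suc by simp
  from Suc.IH[OF this] obtain h where h: "\<And>i. i <= ?k ==> harmpoly (m - i) (n' - i) (h i)"
   and Lf: "Lap f = (\<lambda>z. \<Sum>i\<le>?k. nsq z ^ i * h i z)" by blast
  define c where "c = (\<lambda>i. of_nat (Suc i * (CARD('d) + (m - i) + (n' - i) + i)) :: complex)"
  have c0: "c i ~= 0" for i unfolding c_def of_nat_eq_0_iff by simp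
  define g where "g = (\<lambda>i z. (1 / c i) * (nsq z ^ Suc i * h i z))"
  have gb: "bipoly (Suc m) n (g i)" if "i <= ?k" for i
   using bipoly_scale[OF bipoly_nsq_power[OF harmpoly_bipoly[OF h[OF that]], of "Suc i"], of "1 / c i"] that Suc
   by (simp add: g_def)
  have gL: "Lap (g i) = (\<lambda>z. nsq z ^ i * h i z)" if "i <= ?k" for i
  proof -
   have "Lap (\<lambda>z. nsq z ^ Suc i * h i z) = (\<lambda>z. c i * (nsq z ^ i * h i z))"
    unfolding c_def by (rule Lap_nsq_power[OF h[OF that]])
   then show ?thesis
    using Lap_scale[OF bipoly_nsq_power[OF harmpoly_bipoly[OF h[OF that]], of "Suc i"], of "1 / c i"] c0[of i]
    unfolding g_def by simp
  qed
  define f0 where "f0 = (\<lambda>z. f z + (-1) * (\<Sum>i\<le>?k. g i z))"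
  have sb: "bipoly (Suc m) n (\<lambda>z. \<Sum>i\<le>?k. g i z)" by (rule bipoly_sum) (use gb in auto)
  have "Lap f0 = (\<lambda>z. Lap f z + (-1) * Lap (\<lambda>z. \<Sum>i\<le>?k. g i z) z)"
   unfolding f0_def by (simp only: Lap_add[OF Suc.prems bipoly_scale[OF sb]] Lap_scale[OF sb])
  also have "Lap (\<lambda>z. \<Sum>i\<le>?k. g i z) = (\<lambda>z. \<Sum>i\<le>?k. Lap (g i) z)"
   by (rule Lap_sum[of _ "Suc m" n]) (use gb in auto)
  finally have "Lap f0 = (\<lambda>_. 0)" unfolding Lf by (simp add: gL fun_eq_iff)
  moreover have "bipoly (Suc m) n f0" unfolding f0_def by (intro bipoly_add Suc.prems bipoly_scale sb)
  ultimately have f0: "harmpoly (Suc m) n f0" by (simp add: harmpoly_def)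
  define h' where "h' = (\<lambda>i. case i of 0 => f0 | Suc i => (\<lambda>z. (1 / c i) * h i z))"
  have "harmpoly (Suc m - i) (n - i) (h' i)" if "i <= min (Suc m) n" for i
  proof (cases i)
   case 0
   then show ?thesis using f0 by (simp add: h'_def)
  next
   case (Suc i')
   then have "i' <= ?k" using that \<open>n = Suc n'\<close> by simp
   then have "harmpoly (m - i') (n' - i') (\<lambda>z. (1 / c i') * h i' z)" by (intro harmpoly_scale h)
   then show ?thesis unfolding h'_def Suc \<open>n = Suc n'\<close> nat.case diff_Suc_Suc .
  qed
  moreover have "f = (\<lambda>z. \<Sum>i\<le>min (Suc m) n. nsq z ^ i * h' i z)"
  proof
   fix z
   have "min (Suc m) n = Suc ?k" using Suc by simp
   then have "(\<Sum>i\<le>min (Suc m) n. nsq z ^ i * h' i z) = f0 z + (\<Sum>i\<le>?k. nsq z ^ Suc i * ((1 / c i) * h i z))"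
    by (simp only: sum.atMost_Suc_shift) (simp add: h'_def)
   also have "... = f z" by (simp add: f0_def g_def mult_ac)
   finally show "f z = (\<Sum>i\<le>min (Suc m) n. nsq z ^ i * h' i z)" by simp
  qed
  ultimately show ?thesis by blast
  qed
qed

section \<open>Monomials\<close>

definition monom_fun :: "('d => nat) => ('d => nat) => 'd::finite cfun" where
  "monom_fun \<alpha> \<beta> z = (\<Prod>j\<in>UNIV. (z $ j) ^ \<alpha> j) * (\<Prod>j\<in>UNIV. cnj (z $ j) ^ \<beta> j)"

lemma sum_fun_upd_Suc:
  fixes \<alpha> :: "'d::finite => nat"
  shows "sum (\<alpha>(j := Suc (\<alpha> j))) UNIV = Suc (sum \<alpha> UNIV)"
proof -
  have "sum (\<alpha>(j := Suc (\<alpha> j))) UNIV = Suc (\<alpha> j) + sum (\<alpha>(j := Suc (\<alpha> j))) (UNIV - {j})"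
  by (subst sum.remove[of _ j]) auto
  also have "sum (\<alpha>(j := Suc (\<alpha> j))) (UNIV - {j}) = sum \<alpha> (UNIV - {j})" by (rule sum.cong) auto
  finally show ?thesis by (simp add: sum.remove[of UNIV j \<alpha>])
qed

lemma prod_fun_upd_Suc:
  fixes x :: "'d::finite => complex"
  shows "(\<Prod>i\<in>UNIV. x i ^ (\<alpha>(j := Suc (\<alpha> j))) i) = x j * (\<Prod>i\<in>UNIV. x i ^ \<alpha> i)"
proof -
  have "(\<Prod>i\<in>UNIV. x i ^ (\<alpha>(j := Suc (\<alpha> j))) i)
   = x j ^ Suc (\<alpha> j) * (\<Prod>i\<in>UNIV - {j}. x i ^ (\<alpha>(j := Suc (\<alpha> j))) i)"
  by (subst prod.remove[of _ j]) auto
  also have "(\<Prod>i\<in>UNIV - {j}. x i ^ (\<alpha>(j := Suc (\<alpha> j))) i) = (\<Prod>i\<in>UNIV - {j}. x i ^ \<alpha> i)"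
  by (rule prod.cong) auto
  finally show ?thesis by (simp add: prod.remove[of UNIV j "\<lambda>i. x i ^ \<alpha> i"])
qed

lemma monom_fun_Suc_left: "monom_fun (\<alpha>(j := Suc (\<alpha> j))) \<beta> z = z $ j * monom_fun \<alpha> \<beta> z"
  and monom_fun_Suc_right: "monom_fun \<alpha> (\<beta>(j := Suc (\<beta> j))) z = cnj (z $ j) * monom_fun \<alpha> \<beta> z"
  by (simp_all only: monom_fun_def prod_fun_upd_Suc[of "\<lambda>j. z $ j"] prod_fun_upd_Suc[of "\<lambda>j. cnj (z $ j)"] mult_ac)

lemma monom_fun_zero: "monom_fun (\<lambda>_. 0) (\<lambda>_. 0) = (\<lambda>_. 1)"
  by (simp add: monom_fun_def fun_eq_iff)

lemma finite_exponents: "finite {\<alpha> :: 'd::finite => nat. sum \<alpha> UNIV = m}"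
proof (rule finite_subset)
  show "{\<alpha> :: 'd => nat. sum \<alpha> UNIV = m} \<subseteq> PiE UNIV (\<lambda>_. {..m})"
  by (auto simp: PiE_def) (metis finite iso_tuple_UNIV_I member_le_sum zero_le)
qed (auto intro: finite_PiE)

lemma exponent_decrease:
  fixes \<alpha> :: "'d::finite => nat"
  assumes "\<alpha> j ~= 0"
  obtains \<alpha>' where "\<alpha> = \<alpha>'(j := Suc (\<alpha>' j))" "sum \<alpha> UNIV = Suc (sum \<alpha>' UNIV)"
proof -
  let ?a = "\<alpha>(j := \<alpha> j - 1)"
  have "\<alpha> = ?a(j := Suc (?a j))" using assms by (auto simp: fun_eq_iff)
  moreover have "sum \<alpha> UNIV = Suc (sum ?a UNIV)" by (subst calculation, rule sum_fun_upd_Suc)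
  ultimately show ?thesis by (rule that)
qed

lemma bipoly_mono: "bipoly (sum \<alpha> UNIV) (sum \<beta> UNIV) (monom_fun \<alpha> \<beta>)"
proof (induction "sum \<alpha> UNIV + sum \<beta> UNIV" arbitrary: \<alpha> \<beta>)
  case 0
  then have "\<alpha> = (\<lambda>_. 0)" "\<beta> = (\<lambda>_. 0)" by (auto simp: fun_eq_iff)
  then show ?case using monom_fun_zero bipoly_const[of 1] by (simp add: monom_fun_def[abs_def])
next
  case (Suc k)
  show ?case
  proof (cases "sum \<alpha> UNIV = 0")
  case False
  from sum.not_neutral_contains_not_neutral[OF this] obtain j where "\<alpha> j ~= 0" .
  then obtain \<alpha>' where a: "\<alpha> = \<alpha>'(j := Suc (\<alpha>' j))" "sum \<alpha> UNIV = Suc (sum \<alpha>' UNIV)"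
   by (rule exponent_decrease)
  have "bipoly (sum \<alpha>' UNIV) (sum \<beta> UNIV) (monom_fun \<alpha>' \<beta>)" using Suc.hyps a(2) by simp
  from bipoly_z[OF this, of j] have "bipoly (sum \<alpha> UNIV) (sum \<beta> UNIV) (\<lambda>z. z $ j * monom_fun \<alpha>' \<beta> z)"
   unfolding a(2) .
  then show ?thesis unfolding monom_fun_Suc_left[symmetric] a(1)[symmetric] .
  next
  case True
  then have "sum \<beta> UNIV ~= 0" using Suc.hyps(2) by linarith
  from sum.not_neutral_contains_not_neutral[OF this] obtain j where "\<beta> j ~= 0" .
  then obtain \<beta>' where b: "\<beta> = \<beta>'(j := Suc (\<beta>' j))" "sum \<beta> UNIV = Suc (sum \<beta>' UNIV)"
   by (rule exponent_decrease)
  have "bipoly (sum \<alpha> UNIV) (sum \<beta>' UNIV) (monom_fun \<alpha> \<beta>')" using Suc.hyps b(2) by simp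
  from bipoly_cnj[OF this, of j] have "bipoly (sum \<alpha> UNIV) (sum \<beta> UNIV) (\<lambda>z. cnj (z $ j) * monom_fun \<alpha> \<beta>' z)"
   unfolding b(2) .
  then show ?thesis unfolding monom_fun_Suc_right[symmetric] b(1)[symmetric] .
  qed
qed

lemma bihomogeneous_polys_alt:
  "bihomogeneous_polys m n = {P. \<exists>c. P = (\<lambda>z. \<Sum>\<alpha> | sum \<alpha> UNIV = m. \<Sum>\<beta> | sum \<beta> UNIV = n. c \<alpha> \<beta> * monom_fun \<alpha> \<beta> z)}"
  unfolding bihomogeneous_polys_def monom_fun_def by (simp add: mult.assoc)

lemma bihomogeneous_polys_add:
  "f \<in> bihomogeneous_polys m n ==> g \<in> bihomogeneous_polys m n ==> (\<lambda>z. f z + g z) \<in> bihomogeneous_polys m n"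
proof -
  assume "f \<in> bihomogeneous_polys m n" "g \<in> bihomogeneous_polys m n"
  then obtain c c' where
  "f = (\<lambda>z. \<Sum>\<alpha> | sum \<alpha> UNIV = m. \<Sum>\<beta> | sum \<beta> UNIV = n. c \<alpha> \<beta> * monom_fun \<alpha> \<beta> z)"
  "g = (\<lambda>z. \<Sum>\<alpha> | sum \<alpha> UNIV = m. \<Sum>\<beta> | sum \<beta> UNIV = n. c' \<alpha> \<beta> * monom_fun \<alpha> \<beta> z)"
  unfolding bihomogeneous_polys_alt by blast
  then have "(\<lambda>z. f z + g z) = (\<lambda>z. \<Sum>\<alpha> | sum \<alpha> UNIV = m. \<Sum>\<beta> | sum \<beta> UNIV = n. (c \<alpha> \<beta> + c' \<alpha> \<beta>) * monom_fun \<alpha> \<beta> z)"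
  by (simp add: sum.distrib distrib_right)
  then show ?thesis unfolding bihomogeneous_polys_alt mem_Collect_eq by (intro exI[of _ "\<lambda>\<alpha> \<beta>. c \<alpha> \<beta> + c' \<alpha> \<beta>"])
qed

lemma bihomogeneous_polys_mono:
  fixes \<alpha> \<beta> :: "'d::finite => nat"
  shows "(\<lambda>z. a * monom_fun \<alpha> \<beta> z) \<in> bihomogeneous_polys (sum \<alpha> UNIV) (sum \<beta> UNIV)"
proof -
  let ?c = "\<lambda>\<alpha>' \<beta>'. if \<beta>' = \<beta> then if \<alpha>' = \<alpha> then a else 0 else 0"
  have "(\<Sum>\<alpha>' | sum \<alpha>' UNIV = sum \<alpha> UNIV. \<Sum>\<beta>' | sum \<beta>' UNIV = sum \<beta> UNIV. ?c \<alpha>' \<beta>' * monom_fun \<alpha>' \<beta>' z) = a * monom_fun \<alpha> \<beta> z" for z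
  proof -
  have "(\<Sum>\<beta>' | sum \<beta>' UNIV = sum \<beta> UNIV. ?c \<alpha>' \<beta>' * monom_fun \<alpha>' \<beta>' z) = (if \<alpha>' = \<alpha> then a * monom_fun \<alpha> \<beta> z else 0)" for \<alpha>'
  proof -
   have "(\<Sum>\<beta>' | sum \<beta>' UNIV = sum \<beta> UNIV. ?c \<alpha>' \<beta>' * monom_fun \<alpha>' \<beta>' z)
    = (\<Sum>\<beta>' | sum \<beta>' UNIV = sum \<beta> UNIV. if \<beta>' = \<beta> then (if \<alpha>' = \<alpha> then a * monom_fun \<alpha> \<beta> z else 0) else 0)"
    by (rule sum.cong) auto
   then show ?thesis by (cases "\<alpha>' = \<alpha>") (simp_all add: sum.delta[OF finite_exponents])
  qed
  then show ?thesis by (simp add: sum.delta[OF finite_exponents])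
  qed
  then have "(\<lambda>z. a * monom_fun \<alpha> \<beta> z) = (\<lambda>z. \<Sum>\<alpha>' | sum \<alpha>' UNIV = sum \<alpha> UNIV. \<Sum>\<beta>' | sum \<beta>' UNIV = sum \<beta> UNIV. ?c \<alpha>' \<beta>' * monom_fun \<alpha>' \<beta>' z)"
  by simp
  then show ?thesis unfolding bihomogeneous_polys_alt mem_Collect_eq by (intro exI[of _ ?c])
qed

lemma bihomogeneous_polys_zero: "(\<lambda>_. 0) \<in> bihomogeneous_polys m n"
  unfolding bihomogeneous_polys_alt mem_Collect_eq by (intro exI[of _ "\<lambda>_ _. 0"]) simp

lemma bihomogeneous_polys_sum:
  "(\<And>i. i \<in> I ==> f i \<in> bihomogeneous_polys m n) ==> (\<lambda>z. \<Sum>i\<in>I. f i z) \<in> bihomogeneous_polys m n"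
  by (induction I rule: infinite_finite_induct) (auto intro: bihomogeneous_polys_zero bihomogeneous_polys_add)

lemma bihomogeneous_polys_bipoly: "bihomogeneous_polys m n = {f. bipoly m n f}"
proof (intro equalityI subsetI)
  fix f :: "complex^'d => complex" assume "f \<in> bihomogeneous_polys m n"
  then obtain c where f: "f = (\<lambda>z. \<Sum>\<alpha> | sum \<alpha> UNIV = m. \<Sum>\<beta> | sum \<beta> UNIV = n. c \<alpha> \<beta> * monom_fun \<alpha> \<beta> z)"
  unfolding bihomogeneous_polys_alt by blast
  have "bipoly m n f" unfolding f by (intro bipoly_sum bipoly_scale) (use bipoly_mono in blast)
  then show "f \<in> {f. bipoly m n f}" by simp
next
  fix f :: "complex^'d => complex" assume "f \<in> {f. bipoly m n f}"
  then have "bipoly m n f" by simp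
  then show "f \<in> bihomogeneous_polys m n"
  proof (induction rule: bipoly.induct)
  case (bipoly_const c)
  show ?case using bihomogeneous_polys_mono[of c "\<lambda>_. 0" "\<lambda>_. 0"] by (simp add: monom_fun_zero)
  next
  case (bipoly_zero m n)
  show ?case by (rule bihomogeneous_polys_zero)
  next
  case (bipoly_add m n f g)
  then show ?case by (intro bihomogeneous_polys_add)
  next
  case (bipoly_z m n f j)
  then obtain c where f: "f = (\<lambda>z. \<Sum>\<alpha> | sum \<alpha> UNIV = m. \<Sum>\<beta> | sum \<beta> UNIV = n. c \<alpha> \<beta> * monom_fun \<alpha> \<beta> z)"
   unfolding bihomogeneous_polys_alt by blast
  have "(\<lambda>z. z $ j * f z) = (\<lambda>z. \<Sum>\<alpha> | sum \<alpha> UNIV = m. \<Sum>\<beta> | sum \<beta> UNIV = n. c \<alpha> \<beta> * monom_fun (\<alpha>(j := Suc (\<alpha> j))) \<beta> z)"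
   unfolding f monom_fun_Suc_left by (simp add: sum_distrib_left mult_ac)
  also have "... \<in> bihomogeneous_polys (Suc m) n"
  proof (intro bihomogeneous_polys_sum)
   fix \<alpha> \<beta> :: "'d => nat" assume "\<alpha> \<in> {\<alpha>. sum \<alpha> UNIV = m}" "\<beta> \<in> {\<beta>. sum \<beta> UNIV = n}"
   then show "(\<lambda>z. c \<alpha> \<beta> * monom_fun (\<alpha>(j := Suc (\<alpha> j))) \<beta> z) \<in> bihomogeneous_polys (Suc m) n"
    using bihomogeneous_polys_mono[of "c \<alpha> \<beta>" "\<alpha>(j := Suc (\<alpha> j))" \<beta>] by (simp only: sum_fun_upd_Suc mem_Collect_eq)
  qed
  finally show ?case .
  next
  case (bipoly_cnj m n f j)
  then obtain c where f: "f = (\<lambda>z. \<Sum>\<alpha> | sum \<alpha> UNIV = m. \<Sum>\<beta> | sum \<beta> UNIV = n. c \<alpha> \<beta> * monom_fun \<alpha> \<beta> z)"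
   unfolding bihomogeneous_polys_alt by blast
  have "(\<lambda>z. cnj (z $ j) * f z) = (\<lambda>z. \<Sum>\<alpha> | sum \<alpha> UNIV = m. \<Sum>\<beta> | sum \<beta> UNIV = n. c \<alpha> \<beta> * monom_fun \<alpha> (\<beta>(j := Suc (\<beta> j))) z)"
   unfolding f monom_fun_Suc_right by (simp add: sum_distrib_left mult_ac)
  also have "... \<in> bihomogeneous_polys m (Suc n)"
  proof (intro bihomogeneous_polys_sum)
   fix \<alpha> \<beta> :: "'d => nat" assume "\<alpha> \<in> {\<alpha>. sum \<alpha> UNIV = m}" "\<beta> \<in> {\<beta>. sum \<beta> UNIV = n}"
   then show "(\<lambda>z. c \<alpha> \<beta> * monom_fun \<alpha> (\<beta>(j := Suc (\<beta> j))) z) \<in> bihomogeneous_polys m (Suc n)"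
    using bihomogeneous_polys_mono[of "c \<alpha> \<beta>" \<alpha> "\<beta>(j := Suc (\<beta> j))"] by (simp only: sum_fun_upd_Suc mem_Collect_eq)
  qed
  finally show ?case .
  qed
qed

definition on_sphere :: "'d::finite cfun => 'd cfun" where
  "on_sphere f = (\<lambda>z. if z \<in> sphere 0 1 then f z else 0)"

lemma sphere_harmonics_harmpoly: "sphere_harmonics m n = on_sphere ` {f. harmpoly m n f}"
  unfolding sphere_harmonics_def bihomogeneous_polys_bipoly harmpoly_def on_sphere_def
  by (auto simp: complex_laplacian_Lap fun_eq_iff)

section \<open>Reduction modulo the squared norm\<close>

definition reduced_exponents :: "'d => nat => nat => (('d::finite => nat) \<times> ('d => nat)) set" where
  "reduced_exponents k m n = {(\<alpha>, \<beta>). sum \<alpha> UNIV = m \<and> sum \<beta> UNIV = n \<and> (\<alpha> k = 0 \<or> \<beta> k = 0)}"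

text \<open>The possible cofactors of \<open>nsq\<close> in bidegree \<open>(m, n)\<close>. The case
  distinction prevents the truncated subtraction from admitting cofactors when \<open>m\<close> or
  \<open>n\<close> is zero.\<close>
definition lower_bipoly :: "nat => nat => 'd::finite cfun => bool" where
  "lower_bipoly m n g \<longleftrightarrow> (if m = 0 \<or> n = 0 then g = (\<lambda>_. 0) else bipoly (m - 1) (n - 1) g)"

lemma lower_bipoly_zero: "lower_bipoly m n (\<lambda>_. 0)" by (simp add: lower_bipoly_def bipoly_zero)

lemma lower_bipoly_add: "lower_bipoly m n f ==> lower_bipoly m n g ==> lower_bipoly m n (\<lambda>z. f z + g z)"
  by (auto simp: lower_bipoly_def intro: bipoly_add split: if_splits)

lemma lower_bipoly_scale: "lower_bipoly m n f ==> lower_bipoly m n (\<lambda>z. c * f z)"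
  by (auto simp: lower_bipoly_def intro: bipoly_scale split: if_splits)

lemma lower_bipoly_z: "lower_bipoly m n f ==> lower_bipoly (Suc m) n (\<lambda>z. z $ j * f z)"
  using bipoly_z[of "m - 1" "n - 1" f j] by (cases m) (auto simp: lower_bipoly_def bipoly_zero split: if_splits)

lemma lower_bipoly_cnj: "lower_bipoly m n f ==> lower_bipoly m (Suc n) (\<lambda>z. cnj (z $ j) * f z)"
  using bipoly_cnj[of "m - 1" "n - 1" f j] by (cases n) (auto simp: lower_bipoly_def bipoly_zero split: if_splits)

lemma finite_reduced_exponents: "finite (reduced_exponents k m n)"
  by (rule finite_subset[of _ "{\<alpha>. sum \<alpha> UNIV = m} \<times> {\<beta>. sum \<beta> UNIV = n}"])
  (auto simp: reduced_exponents_def finite_exponents)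

definition reducible_to :: "'d => nat => nat => 'd::finite cfun => bool" where
  "reducible_to k m n f \<longleftrightarrow> (\<exists>c g. lower_bipoly m n g \<and>
  f = (\<lambda>z. (\<Sum>p\<in>reduced_exponents k m n. c p * monom_fun (fst p) (snd p) z) + nsq z * g z))"

lemma reducible_toI: "lower_bipoly m n g ==>
  (\<And>z. f z = (\<Sum>p\<in>reduced_exponents k m n. c p * monom_fun (fst p) (snd p) z) + nsq z * g z) ==> reducible_to k m n f"
  unfolding reducible_to_def by blast

lemma reducible_to_lower: "lower_bipoly m n g ==> reducible_to k m n (\<lambda>z. nsq z * g z)"
  by (rule reducible_toI[where c = "\<lambda>_. 0"]) auto

lemma reducible_to_zero: "reducible_to k m n (\<lambda>z. 0)"
  using reducible_to_lower[OF lower_bipoly_zero] by simp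

lemma reducible_to_add:
  assumes "reducible_to k m n f" "reducible_to k m n f'" shows "reducible_to k m n (\<lambda>z. f z + f' z)"
proof -
  obtain c g where 1: "lower_bipoly m n g"
  "f = (\<lambda>z. (\<Sum>p\<in>reduced_exponents k m n. c p * monom_fun (fst p) (snd p) z) + nsq z * g z)"
  using assms(1) unfolding reducible_to_def by blast
  obtain c' g' where 2: "lower_bipoly m n g'"
  "f' = (\<lambda>z. (\<Sum>p\<in>reduced_exponents k m n. c' p * monom_fun (fst p) (snd p) z) + nsq z * g' z)"
  using assms(2) unfolding reducible_to_def by blast
  show ?thesis by (rule reducible_toI[OF lower_bipoly_add[OF 1(1) 2(1)], where c = "\<lambda>p. c p + c' p"])
   (simp add: 1(2) 2(2) sum.distrib distrib_right distrib_left)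
qed

lemma reducible_to_scale:
  assumes "reducible_to k m n f" shows "reducible_to k m n (\<lambda>z. a * f z)"
proof -
  obtain c g where 1: "lower_bipoly m n g"
  "f = (\<lambda>z. (\<Sum>p\<in>reduced_exponents k m n. c p * monom_fun (fst p) (snd p) z) + nsq z * g z)"
  using assms(1) unfolding reducible_to_def by blast
  show ?thesis by (rule reducible_toI[OF lower_bipoly_scale[OF 1(1), of a], where c = "\<lambda>p. a * c p"])
   (simp add: 1(2) sum_distrib_left distrib_left mult_ac)
qed

lemma reducible_to_sum:
  "(\<And>i. i \<in> I ==> reducible_to k m n (f i)) ==> reducible_to k m n (\<lambda>z. \<Sum>i\<in>I. f i z)"
  by (induction I rule: infinite_finite_induct) (auto intro: reducible_to_zero reducible_to_add)

text \<open>Modulo \<open>nsq\<close> the product \<open>z k * cnj (z k)\<close> is minus the sum of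
  the other products, so every monomial reduces to monomials that do not contain both \<open>z
  k\<close> and its conjugate. Counting these gives the sharp dimension bound.\<close>
lemma reducible_to_mono:
  fixes \<alpha> \<beta> :: "'d::finite => nat"
  shows "reducible_to k (sum \<alpha> UNIV) (sum \<beta> UNIV) (monom_fun \<alpha> \<beta>)"
proof (induction "\<alpha> k" arbitrary: \<alpha> \<beta> rule: less_induct)
  case less
  show ?case
  proof (cases "\<alpha> k = 0 \<or> \<beta> k = 0")
  case True
  then have in_red: "(\<alpha>, \<beta>) \<in> reduced_exponents k (sum \<alpha> UNIV) (sum \<beta> UNIV)" by (auto simp: reduced_exponents_def)
  show ?thesis
  proof (rule reducible_toI[OF lower_bipoly_zero, where c = "\<lambda>p. if p = (\<alpha>, \<beta>) then 1 else 0"])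
   fix z
   have "(\<Sum>p\<in>reduced_exponents k (sum \<alpha> UNIV) (sum \<beta> UNIV). (if p = (\<alpha>, \<beta>) then 1 else 0) * monom_fun (fst p) (snd p) z)
    = (\<Sum>p\<in>reduced_exponents k (sum \<alpha> UNIV) (sum \<beta> UNIV). if p = (\<alpha>, \<beta>) then monom_fun \<alpha> \<beta> z else 0)"
    by (rule sum.cong) auto
   then show "monom_fun \<alpha> \<beta> z = (\<Sum>p\<in>reduced_exponents k (sum \<alpha> UNIV) (sum \<beta> UNIV).
     (if p = (\<alpha>, \<beta>) then 1 else 0) * monom_fun (fst p) (snd p) z) + nsq z * 0"
    using in_red by (simp add: sum.delta[OF finite_reduced_exponents])
  qed
  next
  case False
  then obtain \<alpha>' where a: "\<alpha> = \<alpha>'(k := Suc (\<alpha>' k))" "sum \<alpha> UNIV = Suc (sum \<alpha>' UNIV)"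
   using exponent_decrease[of \<alpha> k] by blast
  obtain \<beta>' where b: "\<beta> = \<beta>'(k := Suc (\<beta>' k))" "sum \<beta> UNIV = Suc (sum \<beta>' UNIV)"
   using exponent_decrease[of \<beta> k] False by blast
  have low: "lower_bipoly (sum \<alpha> UNIV) (sum \<beta> UNIV) (monom_fun \<alpha>' \<beta>')"
   unfolding lower_bipoly_def a(2) b(2) using bipoly_mono[of \<alpha>' \<beta>'] by simp
  have "reducible_to k (sum \<alpha> UNIV) (sum \<beta> UNIV) (\<lambda>z. (-1) * monom_fun (\<alpha>'(j := Suc (\<alpha>' j))) (\<beta>'(j := Suc (\<beta>' j))) z)"
   if "j ~= k" for j
  proof -
   have "(\<alpha>'(j := Suc (\<alpha>' j))) k < \<alpha> k" using that unfolding a(1) by simp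
   from less[of "\<alpha>'(j := Suc (\<alpha>' j))" "\<beta>'(j := Suc (\<beta>' j))", OF this] show ?thesis
    unfolding sum_fun_upd_Suc a(2) b(2) by (rule reducible_to_scale)
  qed
  then have "reducible_to k (sum \<alpha> UNIV) (sum \<beta> UNIV)
    (\<lambda>z. nsq z * monom_fun \<alpha>' \<beta>' z + (\<Sum>j\<in>UNIV - {k}. (-1) * monom_fun (\<alpha>'(j := Suc (\<alpha>' j))) (\<beta>'(j := Suc (\<beta>' j))) z))"
   by (intro reducible_to_add reducible_to_lower low reducible_to_sum) auto
  moreover have "(\<lambda>z. nsq z * monom_fun \<alpha>' \<beta>' z + (\<Sum>j\<in>UNIV - {k}. (-1) * monom_fun (\<alpha>'(j := Suc (\<alpha>' j))) (\<beta>'(j := Suc (\<beta>' j))) z))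
   = monom_fun \<alpha> \<beta>"
  proof
   fix z :: "complex^'d"
   have m: "monom_fun (\<alpha>'(j := Suc (\<alpha>' j))) (\<beta>'(j := Suc (\<beta>' j))) z = z $ j * cnj (z $ j) * monom_fun \<alpha>' \<beta>' z" for j
    by (simp only: monom_fun_Suc_left monom_fun_Suc_right mult_ac)
   have "nsq z = z $ k * cnj (z $ k) + (\<Sum>j\<in>UNIV - {k}. z $ j * cnj (z $ j))"
    unfolding nsq_def by (subst sum.remove[of _ k]) auto
   moreover have "monom_fun \<alpha> \<beta> z = z $ k * cnj (z $ k) * monom_fun \<alpha>' \<beta>' z"
    using m[of k] unfolding a(1)[symmetric] b(1)[symmetric] .
   moreover have "(\<Sum>j\<in>UNIV - {k}. (-1) * (z $ j * cnj (z $ j) * monom_fun \<alpha>' \<beta>' z))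
     = - ((\<Sum>j\<in>UNIV - {k}. z $ j * cnj (z $ j)) * monom_fun \<alpha>' \<beta>' z)"
    by (simp add: sum_distrib_right sum_negf)
   ultimately show "nsq z * monom_fun \<alpha>' \<beta>' z + (\<Sum>j\<in>UNIV - {k}. (-1) * monom_fun (\<alpha>'(j := Suc (\<alpha>' j))) (\<beta>'(j := Suc (\<beta>' j))) z)
   = monom_fun \<alpha> \<beta> z" unfolding m by (simp only:) (simp add: algebra_simps)
  qed
  ultimately show ?thesis by simp
  qed
qed

lemma reducible_bipoly: "bipoly m n f ==> reducible_to k m n f"
proof (induction rule: bipoly.induct)
  case (bipoly_const c)
  have "reducible_to k 0 0 (\<lambda>z. c * monom_fun (\<lambda>_. 0) (\<lambda>_. 0) z)"
  using reducible_to_scale[OF reducible_to_mono[of k "\<lambda>_. 0" "\<lambda>_. 0"], of c] by simp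
  then show ?case by (simp add: monom_fun_zero)
next
  case (bipoly_z m n f j)
  then obtain c g where g: "lower_bipoly m n g"
  "f = (\<lambda>z. (\<Sum>p\<in>reduced_exponents k m n. c p * monom_fun (fst p) (snd p) z) + nsq z * g z)"
  unfolding reducible_to_def by blast
  have eq: "(\<lambda>z. z $ j * f z) = (\<lambda>z. (\<Sum>p\<in>reduced_exponents k m n. c p * monom_fun ((fst p)(j := Suc (fst p j))) (snd p) z)
   + nsq z * (z $ j * g z))"
  unfolding monom_fun_Suc_left g(2) by (simp add: sum_distrib_left distrib_left mult_ac)
  show ?case unfolding eq
  proof (intro reducible_to_add reducible_to_sum reducible_to_scale reducible_to_lower lower_bipoly_z g(1))
  fix p assume "p \<in> reduced_exponents k m n"
  then show "reducible_to k (Suc m) n (monom_fun ((fst p)(j := Suc (fst p j))) (snd p))"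
   using reducible_to_mono[of k "(fst p)(j := Suc (fst p j))" "snd p"]
   unfolding sum_fun_upd_Suc by (auto simp: reduced_exponents_def)
  qed
next
  case (bipoly_cnj m n f j)
  then obtain c g where g: "lower_bipoly m n g"
  "f = (\<lambda>z. (\<Sum>p\<in>reduced_exponents k m n. c p * monom_fun (fst p) (snd p) z) + nsq z * g z)"
  unfolding reducible_to_def by blast
  have eq: "(\<lambda>z. cnj (z $ j) * f z) = (\<lambda>z. (\<Sum>p\<in>reduced_exponents k m n. c p * monom_fun (fst p) ((snd p)(j := Suc (snd p j))) z)
   + nsq z * (cnj (z $ j) * g z))"
  unfolding monom_fun_Suc_right g(2) by (simp add: sum_distrib_left distrib_left mult_ac)
  show ?case unfolding eq
  proof (intro reducible_to_add reducible_to_sum reducible_to_scale reducible_to_lower lower_bipoly_cnj g(1))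
  fix p assume "p \<in> reduced_exponents k m n"
  then show "reducible_to k m (Suc n) (monom_fun (fst p) ((snd p)(j := Suc (snd p j))))"
   using reducible_to_mono[of k "fst p" "(snd p)(j := Suc (snd p j))"]
   unfolding sum_fun_upd_Suc by (auto simp: reduced_exponents_def)
  qed
qed (auto intro: reducible_to_zero reducible_to_add)

section \<open>Orthonormal families\<close>

definition orthonormal :: "'d::finite cfun set => bool" where
  "orthonormal E \<longleftrightarrow> (\<forall>e\<in>E. \<forall>e'\<in>E. ip e e' = (if e = e' then 1 else 0))"

text \<open>Expansions are required on the sphere only, where functions are identified; a function
  whose remainder vanishes there adds nothing to the family.\<close>
lemma gram_schmidt:
  fixes V :: "'d::finite cfun => bool"
  assumes cont: "\<And>f. V f ==> continuous_on UNIV f"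
  and add: "\<And>f g. V f ==> V g ==> V (\<lambda>z. f z + g z)"
  and scale: "\<And>c f. V f ==> V (\<lambda>z. c * f z)"
  and E0: "finite E0" "orthonormal E0" "\<And>e. e \<in> E0 ==> V e"
  and F: "finite F" "\<And>f. f \<in> F ==> V f"
  shows "\<exists>E. E0 \<subseteq> E \<and> finite E \<and> card E <= card E0 + card F \<and> (\<forall>e\<in>E. V e) \<and> orthonormal E \<and>
  (\<forall>f\<in>F. \<forall>z. norm z = 1 --> f z = (\<Sum>e\<in>E. ip f e * e z))" using F
proof (induction F rule: finite_induct)
  case empty
  then show ?case using E0 by (intro exI[of _ E0]) auto
next
  case (insert f F)
  then obtain E where E: "E0 \<subseteq> E" "finite E" "card E <= card E0 + card F" "\<And>e. e \<in> E ==> V e" "orthonormal E"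
  "\<And>f z. f \<in> F ==> norm z = 1 ==> f z = (\<Sum>e\<in>E. ip f e * e z)" by auto
  have Vf: "V f" using insert.prems by simp
  have Vs: "V (\<lambda>z. c0 * f z + (\<Sum>e\<in>B. c e * e z))" if "finite B" "B \<subseteq> E" for B c0 and c :: "_ => complex"
  using that
  proof (induction B rule: finite_induct)
  case empty
  then show ?case using scale[OF Vf, of c0] by simp
  next
  case (insert b B)
  have "V (\<lambda>z. (c0 * f z + (\<Sum>e\<in>B. c e * e z)) + c b * b z)"
   using insert by (intro add[OF _ scale[OF E(4)]]) auto
  moreover have "(\<lambda>z. (c0 * f z + (\<Sum>e\<in>B. c e * e z)) + c b * b z) = (\<lambda>z. c0 * f z + (\<Sum>e\<in>insert b B. c e * e z))"
   using insert by (simp add: fun_eq_iff)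
  ultimately show ?case by simp
  qed
  define res where "res = (\<lambda>z. 1 * f z + (\<Sum>e\<in>E. (- ip f e) * e z))"
  have Vres: "V res" unfolding res_def by (rule Vs[OF E(2)]) simp
  have cE: "continuous_on UNIV e" if "e \<in> E" for e by (rule cont[OF E(4)[OF that]])
  have fres: "f z = res z + (\<Sum>e\<in>E. ip f e * e z)" for z by (simp add: res_def sum_negf)
  have orth: "ip res e = 0" if e: "e \<in> E" for e
  proof -
  have "ip res e = ip (\<lambda>z. 1 * f z) e + ip (\<lambda>z. \<Sum>e\<in>E. (- ip f e) * e z) e"
   unfolding res_def by (intro ip_add_left continuous_intros cont[OF Vf] cE e)
  also have "ip (\<lambda>z. \<Sum>e\<in>E. (- ip f e) * e z) e = (\<Sum>e'\<in>E. ip (\<lambda>z. (- ip f e') * e' z) e)"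
   by (intro ip_sum_left continuous_intros cE e)
  also have "... = (\<Sum>e'\<in>E. if e' = e then - ip f e else 0)"
  proof (rule sum.cong[OF refl])
   fix e' assume "e' \<in> E"
   then show "ip (\<lambda>z. (- ip f e') * e' z) e = (if e' = e then - ip f e else 0)"
    unfolding ip_scale_left using E(5) e by (auto simp: orthonormal_def)
  qed
  also have "... = - ip f e" using e E(2) by simp
  finally show ?thesis by simp
  qed
  show ?case
  proof (cases "ip res res = 0")
  case True
  have "f z = (\<Sum>e\<in>E. ip f e * e z)" if "norm z = 1" for z
   using ip_self_zero[OF cont[OF Vres] True that] fres[of z] by simp
  then show ?thesis using E insert.hyps by (intro exI[of _ E]) auto
  next
  case False
  define q where "q = spint (\<lambda>z. (norm (res z))\<^sup>2)"
  have iq: "ip res res = of_real q" by (simp add: ip_self q_def)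
  have "q >= 0" unfolding q_def by simp
  then have q: "q > 0" using False iq by (cases "q = 0") auto
  define c where "c = complex_of_real (sqrt q)"
  have c: "c ~= 0" "cnj c = c" "c * c = of_real q" using q by (auto simp: c_def of_real_mult[symmetric] simp del: of_real_mult)
  define e' where "e' = (\<lambda>z. (1 / c) * res z)"
  have Ve': "V e'" unfolding e'_def by (rule scale[OF Vres])
  have orth': "ip e' e = 0" "ip e e' = 0" if "e \<in> E" for e
  proof -
   have "ip e' e = (1 / c) * ip res e" unfolding e'_def by (rule ip_scale_left)
   then show "ip e' e = 0" using orth[OF that] by simp
   then show "ip e e' = 0" using ip_cnj[of e e'] by simp
  qed
  have self: "ip e' e' = 1"
   unfolding e'_def ip_scale_left ip_scale_right iq using c q by (simp add: field_simps)
  have notin: "e' \<notin> E" using orth'(1)[of e'] self by auto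
  have on: "orthonormal (insert e' E)" using E(5) orth' self notin unfolding orthonormal_def by auto
  have old: "g z = (\<Sum>e\<in>insert e' E. ip g e * e z)" if g: "g \<in> F" and z: "norm z = 1" for g z
  proof -
   have "ip g e' = ip (\<lambda>z. \<Sum>e\<in>E. ip g e * e z) e'" by (rule ip_cong) (use E(6)[OF g] in auto)
   also have "... = (\<Sum>e\<in>E. ip (\<lambda>z. ip g e * e z) e')"
    by (intro ip_sum_left continuous_intros cE cont[OF Ve'])
   also have "... = 0" using orth' by (simp add: ip_scale_left)
   finally have "ip g e' = 0" .
   then show ?thesis using E(6)[OF g z] notin E(2) by simp
  qed
  have new: "f z = (\<Sum>e\<in>insert e' E. ip f e * e z)" for z
  proof -
   have "ip f e' = ip (\<lambda>z. res z + (\<Sum>e\<in>E. ip f e * e z)) e'"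
    by (rule ip_cong) (rule fres, rule refl)
   also have "... = ip res e' + ip (\<lambda>z. \<Sum>e\<in>E. ip f e * e z) e'"
    by (intro ip_add_left continuous_intros cont[OF Vres] cE cont[OF Ve'])
   also have "ip (\<lambda>z. \<Sum>e\<in>E. ip f e * e z) e' = (\<Sum>e\<in>E. ip (\<lambda>z. ip f e * e z) e')"
    by (intro ip_sum_left continuous_intros cE cont[OF Ve'])
   also have "... = 0" using orth' by (simp add: ip_scale_left)
   also have "ip res e' + 0 = c" unfolding e'_def ip_scale_right iq using c q by (simp add: field_simps)
   finally have "ip f e' * e' z = res z" using c by (simp add: e'_def)
   then show ?thesis using fres[of z] notin E(2) by simp
  qed
  show ?thesis
  proof (intro exI[of _ "insert e' E"] conjI ballI allI impI)
   show "card (insert e' E) <= card E0 + card (insert f F)" using E(2,3) notin insert.hyps by simp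
   show "g z = (\<Sum>e\<in>insert e' E. ip g e * e z)" if "g \<in> insert f F" "norm z = 1" for g z
    using that old new by blast
  qed (use E on Ve' in auto)
  qed
qed

section \<open>Orthonormal bases of spherical harmonics\<close>

lemma harmonic_split:
  assumes "bipoly m n f"
  shows "\<exists>h g. harmpoly m n h \<and> lower_bipoly m n g \<and> f = (\<lambda>z. h z + nsq z * g z)"
proof -
  obtain h where h: "\<And>i. i <= min m n ==> harmpoly (m - i) (n - i) (h i)"
  and f: "f = (\<lambda>z. \<Sum>i\<le>min m n. nsq z ^ i * h i z)"
  using harmonic_decomposition[OF assms] by blast
  show ?thesis
  proof (cases "min m n")
  case 0
  then show ?thesis using h[of 0] f
   by (intro exI[of _ "h 0"] exI[of _ "\<lambda>_. 0"]) (simp add: lower_bipoly_zero)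
  next
  case (Suc k)
  let ?g = "\<lambda>z. \<Sum>i\<le>k. nsq z ^ i * h (Suc i) z"
  have "bipoly (m - 1) (n - 1) ?g"
  proof (rule bipoly_sum)
   fix i assume "i \<in> {..k}"
   then have i: "Suc i <= min m n" using Suc by simp
   have "bipoly (m - Suc i + i) (n - Suc i + i) (\<lambda>z. nsq z ^ i * h (Suc i) z)"
    by (rule bipoly_nsq_power[OF harmpoly_bipoly[OF h[OF i]]])
   moreover have "m - Suc i + i = m - 1" "n - Suc i + i = n - 1" using i by auto
   ultimately show "bipoly (m - 1) (n - 1) (\<lambda>z. nsq z ^ i * h (Suc i) z)" by simp
  qed
  moreover have "m ~= 0" "n ~= 0" using Suc by auto
  ultimately have "lower_bipoly m n ?g" by (simp add: lower_bipoly_def)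
  moreover have "f = (\<lambda>z. h 0 z + nsq z * ?g z)"
   unfolding f Suc sum.atMost_Suc_shift by (simp add: sum_distrib_left mult.assoc)
  ultimately show ?thesis using h[of 0] by (intro exI[of _ "h 0"] exI[of _ ?g]) simp
  qed
qed

lemma lower_bipoly_sum: "(\<And>i. i \<in> I ==> lower_bipoly m n (f i)) ==> lower_bipoly m n (\<lambda>z. \<Sum>i\<in>I. f i z)"
  by (induction I rule: infinite_finite_induct) (auto intro: lower_bipoly_zero lower_bipoly_add)

lemma harmpoly_orthogonal_lower:
  assumes f: "harmpoly m n f" and g: "lower_bipoly m n g"
  shows "ip f g = 0"
proof (cases "m = 0 \<or> n = 0")
  case True
  then show ?thesis using g by (simp add: lower_bipoly_def ip_def)
next
  case False
  then have b: "bipoly (m - 1) (n - 1) g" using g by (simp add: lower_bipoly_def)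
  obtain h where h: "\<And>i. i <= min (m - 1) (n - 1) ==> harmpoly (m - 1 - i) (n - 1 - i) (h i)"
  and g': "g = (\<lambda>z. \<Sum>i\<le>min (m - 1) (n - 1). nsq z ^ i * h i z)"
  using harmonic_decomposition[OF b] by blast
  have "ip f g = ip f (\<lambda>z. \<Sum>i\<le>min (m - 1) (n - 1). h i z)" by (rule ip_cong) (simp_all add: g')
  also have "... = (\<Sum>i\<le>min (m - 1) (n - 1). ip f (h i))"
  by (intro ip_sum_right harmpoly_continuous[OF f]) (use h in \<open>auto intro: harmpoly_continuous\<close>)
  also have "... = 0"
  proof (intro sum.neutral ballI)
  fix i assume "i \<in> {..min (m - 1) (n - 1)}"
  then show "ip f (h i) = 0" by (intro harmpoly_orthogonal[OF f h]) (use False in auto)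
  qed
  finally show ?thesis .
qed

definition basis_of_harmonics :: "nat => nat => 'd::finite cfun set => bool" where
  "basis_of_harmonics m n E \<longleftrightarrow> finite E \<and> (\<forall>e\<in>E. harmpoly m n e) \<and> orthonormal E \<and>
  (\<forall>f. harmpoly m n f --> (\<forall>z. norm z = 1 --> f z = (\<Sum>e\<in>E. ip f e * e z)))"

lemma harmonic_basis_exists:
  "\<exists>E :: 'd::finite cfun set. basis_of_harmonics m n E \<and> card E <= card (reduced_exponents (k::'d) m n)"
proof -
  let ?R = "reduced_exponents k m n"
  let ?m = "\<lambda>p. monom_fun (fst p) (snd p) :: 'd cfun"
  have mb: "bipoly m n (?m p)" if "p \<in> ?R" for p
  using that bipoly_mono by (auto simp: reduced_exponents_def)
  have "\<forall>p\<in>?R. \<exists>hg. harmpoly m n (fst hg) \<and> lower_bipoly m n (snd hg) \<and> ?m p = (\<lambda>z. fst hg z + nsq z * snd hg z)"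
  proof
  fix p assume "p \<in> ?R"
  from harmonic_split[OF mb[OF this]] obtain h g where
   "harmpoly m n h" "lower_bipoly m n g" "?m p = (\<lambda>z. h z + nsq z * g z)" by (elim exE conjE)
  then show "\<exists>hg. harmpoly m n (fst hg) \<and> lower_bipoly m n (snd hg) \<and> ?m p = (\<lambda>z. fst hg z + nsq z * snd hg z)"
   by (intro exI[of _ "(h, g)"]) simp
  qed
  from bchoice[OF this] obtain hg where hg: "\<And>p. p \<in> ?R ==> harmpoly m n (fst (hg p))"
  "\<And>p. p \<in> ?R ==> lower_bipoly m n (snd (hg p))"
  "\<And>p. p \<in> ?R ==> ?m p = (\<lambda>z. fst (hg p) z + nsq z * snd (hg p) z)" by blast
  define F where "F = (\<lambda>p. fst (hg p)) ` ?R"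
  have fF: "finite F" unfolding F_def by (rule finite_imageI[OF finite_reduced_exponents])
  have F: "\<And>f. f \<in> F ==> harmpoly m n f" using hg(1) unfolding F_def by blast
  have oe: "orthonormal {}" by (simp add: orthonormal_def)
  have "\<exists>E. {} \<subseteq> E \<and> finite E \<and> card E <= card ({} :: 'd cfun set) + card F \<and> (\<forall>e\<in>E. harmpoly m n e)
   \<and> orthonormal E \<and> (\<forall>f\<in>F. \<forall>z. norm z = 1 --> f z = (\<Sum>e\<in>E. ip f e * e z))"
  by (rule gram_schmidt[of "harmpoly m n" "{}" F, OF harmpoly_continuous harmpoly_add harmpoly_scale finite.emptyI oe _ fF F])
   (simp_all only: empty_iff)
  then obtain E where E: "finite E" "card E <= card F" "\<And>e. e \<in> E ==> harmpoly m n e" "orthonormal E"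
  "\<And>f z. f \<in> F ==> norm z = 1 ==> f z = (\<Sum>e\<in>E. ip f e * e z)" by (elim exE conjE) simp
  have "f z = (\<Sum>e\<in>E. ip f e * e z)" if f: "harmpoly m n f" and z: "norm z = 1" for f z
  proof -
  obtain c g where g: "lower_bipoly m n g" "f = (\<lambda>z. (\<Sum>p\<in>?R. c p * ?m p z) + nsq z * g z)"
   using reducible_bipoly[OF harmpoly_bipoly[OF f], of k] unfolding reducible_to_def by blast
  define q where "q = (\<lambda>z. (\<Sum>p\<in>?R. c p * snd (hg p) z) + g z)"
  define D where "D = (\<lambda>z. f z + (\<Sum>p\<in>?R. (- c p) * fst (hg p) z))"
  have q: "lower_bipoly m n q" unfolding q_def
   by (intro lower_bipoly_add lower_bipoly_sum lower_bipoly_scale g(1) hg(2))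
  have D: "harmpoly m n D" unfolding D_def by (intro harmpoly_add f harmpoly_sum harmpoly_scale hg(1))
  have "f z = (\<Sum>p\<in>?R. c p * (fst (hg p) z + nsq z * snd (hg p) z)) + nsq z * g z" for z
  proof -
   have "(\<Sum>p\<in>?R. c p * ?m p z) = (\<Sum>p\<in>?R. c p * (fst (hg p) z + nsq z * snd (hg p) z))"
    by (rule sum.cong[OF refl]) (simp only: hg(3))
   then show ?thesis using g(2) by simp
  qed
  then have Dq: "D z = nsq z * q z" for z
   unfolding D_def q_def by (simp add: sum_negf distrib_left sum.distrib sum_distrib_left mult_ac)
  have "ip D D = ip D q" by (rule ip_cong) (use Dq in auto)
  also have "... = 0" by (rule harmpoly_orthogonal_lower[OF D q])
  finally have D0: "D z = 0" if "norm z = 1" for z using ip_self_zero[OF harmpoly_continuous[OF D] _ that] by blast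
  have fsum: "f z = (\<Sum>p\<in>?R. c p * fst (hg p) z)" if "norm z = 1" for z
   using D0[OF that] unfolding D_def by (simp add: sum_negf)
  have ipf: "ip f e = (\<Sum>p\<in>?R. c p * ip (fst (hg p)) e)" if e: "e \<in> E" for e
  proof -
   have "ip f e = ip (\<lambda>z. \<Sum>p\<in>?R. c p * fst (hg p) z) e" by (rule ip_cong) (use fsum in auto)
   also have "... = (\<Sum>p\<in>?R. ip (\<lambda>z. c p * fst (hg p) z) e)"
    by (intro ip_sum_left continuous_intros harmpoly_continuous[OF hg(1)] harmpoly_continuous[OF E(3)[OF e]])
   finally show ?thesis by (simp add: ip_scale_left)
  qed
  have "f z = (\<Sum>p\<in>?R. c p * (\<Sum>e\<in>E. ip (fst (hg p)) e * e z))"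
   unfolding fsum[OF z] by (intro sum.cong refl arg_cong2[where f = "(*)"] E(5) z) (auto simp: F_def)
  also have "... = (\<Sum>e\<in>E. (\<Sum>p\<in>?R. c p * ip (fst (hg p)) e) * e z)"
   by (simp add: sum_distrib_left sum_distrib_right mult.assoc) (rule sum.swap)
  also have "... = (\<Sum>e\<in>E. ip f e * e z)" by (intro sum.cong refl) (simp add: ipf)
  finally show ?thesis .
  qed
  then have "basis_of_harmonics m n E" using E by (simp add: basis_of_harmonics_def)
  moreover have "card E <= card ?R" using E(2) card_image_le[OF finite_reduced_exponents, of "\<lambda>p. fst (hg p)" k m n]
  unfolding F_def by linarith
  ultimately show ?thesis by blast
qed

section \<open>Counting exponents\<close>

definition exponents_on :: "'a set => nat => ('a => nat) set" where
  "exponents_on A l = {f. (\<forall>a. a \<notin> A --> f a = 0) \<and> sum f A = l}"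

lemma exponents_on_empty: "exponents_on {} l = (if l = 0 then {\<lambda>_. 0} else {})"
  by (auto simp: exponents_on_def)

lemma exponents_on_insert:
  assumes "finite A" "a \<notin> A"
  shows "exponents_on (insert a A) l = (\<Union>i\<le>l. (\<lambda>f. f(a := l - i)) ` exponents_on A i)"
proof (intro equalityI subsetI)
  fix f assume f: "f \<in> exponents_on (insert a A) l"
  then have s: "f a + sum f A = l" using assms by (simp add: exponents_on_def)
  have "sum (f(a := 0)) A = sum f A" using assms by (intro sum.cong) auto
  then have "f(a := 0) \<in> exponents_on A (sum f A)" using f assms by (auto simp: exponents_on_def)
  moreover have "f = (f(a := 0))(a := l - sum f A)" using s by (auto simp: fun_eq_iff)
  ultimately show "f \<in> (\<Union>i\<le>l. (\<lambda>f. f(a := l - i)) ` exponents_on A i)"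
  using s by (intro UN_I[of "sum f A"] image_eqI[of _ _ "f(a := 0)"]) auto
next
  fix f assume "f \<in> (\<Union>i\<le>l. (\<lambda>f. f(a := l - i)) ` exponents_on A i)"
  then obtain i g where i: "i <= l" "g \<in> exponents_on A i" "f = g(a := l - i)" by blast
  have "sum f A = sum g A" using assms i(3) by (intro sum.cong) auto
  then show "f \<in> exponents_on (insert a A) l" using i assms by (auto simp: exponents_on_def)
qed

lemma card_exponents_on:
  assumes "finite A"
  shows "finite (exponents_on A l) \<and> card (exponents_on A l) <= (card A + l - 1) choose l" using assms
proof (induction A arbitrary: l rule: finite_induct)
  case empty
  then show ?case by (cases l) (auto simp: exponents_on_empty)
next
  case (insert a A)
  have fin: "finite (exponents_on (insert a A) l)"
  unfolding exponents_on_insert[OF insert(1,2)] using insert.IH by auto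
  have "card (exponents_on (insert a A) l) <= (\<Sum>i\<le>l. card ((\<lambda>f. f(a := l - i)) ` exponents_on A i))"
  unfolding exponents_on_insert[OF insert(1,2)] by (rule card_UN_le) simp
  also have "... <= (\<Sum>i\<le>l. (card A + i - 1) choose i)"
  using insert.IH by (intro sum_mono) (meson card_image_le order_trans)
  also have "... = (card A + l) choose l"
  proof (cases "card A")
  case 0
  have "(\<Sum>i\<le>l. (i - 1) choose i) = (\<Sum>i\<le>l. if i = 0 then 1 else 0)"
   by (rule sum.cong) (auto simp: binomial_eq_0)
  then show ?thesis using 0 by simp
  next
  case (Suc n)
  then show ?thesis using sum_choose_lower[of n l] by simp
  qed
  finally show ?case using fin insert by simp
qed

lemma card_reduced_exponents_level:
  "(\<Sum>m\<le>l. card (reduced_exponents (k::'d::finite) m (l - m))) <= 2 * ((l + 2 * CARD('d) - 2) choose l)"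
proof -
  define J :: "('d => nat) \<times> ('d => nat) => 'd + 'd => nat" where
  "J = (\<lambda>p. case_sum (fst p) (snd p))"
  have inj: "inj J"
  proof (rule injI)
  fix p q assume "J p = J q"
  then have "J p (Inl a) = J q (Inl a)" "J p (Inr a) = J q (Inr a)" for a by simp_all
  then show "p = q" by (auto simp: J_def prod_eq_iff fun_eq_iff)
  qed
  have sumJ: "sum (J p) UNIV = sum (fst p) UNIV + sum (snd p) UNIV" for p
  unfolding UNIV_Plus_UNIV[symmetric] by (subst sum.Plus) (simp_all add: J_def)
  let ?W = "exponents_on (UNIV - {Inl k :: 'd + 'd}) l \<union> exponents_on (UNIV - {Inr k :: 'd + 'd}) l"
  let ?U = "\<Union>m\<le>l. reduced_exponents k m (l - m)"
  have sub: "J ` ?U \<subseteq> ?W"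
  proof
  fix f assume "f \<in> J ` ?U"
  then obtain p m where p: "m <= l" "p \<in> reduced_exponents k m (l - m)" "f = J p" by blast
  have tot: "sum f UNIV = l" using p by (auto simp: sumJ reduced_exponents_def)
  have "f (Inl k) = 0 \<or> f (Inr k) = 0" using p(2,3) by (auto simp: J_def reduced_exponents_def)
  then show "f \<in> ?W"
  proof
   assume z: "f (Inl k) = 0"
   have "sum f (UNIV - {Inl k}) = l" using tot z by (simp add: sum.remove[of UNIV "Inl k" f])
   then show ?thesis using z by (auto simp: exponents_on_def)
  next
   assume z: "f (Inr k) = 0"
   have "sum f (UNIV - {Inr k}) = l" using tot z by (simp add: sum.remove[of UNIV "Inr k" f])
   then show ?thesis using z by (auto simp: exponents_on_def)
  qed
  qed
  have cW: "finite (exponents_on (UNIV - {x :: 'd + 'd}) l)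
  \<and> card (exponents_on (UNIV - {x :: 'd + 'd}) l) <= (l + 2 * CARD('d) - 2) choose l" for x
  proof -
  have "card (UNIV - {x :: 'd + 'd}) = 2 * CARD('d) - 1" by (simp add: card_Diff_subset card_UNIV_sum mult_2)
  moreover have "CARD('d) > 0" by simp
  ultimately have "card (UNIV - {x :: 'd + 'd}) + l - 1 = l + 2 * CARD('d) - 2" by linarith
  then show ?thesis using card_exponents_on[of "UNIV - {x :: 'd + 'd}" l] by simp
  qed
  have disj: "disjoint_family_on (\<lambda>m. reduced_exponents k m (l - m)) {..l}"
  unfolding disjoint_family_on_def by (auto simp: reduced_exponents_def)
  have "(\<Sum>m\<le>l. card (reduced_exponents k m (l - m))) = card ?U"
  by (rule card_UN_disjoint[symmetric]) (use disj finite_reduced_exponents in \<open>auto simp: disjoint_family_on_def\<close>)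
  also have "... = card (J ` ?U)" by (rule card_image[symmetric]) (rule inj_on_subset[OF inj], simp)
  also have "... <= card ?W" by (rule card_mono[OF _ sub]) (use cW in blast)
  also have "... <= 2 * ((l + 2 * CARD('d) - 2) choose l)"
  using card_Un_le[of "exponents_on (UNIV - {Inl k :: 'd + 'd}) l" "exponents_on (UNIV - {Inr k :: 'd + 'd}) l"]
   cW[of "Inl k"] cW[of "Inr k"] by linarith
  finally show ?thesis .
qed

definition harmonic_basis :: "nat => nat => 'd::finite cfun set" where
  "harmonic_basis m n = (SOME E. basis_of_harmonics m n E \<and> card E <= card (reduced_exponents (undefined::'d) m n))"

lemma harmonic_basis:
  "basis_of_harmonics m n (harmonic_basis m n :: 'd::finite cfun set)"
  "card (harmonic_basis m n :: 'd cfun set) <= card (reduced_exponents (undefined::'d) m n)"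
  using someI_ex[OF harmonic_basis_exists[where k = "undefined::'d" and m = m and n = n]]
  unfolding harmonic_basis_def by blast+

lemma finite_harmonic_basis: "finite (harmonic_basis m n)"
  and harmonic_basis_harmpoly: "e \<in> harmonic_basis m n ==> harmpoly m n e"
  and harmonic_basis_orthonormal: "orthonormal (harmonic_basis m n)"
  and harmonic_basis_expand: "harmpoly m n f ==> norm z = 1 ==> f z = (\<Sum>e\<in>harmonic_basis m n. ip f e * e z)"
  using harmonic_basis(1)[of m n] unfolding basis_of_harmonics_def by blast+

lemma harmonic_basis_ip:
  assumes "e \<in> harmonic_basis m n" "e' \<in> harmonic_basis m' n'"
  shows "ip e e' = (if e = e' then 1 else 0)"
proof (cases "(m, n) = (m', n')")
  case True
  then show ?thesis using harmonic_basis_orthonormal[of m n] assms by (auto simp: orthonormal_def)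
next
  case False
  then have 0: "ip e e' = 0" using harmpoly_orthogonal harmonic_basis_harmpoly assms by blast
  have "ip e e = 1" using harmonic_basis_orthonormal[of m n] assms by (auto simp: orthonormal_def)
  then show ?thesis using 0 by auto
qed

definition level :: "nat => 'd::finite cfun set" where
  "level l = (\<Union>m\<le>l. harmonic_basis m (l - m))"

lemma finite_level: "finite (level l)" by (simp add: level_def finite_harmonic_basis)

lemma level_ip: "e \<in> level l ==> e' \<in> level l' ==> ip e e' = (if e = e' then 1 else 0)"
  unfolding level_def using harmonic_basis_ip by blast

lemma level_disjoint: "l ~= l' ==> level l \<inter> (level l' :: 'd::finite cfun set) = {}"
proof (rule ccontr)
  assume ne: "l ~= l'" and "level l \<inter> (level l' :: 'd cfun set) ~= {}"
  then obtain e :: "'d cfun" and m m' where e: "m <= l" "m' <= l'" "e \<in> harmonic_basis m (l - m)" "e \<in> harmonic_basis m' (l' - m')"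
  unfolding level_def by blast
  have "ip e e = 0"
  by (rule harmpoly_orthogonal[OF harmonic_basis_harmpoly[OF e(3)] harmonic_basis_harmpoly[OF e(4)]])
   (use e ne in auto)
  moreover have "ip e e = 1" using harmonic_basis_ip[OF e(3,3)] by simp
  ultimately show False by simp
qed

lemma card_level: "card (level l :: 'd::finite cfun set) <= 2 * ((l + 2 * CARD('d) - 2) choose l)"
proof -
  have "card (level l :: 'd cfun set) <= (\<Sum>m\<le>l. card (harmonic_basis m (l - m) :: 'd cfun set))"
  unfolding level_def by (rule card_UN_le) simp
  also have "... <= (\<Sum>m\<le>l. card (reduced_exponents (undefined::'d) m (l - m)))"
  by (intro sum_mono harmonic_basis(2))
  also have "... <= 2 * ((l + 2 * CARD('d) - 2) choose l)" by (rule card_reduced_exponents_level)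
  finally show ?thesis .
qed

lemma level_continuous: "e \<in> level l ==> continuous_on UNIV e"
  unfolding level_def using harmonic_basis_harmpoly harmpoly_continuous by blast

section \<open>The diagonal of the reproducing kernels\<close>

text \<open>A complexified infinitesimal rotation: it annihilates \<open>nsq\<close> and preserves
  the bidegree.\<close>
definition rotate_deriv :: "'d => 'd => 'd::finite cfun => 'd cfun" where
  "rotate_deriv j k f z = z $ j * wirtinger_z k f z - cnj (z $ k) * wirtinger_cnj j f z"

lemma bipoly_rotate_deriv:
  assumes "bipoly m n f" shows "bipoly m n (rotate_deriv j k f)"
proof -
  have "bipoly m n (\<lambda>z. z $ j * wirtinger_z k f z)"
  using bipoly_z[of "m - 1" n "wirtinger_z k f" j] bipoly_dz[OF assms, of k] by (cases m) (auto intro: bipoly_zero)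
  moreover have "bipoly m n (\<lambda>z. cnj (z $ k) * wirtinger_cnj j f z)"
  using bipoly_cnj[of m "n - 1" "wirtinger_cnj j f" k] bipoly_db[OF assms, of j] by (cases n) (auto intro: bipoly_zero)
  ultimately show ?thesis unfolding rotate_deriv_def[abs_def] by (rule bipoly_diff)
qed

lemma sint_rotate_deriv:
  assumes f: "bipoly m n f" shows "sint (rotate_deriv j k f) = 0"
proof -
  obtain \<kappa> where k: "\<And>m' n' j (G :: complex^'a => complex). bipoly m' n' G ==> m' + n' = Suc (m + n) ==>
  sint (wirtinger_z j G) = of_real \<kappa> * sint (\<lambda>z. cnj (z $ j) * G z) \<and>
  sint (wirtinger_cnj j G) = of_real \<kappa> * sint (\<lambda>z. z $ j * G z)"
  using sphere_ibp[of "Suc (m + n)"] by blast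
  note df = bipoly_diffable[OF f]
  have c: "continuous_on UNIV f" "continuous_on UNIV (wirtinger_z k f)" "continuous_on UNIV (wirtinger_cnj j f)"
  using df diffable_continuous diffable_dz[OF f] diffable_db[OF f] by blast+
  let ?\<delta> = "if j = k then 1 else 0 :: complex"
  have "wirtinger_z k (\<lambda>z. z $ j * f z) = (\<lambda>z. ?\<delta> * f z + z $ j * wirtinger_z k f z)"
  by (simp add: wirtinger_mult[OF diffable_coord df] wirtinger_coord eq_commute[of k j])
  then have 1: "sint (wirtinger_z k (\<lambda>z. z $ j * f z)) = ?\<delta> * sint f + sint (\<lambda>z. z $ j * wirtinger_z k f z)"
  by (simp only:) (subst Bochner_Integration.integral_add, auto intro!: integrable_sphere_continuous continuous_intros c)
  have "wirtinger_cnj j (\<lambda>z. cnj (z $ k) * f z) = (\<lambda>z. ?\<delta> * f z + cnj (z $ k) * wirtinger_cnj j f z)"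
  by (simp add: wirtinger_mult[OF diffable_cnj[OF diffable_coord] df] wirtinger_cnj_coord)
  then have 2: "sint (wirtinger_cnj j (\<lambda>z. cnj (z $ k) * f z)) = ?\<delta> * sint f + sint (\<lambda>z. cnj (z $ k) * wirtinger_cnj j f z)"
  by (simp only:) (subst Bochner_Integration.integral_add, auto intro!: integrable_sphere_continuous continuous_intros c)
  have "sint (wirtinger_z k (\<lambda>z. z $ j * f z)) = sint (wirtinger_cnj j (\<lambda>z. cnj (z $ k) * f z))"
  using k[OF bipoly_z[OF f, of j], of k] k[OF bipoly_cnj[OF f, of k], of j] by (simp add: mult.left_commute)
  then have "sint (\<lambda>z. z $ j * wirtinger_z k f z) = sint (\<lambda>z. cnj (z $ k) * wirtinger_cnj j f z)"
  unfolding 1 2 by simp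
  then show ?thesis unfolding rotate_deriv_def
  by (subst Bochner_Integration.integral_diff) (auto intro!: integrable_sphere_continuous continuous_intros c)
qed

lemma rotate_deriv_mult_cnj:
  assumes f: "bipoly m n f" and g: "bipoly m' n' g"
  shows "rotate_deriv j k (\<lambda>z. f z * cnj (g z)) = (\<lambda>z. rotate_deriv j k f z * cnj (g z) - f z * cnj (rotate_deriv k j g z))"
  by (simp add: fun_eq_iff rotate_deriv_def wirtinger_mult bipoly_diffable[OF f] bipoly_diffable[OF g]
   diffable_cnj wirtinger_of_cnj algebra_simps)

lemma rotate_deriv_adjoint:
  assumes f: "bipoly m n f" and g: "bipoly m n g"
  shows "ip (rotate_deriv j k f) g = ip f (rotate_deriv k j g)"
proof -
  note c = bipoly_continuous[OF f] bipoly_continuous[OF g] bipoly_continuous[OF bipoly_rotate_deriv[OF f]]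
  bipoly_continuous[OF bipoly_rotate_deriv[OF g]]
  have "sint (rotate_deriv j k (\<lambda>z. f z * cnj (g z))) = 0"
  by (rule sint_rotate_deriv[OF bipoly_mult[OF f bipoly_conjugate[OF g]]])
  then have "sint (\<lambda>z. rotate_deriv j k f z * cnj (g z)) - sint (\<lambda>z. f z * cnj (rotate_deriv k j g z)) = 0"
  unfolding rotate_deriv_mult_cnj[OF f g]
  by (subst (asm) Bochner_Integration.integral_diff) (auto intro!: integrable_sphere_continuous continuous_intros c)
  then show ?thesis by (simp add: ip_def)
qed

lemma rotate_deriv_sum:
  assumes "finite I" "\<And>i. i \<in> I ==> bipoly m n (f i)"
  shows "rotate_deriv j k (\<lambda>z. \<Sum>i\<in>I. f i z) = (\<lambda>z. \<Sum>i\<in>I. rotate_deriv j k (f i) z)"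
  using assms
proof (induction I rule: finite_induct)
  case (insert i I)
  have "rotate_deriv j k (\<lambda>z. f i z + (\<Sum>i\<in>I. f i z)) = (\<lambda>z. rotate_deriv j k (f i) z + rotate_deriv j k (\<lambda>z. \<Sum>i\<in>I. f i z) z)"
  using bipoly_diffable[OF insert.prems[of i]] bipoly_diffable[OF bipoly_sum[of I m n f]] insert.prems
  by (simp add: fun_eq_iff rotate_deriv_def wirtinger_add algebra_simps)
  then show ?case using insert by simp
qed (simp add: rotate_deriv_def[abs_def])

text \<open>The diagonal \<open>K\<close> does not depend on the basis, and since the adjoint of
  \<open>rotate_deriv j k\<close> is \<open>rotate_deriv k j\<close>, all these fields annihilate it.
  With Euler's identity this determines the derivative of \<open>K\<close>: the quotient of
  \<open>K\<close> by the matching power of \<open>nsq\<close> is locally constant off the origin,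
  hence constant.\<close>
lemma orthonormal_diag_constant:
  fixes B :: "'d::finite cfun set"
  assumes B: "finite B" "\<And>b. b \<in> B ==> bipoly m n b" "orthonormal B"
  and span: "\<And>f z. bipoly m n f ==> norm z = 1 ==> f z = (\<Sum>b\<in>B. ip f b * b z)"
  and xy: "norm x = 1" "norm y = 1"
  shows "(\<Sum>b\<in>B. b x * cnj (b x)) = (\<Sum>b\<in>B. b y * cnj (b y))"
proof -
  define K where "K = (\<lambda>z. \<Sum>b\<in>B. b z * cnj (b z))"
  let ?M = "m + n"
  have Kb: "bipoly ?M ?M (\<lambda>z. b z * cnj (b z))" if "b \<in> B" for b
  using bipoly_mult[OF B(2)[OF that] bipoly_conjugate[OF B(2)[OF that]]] by (simp add: add.commute)
  have K: "bipoly ?M ?M K" unfolding K_def by (rule bipoly_sum[OF Kb])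
  have XS: "rotate_deriv j k K z = 0" if z: "norm z = 1" for j k z
  proof -
  let ?a = "\<lambda>b b'. ip (rotate_deriv j k b) b'"
  have "rotate_deriv j k K z = (\<Sum>b\<in>B. rotate_deriv j k (\<lambda>z. b z * cnj (b z)) z)"
   unfolding K_def by (subst rotate_deriv_sum[OF B(1) Kb]) auto
  also have "... = (\<Sum>b\<in>B. rotate_deriv j k b z * cnj (b z) - b z * cnj (rotate_deriv k j b z))"
   by (intro sum.cong refl) (simp add: rotate_deriv_mult_cnj[OF B(2) B(2)])
  also have "... = (\<Sum>b\<in>B. (\<Sum>b'\<in>B. ?a b b' * b' z) * cnj (b z) - b z * cnj (\<Sum>b'\<in>B. ip (rotate_deriv k j b) b' * b' z))"
   by (intro sum.cong refl arg_cong2[where f = "(-)"] arg_cong2[where f = "(*)"] arg_cong[where f = cnj]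
     span bipoly_rotate_deriv B(2) z)
  also have "... = (\<Sum>b\<in>B. \<Sum>b'\<in>B. ?a b b' * b' z * cnj (b z)) - (\<Sum>b\<in>B. \<Sum>b'\<in>B. ?a b' b * b z * cnj (b' z))"
  proof -
   have "b z * cnj (\<Sum>b'\<in>B. ip (rotate_deriv k j b) b' * b' z) = (\<Sum>b'\<in>B. ?a b' b * b z * cnj (b' z))" if b: "b \<in> B" for b
   proof -
    have "cnj (ip (rotate_deriv k j b) b') = ?a b' b" if b': "b' \<in> B" for b'
     using ip_cnj[of b' "rotate_deriv k j b"] rotate_deriv_adjoint[OF B(2)[OF b'] B(2)[OF b], of j k] by simp
    then show ?thesis by (simp add: sum_distrib_left mult_ac)
   qed
   then show ?thesis by (simp add: sum_subtractf sum_distrib_right)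
  qed
  also have "(\<Sum>b\<in>B. \<Sum>b'\<in>B. ?a b' b * b z * cnj (b' z)) = (\<Sum>b\<in>B. \<Sum>b'\<in>B. ?a b b' * b' z * cnj (b z))"
   by (rule sum.swap)
  finally show ?thesis by simp
  qed
  have X: "rotate_deriv j k K w = 0" if w: "w ~= 0" for j k w
  proof -
  have "rotate_deriv j k K (norm w *\<^sub>R (w /\<^sub>R norm w)) = of_real (norm w ^ (?M + ?M)) * rotate_deriv j k K (w /\<^sub>R norm w)"
   by (rule bipoly_homogeneous[OF bipoly_rotate_deriv[OF K]])
  also have "rotate_deriv j k K (w /\<^sub>R norm w) = 0" by (rule XS) (use w in simp)
  finally show ?thesis using w by simp
  qed
  have dz: "nsq w * wirtinger_z k K w = of_nat ?M * cnj (w $ k) * K w" if w: "w ~= 0" for k w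
  proof -
  have "nsq w * wirtinger_z k K w = (\<Sum>j\<in>UNIV. cnj (w $ j) * (w $ j * wirtinger_z k K w))"
   unfolding nsq_def sum_distrib_right by (simp only: mult_ac)
  also have "... = (\<Sum>j\<in>UNIV. cnj (w $ k) * (cnj (w $ j) * wirtinger_cnj j K w))"
   by (intro sum.cong refl) (use X[OF w] in \<open>simp add: rotate_deriv_def mult_ac\<close>)
  also have "... = cnj (w $ k) * (of_nat ?M * K w)" unfolding sum_distrib_left[symmetric] euler_cnj[OF K] ..
  finally show ?thesis by (simp add: mult_ac)
  qed
  have db: "nsq w * wirtinger_cnj j K w = of_nat ?M * w $ j * K w" if w: "w ~= 0" for j w
  proof -
  have "nsq w * wirtinger_cnj j K w = (\<Sum>k\<in>UNIV. w $ k * (cnj (w $ k) * wirtinger_cnj j K w))"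
   unfolding nsq_def sum_distrib_right by (simp only: mult_ac)
  also have "... = (\<Sum>k\<in>UNIV. w $ j * (w $ k * wirtinger_z k K w))"
  proof (intro sum.cong refl)
   fix k
   have "w $ j * wirtinger_z k K w = cnj (w $ k) * wirtinger_cnj j K w"
    using X[OF w, of j k] by (simp add: rotate_deriv_def)
   then show "w $ k * (cnj (w $ k) * wirtinger_cnj j K w) = w $ j * (w $ k * wirtinger_z k K w)"
    by (metis mult.left_commute)
  qed
  also have "... = w $ j * (of_nat ?M * K w)" unfolding sum_distrib_left[symmetric] euler_z[OF K] ..
  finally show ?thesis by (simp add: mult_ac)
  qed
  define N where "N = (\<lambda>w v :: complex^'d. \<Sum>j\<in>UNIV. cnj (w $ j) * v $ j + w $ j * cnj (v $ j))"
  have DK: "(K has_derivative (\<lambda>v. of_nat ?M * K w / nsq w * N w v)) (at w)" if w: "w ~= 0" for w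
  proof -
  have n0: "nsq w ~= 0" using w by (simp add: nsq_norm)
  have "wirtinger_z j K w = of_nat ?M * K w / nsq w * cnj (w $ j)" "wirtinger_cnj j K w = of_nat ?M * K w / nsq w * w $ j" for j
   using dz[OF w, of j] db[OF w, of j] n0 by (simp_all add: field_simps)
  then show ?thesis using derivative_wirtinger[OF bipoly_diffable[OF K], of w]
   by (simp add: N_def sum_distrib_left distrib_left mult.assoc)
  qed
  have Dn: "(nsq has_derivative N w) (at w)" for w
  using derivative_wirtinger[OF bipoly_diffable[OF bipoly_nsq], of w] by (simp add: wirtinger_nsq N_def[abs_def])
  define g where "g = (\<lambda>w. K w / nsq w ^ ?M)"
  have "(g has_derivative (\<lambda>v. 0)) (at w)" if w: "w \<in> - {0}" for w
  proof -
  have w0: "w ~= 0" using w by simp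
  have n0: "nsq w ~= 0" using w0 by (simp add: nsq_norm)
  have "(g has_derivative (\<lambda>v. (of_nat ?M * K w / nsq w * N w v * nsq w ^ ?M - K w * (of_nat ?M * N w v * nsq w ^ (?M - 1)))
    / (nsq w ^ ?M * nsq w ^ ?M))) (at w)" unfolding g_def
   by (rule has_derivative_divide'[OF DK[OF w0] has_derivative_power[OF Dn]]) (use n0 in simp)
  moreover have "of_nat ?M * K w / nsq w * N w v * nsq w ^ ?M - K w * (of_nat ?M * N w v * nsq w ^ (?M - 1)) = 0" for v
   using n0 by (cases ?M) (simp_all add: field_simps)
  ultimately show ?thesis by simp
  qed
  moreover have "connected (- {0 :: complex^'d})"
  proof (rule connected_punctured_universe)
  have "DIM(complex^'d) = 2 * CARD('d)" by simp
  moreover have "CARD('d) > 0" by simp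
  ultimately show "2 <= DIM(complex^'d)" by linarith
  qed
  ultimately have "g x = g y" using xy by (intro has_derivative_zero_unique_connected[of "- {0}" g]) auto
  then show ?thesis using xy by (simp add: g_def K_def)
qed

lemma bipoly_basis_exists:
  "\<exists>B :: 'd::finite cfun set. finite B \<and> (\<forall>b\<in>B. bipoly m n b) \<and> orthonormal B \<and>
  (\<forall>f. bipoly m n f --> (\<forall>z. norm z = 1 --> f z = (\<Sum>b\<in>B. ip f b * b z)))"
proof -
  let ?I = "{\<alpha> :: 'd => nat. sum \<alpha> UNIV = m} \<times> {\<beta> :: 'd => nat. sum \<beta> UNIV = n}"
  let ?m = "\<lambda>p. monom_fun (fst p) (snd p) :: 'd cfun"
  have fin: "finite ?I" by (intro finite_cartesian_product finite_exponents)
  have F: "finite (?m ` ?I)" by (rule finite_imageI[OF fin])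
  have Fb: "bipoly m n f" if "f \<in> ?m ` ?I" for f using that bipoly_mono by auto
  have oe: "orthonormal {}" by (simp add: orthonormal_def)
  have "\<exists>B. {} \<subseteq> B \<and> finite B \<and> card B <= card ({} :: 'd cfun set) + card (?m ` ?I) \<and> (\<forall>e\<in>B. bipoly m n e)
   \<and> orthonormal B \<and> (\<forall>f\<in>?m ` ?I. \<forall>z. norm z = 1 --> f z = (\<Sum>e\<in>B. ip f e * e z))"
  by (rule gram_schmidt[of "bipoly m n" "{}" "?m ` ?I", OF bipoly_continuous bipoly_add bipoly_scale finite.emptyI oe _ F Fb])
   (simp_all only: empty_iff)
  then obtain B where B: "finite B" "\<And>e. e \<in> B ==> bipoly m n e" "orthonormal B"
  "\<And>f z. f \<in> ?m ` ?I ==> norm z = 1 ==> f z = (\<Sum>e\<in>B. ip f e * e z)" by (elim exE conjE) blast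
  have "f z = (\<Sum>b\<in>B. ip f b * b z)" if f: "bipoly m n f" and z: "norm z = 1" for f z
  proof -
  have "f \<in> bihomogeneous_polys m n" using f by (simp add: bihomogeneous_polys_bipoly)
  then obtain c where "f = (\<lambda>z. \<Sum>\<alpha> | sum \<alpha> UNIV = m. \<Sum>\<beta> | sum \<beta> UNIV = n. c \<alpha> \<beta> * monom_fun \<alpha> \<beta> z)"
   unfolding bihomogeneous_polys_alt by blast
  then have fs: "f = (\<lambda>z. \<Sum>p\<in>?I. c (fst p) (snd p) * ?m p z)"
   by (simp add: sum.cartesian_product split_beta)
  have ipf: "ip f b = (\<Sum>p\<in>?I. c (fst p) (snd p) * ip (?m p) b)" if b: "b \<in> B" for b
  proof -
   have "ip f b = (\<Sum>p\<in>?I. ip (\<lambda>z. c (fst p) (snd p) * ?m p z) b)"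
    unfolding fs by (intro ip_sum_left continuous_intros bipoly_continuous[OF Fb] bipoly_continuous[OF B(2)[OF b]]) auto
   then show ?thesis by (simp add: ip_scale_left)
  qed
  have "f z = (\<Sum>p\<in>?I. c (fst p) (snd p) * (\<Sum>b\<in>B. ip (?m p) b * b z))"
   unfolding fs by (intro sum.cong refl arg_cong2[where f = "(*)"] B(4) z) auto
  also have "... = (\<Sum>b\<in>B. (\<Sum>p\<in>?I. c (fst p) (snd p) * ip (?m p) b) * b z)"
   by (simp add: sum_distrib_left sum_distrib_right mult.assoc) (rule sum.swap)
  also have "... = (\<Sum>b\<in>B. ip f b * b z)" by (intro sum.cong refl) (simp add: ipf)
  finally show ?thesis .
  qed
  then show ?thesis using B by blast
qed

text \<open>The basis of harmonics together with \<open>nsq\<close> times a basis of bidegree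
  \<open>(m - 1, n - 1)\<close> is a basis of all polynomials of bidegree \<open>(m, n)\<close>. Both
  the latter and the lower basis have constant diagonal.\<close>
lemma harmonic_diag_constant:
  fixes x y :: "complex ^ 'd::finite"
  assumes xy: "norm x = 1" "norm y = 1"
  shows "(\<Sum>e\<in>harmonic_basis m n. e x * cnj (e x)) = (\<Sum>e\<in>harmonic_basis m n. e y * cnj (e y))"
proof -
  let ?E = "harmonic_basis m n :: 'd cfun set"
  have Eb: "bipoly m n e" if "e \<in> ?E" for e using harmonic_basis_harmpoly[OF that] by (rule harmpoly_bipoly)
  show ?thesis
  proof (cases "m = 0 \<or> n = 0")
  case True
  have "harmpoly m n f" if "bipoly m n f" for f :: "'d cfun"
   using Lap_bipoly(2)[OF that True] that by (simp add: harmpoly_def)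
  then show ?thesis
   by (intro orthonormal_diag_constant[OF finite_harmonic_basis Eb harmonic_basis_orthonormal _ xy] harmonic_basis_expand) auto
  next
  case False
  obtain B :: "'d cfun set" where B: "finite B" "\<And>b. b \<in> B ==> bipoly (m - 1) (n - 1) b" "orthonormal B"
  "\<And>f z. bipoly (m - 1) (n - 1) f ==> norm z = 1 ==> f z = (\<Sum>b\<in>B. ip f b * b z)"
   using bipoly_basis_exists[of "m - 1" "n - 1"] by blast
  define q where "q = (\<lambda>(b :: 'd cfun) z. nsq z * b z)"
  have qb: "bipoly m n (q b)" if "bipoly (m - 1) (n - 1) b" for b
   using bipoly_nsq_mult[OF that] False by (simp add: q_def)
  have ipq: "ip (q b) (q b') = ip b b'" "ip f (q b) = ip f b" "ip (q b) f = ip b f" for b b' f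
   by (rule ip_cong; simp add: q_def)+
  have injq: "inj_on q B"
  proof (rule inj_onI)
   fix b b' assume b: "b \<in> B" "b' \<in> B" "q b = q b'"
   have "ip b b' = ip b b" using ipq(1)[of b b'] ipq(1)[of b b] b(3) by simp
   then show "b = b'" using B(3) b by (auto simp: orthonormal_def split: if_splits)
  qed
  have cross: "ip e (q b) = 0" "ip (q b) e = 0" if "e \<in> ?E" "b \<in> B" for e b
  proof -
   have "lower_bipoly m n b" using B(2)[OF that(2)] False by (simp add: lower_bipoly_def)
   then have "ip e b = 0" by (rule harmpoly_orthogonal_lower[OF harmonic_basis_harmpoly[OF that(1)]])
   then show "ip e (q b) = 0" "ip (q b) e = 0" using ipq ip_cnj[of b e] by simp_all
  qed
  have disj: "?E \<inter> q ` B = {}"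
  proof (rule ccontr)
   assume "?E \<inter> q ` B ~= {}"
   then obtain b where b: "b \<in> B" "q b \<in> ?E" by blast
   then have "ip (q b) (q b) = 0" using cross by blast
   moreover have "ip (q b) (q b) = 1" using harmonic_basis_ip[OF b(2,2)] by simp
   ultimately show False by simp
  qed
  have on: "orthonormal (?E \<union> q ` B)" unfolding orthonormal_def
  proof (intro ballI)
   fix e e' assume ee: "e \<in> ?E \<union> q ` B" "e' \<in> ?E \<union> q ` B"
   show "ip e e' = (if e = e' then 1 else 0)"
   proof (cases "e \<in> ?E")
    case e: True
    show ?thesis
    proof (cases "e' \<in> ?E")
     case True
     then show ?thesis by (rule harmonic_basis_ip[OF e])
    next
     case False
     then show ?thesis using ee e cross by auto
    qed
   next
    case e: False
    then obtain b where b: "b \<in> B" "e = q b" using ee by blast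
    show ?thesis
    proof (cases "e' \<in> ?E")
     case True
     then show ?thesis using e b cross by auto
    next
     case False
     then obtain b' where b': "b' \<in> B" "e' = q b'" using ee by blast
     have "ip e e' = ip b b'" using b b' ipq(1) by simp
     also have "... = (if b = b' then 1 else 0)" using B(3) b b' by (simp add: orthonormal_def)
     also have "(b = b') = (e = e')" using inj_on_eq_iff[OF injq b(1) b'(1)] b b' by simp
     finally show ?thesis .
    qed
   qed
  qed
  have span: "f z = (\<Sum>b\<in>?E \<union> q ` B. ip f b * b z)" if f: "bipoly m n f" and z: "norm z = 1" for f z
  proof -
   obtain h g where hg: "harmpoly m n h" "lower_bipoly m n g" "f = (\<lambda>z. h z + nsq z * g z)"
    using harmonic_split[OF f] by blast
   have g: "bipoly (m - 1) (n - 1) g" using hg(2) False by (simp add: lower_bipoly_def)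
   note c = harmpoly_continuous[OF hg(1)] bipoly_continuous[OF g] bipoly_continuous[OF bipoly_nsq]
   have ipf: "ip f e = ip h e + ip g e" if "continuous_on UNIV e" for e
   proof -
    have "ip f e = ip h e + ip (q g) e" unfolding hg(3) q_def by (intro ip_add_left continuous_intros c that)
    then show ?thesis by (simp add: ipq)
   qed
   have 1: "ip f e = ip h e" if e: "e \<in> ?E" for e
    using ipf[OF bipoly_continuous[OF Eb[OF e]]] ip_cnj[of g e]
     harmpoly_orthogonal_lower[OF harmonic_basis_harmpoly[OF e] hg(2)] by simp
   have 2: "ip f (q b) = ip g b" if b: "b \<in> B" for b
   proof -
    have lb: "lower_bipoly m n b" using B(2)[OF b] False by (simp add: lower_bipoly_def)
    have "ip f (q b) = ip h (q b) + ip g (q b)" by (rule ipf[OF bipoly_continuous[OF qb[OF B(2)[OF b]]]])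
    then show ?thesis using harmpoly_orthogonal_lower[OF hg(1) lb] by (simp add: ipq)
   qed
   have "(\<Sum>b\<in>?E \<union> q ` B. ip f b * b z) = (\<Sum>b\<in>?E. ip f b * b z) + (\<Sum>b\<in>q ` B. ip f b * b z)"
    by (rule sum.union_disjoint) (use finite_harmonic_basis B disj in auto)
   also have "(\<Sum>b\<in>q ` B. ip f b * b z) = (\<Sum>b\<in>B. ip f (q b) * q b z)"
    by (simp add: sum.reindex[OF injq])
   also have "... = (\<Sum>b\<in>B. ip g b * b z)"
   proof (intro sum.cong refl)
    fix b assume "b \<in> B"
    moreover have "q b z = b z" using z by (simp add: q_def)
    ultimately show "ip f (q b) * q b z = ip g b * b z" by (simp only: 2)
   qed
   also have "... = g z" by (rule B(4)[OF g z, symmetric])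
   also have "(\<Sum>b\<in>?E. ip f b * b z) = (\<Sum>b\<in>?E. ip h b * b z)" by (intro sum.cong refl) (simp add: 1)
   also have "... = h z" by (rule harmonic_basis_expand[OF hg(1) z, symmetric])
   finally show ?thesis using z by (simp add: hg(3))
  qed
  have const1: "(\<Sum>b\<in>?E \<union> q ` B. b x * cnj (b x)) = (\<Sum>b\<in>?E \<union> q ` B. b y * cnj (b y))"
  proof (rule orthonormal_diag_constant[OF _ _ on span xy])
   show "finite (?E \<union> q ` B)" using finite_harmonic_basis B by simp
   show "bipoly m n b" if "b \<in> ?E \<union> q ` B" for b using that Eb qb[OF B(2)] by blast
  qed
  have const2: "(\<Sum>b\<in>B. b x * cnj (b x)) = (\<Sum>b\<in>B. b y * cnj (b y))"
   by (rule orthonormal_diag_constant[OF B xy])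
  have split: "(\<Sum>b\<in>?E \<union> q ` B. b w * cnj (b w)) = (\<Sum>b\<in>?E. b w * cnj (b w)) + (\<Sum>b\<in>B. b w * cnj (b w))" if "norm w = 1" for w
  proof -
   have "(\<Sum>b\<in>?E \<union> q ` B. b w * cnj (b w)) = (\<Sum>b\<in>?E. b w * cnj (b w)) + (\<Sum>b\<in>q ` B. b w * cnj (b w))"
    by (rule sum.union_disjoint) (use finite_harmonic_basis B disj in auto)
   also have "(\<Sum>b\<in>q ` B. b w * cnj (b w)) = (\<Sum>b\<in>B. b w * cnj (b w))"
    by (subst sum.reindex[OF injq]) (use that in \<open>simp add: q_def\<close>)
   finally show ?thesis .
  qed
  show ?thesis using const1 const2 split[OF xy(1)] split[OF xy(2)] by simp
  qed
qed

abbreviation sphere_area :: "'d::finite itself => real" where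
  "sphere_area T \<equiv> measure (sphere_measure :: (complex ^ 'd) measure) (sphere 0 1)"

lemma harmonic_diag:
  fixes x :: "complex ^ 'd::finite"
  assumes x: "norm x = 1"
  shows "(\<Sum>e\<in>harmonic_basis m n. (norm (e x))\<^sup>2)
  = real (card (harmonic_basis m n :: 'd cfun set)) / sphere_area TYPE('d)"
proof -
  let ?E = "harmonic_basis m n :: 'd cfun set"
  let ?s = "\<lambda>x. \<Sum>e\<in>?E. e x * cnj (e x)"
  have c: "continuous_on UNIV e" if "e \<in> ?E" for e by (rule harmpoly_continuous[OF harmonic_basis_harmpoly[OF that]])
  have "sint ?s = (\<Sum>e\<in>?E. ip e e)"
  unfolding ip_def by (intro Bochner_Integration.integral_sum integrable_sphere_continuous continuous_intros c)
  also have "... = (\<Sum>e\<in>?E. 1)" by (intro sum.cong refl) (simp add: harmonic_basis_ip)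
  also have "... = of_nat (card ?E)" by simp
  finally have 1: "sint ?s = of_nat (card ?E)" .
  have "sint ?s = sint (\<lambda>_::complex^'d. ?s x)"
  by (rule sphere_integral_cong) (rule harmonic_diag_constant[OF _ x])
  also have "... = of_real (sphere_area TYPE('d)) * ?s x"
  by (simp add: space_sphere_measure scaleR_conv_of_real)
  finally have "of_real (sphere_area TYPE('d)) * ?s x = of_nat (card ?E)" using 1 by simp
  moreover have "?s x = of_real (\<Sum>e\<in>?E. (norm (e x))\<^sup>2)" by (simp only: complex_norm_square of_real_sum)
  ultimately have "complex_of_real (sphere_area TYPE('d) * (\<Sum>e\<in>?E. (norm (e x))\<^sup>2)) = of_real (real (card ?E))"
  by simp
  then have "sphere_area TYPE('d) * (\<Sum>e\<in>?E. (norm (e x))\<^sup>2) = real (card ?E)" by (simp only: of_real_eq_iff)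
  then show ?thesis using sphere_measure_pos[where 'a = "complex^'d"] by (simp add: field_simps)
qed

lemma level_diag:
  fixes x :: "complex ^ 'd::finite"
  assumes x: "norm x = 1"
  shows "(\<Sum>e\<in>level l. (norm (e x))\<^sup>2) = real (card (level l :: 'd cfun set)) / sphere_area TYPE('d)"
proof -
  let ?H = "\<lambda>m. harmonic_basis m (l - m) :: 'd cfun set"
  have disj: "?H i \<inter> ?H j = {}" if "i ~= j" "i <= l" "j <= l" for i j
  proof (rule ccontr)
  assume "?H i \<inter> ?H j ~= {}"
  then obtain e where e: "e \<in> ?H i" "e \<in> ?H j" by blast
  have "ip e e = 0"
   by (rule harmpoly_orthogonal[OF harmonic_basis_harmpoly[OF e(1)] harmonic_basis_harmpoly[OF e(2)]])
    (use that in auto)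
  then show False using harmonic_basis_ip[OF e(1,1)] by simp
  qed
  have "(\<Sum>e\<in>level l. (norm (e x))\<^sup>2) = (\<Sum>m\<le>l. \<Sum>e\<in>?H m. (norm (e x))\<^sup>2)"
  unfolding level_def by (rule sum.UNION_disjoint) (use finite_harmonic_basis disj in auto)
  also have "... = real (\<Sum>m\<le>l. card (?H m)) / sphere_area TYPE('d)"
  by (simp add: harmonic_diag[OF x] sum_divide_distrib)
  also have "(\<Sum>m\<le>l. card (?H m)) = card (level l :: 'd cfun set)"
  unfolding level_def by (rule card_UN_disjoint[symmetric]) (use finite_harmonic_basis disj in auto)
  finally show ?thesis .
qed

section \<open>Completeness\<close>

definition upto_level :: "nat => 'd::finite cfun set" where
  "upto_level N = (\<Union>l\<le>N. level l)"

lemma finite_upto_level: "finite (upto_level N)" by (simp add: upto_level_def finite_level)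

lemma upto_level_ip: "e \<in> upto_level N ==> e' \<in> upto_level N' ==> ip e e' = (if e = e' then 1 else 0)"
  unfolding upto_level_def using level_ip by blast

lemma upto_level_continuous: "e \<in> upto_level N ==> continuous_on UNIV e"
  unfolding upto_level_def using level_continuous by blast

lemma harmonic_basis_upto_level: "m + n <= N ==> harmonic_basis m n \<subseteq> upto_level N"
  unfolding upto_level_def level_def by (intro subsetI UN_I[of "m + n"] UN_I[of m]) auto

lemma card_upto_level:
  "card (upto_level N :: 'd::finite cfun set) <= 2 * ((N + 2 * CARD('d) - 1) choose N)"
proof -
  have "CARD('d) > 0" by simp
  then have e: "l + 2 * CARD('d) - 2 = (2 * CARD('d) - 2) + l" "N + 2 * CARD('d) - 1 = Suc ((2 * CARD('d) - 2) + N)" for l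
  by linarith+
  have "card (upto_level N :: 'd cfun set) <= (\<Sum>l\<le>N. card (level l :: 'd cfun set))"
  unfolding upto_level_def by (rule card_UN_le) simp
  also have "... <= (\<Sum>l\<le>N. 2 * (((2 * CARD('d) - 2) + l) choose l))"
  using card_level[where 'd = 'd] unfolding e by (intro sum_mono)
  also have "... = 2 * ((N + 2 * CARD('d) - 1) choose N)"
  unfolding e sum_distrib_left[symmetric] sum_choose_lower ..
  finally show ?thesis .
qed

text \<open>Polynomials of degree at most \<open>N\<close> in \<open>z\<close> and its conjugate
  together.\<close>
inductive polydeg :: "nat => 'd::finite cfun => bool" for N where
  polydeg_bipoly: "bipoly a b f ==> a + b <= N ==> polydeg N f"
| polydeg_add: "polydeg N f ==> polydeg N g ==> polydeg N (\<lambda>z. f z + g z)"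

lemma polydeg_mono: "polydeg N f ==> N <= N' ==> polydeg N' f"
  by (induction rule: polydeg.induct) (auto intro: polydeg.intros)

lemma polydeg_continuous: "polydeg N f ==> continuous_on UNIV f"
  by (induction rule: polydeg.induct) (auto intro: bipoly_continuous continuous_intros)

lemma polydeg_cnj: "polydeg N f ==> polydeg N (\<lambda>z. cnj (f z))"
proof (induction rule: polydeg.induct)
  case (polydeg_bipoly a b f)
  then show ?case using polydeg.polydeg_bipoly[OF bipoly_conjugate] by (simp add: add.commute)
next
  case (polydeg_add f g)
  then show ?case using polydeg.polydeg_add[of N "\<lambda>z. cnj (f z)" "\<lambda>z. cnj (g z)"] by simp
qed

lemma polydeg_mult:
  assumes "polydeg N f" "polydeg N' g" shows "polydeg (N + N') (\<lambda>z. f z * g z)" using assms(1)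
proof (induction rule: polydeg.induct)
  case (polydeg_bipoly a b f)
  from assms(2) show ?case
  proof (induction rule: polydeg.induct)
  case (polydeg_bipoly a' b' g)
  then show ?case using bipoly_mult[OF \<open>bipoly a b f\<close>, of a' b' g] \<open>a + b <= N\<close>
   by (intro polydeg.polydeg_bipoly) auto
  next
  case (polydeg_add g h)
  then show ?case using polydeg.polydeg_add[of "N + N'" "\<lambda>z. f z * g z" "\<lambda>z. f z * h z"] by (simp add: distrib_left)
  qed
next
  case (polydeg_add f h)
  then show ?case using polydeg.polydeg_add[of "N + N'" "\<lambda>z. f z * g z" "\<lambda>z. h z * g z"] by (simp add: distrib_right)
qed

lemma polydeg_const: "polydeg N (\<lambda>_. c)" by (rule polydeg_bipoly[OF bipoly_const]) simp

lemma polydeg_scale: "polydeg N f ==> polydeg N (\<lambda>z. c * f z)"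
  using polydeg_mult[OF polydeg_const[of 0 c], of N f] by simp

lemma polydeg_sum: "(\<And>i. i \<in> I ==> polydeg N (f i)) ==> polydeg N (\<lambda>z. \<Sum>i\<in>I. f i z)"
  by (induction I rule: infinite_finite_induct) (auto intro: polydeg_const polydeg_add)

lemma polydeg_power: "polydeg N f ==> polydeg (s * N) (\<lambda>z. f z ^ s)"
proof (induction s)
  case 0
  then show ?case using polydeg_const[of 0 1] by simp
next
  case (Suc s)
  then show ?case using polydeg_mult[of N f "s * N" "\<lambda>z. f z ^ s"] by simp
qed

lemma polydeg_level: "e \<in> level l ==> l <= N ==> polydeg N e"
  unfolding level_def using polydeg_bipoly[OF harmpoly_bipoly[OF harmonic_basis_harmpoly]] by fastforce

lemma upto_level_coefficients:
  assumes "\<And>z. norm z = 1 ==> f z = (\<Sum>e\<in>upto_level N. c e * e z)" "norm z = 1"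
  shows "f z = (\<Sum>e\<in>upto_level N. ip f e * e z)"
proof -
  have "ip f e = c e" if e: "e \<in> upto_level N" for e
  proof -
  have "ip f e = ip (\<lambda>z. \<Sum>e\<in>upto_level N. c e * e z) e" by (rule ip_cong) (use assms(1) in auto)
  also have "... = (\<Sum>e'\<in>upto_level N. ip (\<lambda>z. c e' * e' z) e)"
   by (intro ip_sum_left continuous_intros upto_level_continuous[OF e]) (rule upto_level_continuous)
  also have "... = (\<Sum>e'\<in>upto_level N. if e' = e then c e else 0)"
   by (intro sum.cong refl) (simp add: ip_scale_left upto_level_ip[of _ N e N, OF _ e])
  also have "... = c e" using e finite_upto_level by (simp add: sum.delta[OF finite_upto_level])
  finally show ?thesis .
  qed
  then show ?thesis using assms by simp
qed

lemma polydeg_expand: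
  assumes "polydeg N f" "norm z = 1"
  shows "f z = (\<Sum>e\<in>upto_level N. ip f e * e z)"
proof -
  have "\<exists>c. \<forall>z. norm z = 1 --> f z = (\<Sum>e\<in>upto_level N. c e * e z)" using assms(1)
  proof (induction rule: polydeg.induct)
  case (polydeg_bipoly a b f)
  obtain h where h: "\<And>i. i <= min a b ==> harmpoly (a - i) (b - i) (h i)"
   and f: "f = (\<lambda>z. \<Sum>i\<le>min a b. nsq z ^ i * h i z)"
   using harmonic_decomposition[OF polydeg_bipoly(1)] by blast
  let ?B = "\<lambda>i. harmonic_basis (a - i) (b - i) :: (complex^'a => complex) set"
  have sub: "?B i \<subseteq> upto_level N" for i
   by (rule harmonic_basis_upto_level) (use polydeg_bipoly(2) in linarith)
  have "f z = (\<Sum>e\<in>upto_level N. (\<Sum>i\<le>min a b. if e \<in> ?B i then ip (h i) e else 0) * e z)" if z: "norm z = 1" for z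
  proof -
   have "f z = (\<Sum>i\<le>min a b. \<Sum>e\<in>?B i. ip (h i) e * e z)"
    unfolding f using z h by (intro sum.cong refl) (simp add: harmonic_basis_expand[symmetric])
   also have "... = (\<Sum>i\<le>min a b. \<Sum>e\<in>upto_level N. (if e \<in> ?B i then ip (h i) e else 0) * e z)"
   proof (rule sum.cong[OF refl])
    fix i
    show "(\<Sum>e\<in>?B i. ip (h i) e * e z) = (\<Sum>e\<in>upto_level N. (if e \<in> ?B i then ip (h i) e else 0) * e z)"
     by (rule sum.mono_neutral_cong_left[OF finite_upto_level sub]) auto
   qed
   also have "... = (\<Sum>e\<in>upto_level N. (\<Sum>i\<le>min a b. if e \<in> ?B i then ip (h i) e else 0) * e z)"
    unfolding sum_distrib_right by (rule sum.swap)
   finally show ?thesis .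
  qed
  then show ?case by (intro exI[of _ "\<lambda>e. \<Sum>i\<le>min a b. if e \<in> ?B i then ip (h i) e else 0"]) blast
  next
  case (polydeg_add f g)
  then obtain c c' where "\<And>z. norm z = 1 ==> f z = (\<Sum>e\<in>upto_level N. c e * e z)"
   "\<And>z. norm z = 1 ==> g z = (\<Sum>e\<in>upto_level N. c' e * e z)" by blast
  then show ?case by (intro exI[of _ "\<lambda>e. c e + c' e"]) (simp add: sum.distrib distrib_right)
  qed
  then obtain c where "\<And>z. norm z = 1 ==> f z = (\<Sum>e\<in>upto_level N. c e * e z)" by blast
  then show ?thesis using assms(2) by (rule upto_level_coefficients)
qed

lemma real_polynomial_polydeg:
  fixes p :: "complex ^ 'd::finite => real"
  assumes "real_polynomial_function p"
  shows "\<exists>N. polydeg N (\<lambda>z. of_real (p z))" using assms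
proof (induction rule: real_polynomial_function.induct)
  case (linear f)
  interpret f: bounded_linear f by fact
  have P: "polydeg 1 (\<lambda>z. \<Sum>j\<in>UNIV. (of_real (f (axis j 1)) - \<i> * of_real (f (axis j \<i>))) / 2 * z $ j
   + (of_real (f (axis j 1)) + \<i> * of_real (f (axis j \<i>))) / 2 * cnj (z $ j))"
  by (intro polydeg_sum polydeg_add polydeg_scale polydeg_bipoly[OF bipoly_coord(1)] polydeg_bipoly[OF bipoly_coord(2)]) auto
  have "complex_of_real (f z) = (\<Sum>j\<in>UNIV. (of_real (f (axis j 1)) - \<i> * of_real (f (axis j \<i>))) / 2 * z $ j
   + (of_real (f (axis j 1)) + \<i> * of_real (f (axis j \<i>))) / 2 * cnj (z $ j))" for z :: "complex^'d"
  proof -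
  have "f z = f (\<Sum>j\<in>UNIV. Re (z $ j) *\<^sub>R axis j 1 + Im (z $ j) *\<^sub>R axis j \<i>)"
   using complex_vec_expand[of z] by simp
  also have "... = (\<Sum>j\<in>UNIV. Re (z $ j) * f (axis j 1) + Im (z $ j) * f (axis j \<i>))"
   by (simp add: f.sum f.add f.scaleR)
  finally have "complex_of_real (f z) = (\<Sum>j\<in>UNIV. of_real (Re (z $ j)) * of_real (f (axis j 1)) + of_real (Im (z $ j)) * of_real (f (axis j \<i>)))"
   by simp
  also have "... = (\<Sum>j\<in>UNIV. (of_real (f (axis j 1)) - \<i> * of_real (f (axis j \<i>))) / 2 * z $ j
   + (of_real (f (axis j 1)) + \<i> * of_real (f (axis j \<i>))) / 2 * cnj (z $ j))"
   by (intro sum.cong refl) (simp add: complex_eq_iff field_simps)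
  finally show ?thesis .
  qed
  then have eq: "(\<lambda>z. complex_of_real (f z)) = (\<lambda>z. \<Sum>j\<in>UNIV. (of_real (f (axis j 1)) - \<i> * of_real (f (axis j \<i>))) / 2 * z $ j
   + (of_real (f (axis j 1)) + \<i> * of_real (f (axis j \<i>))) / 2 * cnj (z $ j))" by (rule ext)
  show ?case by (rule exI[of _ 1], subst eq, rule P)
next
  case (const c)
  show ?case by (intro exI[of _ 0] polydeg_const)
next
  case (add f g)
  then obtain N N' where "polydeg N (\<lambda>z. of_real (f z))" "polydeg N' (\<lambda>z. of_real (g z))" by blast
  then have "polydeg (max N N') (\<lambda>z. of_real (f z) + of_real (g z))"
  by (intro polydeg_add) (auto elim: polydeg_mono)
  then show ?case by (intro exI[of _ "max N N'"]) simp
next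
  case (mult f g)
  then obtain N N' where "polydeg N (\<lambda>z. of_real (f z))" "polydeg N' (\<lambda>z. of_real (g z))" by blast
  then have "polydeg (N + N') (\<lambda>z. of_real (f z) * of_real (g z))" by (rule polydeg_mult)
  then show ?case by (intro exI[of _ "N + N'"]) simp
qed

lemma integrable_mult_continuous:
  fixes \<phi> :: "'d::finite cfun"
  assumes \<phi>: "integrable sphere_measure \<phi>" and g: "continuous_on UNIV g"
  shows "integrable sphere_measure (\<lambda>z. \<phi> z * g z)"
proof -
  obtain B where B: "B >= 0" "\<And>x. norm x = 1 ==> norm (g x) <= B" using continuous_bounded_sphere[OF g] by blast
  show ?thesis
  proof (rule Bochner_Integration.integrable_bound)
  show "integrable sphere_measure (\<lambda>z. B * norm (\<phi> z))" using \<phi> by simp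
  show "(\<lambda>z. \<phi> z * g z) \<in> borel_measurable sphere_measure"
   using \<phi> borel_measurable_sphere[OF borel_measurable_continuous_onI[OF g]] by simp
  show "AE z in sphere_measure. norm (\<phi> z * g z) <= norm (B * norm (\<phi> z))"
   using B by (intro AE_I2) (simp add: space_sphere_measure norm_mult mult.commute[of B] mult_left_mono)
  qed
qed

lemma ip_integrable_sum_right:
  assumes \<phi>: "integrable sphere_measure \<phi>" and "\<And>i. i \<in> I ==> continuous_on UNIV (f i)"
  shows "ip \<phi> (\<lambda>z. \<Sum>i\<in>I. c i * f i z) = (\<Sum>i\<in>I. cnj (c i) * ip \<phi> (f i))"
proof -
  have "ip \<phi> (\<lambda>z. \<Sum>i\<in>I. c i * f i z) = sint (\<lambda>z. \<Sum>i\<in>I. cnj (c i) * (\<phi> z * cnj (f i z)))"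
  unfolding ip_def by (simp add: sum_distrib_left mult_ac)
  also have "... = (\<Sum>i\<in>I. sint (\<lambda>z. cnj (c i) * (\<phi> z * cnj (f i z))))"
  by (intro Bochner_Integration.integral_sum integrable_mult_right integrable_mult_continuous[OF \<phi>] continuous_intros assms(2))
  finally show ?thesis by (simp add: ip_def)
qed

text \<open>Uniform approximation by polynomials (Stone-Weierstrass).\<close>
lemma orthogonal_to_continuous:
  fixes D :: "'d::finite cfun" and f :: "complex ^ 'd => real"
  assumes D: "integrable sphere_measure D" and orth: "\<And>N e. e \<in> upto_level N ==> ip D e = 0"
  and f: "continuous_on UNIV f"
  shows "sint (\<lambda>z. f z *\<^sub>R D z) = 0"
proof -
  have poly: "sint (\<lambda>z. D z * g z) = 0" if g: "polydeg N g" for N g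
  proof -
  have g': "polydeg N (\<lambda>z. cnj (g z))" by (rule polydeg_cnj[OF g])
  have "sint (\<lambda>z. D z * g z) = ip D (\<lambda>z. cnj (g z))" by (simp add: ip_def)
  also have "... = ip D (\<lambda>z. \<Sum>e\<in>upto_level N. ip (\<lambda>z. cnj (g z)) e * e z)"
   by (rule ip_cong) (auto simp: polydeg_expand[OF g'])
  also have "... = 0"
   using ip_integrable_sum_right[OF D, of "upto_level N" "\<lambda>e. e" "ip (\<lambda>z. cnj (g z))"]
   by (simp add: orth upto_level_continuous)
  finally show ?thesis .
  qed
  let ?I = "spint (\<lambda>z. norm (D z))"
  have fc: "continuous_on UNIV (\<lambda>z. complex_of_real (f z))" by (intro continuous_intros f)
  have eq: "sint (\<lambda>z. f z *\<^sub>R D z) = sint (\<lambda>z. D z * of_real (f z))"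
  by (simp add: scaleR_conv_of_real mult.commute)
  have "norm (sint (\<lambda>z. D z * of_real (f z))) <= \<epsilon> * ?I" if "\<epsilon> > 0" for \<epsilon>
  proof -
  obtain p where p: "real_polynomial_function p" "\<And>x. x \<in> sphere 0 1 ==> \<bar>f x - p x\<bar> < \<epsilon>"
   using Stone_Weierstrass_real_polynomial_function[of "sphere 0 1" f \<epsilon>] continuous_on_subset[OF f] \<open>\<epsilon> > 0\<close> by auto
  obtain N where N: "polydeg N (\<lambda>z. of_real (p z))" using real_polynomial_polydeg[OF p(1)] by blast
  note pc = polydeg_continuous[OF N]
  have "sint (\<lambda>z. D z * of_real (f z)) = sint (\<lambda>z. D z * of_real (f z)) - sint (\<lambda>z. D z * of_real (p z))"
   using poly[OF N] by simp
  also have "... = sint (\<lambda>z. D z * of_real (f z) - D z * of_real (p z))"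
   by (intro Bochner_Integration.integral_diff[symmetric] integrable_mult_continuous[OF D] fc pc)
  finally have eq': "sint (\<lambda>z. D z * of_real (f z)) = sint (\<lambda>z. D z * of_real (f z) - D z * of_real (p z))" .
  have "norm (sint (\<lambda>z. D z * of_real (f z))) <= spint (\<lambda>z. norm (D z * of_real (f z) - D z * of_real (p z)))"
   unfolding eq' by (rule Bochner_Integration.integral_norm_bound)
  also have "... <= spint (\<lambda>z. \<epsilon> * norm (D z))"
  proof (rule integral_mono)
   show "integrable sphere_measure (\<lambda>z. norm (D z * of_real (f z) - D z * of_real (p z)))"
    by (intro integrable_norm Bochner_Integration.integrable_diff integrable_mult_continuous[OF D] fc pc)
   show "integrable sphere_measure (\<lambda>z. \<epsilon> * norm (D z))" using D by simp
   fix z :: "complex^'d" assume "z \<in> space sphere_measure"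
   then have "\<bar>f z - p z\<bar> <= \<epsilon>" using p(2)[of z] by (simp add: space_sphere_measure)
   moreover have "norm (D z * of_real (f z) - D z * of_real (p z)) = norm (D z) * \<bar>f z - p z\<bar>"
    by (metis norm_mult norm_of_real of_real_diff right_diff_distrib)
   ultimately show "norm (D z * of_real (f z) - D z * of_real (p z)) <= \<epsilon> * norm (D z)"
    by (simp add: mult.commute[of \<epsilon>] mult_left_mono)
  qed
  finally show ?thesis by simp
  qed
  then have "norm (sint (\<lambda>z. D z * of_real (f z))) <= 0 + e" if "e > 0" for e
  proof -
  have I: "?I >= 0" by simp
  have "norm (sint (\<lambda>z. D z * of_real (f z))) <= e / (?I + 1) * ?I"
  proof (rule \<open>\<And>\<epsilon>. \<epsilon> > 0 ==> _ <= \<epsilon> * ?I\<close>)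
   have "?I + 1 > 0" using I by linarith
   then show "e / (?I + 1) > 0" using that by simp
  qed
  also have "... <= e / (?I + 1) * (?I + 1)" using that I by (intro mult_left_mono) auto
  also have "... = e"
  proof -
   have "?I + 1 ~= 0" using I by linarith
   then show ?thesis by (rule nonzero_divide_eq_eq[THEN iffD1, OF _ refl, symmetric])
  qed
  finally show ?thesis by simp
  qed
  then have "norm (sint (\<lambda>z. D z * of_real (f z))) <= 0" by (rule field_le_epsilon)
  then show ?thesis unfolding eq by simp
qed

text \<open>Continuous functions approximate the indicator of a closed set boundedly, and the closed
  sets generate the Borel sets; a function whose integral over every Borel set vanishes is zero almost
  everywhere.\<close>
lemma orthogonal_to_all_zero:
  fixes D :: "'d::finite cfun"
  assumes D: "integrable sphere_measure D" and orth: "\<And>N e. e \<in> upto_level N ==> ip D e = 0"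
  shows "AE z in sphere_measure. D z = 0"
proof (rule sphere.density_zero[OF D])
  let ?M = "sphere_measure :: (complex^'d) measure"
  let ?S = "sphere 0 1 :: (complex^'d) set"
  have inM: "B \<inter> ?S \<in> sets ?M" if "B \<in> sets borel" for B
  unfolding sets_sphere_measure using that by (auto simp: sets_restrict_space)
  have indint: "set_integrable ?M (B \<inter> ?S) D" if "B \<in> sets borel" for B
  unfolding set_integrable_def by (rule integrable_mult_indicator[OF inM[OF that] D])
  have closed: "set_lebesgue_integral ?M (C \<inter> ?S) D = 0" if C: "closed C" for C
  proof (cases "C = {}")
  case False
  define f where "f = (\<lambda>n x. max 0 (1 - real n * infdist x C))"
  have fc: "continuous_on UNIV (f n)" for n
   unfolding f_def by (intro continuous_intros continuous_on_infdist continuous_on_id)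
  have lim: "(\<lambda>n. f n x) \<longlonglongrightarrow> indicator C x" for x
  proof (cases "x \<in> C")
   case True
   then show ?thesis by (simp add: f_def)
  next
   case xC: False
   then have pos: "infdist x C > 0" using C False infdist_pos_not_in_closed by blast
   obtain n0 :: nat where n0: "1 / infdist x C < real n0" using reals_Archimedean2 by blast
   have "f n x = 0" if "n >= n0" for n
   proof -
    have "1 / infdist x C < real n" using n0 that by linarith
    then have "1 < real n * infdist x C" using pos by (simp add: field_simps)
    then show ?thesis by (simp add: f_def)
   qed
   then have "eventually (\<lambda>n. f n x = indicator C x) sequentially"
    using xC by (intro eventually_sequentiallyI[of n0]) auto
   then show ?thesis by (rule tendsto_eventually)
  qed
  have "(\<lambda>n. sint (\<lambda>z. f n z *\<^sub>R D z)) \<longlonglongrightarrow> sint (\<lambda>z. indicator C z *\<^sub>R D z)"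
  proof (rule integral_dominated_convergence[where w = "\<lambda>z. norm (D z)"])
   show "(\<lambda>z. indicator C z *\<^sub>R D z) \<in> borel_measurable ?M"
    using borel_measurable_sphere[OF borel_measurable_indicator[of C borel]] C D
    by (intro borel_measurable_scaleR) auto
   show "(\<lambda>z. f n z *\<^sub>R D z) \<in> borel_measurable ?M" for n
    using borel_measurable_sphere[OF borel_measurable_continuous_onI[OF fc]] D
    by (intro borel_measurable_scaleR) auto
   show "integrable ?M (\<lambda>z. norm (D z))" using D by simp
   show "AE z in ?M. (\<lambda>n. f n z *\<^sub>R D z) \<longlonglongrightarrow> indicator C z *\<^sub>R D z"
    by (intro AE_I2 tendsto_scaleR lim tendsto_const)
   show "AE z in ?M. norm (f n z *\<^sub>R D z) <= norm (D z)" for n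
   proof (intro AE_I2)
    fix z
    have "\<bar>f n z\<bar> <= 1" using infdist_nonneg[of z C] by (auto simp: f_def max_def)
    then show "norm (f n z *\<^sub>R D z) <= norm (D z)" by (simp add: mult_left_le_one_le)
   qed
  qed
  moreover have "sint (\<lambda>z. f n z *\<^sub>R D z) = 0" for n by (rule orthogonal_to_continuous[OF D orth fc])
  ultimately have "sint (\<lambda>z. indicator C z *\<^sub>R D z) = 0"
   using LIMSEQ_unique[OF _ tendsto_const[of 0]] by simp
  moreover have "sint (\<lambda>z. indicator C z *\<^sub>R D z) = set_lebesgue_integral ?M (C \<inter> ?S) D"
   unfolding set_lebesgue_integral_def by (rule sphere_integral_cong) (simp add: indicator_def)
  ultimately show ?thesis by simp
  qed (simp add: set_lebesgue_integral_def)
  have all: "set_lebesgue_integral ?M (B \<inter> ?S) D = 0" if B: "B \<in> sets borel" for B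
  proof -
  have st: "Int_stable {C :: (complex^'d) set. closed C}" by (auto simp: Int_stable_def)
  have B': "B \<in> sigma_sets UNIV {C. closed C}" using B unfolding borel_eq_closed by simp
  have sub: "{C :: (complex^'d) set. closed C} \<subseteq> Pow UNIV" by simp
  show ?thesis using st sub B'
  proof (induction rule: sigma_sets_induct_disjoint)
   case (basic A)
   then show ?case using closed by simp
  next
   case empty
   then show ?case by (simp add: set_lebesgue_integral_def)
  next
   case (compl A)
   have A: "A \<in> sets borel" using compl(1) by (simp add: borel_eq_closed)
   have "set_lebesgue_integral ?M (UNIV \<inter> ?S) D = sint D"
    unfolding set_lebesgue_integral_def by (rule sphere_integral_cong) simp
   then have tot: "sint D = 0" using closed[of UNIV] by simp
   have "set_lebesgue_integral ?M ((UNIV - A) \<inter> ?S) D = sint (\<lambda>z. D z - indicator (A \<inter> ?S) z *\<^sub>R D z)"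
    unfolding set_lebesgue_integral_def by (rule sphere_integral_cong) (simp add: indicator_def)
   also have "... = sint D - set_lebesgue_integral ?M (A \<inter> ?S) D" unfolding set_lebesgue_integral_def
    using indint[OF A] D by (intro Bochner_Integration.integral_diff) (auto simp: set_integrable_def)
   finally show ?case using compl(2) tot by simp
  next
   case (union A)
   have A: "A i \<in> sets borel" for i using union(2) by (auto simp: borel_eq_closed)
   have "set_lebesgue_integral ?M (\<Union>i. A i \<inter> ?S) D = (\<Sum>i. set_lebesgue_integral ?M (A i \<inter> ?S) D)"
   proof (rule lebesgue_integral_countable_add)
    show "A i \<inter> ?S \<in> sets ?M" for i by (rule inM[OF A])
    show "(A i \<inter> ?S) \<inter> (A j \<inter> ?S) = {}" if "i ~= j" for i j
     using union(1) that by (auto simp: disjoint_family_on_def)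
    have "(\<Union>i. A i) \<in> sets borel" using A by auto
    from indint[OF this] show "set_integrable ?M (\<Union>i. A i \<inter> ?S) D" by simp
   qed
   also have "... = 0" by (simp only: union(3) suminf_zero)
   finally have 0: "set_lebesgue_integral ?M (\<Union>i. A i \<inter> ?S) D = 0" .
   have eq: "(\<Union>i. A i) \<inter> ?S = (\<Union>i. A i \<inter> ?S)" by blast
   show ?case unfolding eq by (rule 0)
  qed
  qed
  fix A assume "A \<in> sets ?M"
  then obtain B where "B \<in> sets borel" "A = B \<inter> ?S"
  unfolding sets_sphere_measure by (auto simp: sets_restrict_space)
  then show "set_lebesgue_integral ?M A D = 0" using all by simp
qed

section \<open>Components and multiplier expansions\<close>

lemma reproducing_kernel_eq:
  fixes w :: "complex ^ 'd::finite"
  assumes w: "norm w = 1"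
  shows "reproducing_kernel m n w = on_sphere (\<lambda>z. \<Sum>e\<in>harmonic_basis m n. cnj (e w) * e z)"
proof -
  let ?E = "harmonic_basis m n :: 'd cfun set"
  define k where "k = (\<lambda>z. \<Sum>e\<in>?E. cnj (e w) * e z)"
  have k: "harmpoly m n k" unfolding k_def by (intro harmpoly_sum harmpoly_scale harmonic_basis_harmpoly)
  have int: "(\<integral>z. on_sphere f z * cnj (on_sphere g z) \<partial>sphere_measure) = ip f g" for f g :: "'d cfun"
  unfolding ip_def by (rule sphere_integral_cong) (simp add: on_sphere_def)
  have rep: "h w = ip h k" if h: "harmpoly m n h" for h
  proof -
  have "ip h k = (\<Sum>e\<in>?E. cnj (cnj (e w)) * ip h e)" unfolding k_def
   by (rule ip_integrable_sum_right[OF integrable_bipoly[OF harmpoly_bipoly[OF h]] harmpoly_continuous[OF harmonic_basis_harmpoly]])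
  then show ?thesis using harmonic_basis_expand[OF h w] by (simp add: mult.commute)
  qed
  show ?thesis unfolding reproducing_kernel_def k_def[symmetric]
  proof (rule the_equality)
  show "on_sphere k \<in> sphere_harmonics m n \<and>
    (\<forall>f\<in>sphere_harmonics m n. f w = (\<integral>z. f z * cnj (on_sphere k z) \<partial>sphere_measure))"
   unfolding sphere_harmonics_harmpoly using k w by (auto simp: int rep) (simp_all add: on_sphere_def rep)
  fix Z assume Z: "Z \<in> sphere_harmonics m n \<and>
    (\<forall>f\<in>sphere_harmonics m n. f w = (\<integral>z. f z * cnj (Z z) \<partial>sphere_measure))"
  then obtain h where h: "harmpoly m n h" "Z = on_sphere h" unfolding sphere_harmonics_harmpoly by blast
  have r: "f w = ip f h" if f: "harmpoly m n f" for f
  proof -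
   have "on_sphere f w = (\<integral>z. on_sphere f z * cnj (Z z) \<partial>sphere_measure)"
    using Z f unfolding sphere_harmonics_harmpoly by blast
   then show ?thesis using w unfolding h(2) int by (simp add: on_sphere_def)
  qed
  define D where "D = (\<lambda>z. h z + (-1) * k z)"
  have D: "harmpoly m n D" unfolding D_def by (intro harmpoly_add h(1) harmpoly_scale k)
  note c = harmpoly_continuous[OF D] harmpoly_continuous[OF h(1)] harmpoly_continuous[OF k]
  have "ip D D = ip D h + ip D (\<lambda>z. (-1) * k z)"
   by (subst (2) D_def) (intro ip_add_right continuous_intros c)
  also have "... = 0" using r[OF D] rep[OF D] ip_scale_right[of D "-1" k] by simp
  finally have "D z = 0" if "norm z = 1" for z using ip_self_zero[OF c(1) _ that] by blast
  then show "Z = on_sphere k" unfolding h(2) by (auto simp: D_def on_sphere_def fun_eq_iff)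
  qed
qed

lemma harmonic_component_eq:
  fixes w :: "complex ^ 'd::finite"
  assumes \<phi>: "integrable sphere_measure \<phi>" and w: "norm w = 1"
  shows "harmonic_component m n \<phi> w = (\<Sum>e\<in>harmonic_basis m n. ip \<phi> e * e w)"
proof -
  have "harmonic_component m n \<phi> w = ip \<phi> (\<lambda>z. \<Sum>e\<in>harmonic_basis m n. cnj (e w) * e z)"
  unfolding harmonic_component_def reproducing_kernel_eq[OF w] ip_def
  by (rule sphere_integral_cong) (simp add: on_sphere_def)
  also have "... = (\<Sum>e\<in>harmonic_basis m n. cnj (cnj (e w)) * ip \<phi> e)"
  by (rule ip_integrable_sum_right[OF \<phi> harmpoly_continuous[OF harmonic_basis_harmpoly]])
  finally show ?thesis by (simp add: mult.commute)
qed

lemma has_multiplier_expansion_iff: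
  fixes \<phi> \<psi> :: "'d::finite cfun"
  assumes \<phi>: "integrable sphere_measure \<phi>" and \<psi>: "integrable sphere_measure \<psi>"
  shows "has_multiplier_expansion lam \<phi> \<psi> \<longleftrightarrow> (\<forall>m n. \<forall>e\<in>harmonic_basis m n. ip \<psi> e = lam m n * ip \<phi> e)"
proof
  assume L: "has_multiplier_expansion lam \<phi> \<psi>"
  show "\<forall>m n. \<forall>e\<in>harmonic_basis m n. ip \<psi> e = lam m n * ip \<phi> e"
  proof (intro allI ballI)
  fix m n and e :: "'d cfun" assume e: "e \<in> harmonic_basis m n"
  let ?E = "harmonic_basis m n :: 'd cfun set"
  let ?c = "\<lambda>e. ip \<psi> e - lam m n * ip \<phi> e"
  have c: "continuous_on UNIV e" if "e \<in> ?E" for e by (rule harmpoly_continuous[OF harmonic_basis_harmpoly[OF that]])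
  have z: "(\<Sum>e\<in>?E. ?c e * e w) = 0" if w: "norm w = 1" for w
  proof -
   have "harmonic_component m n \<psi> w = lam m n * harmonic_component m n \<phi> w"
    using L w unfolding has_multiplier_expansion_def by simp
   then show ?thesis unfolding harmonic_component_eq[OF \<phi> w] harmonic_component_eq[OF \<psi> w]
    by (simp add: left_diff_distrib sum_subtractf sum_distrib_left mult.assoc)
  qed
  have "0 = ip (\<lambda>_. 0) e" by (simp add: ip_def)
  also have "... = ip (\<lambda>w. \<Sum>e\<in>?E. ?c e * e w) e" by (rule ip_cong) (simp_all add: z)
  also have "... = (\<Sum>e'\<in>?E. ip (\<lambda>w. ?c e' * e' w) e)" by (intro ip_sum_left continuous_intros c e)
  also have "... = (\<Sum>e'\<in>?E. if e' = e then ?c e else 0)"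
   by (intro sum.cong refl) (simp add: ip_scale_left harmonic_basis_ip[OF _ e])
  also have "... = ?c e" using e by (simp add: sum.delta[OF finite_harmonic_basis])
  finally show "ip \<psi> e = lam m n * ip \<phi> e" by simp
  qed
next
  assume "\<forall>m n. \<forall>e\<in>harmonic_basis m n. ip \<psi> e = lam m n * ip \<phi> e"
  then show "has_multiplier_expansion lam \<phi> \<psi>" unfolding has_multiplier_expansion_def
  by (auto simp: harmonic_component_eq[OF \<phi>] harmonic_component_eq[OF \<psi>] sum_distrib_left mult.assoc)
qed

section \<open>Bessel's inequality and extension of finite families\<close>

lemma bessel:
  fixes \<phi> :: "'d::finite cfun"
  assumes \<phi>: "integrable sphere_measure \<phi>" and \<phi>2: "integrable sphere_measure (\<lambda>z. (norm (\<phi> z))\<^sup>2)"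
  and E: "finite E" "orthonormal E" "\<And>e. e \<in> E ==> continuous_on UNIV e"
  shows "(\<Sum>e\<in>E. (norm (ip \<phi> e))\<^sup>2) <= spint (\<lambda>z. (norm (\<phi> z))\<^sup>2)"
proof -
  define s where "s = (\<lambda>z. \<Sum>e\<in>E. ip \<phi> e * e z)"
  let ?q = "\<Sum>e\<in>E. (norm (ip \<phi> e))\<^sup>2"
  have sc: "continuous_on UNIV s" unfolding s_def by (intro continuous_intros E(3))
  have c: "(\<Sum>e\<in>E. cnj (ip \<phi> e) * ip \<phi> e) = of_real ?q"
  by (simp only: of_real_sum complex_norm_square mult.commute)
  have 1: "ip \<phi> s = of_real ?q"
  unfolding s_def using ip_integrable_sum_right[OF \<phi>, of E "\<lambda>e. e" "ip \<phi>"] E(3) c by simp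
  have se: "ip s e = ip \<phi> e" if e: "e \<in> E" for e
  proof -
  have "ip s e = (\<Sum>e'\<in>E. ip (\<lambda>z. ip \<phi> e' * e' z) e)"
   unfolding s_def by (intro ip_sum_left continuous_intros E(3) e)
  also have "... = (\<Sum>e'\<in>E. if e' = e then ip \<phi> e else 0)"
   by (intro sum.cong refl) (use E(2) e in \<open>auto simp: ip_scale_left orthonormal_def\<close>)
  also have "... = ip \<phi> e" using e E(1) by simp
  finally show ?thesis .
  qed
  have 2: "ip s s = of_real ?q"
  proof -
  have "ip s s = (\<Sum>e\<in>E. cnj (ip \<phi> e) * ip s e)"
   using ip_integrable_sum_right[OF integrable_sphere_continuous[OF sc], of E "\<lambda>e. e" "ip \<phi>"] E(3)
   by (simp add: s_def)
  then show ?thesis using se c by simp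
  qed
  have int: "integrable sphere_measure (\<lambda>z. \<phi> z * cnj (s z))"
  by (intro integrable_mult_continuous[OF \<phi>] continuous_intros sc)
  have 3: "spint (\<lambda>z. Re (\<phi> z * cnj (s z))) = ?q"
  proof -
  have "sint (\<lambda>z. \<phi> z * cnj (s z)) = of_real ?q" using 1 unfolding ip_def[of \<phi> s] .
  then show ?thesis by (simp only: integral_Re[OF int] Re_complex_of_real)
  qed
  have 4: "spint (\<lambda>z. (norm (s z))\<^sup>2) = ?q"
  using 2 unfolding ip_self by (simp only: of_real_eq_iff)
  have id: "(norm (a - b))\<^sup>2 = (norm a)\<^sup>2 - 2 * Re (a * cnj b) + (norm b)\<^sup>2" for a b :: complex
  by (simp only: cmod_power2) (simp add: power2_eq_square algebra_simps)
  have "0 <= spint (\<lambda>z. (norm (\<phi> z - s z))\<^sup>2)" by simp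
  also have "... = spint (\<lambda>z. (norm (\<phi> z))\<^sup>2 - 2 * Re (\<phi> z * cnj (s z)) + (norm (s z))\<^sup>2)"
  by (simp only: id)
  also have "... = spint (\<lambda>z. (norm (\<phi> z))\<^sup>2) - 2 * ?q + ?q"
  proof -
  have i1: "integrable sphere_measure (\<lambda>z. 2 * Re (\<phi> z * cnj (s z)))"
   by (intro integrable_mult_right integrable_Re int)
  have i2: "integrable sphere_measure (\<lambda>z. (norm (s z))\<^sup>2)"
   by (intro integrable_sphere_continuous continuous_intros sc)
  show ?thesis
   unfolding Bochner_Integration.integral_add[OF Bochner_Integration.integrable_diff[OF \<phi>2 i1] i2]
    Bochner_Integration.integral_diff[OF \<phi>2 i1] integral_mult_right_zero 3 4 ..
  qed
  finally show ?thesis by simp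
qed

lemma harmonic_basis_power_nonempty: "harmonic_basis m 0 ~= ({} :: 'd::finite cfun set)"
proof
  assume 0: "harmonic_basis m 0 = ({} :: 'd cfun set)"
  define j where "j = (undefined :: 'd)"
  have b: "bipoly m 0 (\<lambda>z :: complex^'d. (z $ j) ^ m)"
  proof (induction m)
  case 0
  then show ?case using bipoly_const[of 1] by simp
  next
  case (Suc m)
  from bipoly_z[OF this, of j] show ?case by simp
  qed
  then have "harmpoly m 0 (\<lambda>z :: complex^'d. (z $ j) ^ m)"
  using Lap_bipoly(2)[OF b] by (simp add: harmpoly_def)
  moreover have "norm (axis j 1 :: complex^'d) = 1" by (simp add: norm_eq_1 inner_axis_axis)
  ultimately have "((axis j 1 :: complex^'d) $ j) ^ m = (\<Sum>e\<in>harmonic_basis m 0. ip (\<lambda>z. (z $ j) ^ m) e * e (axis j 1))"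
  by (rule harmonic_basis_expand)
  then show False unfolding 0 by simp
qed

text \<open>A width refers to subspaces of dimension exactly \<open>k\<close>, so a smaller family
  must be completed. The holomorphic harmonics supply arbitrarily many orthonormal functions; the
  extended family has at least \<open>k\<close> members because it expands \<open>k\<close> of
  them.\<close>
lemma extend_to_independent:
  fixes F :: "'d::finite cfun set"
  assumes F: "finite F" "card F <= k" "\<And>f. f \<in> F ==> continuous_on UNIV f"
  shows "\<exists>b :: nat => 'd cfun. (\<forall>i<k. continuous_on UNIV (b i)) \<and>
  (\<forall>c :: nat => complex. (AE x in sphere_measure. (\<Sum>i<k. c i * b i x) = 0) --> (\<forall>i<k. c i = 0)) \<and>
  (\<forall>f\<in>F. \<exists>c. \<forall>z. norm z = 1 --> f z = (\<Sum>i<k. c i * b i z))"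
proof -
  let ?V = "\<lambda>f :: 'd cfun. continuous_on UNIV f"
  have V: "?V f ==> ?V f" "?V f ==> ?V g ==> ?V (\<lambda>z. f z + g z)" "?V f ==> ?V (\<lambda>z. c * f z)" for f g c
  by (auto intro: continuous_intros)
  have oe: "orthonormal {}" by (simp add: orthonormal_def)
  have "\<exists>E. {} \<subseteq> E \<and> finite E \<and> card E <= card ({} :: 'd cfun set) + card F \<and> (\<forall>e\<in>E. ?V e)
   \<and> orthonormal E \<and> (\<forall>f\<in>F. \<forall>z. norm z = 1 --> f z = (\<Sum>e\<in>E. ip f e * e z))"
  by (rule gram_schmidt[of ?V "{}" F, OF V finite.emptyI oe _ F(1,3)]) (simp_all only: empty_iff)
  then obtain E where E: "finite E" "card E <= card F" "\<And>e. e \<in> E ==> ?V e" "orthonormal E"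
  "\<And>f z. f \<in> F ==> norm z = 1 ==> f z = (\<Sum>e\<in>E. ip f e * e z)" by (elim exE conjE) simp
  have "\<forall>m. \<exists>p. p \<in> (harmonic_basis m 0 :: 'd cfun set)" using harmonic_basis_power_nonempty by blast
  then obtain p :: "nat => 'd cfun" where p: "\<And>m. p m \<in> harmonic_basis m 0" by metis
  have pc: "?V (p m)" for m by (rule harmpoly_continuous[OF harmonic_basis_harmpoly[OF p]])
  have pip: "ip (p m) (p m') = (if m = m' then 1 else 0)" for m m'
  proof (cases "m = m'")
  case True
  then show ?thesis using harmonic_basis_ip[OF p p, of m m'] by simp
  next
  case False
  then show ?thesis using harmpoly_orthogonal[OF harmonic_basis_harmpoly[OF p] harmonic_basis_harmpoly[OF p], of m m'] by simp
  qed
  have pinj: "inj p"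
  proof (rule injI)
  fix m m' assume "p m = p m'"
  then show "m = m'" using pip[of m m'] pip[of m m] by (auto split: if_splits)
  qed
  let ?P = "p ` {..<k}"
  have Pon: "orthonormal ?P" unfolding orthonormal_def using pip pinj by (auto simp: inj_eq)
  have Pc: "?V f" if "f \<in> ?P" for f using that pc by blast
  have Pfin: "finite ?P" by simp
  have "\<exists>E'. E \<subseteq> E' \<and> finite E' \<and> card E' <= card E + card ?P \<and> (\<forall>e\<in>E'. ?V e)
   \<and> orthonormal E' \<and> (\<forall>f\<in>?P. \<forall>z. norm z = 1 --> f z = (\<Sum>e\<in>E'. ip f e * e z))"
  by (rule gram_schmidt[of ?V E ?P, OF V E(1,4,3) Pfin Pc])
  then obtain E' where E': "E \<subseteq> E'" "finite E'" "\<And>e. e \<in> E' ==> ?V e" "orthonormal E'"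
  "\<And>f z. f \<in> ?P ==> norm z = 1 ==> f z = (\<Sum>e\<in>E'. ip f e * e z)" by (elim exE conjE) blast
  have "k <= card E'"
  proof -
  have 1: "(\<Sum>e\<in>E'. (norm (ip f e))\<^sup>2) = 1" if f: "f \<in> ?P" for f
  proof -
   have "1 = ip f f" using f pip by auto
   also have "... = ip (\<lambda>z. \<Sum>e\<in>E'. ip f e * e z) f" by (rule ip_cong) (use E'(5)[OF f] in auto)
   also have "... = (\<Sum>e\<in>E'. ip (\<lambda>z. ip f e * e z) f)"
    by (intro ip_sum_left continuous_intros E'(3) Pc[OF f])
   also have "... = (\<Sum>e\<in>E'. ip f e * cnj (ip f e))"
    by (intro sum.cong refl) (simp only: ip_scale_left ip_cnj[of _ f])
   also have "... = of_real (\<Sum>e\<in>E'. (norm (ip f e))\<^sup>2)" by (simp only: complex_norm_square of_real_sum)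
   finally show ?thesis by (metis of_real_eq_1_iff)
  qed
  have 2: "(\<Sum>f\<in>?P. (norm (ip f e))\<^sup>2) <= 1" if e: "e \<in> E'" for e
  proof -
   have "(\<Sum>f\<in>?P. (norm (ip e f))\<^sup>2) <= spint (\<lambda>z. (norm (e z))\<^sup>2)"
    by (intro bessel integrable_sphere_continuous continuous_intros E'(3) e Pfin Pon Pc)
   moreover have "ip e e = 1" using E'(4) e by (simp add: orthonormal_def)
   then have "spint (\<lambda>z. (norm (e z))\<^sup>2) = 1" unfolding ip_self by (simp only: of_real_eq_1_iff)
   moreover have "norm (ip e f) = norm (ip f e)" for f unfolding ip_cnj[of e f] by simp
   ultimately show ?thesis by simp
  qed
  have "real k = (\<Sum>f\<in>?P. \<Sum>e\<in>E'. (norm (ip f e))\<^sup>2)"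
   using 1 by (simp add: card_image[OF inj_on_subset[OF pinj]])
  also have "... = (\<Sum>e\<in>E'. \<Sum>f\<in>?P. (norm (ip f e))\<^sup>2)" by (rule sum.swap)
  also have "... <= (\<Sum>e\<in>E'. 1)" by (intro sum_mono 2)
  finally show ?thesis by simp
  qed
  then obtain E'' where E'': "E \<subseteq> E''" "E'' \<subseteq> E'" "card E'' = k"
  using exists_subset_between[of E k E'] E(2) F(2) E'(1,2) by auto
  have fE'': "finite E''" using E''(2) E'(2) finite_subset by blast
  then obtain b where b: "bij_betw b {..<k} E''" using ex_bij_betw_nat_finite[OF fE''] E''(3) by (auto simp: atLeast0LessThan)
  have bE: "b i \<in> E''" if "i < k" for i using b that bij_betwE by blast
  have bip: "ip (b i) (b j) = (if i = j then 1 else 0)" if "i < k" "j < k" for i j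
  proof -
  have "ip (b i) (b j) = (if b i = b j then 1 else 0)"
   using E'(4) bE[OF that(1)] bE[OF that(2)] E''(2) unfolding orthonormal_def by blast
  also have "(b i = b j) = (i = j)" using b that by (auto simp: bij_betw_def inj_on_def)
  finally show ?thesis .
  qed
  have bc: "?V (b i)" if "i < k" for i using bE[OF that] E''(2) E'(3) by blast
  show ?thesis
  proof (intro exI[of _ b] conjI allI impI ballI)
  show "?V (b i)" if "i < k" for i by (rule bc[OF that])
  show "c i = 0" if ae: "AE x in sphere_measure. (\<Sum>i<k. c i * b i x) = 0" and i: "i < k" for c i
  proof -
   let ?s = "\<lambda>z. \<Sum>i<k. c i * b i z"
   have sc: "?V ?s" by (intro continuous_intros bc) simp
   have "ip ?s (b i) = (\<Sum>j<k. ip (\<lambda>z. c j * b j z) (b i))"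
    by (intro ip_sum_left continuous_intros bc i) simp
   also have "... = (\<Sum>j<k. if j = i then c i else 0)"
    by (intro sum.cong refl) (simp add: ip_scale_left bip i)
   also have "... = c i" using i by simp
   finally have "ip ?s (b i) = c i" .
   moreover have "ip ?s (b i) = sint (\<lambda>_::complex^'d. 0)" unfolding ip_def
   proof (rule integral_cong_AE)
    show "(\<lambda>z. ?s z * cnj (b i z)) \<in> borel_measurable sphere_measure"
     by (intro borel_measurable_sphere borel_measurable_continuous_onI continuous_intros sc bc i)
    show "AE z in sphere_measure. ?s z * cnj (b i z) = 0" using ae by eventually_elim simp
   qed simp
   ultimately show ?thesis by simp
  qed
  fix f assume f: "f \<in> F"
  have "f z = (\<Sum>i<k. (if b i \<in> E then ip f (b i) else 0) * b i z)" if z: "norm z = 1" for z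
  proof -
   have "f z = (\<Sum>e\<in>E''. (if e \<in> E then ip f e else 0) * e z)"
    unfolding E(5)[OF f z] by (rule sum.mono_neutral_cong_left[OF fE'' E''(1)]) auto
   also have "... = (\<Sum>i<k. (if b i \<in> E then ip f (b i) else 0) * b i z)"
    by (rule sum.reindex_bij_betw[OF b, symmetric])
   finally show ?thesis .
  qed
  then show "\<exists>c. \<forall>z. norm z = 1 --> f z = (\<Sum>i<k. c i * b i z)"
   by (intro exI[of _ "\<lambda>i. if b i \<in> E then ip f (b i) else 0"] allI impI)
  qed
qed

section \<open>Multiplier operators as series\<close>

definition level_part :: "nat => 'd::finite cfun => 'd cfun" where
  "level_part l \<phi> z = (\<Sum>e\<in>level l. ip \<phi> e * e z)"

text \<open>The projection onto a level is an integral operator, and by Cauchy-Schwarz its kernel is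
  nowhere larger than on the diagonal.\<close>
lemma level_part_bound:
  fixes \<phi> :: "'d::finite cfun"
  assumes \<phi>: "integrable sphere_measure \<phi>" and z: "norm z = 1"
  shows "norm (level_part l \<phi> z) <= spint (\<lambda>x. norm (\<phi> x))
  * (real (card (level l :: 'd cfun set)) / sphere_area TYPE('d))"
proof -
  let ?L = "level l :: 'd cfun set"
  let ?K = "real (card ?L) / sphere_area TYPE('d)"
  have int: "integrable sphere_measure (\<lambda>x. \<phi> x * cnj (e x))" if "e \<in> ?L" for e
  by (intro integrable_mult_continuous[OF \<phi>] continuous_intros level_continuous[OF that])
  have "level_part l \<phi> z = sint (\<lambda>x. \<phi> x * (\<Sum>e\<in>?L. cnj (e x) * e z))"
  proof -
  have "sint (\<lambda>x. \<phi> x * (\<Sum>e\<in>?L. cnj (e x) * e z)) = sint (\<lambda>x. \<Sum>e\<in>?L. \<phi> x * cnj (e x) * e z)"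
   by (simp add: sum_distrib_left mult.assoc)
  also have "... = (\<Sum>e\<in>?L. sint (\<lambda>x. \<phi> x * cnj (e x) * e z))"
   by (intro Bochner_Integration.integral_sum integrable_mult_left int)
  finally show ?thesis by (simp add: level_part_def ip_def)
  qed
  also have "norm \<dots> <= spint (\<lambda>x. norm (\<phi> x * (\<Sum>e\<in>?L. cnj (e x) * e z)))"
  by (rule Bochner_Integration.integral_norm_bound)
  also have "... <= spint (\<lambda>x. norm (\<phi> x) * ?K)"
  proof (rule integral_mono)
  show "integrable sphere_measure (\<lambda>x. norm (\<phi> x * (\<Sum>e\<in>?L. cnj (e x) * e z)))"
   by (intro integrable_norm integrable_mult_continuous[OF \<phi>] continuous_intros level_continuous)
  show "integrable sphere_measure (\<lambda>x. norm (\<phi> x) * ?K)" using \<phi> by simp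
  fix x :: "complex^'d" assume "x \<in> space sphere_measure"
  then have x: "norm x = 1" by (simp add: space_sphere_measure)
  have "norm (\<Sum>e\<in>?L. cnj (e x) * e z) <= (\<Sum>e\<in>?L. \<bar>norm (e x)\<bar> * \<bar>norm (e z)\<bar>)"
   by (rule order_trans[OF norm_sum]) (simp add: norm_mult)
  also have "... <= L2_set (\<lambda>e. norm (e x)) ?L * L2_set (\<lambda>e. norm (e z)) ?L" by (rule L2_set_mult_ineq)
  also have "... = ?K" using sphere_measure_pos[where 'a = "complex^'d"] by (simp add: L2_set_def level_diag[OF x] level_diag[OF z])
  finally have "norm (\<Sum>e\<in>?L. cnj (e x) * e z) <= ?K" .
  then show "norm (\<phi> x * (\<Sum>e\<in>?L. cnj (e x) * e z)) <= norm (\<phi> x) * ?K"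
   unfolding norm_mult by (rule mult_left_mono[OF _ norm_ge_zero])
  qed
  also have "... = spint (\<lambda>x. norm (\<phi> x)) * ?K" by simp
  finally show ?thesis .
qed

lemma level_part_continuous: "continuous_on UNIV (level_part l \<phi>)"
  unfolding level_part_def by (intro continuous_intros level_continuous)

lemma ip_level_part:
  assumes e: "e \<in> level l'"
  shows "ip (level_part l \<phi>) e = (if l = l' then ip \<phi> e else 0)"
proof -
  have "ip (level_part l \<phi>) e = (\<Sum>e'\<in>level l. ip (\<lambda>z. ip \<phi> e' * e' z) e)"
  unfolding level_part_def by (intro ip_sum_left continuous_intros level_continuous[OF e]) (rule level_continuous)
  also have "... = (\<Sum>e'\<in>level l. if e' = e then ip \<phi> e else 0)"
  by (intro sum.cong refl) (simp add: ip_scale_left level_ip[OF _ e])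
  also have "... = (if e \<in> level l then ip \<phi> e else 0)" by (simp add: sum.delta[OF finite_level])
  also have "(e \<in> level l) = (l = l')" using e level_disjoint[of l l'] by blast
  finally show ?thesis .
qed

lemma Lp_space_1: "f \<in> Lp_space M 1 \<longleftrightarrow> integrable M f"
  unfolding Lp_space_def Lp_norm_def by (auto simp: integrable_iff_bounded less_top Let_def split: if_splits)

definition multiplier_series :: "(nat => real) => 'd::finite cfun => 'd cfun" where
  "multiplier_series lam \<phi> z = (\<Sum>l. of_real (lam l) * level_part l \<phi> z)"

lemma multiplier_series_facts:
  fixes \<phi> :: "'d::finite cfun"
  assumes \<phi>: "integrable sphere_measure \<phi>" and nn: "\<And>l. lam l >= 0"
  and sm: "summable (\<lambda>l. lam l * real (card (level l :: 'd cfun set)))"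
  shows "integrable sphere_measure (multiplier_series lam \<phi>)" (is ?A)
  and "\<And>e l. e \<in> level l ==> ip (multiplier_series lam \<phi>) e = of_real (lam l) * ip \<phi> e" (is "\<And>e l. _ ==> ?B e l")
  and "\<And>z. norm z = 1 ==> summable (\<lambda>l. norm (of_real (lam l) * level_part l \<phi> z))" (is "\<And>z. _ ==> ?C z")
proof -
  let ?I = "spint (\<lambda>x. norm (\<phi> x))"
  let ?a = "\<lambda>l. ?I / sphere_area TYPE('d) * (lam l * real (card (level l :: 'd cfun set)))"
  have sma: "summable ?a" by (rule summable_mult[OF sm])
  have bd: "norm (of_real (lam l) * level_part l \<phi> z) <= ?a l" if z: "norm z = 1" for l z
  proof -
  have "norm (of_real (lam l) * level_part l \<phi> z) = lam l * norm (level_part l \<phi> z)" using nn by (simp add: norm_mult)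
  also have "... <= lam l * (?I * (real (card (level l :: 'd cfun set)) / sphere_area TYPE('d)))"
   by (intro mult_left_mono level_part_bound \<phi> z nn)
  finally show ?thesis by (simp add: field_simps)
  qed
  show C: "?C z" if "norm z = 1" for z by (rule summable_comparison_test'[OF sma]) (use bd[OF that] in simp)
  have contl: "continuous_on UNIV (\<lambda>z. of_real (lam l) * level_part l \<phi> z)" for l
  by (intro continuous_intros level_part_continuous)
  have meas: "multiplier_series lam \<phi> \<in> borel_measurable sphere_measure"
  unfolding multiplier_series_def
  by (intro borel_measurable_suminf borel_measurable_sphere borel_measurable_continuous_onI contl)
  show ?A
  proof (rule integrable_sphere_bounded[OF meas])
  fix z :: "complex^'d" assume z: "norm z = 1"
  have "norm (multiplier_series lam \<phi> z) <= (\<Sum>l. norm (of_real (lam l) * level_part l \<phi> z))"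
   unfolding multiplier_series_def by (rule summable_norm[OF C[OF z]])
  also have "... <= suminf ?a" by (rule suminf_le[OF bd[OF z] C[OF z] sma])
  finally show "norm (multiplier_series lam \<phi> z) <= suminf ?a" .
  qed
  show "?B e l" if e: "e \<in> level l" for e l
  proof -
  have ec: "continuous_on UNIV e" by (rule level_continuous[OF e])
  obtain B where B: "B >= 0" "\<And>x. norm x = 1 ==> norm (e x) <= B" using continuous_bounded_sphere[OF ec] by blast
  let ?f = "\<lambda>l z. of_real (lam l) * level_part l \<phi> z * cnj (e z)"
  have fb: "norm (?f l z) <= ?a l * B" if "norm z = 1" for l z
   using mult_mono[OF bd[OF that, of l] B(2)[OF that]] B(1) order_trans[OF norm_ge_zero bd[OF that, of l]]
   by (simp add: norm_mult)
  have fi: "integrable sphere_measure (?f l)" for l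
   by (intro integrable_sphere_continuous continuous_intros contl ec level_part_continuous)
  have smB: "summable (\<lambda>l. ?a l * B)" by (rule summable_mult2[OF sma])
  have "ip (multiplier_series lam \<phi>) e = sint (\<lambda>z. \<Sum>l. ?f l z)"
   unfolding ip_def multiplier_series_def
   by (rule sphere_integral_cong) (rule suminf_mult2[OF summable_norm_cancel[OF C]])
  also have "... = (\<Sum>l. sint (?f l))"
  proof (rule integral_suminf[OF fi])
   show "AE z in sphere_measure. summable (\<lambda>l. norm (?f l z))"
    by (intro AE_I2 summable_comparison_test'[OF smB]) (use fb in \<open>auto simp: space_sphere_measure\<close>)
   show "summable (\<lambda>l. spint (\<lambda>z. norm (?f l z)))"
   proof (rule summable_comparison_test')
    show "summable (\<lambda>l. ?a l * B * sphere_area TYPE('d))" by (rule summable_mult2[OF smB])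
    fix l
    have "spint (\<lambda>z. norm (?f l z)) <= spint (\<lambda>z::complex^'d. ?a l * B)"
     by (rule integral_mono[OF integrable_norm[OF fi]]) (use fb in \<open>auto simp: space_sphere_measure\<close>)
    also have "... = ?a l * B * sphere_area TYPE('d)" by (simp add: space_sphere_measure)
    finally show "norm (spint (\<lambda>z. norm (?f l z))) <= ?a l * B * sphere_area TYPE('d)" by simp
   qed
  qed
  also have "(\<lambda>l. sint (?f l)) = (\<lambda>l'. if l' = l then of_real (lam l) * ip \<phi> e else 0)"
  proof
   fix l'
   have "sint (?f l') = ip (\<lambda>z. of_real (lam l') * level_part l' \<phi> z) e" by (simp add: ip_def)
   then show "sint (?f l') = (if l' = l then of_real (lam l) * ip \<phi> e else 0)"
    by (simp add: ip_scale_left ip_level_part[OF e])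
  qed
  also have "(\<Sum>l'. if l' = l then of_real (lam l) * ip \<phi> e else 0) = of_real (lam l) * ip \<phi> e"
   by (rule sums_unique[symmetric]) (rule sums_single)
  finally show ?thesis .
  qed
qed

text \<open>Both functions are integrable and have the same components, so completeness applies to
  their difference.\<close>
lemma multiplier_operator_AE:
  fixes \<phi> :: "'d::finite cfun"
  assumes \<phi>: "integrable sphere_measure \<phi>" and nn: "\<And>l. lam l >= 0"
  and sm: "summable (\<lambda>l. lam l * real (card (level l :: 'd cfun set)))"
  and L: "\<And>m n. L m n = of_real (lam (m + n))"
  shows "AE z in sphere_measure. multiplier_operator L \<phi> z = multiplier_series lam \<phi> z"
  and "multiplier_operator L \<phi> \<in> borel_measurable sphere_measure"
proof -
  note F = multiplier_series_facts[OF \<phi> nn sm]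
  have hb: "harmonic_basis m n \<subseteq> (level (m + n) :: 'd cfun set)" for m n
  unfolding level_def by (intro subsetI UN_I[of m]) auto
  have "has_multiplier_expansion L \<phi> (multiplier_series lam \<phi>)"
  unfolding has_multiplier_expansion_iff[OF \<phi> F(1)] L using F(2) hb by blast
  then have "\<exists>\<psi>. \<psi> \<in> Lp_space sphere_measure 1 \<and> has_multiplier_expansion L \<phi> \<psi>"
  using F(1) unfolding Lp_space_1 by blast
  from someI_ex[OF this] have op': "multiplier_operator L \<phi> \<in> Lp_space sphere_measure 1 \<and>
   has_multiplier_expansion L \<phi> (multiplier_operator L \<phi>)" unfolding multiplier_operator_def .
  have op: "integrable sphere_measure (multiplier_operator L \<phi>)"
  "has_multiplier_expansion L \<phi> (multiplier_operator L \<phi>)" using op' unfolding Lp_space_1 by blast+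
  show "multiplier_operator L \<phi> \<in> borel_measurable sphere_measure" using op(1) by simp
  let ?D = "\<lambda>z. multiplier_operator L \<phi> z - multiplier_series lam \<phi> z"
  have "AE z in sphere_measure. ?D z = 0"
  proof (rule orthogonal_to_all_zero)
  show "integrable sphere_measure ?D" by (intro Bochner_Integration.integrable_diff op(1) F(1))
  fix N and e :: "'d cfun" assume "e \<in> upto_level N"
  then obtain l m where e: "m <= l" "e \<in> harmonic_basis m (l - m)" "e \<in> level l"
   unfolding upto_level_def level_def by blast
  have ec: "continuous_on UNIV (\<lambda>z. cnj (e z))" by (intro continuous_intros level_continuous[OF e(3)])
  have "ip ?D e = ip (multiplier_operator L \<phi>) e - ip (multiplier_series lam \<phi>) e"
   unfolding ip_def left_diff_distrib
   by (intro Bochner_Integration.integral_diff integrable_mult_continuous op(1) F(1) ec)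
  also have "ip (multiplier_operator L \<phi>) e = L m (l - m) * ip \<phi> e"
   using op(2) e(2) unfolding has_multiplier_expansion_iff[OF \<phi> op(1)] by blast
  also have "L m (l - m) = of_real (lam l)" unfolding L using e(1) by simp
  finally show "ip ?D e = 0" using F(2)[OF e(3)] by simp
  qed
  then show "AE z in sphere_measure. multiplier_operator L \<phi> z = multiplier_series lam \<phi> z" by simp
qed

section \<open>Sums of stretched exponentials and the choice of the degree\<close>

text \<open>The function \<open>exp (-\<gamma> x^r) x^(D-r)\<close> is eventually decreasing, and
  its derivative dominates the summand: the sum telescopes.\<close>
lemma stretched_exp_tail:
  fixes \<gamma> r :: real and D :: nat
  assumes \<gamma>: "\<gamma> > 0" and r: "0 < r" "r <= 1" and D: "D >= 1"
  shows "\<exists>C>0. \<exists>N0\<ge>1. \<forall>N\<ge>N0. \<forall>L. (\<Sum>l\<in>{N<..L}. exp (- \<gamma> * real l powr r) * (real l + 1) ^ (D - 1))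
  <= C * (exp (- \<gamma> * real N powr r) * real N powr (real D - r))"
proof -
  define G where "G = (\<lambda>x. exp (- \<gamma> * x powr r) * x powr (real D - r))"
  define C where "C = 2 * 3 ^ (D - 1) / (\<gamma> * r)"
  have C: "C > 0" unfolding C_def using \<gamma> r by (intro divide_pos_pos mult_pos_pos) auto
  define x0 where "x0 = max 1 ((2 * (real D - r) / (\<gamma> * r)) powr (1 / r))"
  obtain N0 :: nat where N0: "real N0 >= x0" "N0 >= 1" 
  using real_arch_simple[of x0] unfolding x0_def by (metis max.bounded_iff of_nat_1 of_nat_le_iff)
  have Dr: "real D - r >= 0" using D r by linarith
  have xr: "(real D - r) * x powr (- r) <= \<gamma> * r / 2" if x: "x >= x0" for x
  proof -
  let ?q = "2 * (real D - r) / (\<gamma> * r)"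
  have q0: "?q >= 0" using Dr \<gamma> r by simp
  have x1: "x > 0" "x >= ?q powr (1 / r)" using x by (auto simp: x0_def)
  have "?q = (?q powr (1 / r)) powr r" unfolding powr_powr using q0 r by (simp only: nonzero_divide_eq_eq[OF less_imp_neq[OF r(1), symmetric]] powr_one times_divide_eq_left mult_1 divide_self[OF less_imp_neq[OF r(1), symmetric]])
  also have "... <= x powr r" using x1 r by (intro powr_mono2) auto
  finally have "?q <= x powr r" .
  then have "real D - r <= \<gamma> * r / 2 * x powr r" using \<gamma> r by (simp add: field_simps)
  then have "(real D - r) * x powr (- r) <= (\<gamma> * r / 2 * x powr r) * x powr (- r)"
   by (intro mult_right_mono) auto
  also have "... = \<gamma> * r / 2" using x1 by (simp add: powr_minus)
  finally show ?thesis .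
  qed
  define G' where "G' = (\<lambda>x. - exp (- \<gamma> * x powr r) * x powr (real D - 1) * (\<gamma> * r - (real D - r) * x powr (- r)))"
  have dG: "(G has_real_derivative G' x) (at x)" if x: "x > 0" for x
  proof -
  have "(G has_real_derivative exp (- \<gamma> * x powr r) * (- \<gamma> * (r * x powr (r - 1))) * x powr (real D - r)
    + exp (- \<gamma> * x powr r) * ((real D - r) * x powr (real D - r - 1))) (at x)"
   unfolding G_def using x by (auto intro!: derivative_eq_intros)
  moreover have a: "x powr (real D - 1) = x powr (r - 1) * x powr (real D - r)"
   unfolding powr_add[symmetric] by (rule arg_cong[where f = "(powr) x"]) simp
  have b: "x powr (real D - r - 1) = x powr (r - 1) * x powr (real D - r) * x powr (- r)"
   unfolding powr_add[symmetric] by (rule arg_cong[where f = "(powr) x"]) simp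
  have "exp (- \<gamma> * x powr r) * (- \<gamma> * (r * x powr (r - 1))) * x powr (real D - r)
    + exp (- \<gamma> * x powr r) * ((real D - r) * x powr (real D - r - 1)) = G' x"
   unfolding G'_def a b by (simp add: algebra_simps)
  ultimately show ?thesis by metis
  qed
  have step: "exp (- \<gamma> * real l powr r) * (real l + 1) ^ (D - 1) <= C * (G (real l - 1) - G (real l))" if l: "l > N0" for l
  proof -
  have l1: "real l - 1 >= x0" "real l - 1 >= 1" using l N0 by (auto simp: x0_def)
  obtain \<xi> where xi: "real l - 1 < \<xi>" "\<xi> < real l" "G (real l) - G (real l - 1) = (real l - (real l - 1)) * G' \<xi>"
   using MVT2[of "real l - 1" "real l" G G'] dG l1 by auto
  have xi0: "\<xi> >= x0" "\<xi> > 0" using xi l1 by auto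
  have "\<gamma> * r / 2 * (exp (- \<gamma> * real l powr r) * ((real l + 1) / 3) ^ (D - 1))
   <= \<gamma> * r / 2 * (exp (- \<gamma> * \<xi> powr r) * \<xi> powr (real D - 1))"
  proof (intro mult_left_mono mult_mono)
   show "exp (- \<gamma> * real l powr r) <= exp (- \<gamma> * \<xi> powr r)"
    using \<gamma> xi xi0 r by (simp add: powr_mono2)
   have "((real l + 1) / 3) ^ (D - 1) <= \<xi> ^ (D - 1)" using xi l1 by (intro power_mono) auto
   also have "... = \<xi> powr (real D - 1)" using xi0 D by (simp add: powr_realpow[symmetric] of_nat_diff)
   finally show "((real l + 1) / 3) ^ (D - 1) <= \<xi> powr (real D - 1)" .
  qed (use \<gamma> r in auto)
  also have "... <= (\<gamma> * r - (real D - r) * \<xi> powr (- r)) * (exp (- \<gamma> * \<xi> powr r) * \<xi> powr (real D - 1))"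
   using xr[OF xi0(1)] by (intro mult_right_mono) auto
  also have "... = G (real l - 1) - G (real l)" using xi(3) by (simp add: G'_def algebra_simps)
  finally have *: "\<gamma> * r / 2 * (exp (- \<gamma> * real l powr r) * ((real l + 1) / 3) ^ (D - 1)) <= G (real l - 1) - G (real l)" .
  have "exp (- \<gamma> * real l powr r) * (real l + 1) ^ (D - 1)
    = C * (\<gamma> * r / 2 * (exp (- \<gamma> * real l powr r) * ((real l + 1) / 3) ^ (D - 1)))"
   using \<gamma> r by (simp add: C_def power_divide)
  also have "... <= C * (G (real l - 1) - G (real l))" using * C by (intro mult_left_mono) auto
  finally show ?thesis .
  qed
  have sum: "(\<Sum>l\<in>{N<..L}. exp (- \<gamma> * real l powr r) * (real l + 1) ^ (D - 1)) <= C * (G (real N) - G (real (max N L)))"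
  if N: "N >= N0" for N L
  proof (induction L)
  case (Suc L)
  show ?case
  proof (cases "Suc L > N")
   case True
   then have "{N<..Suc L} = insert (Suc L) {N<..L}" by auto
   then have "(\<Sum>l\<in>{N<..Suc L}. exp (- \<gamma> * real l powr r) * (real l + 1) ^ (D - 1))
    = exp (- \<gamma> * real (Suc L) powr r) * (real (Suc L) + 1) ^ (D - 1) + (\<Sum>l\<in>{N<..L}. exp (- \<gamma> * real l powr r) * (real l + 1) ^ (D - 1))"
    by simp
   also have "... <= C * (G (real (Suc L) - 1) - G (real (Suc L))) + C * (G (real N) - G (real (max N L)))"
    using step[of "Suc L"] True N Suc.IH by (intro add_mono) auto
   also have "real (Suc L) - 1 = real (max N L)" using True by simp
   finally show ?thesis using True by (simp add: algebra_simps max_def)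
  next
   case False
   then have "{N<..Suc L} = {}" "max N (Suc L) = N" by auto
   then show ?thesis by simp
  qed
  qed simp
  show ?thesis
  proof (intro exI[of _ C] exI[of _ N0] conjI allI impI)
  fix N L assume N: "N0 <= N"
  have "(\<Sum>l\<in>{N<..L}. exp (- \<gamma> * real l powr r) * (real l + 1) ^ (D - 1)) <= C * (G (real N) - G (real (max N L)))"
   by (rule sum[OF N])
  also have "... <= C * G (real N)" using C by (intro mult_left_mono) (auto simp: G_def)
  finally show "(\<Sum>l\<in>{N<..L}. exp (- \<gamma> * real l powr r) * (real l + 1) ^ (D - 1))
  <= C * (exp (- \<gamma> * real N powr r) * real N powr (real D - r))" by (simp add: G_def)
  qed (use C N0 in auto)
qed

lemma stretched_exp_summable:
  fixes \<gamma> r :: real and D :: nat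
  assumes "\<gamma> > 0" "0 < r" "r <= 1" "D >= 1"
  shows "summable (\<lambda>l. exp (- \<gamma> * real l powr r) * (real l + 1) ^ (D - 1))"
proof -
  let ?f = "\<lambda>l. exp (- \<gamma> * real l powr r) * (real l + 1) ^ (D - 1)"
  obtain C N0 where C: "\<And>L. (\<Sum>l\<in>{N0<..L}. ?f l) <= C * (exp (- \<gamma> * real N0 powr r) * real N0 powr (real D - r))"
  using stretched_exp_tail[OF assms] by blast
  show ?thesis
  proof (rule summableI_nonneg_bounded)
  fix n
  have "(\<Sum>i<n. ?f i) <= (\<Sum>i\<in>{..N0} \<union> {N0<..n}. ?f i)" by (rule sum_mono2) auto
  also have "... = (\<Sum>i\<le>N0. ?f i) + (\<Sum>i\<in>{N0<..n}. ?f i)" by (rule sum.union_disjoint) auto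
  also have "... <= (\<Sum>i\<le>N0. ?f i) + C * (exp (- \<gamma> * real N0 powr r) * real N0 powr (real D - r))"
   using C by simp
  finally show "(\<Sum>i<n. ?f i) <= (\<Sum>i\<le>N0. ?f i) + C * (exp (- \<gamma> * real N0 powr r) * real N0 powr (real D - r))" .
  qed simp
qed

lemma stretched_exp_double:
  fixes \<gamma> r b :: real
  assumes \<gamma>: "\<gamma> > 0" and r: "0 < r" and b: "b >= 0"
  shows "\<exists>C>0. \<forall>x\<ge>1. exp (- \<gamma> * (2 * x) powr r) * (2 * x) powr b <= C * exp (- \<gamma> * x powr r)"
proof -
  define a where "a = \<gamma> * (2 powr r - 1)"
  have "(2::real) powr r > 2 powr 0" using r by (intro powr_less_mono) auto
  then have a: "a > 0" using \<gamma> by (simp add: a_def)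
  obtain m :: nat where m: "b / r <= real m" using real_arch_simple by blast
  define C where "C = 2 powr b * (fact m / a ^ m)"
  show ?thesis
  proof (intro exI[of _ C] conjI allI impI)
  show "C > 0" using a by (simp add: C_def)
  fix x :: real assume x: "x >= 1"
  let ?y = "a * x powr r"
  have xr: "x powr r >= 1" using x r by (simp add: ge_one_powr_ge_zero)
  have "x powr b = (x powr r) powr (b / r)" using r by (simp add: powr_powr)
  also have "... <= (x powr r) powr real m" using xr m by (intro powr_mono) auto
  also have "... = (x powr r) ^ m" using xr by (intro powr_realpow) auto
  also have "... = ?y ^ m / a ^ m" using a by (simp add: power_mult_distrib)
  also have "... <= (fact m * exp ?y) / a ^ m"
  proof -
   have "?y ^ m / fact m <= exp ?y"
   proof -
    have s: "(\<lambda>n. ?y ^ n /\<^sub>R fact n) sums exp ?y" by (rule exp_converges)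
    have "(\<Sum>i\<in>{m}. ?y ^ i /\<^sub>R fact i) <= (\<Sum>i. ?y ^ i /\<^sub>R fact i)"
     using s a by (intro sum_le_suminf) (auto simp: sums_iff)
    then show ?thesis using s by (simp add: sums_iff field_simps)
   qed
   then have "?y ^ m <= fact m * exp ?y" by (simp add: field_simps)
   then show ?thesis using a by (intro divide_right_mono) auto
  qed
  finally have xb: "x powr b <= (fact m / a ^ m) * exp ?y" by simp
  have "exp (- \<gamma> * (2 * x) powr r) * (2 * x) powr b = (2 powr b * exp (- \<gamma> * (2 * x) powr r)) * x powr b"
   using x by (simp add: powr_mult)
  also have "... <= (2 powr b * exp (- \<gamma> * (2 * x) powr r)) * ((fact m / a ^ m) * exp ?y)"
   by (intro mult_left_mono xb) simp
  also have "... = C * (exp (- \<gamma> * (2 * x) powr r) * exp ?y)" by (simp add: C_def)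
  also have "exp (- \<gamma> * (2 * x) powr r) * exp ?y = exp (- \<gamma> * x powr r)"
   using x by (simp add: exp_add[symmetric] a_def powr_mult algebra_simps)
  finally show "exp (- \<gamma> * (2 * x) powr r) * (2 * x) powr b <= C * exp (- \<gamma> * x powr r)" .
  qed
qed

lemma binomial_le_power_fact: "real ((N + D) choose N) <= real (N + D) ^ D / fact D"
proof -
  have "real ((N + D) choose N) = real ((N + D) choose D)" using binomial_symmetric[of N "N + D"] by simp
  moreover have "real (((N + D) choose D) * fact D) <= real ((N + D) ^ D)"
  using binomial_fact_pow[of "N + D" D] of_nat_le_iff by blast
  ultimately show ?thesis by (simp add: field_simps)
qed

text \<open>With \<open>\<kappa>\<close> solving \<open>2 \<kappa>^D / D! = k\<close>, take
  \<open>N\<close> just below \<open>\<kappa> - \<kappa>^(1-r)\<close>. This lowers \<open>N^r\<close>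
  by a bounded amount only, since \<open>\<kappa>^r (1 - \<kappa>^(-r)) = \<kappa>^r - 1\<close>, and
  it frees a multiple of \<open>\<kappa>^(D-r)\<close> dimensions.\<close>
lemma choice_of_degree:
  fixes r :: real and D N0 :: nat
  assumes r: "0 < r" "r <= 1" and D: "D >= 2"
  shows "\<exists>k0 C. C > 0 \<and> (\<forall>k\<ge>k0. \<exists>N k'. N >= N0 \<and> N >= 1 \<and> k' >= 1 \<and> 2 * ((N + D) choose N) + k' <= k
  \<and> (fact D / 2) powr (r / real D) * real k powr (r / real D) <= real N powr r + C
  \<and> real N powr (real D - r) <= C * real k'
  \<and> real N <= C * real k
  \<and> real N powr (real D - r) <= C * real k powr (1 - r / real D))"
proof -
  define F where "F = (fact D :: real)"
  have F1: "F >= 2" unfolding F_def using fact_mono[OF D, where 'a = real] by simp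
  define K0 where "K0 = Max {2 powr (1 / r), 2 * (real D + real N0 + 3), F}"
  have K0: "K0 >= 2 powr (1 / r)" "K0 >= 2 * (real D + real N0 + 3)" "K0 >= F" by (simp_all add: K0_def)
  define k0 where "k0 = nat \<lceil>K0 ^ D\<rceil>"
  define C where "C = Max {real D + 2, F, (F / 2) powr (1 - r / real D)}"
  have C: "C >= real D + 2" "C >= F" "C >= (F / 2) powr (1 - r / real D)" by (simp_all add: C_def)
  show ?thesis
  proof (rule exI[of _ k0], rule exI[of _ C], intro conjI allI impI)
  show C0: "C > 0" using C(2) F1 by linarith
  fix k assume k: "k0 <= k"
  define \<kappa> where "\<kappa> = (real k * F / 2) powr (1 / real D)"
  have kK: "real k >= K0 ^ D" using k unfolding k0_def by linarith
  have K0pos: "K0 >= 2" using K0(3) F1 by linarith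
  have kpos: "real k > 0" using kK K0pos by (metis less_le_trans zero_less_power zero_less_numeral)
  have base: "real k * F / 2 >= real k" "real k * F / 2 > 0" using F1 kpos by (auto simp: field_simps)
  have Dpos: "real D > 0" using D by simp
  have "K0 = (K0 ^ D) powr (1 / real D)" using K0pos Dpos by (simp add: powr_realpow[symmetric] powr_powr)
  also have "... <= \<kappa>" unfolding \<kappa>_def using kK base K0pos by (intro powr_mono2) auto
  finally have kap: "\<kappa> >= K0" .
  have kap0: "\<kappa> > 0" "\<kappa> >= 1" using kap K0pos by auto
  have kapD: "\<kappa> ^ D = real k * F / 2"
  proof -
   have "\<kappa> ^ D = \<kappa> powr real D" using kap0 by (simp add: powr_realpow)
   also have "... = (real k * F / 2) powr 1" unfolding \<kappa>_def powr_powr using Dpos by (simp only: times_divide_eq_left mult_1) simp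
   also have "... = real k * F / 2" using base(2) by (simp only: powr_one)
   finally show ?thesis .
  qed
  have kapp: "\<kappa> powr t = (real k * F / 2) powr (t / real D)" for t unfolding \<kappa>_def by (simp add: powr_powr)
  have kapr2: "\<kappa> powr r >= 2"
  proof -
   have "2 = (2 powr (1 / r)) powr r" using r by (simp add: powr_powr)
   also have "... <= \<kappa> powr r" using kap K0(1) r by (intro powr_mono2) auto
   finally show ?thesis .
  qed
  define u where "u = \<kappa> powr (1 - r)"
  have u: "u * \<kappa> powr r = \<kappa>" unfolding u_def using kap0 by (simp add: powr_add[symmetric])
  have u0: "u > 0" using kap0 by (simp add: u_def)
  have u2: "u <= \<kappa> / 2"
  proof -
   have "u * 2 <= u * \<kappa> powr r" using kapr2 u0 by (intro mult_left_mono) auto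
   then show ?thesis using u by simp
  qed
  define y where "y = \<kappa> - u"
  have y: "y >= \<kappa> / 2" "y <= \<kappa>" using u2 u0 by (auto simp: y_def)
  have ybig: "y >= real D + real N0 + 3" 
  proof -
   have "2 * (real D + real N0 + 3) <= 2 * y" using y(1) kap K0(2) by (simp add: field_simps)
   then show ?thesis by simp
  qed
  define N where "N = nat \<lfloor>y\<rfloor> - D"
  define k' where "k' = nat \<lfloor>2 / F * \<kappa> powr (real D - r)\<rfloor>"
  have fl: "real (nat \<lfloor>y\<rfloor>) <= y" "real (nat \<lfloor>y\<rfloor>) > y - 1" using ybig by linarith+
  have DN: "D <= nat \<lfloor>y\<rfloor>" using fl(2) ybig by linarith
  then have Nr: "real N = real (nat \<lfloor>y\<rfloor>) - real D" by (simp add: N_def of_nat_diff)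
  have N1: "real N + real D <= y" "real N > y - 1 - real D" using Nr fl by auto
  have Nge: "N >= N0" "N >= 1" using N1(2) ybig by linarith+
  have Nkap: "real N <= \<kappa>" using N1(1) y(2) Dpos by linarith
  have Dr1: "real D - r >= 1" using D r by linarith
  let ?x = "2 / F * \<kappa> powr (real D - r)"
  have "\<kappa> powr (real D - r) >= \<kappa> powr 1" using kap0 Dr1 by (intro powr_mono) auto
  then have "\<kappa> powr (real D - r) >= F" using kap0 kap K0(3) by simp
  then have x2: "?x >= 2" using F1 by (simp add: field_simps)
  have "real (nat \<lfloor>X\<rfloor>) <= X \<and> real (nat \<lfloor>X\<rfloor>) >= X / 2" if "X >= 2" for X :: real using that by linarith
  from this[OF x2] have k'b: "real k' <= ?x" "real k' >= ?x / 2" unfolding k'_def by blast+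
  have Npow: "real N powr (real D - r) <= \<kappa> powr (real D - r)" using Nkap Dr1 by (intro powr_mono2) auto
  show "\<exists>N k'. N >= N0 \<and> N >= 1 \<and> k' >= 1 \<and> 2 * ((N + D) choose N) + k' <= k
  \<and> (fact D / 2) powr (r / real D) * real k powr (r / real D) <= real N powr r + C
  \<and> real N powr (real D - r) <= C * real k'
  \<and> real N <= C * real k
  \<and> real N powr (real D - r) <= C * real k powr (1 - r / real D)"
  proof (rule exI[of _ N], rule exI[of _ k'], intro conjI Nge)
   have "X / 2 >= 1" if "X >= 2" for X :: real using that by simp
   from order_trans[OF this[OF x2] k'b(2)] show "k' >= 1" by simp
   have "real (2 * ((N + D) choose N) + k') <= 2 * (real (N + D) ^ D / F) + ?x"
    using binomial_le_power_fact[of N D] k'b(1) unfolding F_def by simp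
   also have "... <= 2 * ((\<kappa> ^ D - u * \<kappa> ^ (D - 1)) / F) + ?x"
   proof -
    have "real (N + D) ^ D <= y ^ D" using N1(1) by (intro power_mono) auto
    also have "... = y * y ^ (D - 1)" using D by (simp add: power_eq_if)
    also have "... <= y * \<kappa> ^ (D - 1)" using y ybig by (intro mult_left_mono power_mono) auto
    also have "... = \<kappa> ^ D - u * \<kappa> ^ (D - 1)" using D by (simp add: y_def left_diff_distrib power_eq_if)
    finally show ?thesis using F1 by (simp add: divide_right_mono)
   qed
   also have "u * \<kappa> ^ (D - 1) = \<kappa> powr (real D - r)"
    unfolding u_def using kap0 D by (simp add: powr_realpow[symmetric] powr_add[symmetric] of_nat_diff)
   also have "2 * ((\<kappa> ^ D - \<kappa> powr (real D - r)) / F) + ?x = 2 * \<kappa> ^ D / F"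
    by (simp add: diff_divide_distrib right_diff_distrib)
   also have "... = real k" using F1 by (simp add: kapD)
   finally show "2 * ((N + D) choose N) + k' <= k" by (simp only: of_nat_le_iff)
   have "(fact D / 2) powr (r / real D) * real k powr (r / real D) = \<kappa> powr r"
    unfolding kapp F_def[symmetric] using F1 kpos by (simp add: powr_mult[symmetric] mult.commute)
   also have "... <= real N powr r + (real D + 2)"
   proof -
    let ?q = "real N / \<kappa>"
    have q: "?q <= 1" "?q > 0" using Nkap kap0 Nge by auto
    have "\<kappa> powr r * ?q = \<kappa> powr (r - 1) * real N" using kap0 by (simp add: powr_diff)
    have "?q powr 1 <= ?q powr r" using q r by (intro powr_mono') auto
    then have "\<kappa> powr r * ?q <= \<kappa> powr r * ?q powr r" using q kap0 by (intro mult_left_mono) auto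
    also have "... = real N powr r" using kap0 q Nge by (simp add: powr_mult[symmetric])
    finally have 1: "\<kappa> powr r * ?q <= real N powr r" .
    have "?q >= (\<kappa> - u - 1 - real D) / \<kappa>" using N1(2) kap0 unfolding y_def by (intro divide_right_mono) auto
    then have "\<kappa> powr r * ?q >= \<kappa> powr r * ((\<kappa> - u - 1 - real D) / \<kappa>)" by (intro mult_left_mono) auto
    moreover have "\<kappa> powr r * ((\<kappa> - u - 1 - real D) / \<kappa>) = \<kappa> powr r - 1 - (1 + real D) * (\<kappa> powr r / \<kappa>)"
     using u kap0 by (simp add: field_simps)
    moreover have "(1 + real D) * (\<kappa> powr r / \<kappa>) <= (1 + real D) * 1"
     using powr_mono[OF r(2) kap0(2)] kap0 by (intro mult_left_mono) auto
    moreover have "a <= n + (d + 2)" if "x <= y" "x = a - 1 - w" "w <= (1 + d) * 1" "y <= n" for a n d x y w :: real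
     using that by (simp add: algebra_simps)
    ultimately show ?thesis using 1 by blast
   qed
   also have "... <= real N powr r + C" using C(1) by simp
   finally show "(fact D / 2) powr (r / real D) * real k powr (r / real D) <= real N powr r + C" .
   have "real N powr (real D - r) <= F * (?x / 2)" using Npow F1 by simp
   also have "... <= F * real k'" using k'b(2) F1 by (intro mult_left_mono) auto
   also have "... <= C * real k'" using C(2) by (intro mult_right_mono) auto
   finally show "real N powr (real D - r) <= C * real k'" .
   have "\<kappa> <= (real k * F / 2) powr 1" unfolding \<kappa>_def
   proof (rule powr_mono)
    have "real k >= 1" using kpos by (simp add: Suc_le_eq)
    then show "1 <= real k * F / 2" using base(1) by linarith
   qed (use D in simp)
   also have "... <= C * real k" using base C(2) F1 kpos by (simp add: field_simps)
   finally show "real N <= C * real k" using Nkap by linarith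
   have "\<kappa> powr (real D - r) = (F / 2) powr (1 - r / real D) * real k powr (1 - r / real D)"
    unfolding kapp using F1 kpos Dpos by (simp add: powr_mult[symmetric] diff_divide_distrib mult.commute)
   also have "... <= C * real k powr (1 - r / real D)" using C(3) by (intro mult_right_mono) auto
   finally show "real N powr (real D - r) <= C * real k powr (1 - r / real D)" using Npow by linarith
  qed
  qed
qed

section \<open>The even Lebesgue norms of continuous functions\<close>

definition even_norm :: "nat => 'd::finite cfun => real" where
  "even_norm s f = root (2 * s) (spint (\<lambda>z. norm (f z) ^ (2 * s)))"

lemma even_norm_nonneg: "s >= 1 ==> even_norm s f >= 0"
  unfolding even_norm_def by (intro real_root_ge_zero) simp

lemma even_norm_power: "s >= 1 ==> even_norm s f ^ (2 * s) = spint (\<lambda>z. norm (f z) ^ (2 * s))"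
  unfolding even_norm_def by (intro real_root_pow_pos2) auto

lemma even_norm_scale:
  assumes "s >= 1" shows "even_norm s (\<lambda>z. of_real c * f z) = \<bar>c\<bar> * even_norm s f"
proof -
  have "even_norm s (\<lambda>z. of_real c * f z) = root (2 * s) (\<bar>c\<bar> ^ (2 * s) * spint (\<lambda>z. norm (f z) ^ (2 * s)))"
  unfolding even_norm_def norm_mult power_mult_distrib integral_mult_right_zero by simp
  also have "... = \<bar>c\<bar> * even_norm s f"
  unfolding even_norm_def real_root_mult using assms by (subst real_root_power_cancel) auto
  finally show ?thesis .
qed

text \<open>Minkowski's inequality from the convexity of the power, after normalising both
  functions.\<close>
lemma even_norm_triangle:
  fixes f g :: "'d::finite cfun"
  assumes s: "s >= 1" and f: "continuous_on UNIV f" and g: "continuous_on UNIV g"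
  shows "even_norm s (\<lambda>z. f z + g z) <= even_norm s f + even_norm s g"
proof (rule field_le_epsilon)
  fix \<epsilon> :: real assume e: "\<epsilon> > 0"
  let ?n = "2 * s"
  define A where "A = even_norm s f + \<epsilon> / 2"
  define B where "B = even_norm s g + \<epsilon> / 2"
  have AB: "A > 0" "B > 0" using e even_norm_nonneg[OF s, of f] even_norm_nonneg[OF s, of g] by (auto simp: A_def B_def)
  define t where "t = B / (A + B)"
  have t: "0 <= t" "t <= 1" "1 - t = A / (A + B)" using AB by (auto simp: t_def field_simps)
  have int: "integrable sphere_measure (\<lambda>z. norm (h z) ^ ?n)" if "continuous_on UNIV h" for h :: "'d cfun"
  by (intro integrable_sphere_continuous continuous_intros that)
  have conv: "convex_on UNIV (\<lambda>x::real. x ^ ?n)" by (rule convex_power_even) simp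
  have pt: "norm (f z + g z) ^ ?n <= (A + B) ^ ?n * ((1 - t) / A ^ ?n * norm (f z) ^ ?n + t / B ^ ?n * norm (g z) ^ ?n)" for z
  proof -
  have "norm (f z + g z) <= norm (f z) + norm (g z)" by (rule norm_triangle_ineq)
  also have "... = (A + B) * ((1 - t) * (norm (f z) / A) + t * (norm (g z) / B))"
  proof -
   have "(A + B) * (1 - t) = A" "(A + B) * t = B" using AB by (simp_all add: t(3)) (simp add: t_def)
   then have "(A + B) * ((1 - t) * x + t * y) = A * x + B * y" for x y
    by (simp only: distrib_left mult.assoc[symmetric])
   from this[of "norm (f z) / A" "norm (g z) / B"] show ?thesis using AB by simp
  qed
  finally have "norm (f z + g z) ^ ?n <= ((A + B) * ((1 - t) * (norm (f z) / A) + t * (norm (g z) / B))) ^ ?n"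
   by (intro power_mono) auto
  also have "... = (A + B) ^ ?n * ((1 - t) * (norm (f z) / A) + t * (norm (g z) / B)) ^ ?n"
   by (rule power_mult_distrib)
  also have "... <= (A + B) ^ ?n * ((1 - t) * (norm (f z) / A) ^ ?n + t * (norm (g z) / B) ^ ?n)"
   using convex_onD[OF conv t(1,2), of "norm (f z) / A" "norm (g z) / B"] AB by (intro mult_left_mono) auto
  finally show ?thesis by (simp add: power_divide)
  qed
  have q: "even_norm s h ^ ?n / X ^ ?n <= 1" if "X = even_norm s h + \<epsilon> / 2" for h :: "'d cfun" and X
  using power_mono[of "even_norm s h" X ?n] even_norm_nonneg[OF s, of h] e that by (simp add: divide_le_eq_1)
  have "even_norm s (\<lambda>z. f z + g z) ^ ?n <= spint
   (\<lambda>z. (A + B) ^ ?n * ((1 - t) / A ^ ?n * norm (f z) ^ ?n + t / B ^ ?n * norm (g z) ^ ?n))"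
  unfolding even_norm_power[OF s]
  by (intro integral_mono pt int integrable_mult_right Bochner_Integration.integrable_add continuous_intros f g)
  also have "... = (A + B) ^ ?n * ((1 - t) / A ^ ?n * even_norm s f ^ ?n + t / B ^ ?n * even_norm s g ^ ?n)"
  unfolding even_norm_power[OF s] integral_mult_right_zero
  by (subst Bochner_Integration.integral_add) (auto intro!: integrable_mult_right int f g)
  also have "... = (A + B) ^ ?n * ((1 - t) * (even_norm s f ^ ?n / A ^ ?n) + t * (even_norm s g ^ ?n / B ^ ?n))" by simp
  also have "... <= (A + B) ^ ?n * ((1 - t) * 1 + t * 1)"
  using t AB q[OF A_def] q[OF B_def] by (intro mult_left_mono add_mono) auto
  finally have "even_norm s (\<lambda>z. f z + g z) ^ ?n <= (A + B) ^ ?n" by simp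
  then have "even_norm s (\<lambda>z. f z + g z) <= A + B"
  using power_strict_mono[of "A + B" "even_norm s (\<lambda>z. f z + g z)" ?n] AB s by fastforce
  then show "even_norm s (\<lambda>z. f z + g z) <= even_norm s f + even_norm s g + \<epsilon>" by (simp add: A_def B_def)
qed

section \<open>Random subspaces of a block of harmonics\<close>

lemma row_average_integral:
  fixes F :: "(nat => 'i => real) => 'b => real"
  assumes "\<And>G. integrable M (F G)"
  shows "integrable M (\<lambda>z. row_average A k (\<lambda>G. F G z)) \<and>
  row_average A k (\<lambda>G. integral\<^sup>L M (F G)) = integral\<^sup>L M (\<lambda>z. row_average A k (\<lambda>G. F G z))"
  using assms
proof (induction k arbitrary: F)
  case 0
  then show ?case by simp
next
  case (Suc k)
  have IH: "integrable M (\<lambda>z. row_average A k (\<lambda>G. F (G(k := g)) z))"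
  "row_average A k (\<lambda>G. integral\<^sup>L M (F (G(k := g)))) = integral\<^sup>L M (\<lambda>z. row_average A k (\<lambda>G. F (G(k := g)) z))" for g
  using Suc.IH[of "\<lambda>G. F (G(k := g))"] Suc.prems by blast+
  show ?case using IH(1) by (auto simp: average_def IH(2) intro!: integrable_divide Bochner_Integration.integrable_sum)
qed

lemma norm_even_power_le:
  fixes w :: complex
  shows "norm w ^ (2 * s) <= 2 ^ s * (Re w ^ (2 * s) + Im w ^ (2 * s))"
proof -
  have *: "(x + y) ^ s <= 2 ^ s * (x ^ s + y ^ s)" if "x >= 0" "y >= 0" for x y :: real
  proof -
  have "(x + y) ^ s <= (2 * max x y) ^ s" using that by (intro power_mono) auto
  also have "... = 2 ^ s * (max x y) ^ s" by (rule power_mult_distrib)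
  also have "(max x y) ^ s <= x ^ s + y ^ s" using that by (auto simp: max_def)
  finally show ?thesis by simp
  qed
  have "norm w ^ (2 * s) = ((Re w)\<^sup>2 + (Im w)\<^sup>2) ^ s" by (simp add: power_mult cmod_power2)
  also have "... <= 2 ^ s * (((Re w)\<^sup>2) ^ s + ((Im w)\<^sup>2) ^ s)" by (rule *) auto
  finally show ?thesis by (simp add: power_mult)
qed

lemma random_block_moment:
  fixes u :: "'i => complex"
  assumes A: "finite A" and s: "s >= 1" and V: "(\<Sum>a\<in>A. (norm (u a))\<^sup>2) <= 2 * V0" "V0 >= 0"
  shows "row_average A k (\<lambda>G. norm (\<Sum>i<k. \<Sum>a\<in>A. of_real (G i a) * u a) ^ (2 * s)) <= (96 * real s * real k * V0) ^ s"
proof -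
  let ?W = "\<lambda>G. \<Sum>i<k. \<Sum>a\<in>A. of_real (G i a) * u a"
  have part: "row_average A k (\<lambda>G. (\<Sum>i<k. \<Sum>a\<in>A. G i a * y a) ^ (2 * s)) <= 2 * (12 * real s * real k * V0) ^ s"
  if y: "\<And>a. \<bar>y a\<bar> <= norm (u a)" for y
  proof -
  have "(\<Sum>a\<in>A. (y a)\<^sup>2) <= (\<Sum>a\<in>A. (norm (u a))\<^sup>2)"
   using y by (intro sum_mono) (metis abs_ge_zero power2_abs power_mono)
  then have le: "(\<Sum>a\<in>A. (y a)\<^sup>2) <= 2 * V0" using V by linarith
  have "row_average A k (\<lambda>G. (\<Sum>i<k. \<Sum>a\<in>A. G i a * y a) ^ (2 * s)) <= 2 * (6 * real s * (real k * (\<Sum>a\<in>A. (y a)\<^sup>2))) ^ s"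
   by (rule row_average_moment[OF A s])
  also have "... <= 2 * (6 * real s * (real k * (2 * V0))) ^ s"
   using le by (intro mult_left_mono power_mono mult_nonneg_nonneg sum_nonneg) auto
  finally show ?thesis by (simp add: mult_ac)
  qed
  have Re: "Re (?W G) = (\<Sum>i<k. \<Sum>a\<in>A. G i a * Re (u a))" and Im: "Im (?W G) = (\<Sum>i<k. \<Sum>a\<in>A. G i a * Im (u a))" for G
  by simp_all
  have "row_average A k (\<lambda>G. norm (?W G) ^ (2 * s))
   <= row_average A k (\<lambda>G. 2 ^ s * ((\<Sum>i<k. \<Sum>a\<in>A. G i a * Re (u a)) ^ (2 * s) + (\<Sum>i<k. \<Sum>a\<in>A. G i a * Im (u a)) ^ (2 * s)))"
  unfolding Re[symmetric] Im[symmetric] by (intro row_average_mono norm_even_power_le)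
  also have "... <= 2 ^ s * (2 * (12 * real s * real k * V0) ^ s + 2 * (12 * real s * real k * V0) ^ s)"
  unfolding row_average_mult row_average_add
  by (intro mult_left_mono add_mono part abs_Re_le_cmod abs_Im_le_cmod) auto
  also have "... = 4 * (24 * real s * real k * V0) ^ s"
  proof -
  have "24 * real s * real k * V0 = 2 * (12 * real s * real k * V0)" by simp
  then have "(24 * real s * real k * V0) ^ s = 2 ^ s * (12 * real s * real k * V0) ^ s" by (simp only: power_mult_distrib)
  then show ?thesis by simp
  qed
  also have "... <= 4 ^ s * (24 * real s * real k * V0) ^ s"
  using power_increasing[of 1 s "4::real"] s V by (intro mult_right_mono) auto
  also have "... = (4 * (24 * real s * real k * V0)) ^ s" by (rule power_mult_distrib[symmetric])
  also have "4 * (24 * real s * real k * V0) = 96 * real s * real k * V0" by simp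
  finally show ?thesis .
qed

text \<open>The complex coefficients are read as real ones on two copies of \<open>E\<close>, so
  that the real random subspace theorem applies to the even norm. The \<open>\<alpha> i\<close> are
  the random rows, and they serve all \<open>x\<close> simultaneously.\<close>
lemma block_approximation:
  fixes E :: "'d::finite cfun set" and \<nu> :: "'d cfun => real"
  assumes E: "finite E" "\<And>e. e \<in> E ==> continuous_on UNIV e"
  and V: "V0 > 0" "\<And>z. norm z = 1 ==> (\<Sum>e\<in>E. (\<nu> e)\<^sup>2 * (norm (e z))\<^sup>2) <= V0"
  and k: "k > 0" and s: "s >= 1"
  shows "\<exists>\<alpha> :: nat => 'd cfun => complex. \<forall>x X. X > 0 --> (\<Sum>e\<in>E. (norm (x e))\<^sup>2) <= X\<^sup>2 -->
  (\<exists>c :: nat => complex. spint (\<lambda>z. norm ((\<Sum>e\<in>E. x e * of_real (\<nu> e) * e z)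
    - (\<Sum>i<k. c i * (\<Sum>e\<in>E. \<alpha> i e * e z))) ^ (2 * s))
   <= (100 * (1 + sphere_area TYPE('d)) * sqrt (real s * V0 / real k) * X) ^ (2 * s))"
proof -
  let ?\<sigma> = "sphere_area TYPE('d)"
  have \<sigma>: "?\<sigma> > 0" by (rule sphere_measure_pos)
  define A where "A = E \<times> (UNIV :: bool set)"
  define u where "u = (\<lambda>a z. (if snd a then \<i> else 1) * of_real (\<nu> (fst a)) * fst a z)"
  define p where "p = (\<lambda>x. even_norm s (\<lambda>z. \<Sum>a\<in>A. of_real (x a) * u a z))"
  have A: "finite A" unfolding A_def using E(1) by simp
  have uc: "continuous_on UNIV (u a)" if "a \<in> A" for a
  proof -
  have "continuous_on UNIV (fst a)" using that by (intro E(2)) (auto simp: A_def)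
  then show ?thesis unfolding u_def by (intro continuous_intros)
  qed
  have sc: "continuous_on UNIV (\<lambda>z. \<Sum>a\<in>A. of_real (x a) * u a z)" for x :: "_ => real"
  by (intro continuous_intros uc)
  have add: "p (\<lambda>a. x a + y a) <= p x + p y" for x y
  proof -
  have "p (\<lambda>a. x a + y a) = even_norm s (\<lambda>z. (\<Sum>a\<in>A. of_real (x a) * u a z) + (\<Sum>a\<in>A. of_real (y a) * u a z))"
   unfolding p_def by (simp add: distrib_right sum.distrib)
  also have "... <= p x + p y" unfolding p_def by (intro even_norm_triangle s sc)
  finally show ?thesis .
  qed
  have scale: "p (\<lambda>a. c * x a) = \<bar>c\<bar> * p x" for c x
  unfolding p_def even_norm_scale[OF s, symmetric] by (simp add: sum_distrib_left mult.assoc)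
  have pA: "p x = p y" if "\<And>a. a \<in> A ==> x a = y a" for x y
  unfolding p_def using that by (intro arg_cong[where f = "even_norm s"] ext sum.cong) auto
  have p0: "p x >= 0" for x unfolding p_def by (rule even_norm_nonneg[OF s])
  define Q where "Q = 96 * real s * real k * V0"
  have Q: "Q > 0" using s k V by (simp add: Q_def)
  define \<beta> where "\<beta> = (1 + ?\<sigma>) * sqrt Q"
  have \<beta>: "\<beta> > 0" using Q \<sigma> by (simp add: \<beta>_def)
  have \<beta>s: "?\<sigma> * Q ^ s <= \<beta> ^ (2 * s)"
  proof -
  have "?\<sigma> <= (1 + ?\<sigma>) ^ 1" using \<sigma> by simp
  also have "... <= (1 + ?\<sigma>) ^ (2 * s)" using \<sigma> s by (intro power_increasing) auto
  finally have "?\<sigma> * Q ^ s <= (1 + ?\<sigma>) ^ (2 * s) * Q ^ s" using Q by (intro mult_right_mono) auto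
  also have "... = \<beta> ^ (2 * s)" using Q by (simp add: \<beta>_def power_mult_distrib power_mult)
  finally show ?thesis .
  qed
  have usum: "(\<Sum>a\<in>A. (norm (u a z))\<^sup>2) <= 2 * V0" if z: "norm z = 1" for z
  proof -
  have "(\<Sum>a\<in>A. (norm (u a z))\<^sup>2) = (\<Sum>e\<in>E. \<Sum>b\<in>(UNIV::bool set). (norm (u (e, b) z))\<^sup>2)"
   unfolding A_def by (simp add: sum.cartesian_product)
  also have "... = (\<Sum>e\<in>E. 2 * ((\<nu> e)\<^sup>2 * (norm (e z))\<^sup>2))"
   by (intro sum.cong refl) (simp add: u_def UNIV_bool norm_mult power_mult_distrib)
  finally show ?thesis using V(2)[OF z] by (simp add: sum_distrib_left[symmetric])
  qed
  have mean: "row_average A k (\<lambda>G. p (\<lambda>a. \<Sum>i<k. G i a)) <= 2 * \<beta>"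
  proof -
  let ?n = "2 * s"
  have split: "t <= \<beta> + 1 / \<beta> ^ (?n - 1) * t ^ ?n" if "t >= 0" for t
  proof (cases "t <= \<beta>")
   case True
   have "1 / \<beta> ^ (?n - 1) * t ^ ?n >= 0" using \<beta> that by simp
   then show ?thesis using True by linarith
  next
   case False
   have "t * \<beta> ^ (?n - 1) <= t * t ^ (?n - 1)" using False \<beta> that by (intro mult_left_mono power_mono) auto
   also have "... = t ^ ?n"
    unfolding power_Suc[symmetric] by (rule arg_cong[where f = "\<lambda>m. t ^ m"]) (use s in simp)
   finally have "t <= 1 / \<beta> ^ (?n - 1) * t ^ ?n" using \<beta> by (simp add: field_simps)
   then show ?thesis using \<beta> by linarith
  qed
  let ?W = "\<lambda>G z. \<Sum>i<k. \<Sum>a\<in>A. of_real (G i a) * u a z"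
  have pn: "p (\<lambda>a. \<Sum>i<k. G i a) ^ ?n = spint (\<lambda>z. norm (?W G z) ^ ?n)" for G
  proof -
   have "(\<Sum>a\<in>A. of_real (\<Sum>i<k. G i a) * u a z) = ?W G z" for z
    by (simp add: sum_distrib_right sum.swap[of _ A])
   then show ?thesis unfolding p_def even_norm_power[OF s] by simp
  qed
  have Wint: "integrable sphere_measure (\<lambda>z. norm (?W G z) ^ ?n)" for G
   by (intro integrable_sphere_continuous continuous_intros uc)
  have "row_average A k (\<lambda>G. p (\<lambda>a. \<Sum>i<k. G i a)) <= row_average A k (\<lambda>G. \<beta> + 1 / \<beta> ^ (?n - 1) * p (\<lambda>a. \<Sum>i<k. G i a) ^ ?n)"
   by (intro row_average_mono split p0)
  also have "... = \<beta> + 1 / \<beta> ^ (?n - 1) * row_average A k (\<lambda>G. spint (\<lambda>z. norm (?W G z) ^ ?n))"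
   unfolding row_average_add row_average_mult row_average_const[OF A] pn ..
  also have "... = \<beta> + 1 / \<beta> ^ (?n - 1) * spint (\<lambda>z. row_average A k (\<lambda>G. norm (?W G z) ^ ?n))"
   using row_average_integral[of sphere_measure "\<lambda>G z. norm (?W G z) ^ ?n" A k] Wint by simp
  also have "... <= \<beta> + 1 / \<beta> ^ (?n - 1) * spint (\<lambda>z :: complex^'d. Q ^ s)"
  proof (intro add_left_mono mult_left_mono integral_mono)
   show "integrable sphere_measure (\<lambda>z. row_average A k (\<lambda>G. norm (?W G z) ^ ?n))"
    using row_average_integral[of sphere_measure "\<lambda>G z. norm (?W G z) ^ ?n" A k] Wint by simp
   fix z :: "complex^'d" assume "z \<in> space sphere_measure"
   then have "norm z = 1" by (simp add: space_sphere_measure)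
   then show "row_average A k (\<lambda>G. norm (?W G z) ^ ?n) <= Q ^ s"
    unfolding Q_def using usum V(1) by (intro random_block_moment A s) auto
  qed (use \<beta> in auto)
  also have "... = \<beta> + 1 / \<beta> ^ (?n - 1) * (?\<sigma> * Q ^ s)" by (simp add: space_sphere_measure)
  also have "... <= \<beta> + 1 / \<beta> ^ (?n - 1) * \<beta> ^ ?n" using \<beta>s \<beta> by (intro add_left_mono mult_left_mono) auto
  also have "\<beta> ^ ?n = \<beta> * \<beta> ^ (?n - 1)"
   unfolding power_Suc[symmetric] by (rule arg_cong[where f = "\<lambda>m. \<beta> ^ m"]) (use s in simp)
  also have "\<beta> + 1 / \<beta> ^ (?n - 1) * (\<beta> * \<beta> ^ (?n - 1)) = 2 * \<beta>" using \<beta> by simp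
  finally show ?thesis .
  qed
  have "\<exists>G. \<forall>x \<epsilon>. \<epsilon> > 0 --> (\<exists>t. p (\<lambda>a. x a - (\<Sum>i<k. t i * G i a)) <= 4 * (2 * \<beta>) / real k * sqrt (\<Sum>a\<in>A. (x a)\<^sup>2) + \<epsilon>)"
  proof (rule random_sign_subspace[where p = p and \<beta> = "2 * \<beta>", OF A k add scale pA mean])
  fix G
  assume G: "\<And>x \<epsilon>. \<epsilon> > 0 ==> \<exists>t. p (\<lambda>a. x a - (\<Sum>i<k. t i * G i a)) <= 4 * (2 * \<beta>) / real k * sqrt (\<Sum>a\<in>A. (x a)\<^sup>2) + \<epsilon>"
  show ?thesis by (rule exI[of _ G], intro allI impI, rule G)
  qed
  then obtain G where G: "\<forall>x \<epsilon>. \<epsilon> > 0 --> (\<exists>t. p (\<lambda>a. x a - (\<Sum>i<k. t i * G i a)) <= 4 * (2 * \<beta>) / real k * sqrt (\<Sum>a\<in>A. (x a)\<^sup>2) + \<epsilon>)"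
  by (rule exE)
  define \<alpha> where "\<alpha> = (\<lambda>i e. of_real (\<nu> e) * (of_real (G i (e, False)) + \<i> * of_real (G i (e, True))))"
  show ?thesis
  proof (intro exI[of _ \<alpha>] allI impI)
  fix x :: "'d cfun => complex" and X :: real
  assume X: "X > 0" and xX: "(\<Sum>e\<in>E. (norm (x e))\<^sup>2) <= X\<^sup>2"
  define y where "y = (\<lambda>a. if snd a then Im (x (fst a)) else Re (x (fst a)))"
  let ?R = "sqrt (real s * V0 / real k)"
  have R: "?R > 0" using s V k by simp
  define \<epsilon> where "\<epsilon> = (1 + ?\<sigma>) * ?R * X"
  have e: "\<epsilon> > 0" using R X \<sigma> by (simp add: \<epsilon>_def)
  obtain t where t: "p (\<lambda>a. y a - (\<Sum>i<k. t i * G i a)) <= 4 * (2 * \<beta>) / real k * sqrt (\<Sum>a\<in>A. (y a)\<^sup>2) + \<epsilon>"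
   using G[rule_format, OF e, of y] by (rule exE)
  have sumA: "(\<Sum>a\<in>A. h a) = (\<Sum>e\<in>E. h (e, False) + h (e, True))" for h :: "_ => 'z::comm_monoid_add"
  proof -
   have "(\<Sum>a\<in>A. h a) = (\<Sum>e\<in>E. \<Sum>b\<in>UNIV. h (e, b))" unfolding A_def by (simp add: sum.cartesian_product)
   then show ?thesis by (simp add: UNIV_bool)
  qed
  have "(\<Sum>a\<in>A. (y a)\<^sup>2) = (\<Sum>e\<in>E. (norm (x e))\<^sup>2)"
   unfolding sumA by (simp add: y_def cmod_power2)
  then have "sqrt (\<Sum>a\<in>A. (y a)\<^sup>2) <= X" using xX X by (simp add: real_le_lsqrt)
  then have 1: "4 * (2 * \<beta>) / real k * sqrt (\<Sum>a\<in>A. (y a)\<^sup>2) <= 4 * (2 * \<beta>) / real k * X"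
   using \<beta> by (intro mult_left_mono) auto
  have "Q = 96 * (real s * V0 / real k) * (real k)\<^sup>2" using k by (simp add: Q_def power2_eq_square)
  then have "sqrt Q = sqrt 96 * ?R * real k" by (simp only: real_sqrt_mult real_sqrt_abs)
  then have 2: "4 * (2 * \<beta>) / real k = 8 * (1 + ?\<sigma>) * (sqrt 96 * ?R)" using k by (simp add: \<beta>_def)
  have "sqrt 96 <= sqrt (10\<^sup>2)" by (rule real_sqrt_le_mono) simp
  then have "sqrt 96 * ?R <= 10 * ?R" using R by (intro mult_right_mono) auto
  then have 3: "8 * (1 + ?\<sigma>) * (sqrt 96 * ?R) * X <= 8 * (1 + ?\<sigma>) * (10 * ?R) * X"
   by (rule mult_right_mono[OF mult_left_mono]) (use X \<sigma> in auto)
  have "8 * (1 + ?\<sigma>) * (10 * ?R) * X + \<epsilon> = 81 * (1 + ?\<sigma>) * ?R * X"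
  proof -
   have "8 * (1 + a) * (10 * b) * c + (1 + a) * b * c = 81 * (1 + a) * b * c" for a b c :: real
    by (simp add: algebra_simps)
   then show ?thesis unfolding \<epsilon>_def .
  qed
  then have "4 * (2 * \<beta>) / real k * sqrt (\<Sum>a\<in>A. (y a)\<^sup>2) + \<epsilon> <= 81 * (1 + ?\<sigma>) * ?R * X"
   using 1 3 unfolding 2 by linarith
  also have "... <= 100 * (1 + ?\<sigma>) * ?R * X" using R X \<sigma> by (intro mult_right_mono) auto
  finally have pl: "p (\<lambda>a. y a - (\<Sum>i<k. t i * G i a)) <= 100 * (1 + ?\<sigma>) * ?R * X" using t by linarith
  have "p (\<lambda>a. y a - (\<Sum>i<k. t i * G i a)) ^ (2 * s) <= (100 * (1 + ?\<sigma>) * ?R * X) ^ (2 * s)"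
   by (intro power_mono pl p0)
  moreover have "(\<Sum>a\<in>A. of_real (y a - (\<Sum>i<k. t i * G i a)) * u a z) = (\<Sum>e\<in>E. x e * of_real (\<nu> e) * e z)
    - (\<Sum>i<k. of_real (t i) * (\<Sum>e\<in>E. \<alpha> i e * e z))" for z
  proof -
   have 1: "(\<Sum>a\<in>A. of_real (y a) * u a z) = (\<Sum>e\<in>E. x e * of_real (\<nu> e) * e z)"
    unfolding sumA
   proof (rule sum.cong[OF refl])
    fix e
    have x: "(of_real (Re (x e)) + \<i> * of_real (Im (x e))) * of_real (\<nu> e) * e z = x e * of_real (\<nu> e) * e z"
     by (simp only: complex_eq[symmetric])
    show "of_real (y (e, False)) * u (e, False) z + of_real (y (e, True)) * u (e, True) z = x e * of_real (\<nu> e) * e z"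
     unfolding x[symmetric] y_def u_def by (simp add: algebra_simps)
   qed
   have 2: "(\<Sum>a\<in>A. of_real (G i a) * u a z) = (\<Sum>e\<in>E. \<alpha> i e * e z)" for i
    unfolding sumA \<alpha>_def u_def by (intro sum.cong refl) (simp add: algebra_simps)
   have "(\<Sum>a\<in>A. of_real (y a - (\<Sum>i<k. t i * G i a)) * u a z)
    = (\<Sum>a\<in>A. of_real (y a) * u a z) - (\<Sum>i<k. of_real (t i) * (\<Sum>a\<in>A. of_real (G i a) * u a z))"
    by (simp add: left_diff_distrib sum_subtractf sum_distrib_right sum_distrib_left sum.swap[of _ A] mult.assoc)
   then show ?thesis unfolding 1 2 .
  qed
  ultimately have "spint (\<lambda>z. norm ((\<Sum>e\<in>E. x e * of_real (\<nu> e) * e z)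
    - (\<Sum>i<k. of_real (t i) * (\<Sum>e\<in>E. \<alpha> i e * e z))) ^ (2 * s)) <= (100 * (1 + ?\<sigma>) * ?R * X) ^ (2 * s)"
   unfolding p_def even_norm_power[OF s] by simp
  then show "\<exists>c :: nat => complex. spint (\<lambda>z. norm ((\<Sum>e\<in>E. x e * of_real (\<nu> e) * e z)
    - (\<Sum>i<k. c i * (\<Sum>e\<in>E. \<alpha> i e * e z))) ^ (2 * s)) <= (100 * (1 + ?\<sigma>) * ?R * X) ^ (2 * s)"
   by (rule exI[of _ "\<lambda>i. of_real (t i)"])
  qed
qed

section \<open>From even norms to the supremum norm\<close>

lemma upto_level_diag:
  fixes z :: "complex ^ 'd::finite"
  assumes z: "norm z = 1"
  shows "(\<Sum>e\<in>upto_level N. (norm (e z))\<^sup>2) = real (card (upto_level N :: 'd cfun set)) / sphere_area TYPE('d)"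
proof -
  let ?L = "level :: nat => 'd cfun set"
  have "(\<Sum>e\<in>upto_level N. (norm (e z))\<^sup>2) = (\<Sum>l\<le>N. \<Sum>e\<in>?L l. (norm (e z))\<^sup>2)"
  unfolding upto_level_def by (rule sum.UNION_disjoint) (use finite_level level_disjoint in auto)
  also have "... = real (\<Sum>l\<le>N. card (?L l)) / sphere_area TYPE('d)"
  by (simp add: level_diag[OF z] sum_divide_distrib)
  also have "(\<Sum>l\<le>N. card (?L l)) = card (upto_level N :: 'd cfun set)"
  unfolding upto_level_def by (rule card_UN_disjoint[symmetric]) (use finite_level level_disjoint in auto)
  finally show ?thesis .
qed

text \<open>The power \<open>f^s\<close> is a polynomial of degree \<open>s n\<close>; its value is
  estimated by Cauchy-Schwarz in its orthonormal expansion and by Bessel's inequality.\<close>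
lemma nikolskii:
  fixes f :: "'d::finite cfun"
  assumes f: "polydeg n f" and z: "norm z = 1"
  shows "norm (f z) ^ (2 * s) <= real (card (upto_level (s * n) :: 'd cfun set)) / sphere_area TYPE('d)
  * spint (\<lambda>z. norm (f z) ^ (2 * s))"
proof -
  let ?U = "upto_level (s * n) :: 'd cfun set"
  define F where "F = (\<lambda>z. f z ^ s)"
  have F: "polydeg (s * n) F" unfolding F_def by (rule polydeg_power[OF f])
  have Fc: "continuous_on UNIV F" by (rule polydeg_continuous[OF F])
  have U: "finite ?U" "orthonormal ?U" "\<And>e. e \<in> ?U ==> continuous_on UNIV e"
  by (rule finite_upto_level) (auto simp: orthonormal_def upto_level_ip intro: upto_level_continuous)
  have bes: "(\<Sum>e\<in>?U. (norm (ip F e))\<^sup>2) <= spint (\<lambda>z. (norm (F z))\<^sup>2)"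
  by (rule bessel[OF _ _ U]) (intro integrable_sphere_continuous continuous_intros Fc)+
  have "norm (F z) <= (\<Sum>e\<in>?U. \<bar>norm (ip F e)\<bar> * \<bar>norm (e z)\<bar>)"
  unfolding polydeg_expand[OF F z] by (rule order_trans[OF norm_sum]) (simp add: norm_mult)
  also have "... <= L2_set (\<lambda>e. norm (ip F e)) ?U * L2_set (\<lambda>e. norm (e z)) ?U" by (rule L2_set_mult_ineq)
  finally have "(norm (F z))\<^sup>2 <= (L2_set (\<lambda>e. norm (ip F e)) ?U * L2_set (\<lambda>e. norm (e z)) ?U)\<^sup>2"
  by (intro power_mono) auto
  also have "... = (\<Sum>e\<in>?U. (norm (ip F e))\<^sup>2) * (\<Sum>e\<in>?U. (norm (e z))\<^sup>2)"
  by (simp add: power_mult_distrib L2_set_def sum_nonneg)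
  also have "... <= spint (\<lambda>z. (norm (F z))\<^sup>2) * (\<Sum>e\<in>?U. (norm (e z))\<^sup>2)"
  by (intro mult_right_mono bes sum_nonneg) auto
  finally show ?thesis
  unfolding upto_level_diag[OF z] F_def norm_power power_mult[symmetric] by (simp add: mult_ac)
qed

section \<open>The unit ball of a Lebesgue space\<close>

lemma unit_ball_power_integral:
  assumes \<phi>: "\<phi> \<in> Lp_unit_ball M (ennreal P)" and P: "P >= 1"
  shows "\<phi> \<in> borel_measurable M" "integrable M (\<lambda>z. norm (\<phi> z) powr P)" "integral\<^sup>L M (\<lambda>z. norm (\<phi> z) powr P) <= 1"
proof -
  define I where "I = (\<integral>\<^sup>+ x. ennreal (norm (\<phi> x) powr P) \<partial>M)"
  show meas: "\<phi> \<in> borel_measurable M" using \<phi> by (simp add: Lp_unit_ball_def)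
  have pm: "(\<lambda>z. norm (\<phi> z) powr P) \<in> borel_measurable M" using meas by measurable
  have L: "(if I = \<infinity> then \<infinity> else ennreal (enn2real I powr (1 / P))) <= 1"
  proof -
  have "Lp_norm M (ennreal P) \<phi> = (if I = \<infinity> then \<infinity> else ennreal (enn2real I powr (1 / P)))"
   unfolding Lp_norm_def Let_def I_def using P by simp
  then show ?thesis using \<phi> unfolding Lp_unit_ball_def by simp
  qed
  then have fin: "I < \<infinity>" by (auto split: if_splits simp: less_top dest: top.extremum_uniqueI)
  then have "ennreal (enn2real I powr (1 / P)) <= ennreal 1" using L by (auto split: if_splits)
  then have "enn2real I powr (1 / P) <= 1" by (simp only: ennreal_le_iff zero_le_one)
  then have "(enn2real I powr (1 / P)) powr P <= 1 powr P" using P by (intro powr_mono2) auto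
  then have le: "enn2real I <= 1" using P by (simp add: powr_powr)
  show "integrable M (\<lambda>z. norm (\<phi> z) powr P)"
  using fin pm unfolding integrable_iff_bounded I_def by simp
  have "integral\<^sup>L M (\<lambda>z. norm (\<phi> z) powr P) = enn2real I"
  unfolding I_def by (rule integral_eq_nn_integral[OF pm]) simp
  then show "integral\<^sup>L M (\<lambda>z. norm (\<phi> z) powr P) <= 1" using le by simp
qed

text \<open>For \<open>p < 2\<close> the function is truncated at height \<open>T = M powr (1 /
  p)\<close>, where the large and the small part give the same power of \<open>M\<close>; for \<open>p
  >= 2\<close> it is square integrable as it stands.\<close>
lemma unit_ball_split:
  fixes \<phi> :: "'d::finite cfun"
  assumes \<phi>: "\<phi> \<in> Lp_unit_ball sphere_measure p" and p: "1 <= p" and M: "M >= 1"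
  shows "\<exists>\<phi>1 \<phi>2. integrable sphere_measure \<phi>1 \<and> integrable sphere_measure \<phi>2
  \<and> integrable sphere_measure (\<lambda>z. (norm (\<phi>2 z))\<^sup>2) \<and> \<phi> = (\<lambda>z. \<phi>1 z + \<phi>2 z)
  \<and> spint (\<lambda>z. norm (\<phi>1 z)) * sqrt M <= M powr pos_part (enn2real (1 / p) - 1 / 2)
  \<and> sqrt (spint (\<lambda>z. (norm (\<phi>2 z))\<^sup>2)) <= (2 + sphere_area TYPE('d)) * M powr pos_part (enn2real (1 / p) - 1 / 2)"
proof -
  let ?\<sigma> = "sphere_area TYPE('d)"
  have \<sigma>: "?\<sigma> > 0" by (rule sphere_measure_pos)
  have meas: "\<phi> \<in> borel_measurable sphere_measure" using \<phi> by (simp add: Lp_unit_ball_def)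
  have pp: "M powr pos_part t >= 1" for t using M by (intro ge_one_powr_ge_zero) (auto simp: pos_part_def)
  have bounded_square: ?thesis
  if int2: "integrable sphere_measure (\<lambda>z. (norm (\<phi> z))\<^sup>2)"
   and le: "spint (\<lambda>z. (norm (\<phi> z))\<^sup>2) <= 1 + ?\<sigma>"
  proof -
  have "integrable sphere_measure \<phi>"
  proof (rule Bochner_Integration.integrable_bound)
   show "integrable sphere_measure (\<lambda>z :: complex^'d. 1 + (norm (\<phi> z))\<^sup>2)" using int2 by simp
   have "x <= 1 + x\<^sup>2" for x :: real using zero_le_square[of "x - 1 / 2"] by (simp add: power2_eq_square algebra_simps)
   then show "AE x in sphere_measure. norm (\<phi> x) <= norm (1 + (norm (\<phi> x))\<^sup>2)" by (intro AE_I2) simp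
  qed (rule meas)
  moreover have "sqrt (spint (\<lambda>z. (norm (\<phi> z))\<^sup>2)) <= (2 + ?\<sigma>) * M powr pos_part (enn2real (1 / p) - 1 / 2)"
  proof -
   have "sqrt (spint (\<lambda>z. (norm (\<phi> z))\<^sup>2)) <= sqrt ((1 + ?\<sigma>)\<^sup>2)"
   proof (intro real_sqrt_le_mono)
    have "1 + ?\<sigma> <= (1 + ?\<sigma>)\<^sup>2" using \<sigma> by (intro self_le_power) auto
    then show "spint (\<lambda>z. (norm (\<phi> z))\<^sup>2) <= (1 + ?\<sigma>)\<^sup>2" using le by linarith
   qed
   also have "... <= (2 + ?\<sigma>) * 1" using \<sigma> by simp
   also have "... <= (2 + ?\<sigma>) * M powr pos_part (enn2real (1 / p) - 1 / 2)" using \<sigma> pp by (intro mult_left_mono) auto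
   finally show ?thesis .
  qed
  ultimately show ?thesis using int2 by (intro exI[of _ "\<lambda>_. 0"] exI[of _ \<phi>] conjI) auto
  qed
  show ?thesis
  proof (cases "p = \<infinity>")
  case True
  have "esssup sphere_measure (\<lambda>x. ennreal (norm (\<phi> x))) <= 1"
   using \<phi> True by (simp add: Lp_unit_ball_def Lp_norm_def)
  moreover have "AE x in sphere_measure. ennreal (norm (\<phi> x)) <= esssup sphere_measure (\<lambda>x. ennreal (norm (\<phi> x)))"
   by (rule esssup_AE)
  ultimately have ae: "AE x in sphere_measure. norm (\<phi> x) <= 1"
   by (elim AE_mp, intro AE_I2 impI) (metis order_trans ennreal_1 ennreal_le_iff zero_le_one)
  then have ae2: "AE x in sphere_measure. (norm (\<phi> x))\<^sup>2 <= 1" by (elim AE_mp, intro AE_I2 impI) (simp add: power_le_one)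
  have int2: "integrable sphere_measure (\<lambda>z. (norm (\<phi> z))\<^sup>2)"
   by (rule sphere.integrable_const_bound[where B = 1]) (use ae2 meas in auto)
  have "spint (\<lambda>z. (norm (\<phi> z))\<^sup>2) <= spint (\<lambda>z :: complex^'d. 1)"
   by (rule integral_mono_AE[OF int2 _ ae2]) simp
  then show ?thesis using \<sigma> by (intro bounded_square int2) (simp add: space_sphere_measure)
  next
  case False
  then obtain P where P: "p = ennreal P" "P >= 0" by (cases p rule: ennreal_cases) auto
  have P1: "P >= 1" using p P by (metis ennreal_1 ennreal_le_iff)
  note U = unit_ball_power_integral[OF \<phi>[unfolded P(1)] P1]
  have inv: "enn2real (1 / p) = 1 / P"
   using P1 unfolding P(1) ennreal_1[symmetric] by (subst divide_ennreal) auto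
  show ?thesis
  proof (cases "P >= 2")
   case True
   have le: "(norm (\<phi> z))\<^sup>2 <= 1 + norm (\<phi> z) powr P" for z
   proof (cases "norm (\<phi> z) <= 1")
    case True
    then have "(norm (\<phi> z))\<^sup>2 <= 1" by (simp add: power_le_one)
    then show ?thesis by (smt (verit) powr_ge_zero)
   next
    case False
    then have "(norm (\<phi> z))\<^sup>2 = norm (\<phi> z) powr 2" by (simp add: powr_numeral)
    also have "... <= norm (\<phi> z) powr P" using False True by (intro powr_mono) auto
    finally show ?thesis by simp
   qed
   have int2: "integrable sphere_measure (\<lambda>z. (norm (\<phi> z))\<^sup>2)"
   proof (rule Bochner_Integration.integrable_bound)
    show "integrable sphere_measure (\<lambda>z. 1 + norm (\<phi> z) powr P)" using U(2) by simp
    show "AE x in sphere_measure. norm ((norm (\<phi> x))\<^sup>2) <= norm (1 + norm (\<phi> x) powr P)"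
     using le by (intro AE_I2) (smt (verit) real_norm_def zero_le_power2)
   qed (use meas in measurable)
   have "spint (\<lambda>z. (norm (\<phi> z))\<^sup>2) <= spint (\<lambda>z. 1 + norm (\<phi> z) powr P)"
    by (rule integral_mono[OF int2 _ le]) (use U(2) in simp)
   also have "... <= 1 + ?\<sigma>" using U(2,3) by (simp add: space_sphere_measure)
   finally show ?thesis by (rule bounded_square[OF int2])
  next
   case False
   then have P2: "P < 2" by simp
   (* At this height both parts contribute M powr (1 / P - 1 / 2). *)
   define T where "T = M powr (1 / P)"
   have T: "T > 0" using M by (simp add: T_def)
   have Tp: "T powr t = M powr (t / P)" for t unfolding T_def by (simp add: powr_powr)
   have ppe: "pos_part (enn2real (1 / p) - 1 / 2) = 1 / P - 1 / 2"
    unfolding inv pos_part_def using P1 P2 by (simp add: field_simps)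
   define \<phi>1 where "\<phi>1 = (\<lambda>z. if norm (\<phi> z) > T then \<phi> z else 0)"
   define \<phi>2 where "\<phi>2 = (\<lambda>z. if norm (\<phi> z) > T then 0 else \<phi> z)"
   have m12: "\<phi>1 \<in> borel_measurable sphere_measure" "\<phi>2 \<in> borel_measurable sphere_measure"
    unfolding \<phi>1_def \<phi>2_def using meas by measurable
   have b1: "norm (\<phi>1 z) <= T powr (1 - P) * norm (\<phi> z) powr P" for z
   proof (cases "norm (\<phi> z) > T")
    case True
    then have "norm (\<phi> z) = norm (\<phi> z) powr (1 - P) * norm (\<phi> z) powr P"
     using T by (simp add: powr_add[symmetric])
    also have "... <= T powr (1 - P) * norm (\<phi> z) powr P"
     using True T P1 by (intro mult_right_mono powr_mono2') auto
    finally show ?thesis using True by (simp add: \<phi>1_def)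
   qed (simp add: \<phi>1_def)
   have b2: "(norm (\<phi>2 z))\<^sup>2 <= T powr (2 - P) * norm (\<phi> z) powr P" for z
   proof (cases "norm (\<phi> z) > T \<or> \<phi> z = 0")
    case False
    then have n: "norm (\<phi> z) <= T" "norm (\<phi> z) > 0" by auto
    then have "(norm (\<phi> z))\<^sup>2 = norm (\<phi> z) powr (2 - P) * norm (\<phi> z) powr P"
     by (simp add: powr_add[symmetric] powr_numeral)
    also have "... <= T powr (2 - P) * norm (\<phi> z) powr P"
     using n P2 by (intro mult_right_mono powr_mono2) auto
    finally show ?thesis using n by (simp add: \<phi>2_def)
   qed (auto simp: \<phi>2_def)
   have b2': "norm (\<phi>2 z) <= T" for z using T by (simp add: \<phi>2_def)
   have i1: "integrable sphere_measure \<phi>1"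
   proof (rule Bochner_Integration.integrable_bound)
    show "integrable sphere_measure (\<lambda>z. T powr (1 - P) * norm (\<phi> z) powr P)" using U(2) by simp
    show "AE x in sphere_measure. norm (\<phi>1 x) <= norm (T powr (1 - P) * norm (\<phi> x) powr P)"
     using b1 by (intro AE_I2) (smt (verit) real_norm_def)
   qed (rule m12)
   have i2: "integrable sphere_measure \<phi>2" by (rule integrable_sphere_bounded[OF m12(2) b2'])
   have i22: "integrable sphere_measure (\<lambda>z. (norm (\<phi>2 z))\<^sup>2)"
    by (rule integrable_sphere_bounded[where B = "T\<^sup>2"]) (use m12 b2' in \<open>auto intro: power_mono\<close>)
   have 1: "spint (\<lambda>z. norm (\<phi>1 z)) <= T powr (1 - P)"
   proof -
    have "spint (\<lambda>z. norm (\<phi>1 z)) <= spint (\<lambda>z. T powr (1 - P) * norm (\<phi> z) powr P)"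
     using i1 U(2) by (intro integral_mono b1) auto
    also have "... <= T powr (1 - P) * 1" unfolding integral_mult_right_zero by (intro mult_left_mono U(3)) simp
    finally show ?thesis by simp
   qed
   have 2: "spint (\<lambda>z. (norm (\<phi>2 z))\<^sup>2) <= T powr (2 - P)"
   proof -
    have "spint (\<lambda>z. (norm (\<phi>2 z))\<^sup>2) <= spint (\<lambda>z. T powr (2 - P) * norm (\<phi> z) powr P)"
     using i22 U(2) by (intro integral_mono b2) auto
    also have "... <= T powr (2 - P) * 1" unfolding integral_mult_right_zero by (intro mult_left_mono U(3)) simp
    finally show ?thesis by simp
   qed
   have sq: "sqrt x = x powr (1 / 2)" if "x >= 0" for x :: real using that by (simp add: powr_half_sqrt)
   have "spint (\<lambda>z. norm (\<phi>1 z)) * sqrt M <= T powr (1 - P) * sqrt M"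
    using 1 M by (intro mult_right_mono) auto
   also have "... = M powr ((1 - P) / P + 1 / 2)" unfolding Tp powr_add using M by (simp add: sq)
   also have "(1 - P) / P + 1 / 2 = 1 / P - 1 / 2" using P1 by (simp add: field_simps)
   finally have A1: "spint (\<lambda>z. norm (\<phi>1 z)) * sqrt M <= M powr (1 / P - 1 / 2)" .
   have "sqrt (spint (\<lambda>z. (norm (\<phi>2 z))\<^sup>2)) <= sqrt (T powr (2 - P))" by (intro real_sqrt_le_mono 2)
   also have "... = M powr ((2 - P) / P * (1 / 2))" unfolding Tp powr_powr[symmetric] by (simp add: sq)
   also have "(2 - P) / P * (1 / 2) = 1 / P - 1 / 2" using P1 by (simp add: field_simps)
   also have "M powr (1 / P - 1 / 2) <= (2 + ?\<sigma>) * M powr (1 / P - 1 / 2)"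
    using mult_right_mono[of 1 "2 + ?\<sigma>" "M powr (1 / P - 1 / 2)"] \<sigma> by simp
   finally have A2: "sqrt (spint (\<lambda>z. (norm (\<phi>2 z))\<^sup>2)) <= (2 + ?\<sigma>) * M powr (1 / P - 1 / 2)" .
   show ?thesis unfolding ppe
    using i1 i2 i22 A1 A2 by (intro exI[of _ \<phi>1] exI[of _ \<phi>2] conjI) (auto simp: \<phi>1_def \<phi>2_def)
  qed
  qed
qed

section \<open>Weighted coefficients\<close>

text \<open>Pairing \<open>\<phi>\<close> with \<open>g\<close>, the sum of \<open>(\<nu> e)^2 * ip
  \<phi> e * e\<close>, gives the square of the left-hand side, while \<open>g\<close> is bounded
  pointwise by Cauchy-Schwarz.\<close>
lemma weighted_coefficients_L1:
  fixes \<phi> :: "'d::finite cfun" and \<nu> :: "'d cfun => real"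
  assumes \<phi>: "integrable sphere_measure \<phi>"
  and E: "finite E" "\<And>e. e \<in> E ==> continuous_on UNIV e"
  and V: "\<And>z. norm z = 1 ==> (\<Sum>e\<in>E. (\<nu> e)\<^sup>2 * (norm (e z))\<^sup>2) <= V"
  shows "L2_set (\<lambda>e. \<nu> e * norm (ip \<phi> e)) E <= spint (\<lambda>z. norm (\<phi> z)) * sqrt V"
proof -
  define S where "S = L2_set (\<lambda>e. \<nu> e * norm (ip \<phi> e)) E"
  let ?I = "spint (\<lambda>z. norm (\<phi> z))"
  define g where "g = (\<lambda>z. \<Sum>e\<in>E. of_real ((\<nu> e)\<^sup>2) * ip \<phi> e * e z)"
  have gc: "continuous_on UNIV g" unfolding g_def by (intro continuous_intros E(2))
  have S2: "S\<^sup>2 = (\<Sum>e\<in>E. (\<nu> e)\<^sup>2 * (norm (ip \<phi> e))\<^sup>2)"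
  unfolding S_def L2_set_def by (simp add: sum_nonneg power_mult_distrib)
  have "ip \<phi> g = (\<Sum>e\<in>E. cnj (of_real ((\<nu> e)\<^sup>2) * ip \<phi> e) * ip \<phi> e)"
  unfolding g_def by (rule ip_integrable_sum_right[OF \<phi>]) (rule E(2))
  also have "... = of_real (S\<^sup>2)"
  unfolding S2 of_real_sum by (intro sum.cong refl) (simp add: complex_norm_square mult_ac del: of_real_power)
  finally have "of_real (S\<^sup>2) = sint (\<lambda>z. \<phi> z * cnj (g z))" by (simp add: ip_def)
  then have "S\<^sup>2 = norm (sint (\<lambda>z. \<phi> z * cnj (g z)))" by (metis norm_of_real abs_power2)
  also have "... <= spint (\<lambda>z. norm (\<phi> z * cnj (g z)))" by (rule integral_norm_bound)
  also have "... <= spint (\<lambda>z. norm (\<phi> z) * (S * sqrt V))"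
  proof (rule integral_mono)
  show "integrable sphere_measure (\<lambda>z. norm (\<phi> z * cnj (g z)))"
   by (intro integrable_norm integrable_mult_continuous[OF \<phi>] continuous_intros gc)
  show "integrable sphere_measure (\<lambda>z. norm (\<phi> z) * (S * sqrt V))" using \<phi> by simp
  fix z :: "complex^'d" assume "z \<in> space sphere_measure"
  then have z: "norm z = 1" by (simp add: space_sphere_measure)
  have "norm (g z) <= (\<Sum>e\<in>E. \<bar>\<nu> e * norm (ip \<phi> e)\<bar> * \<bar>\<nu> e * norm (e z)\<bar>)"
  proof -
   have "\<bar>n * a\<bar> * \<bar>n * b\<bar> = n\<^sup>2 * a * b" if ab: "a >= 0" "b >= 0" for n a b :: real
    unfolding power2_abs[symmetric, of n]
    by (simp only: abs_mult abs_of_nonneg[OF ab(1)] abs_of_nonneg[OF ab(2)] power2_eq_square mult_ac)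
   then show ?thesis unfolding g_def by (intro order_trans[OF norm_sum]) (simp add: norm_mult norm_power)
  qed
  also have "... <= S * L2_set (\<lambda>e. \<nu> e * norm (e z)) E" unfolding S_def by (rule L2_set_mult_ineq)
  also have "... <= S * sqrt V" using V[OF z] unfolding L2_set_def power_mult_distrib
   by (intro mult_left_mono real_sqrt_le_mono) (auto simp: S_def L2_set_nonneg)
  finally show "norm (\<phi> z * cnj (g z)) <= norm (\<phi> z) * (S * sqrt V)"
   unfolding norm_mult complex_mod_cnj by (intro mult_left_mono) auto
  qed
  also have "... = S * (?I * sqrt V)" by simp
  finally have "S * S <= S * (?I * sqrt V)" by (simp add: power2_eq_square)
  moreover have "S >= 0" unfolding S_def by (rule L2_set_nonneg)
  moreover have "?I * sqrt V >= 0"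
  proof -
  have n: "norm (axis undefined 1 :: complex^'d) = 1" by simp
  have "0 <= (\<Sum>e\<in>E. (\<nu> e)\<^sup>2 * (norm (e (axis undefined 1)))\<^sup>2)" by (intro sum_nonneg) simp
  also have "... <= V" by (rule V[OF n])
  finally have "0 <= V" .
  then show ?thesis by simp
  qed
  ultimately show ?thesis unfolding S_def[symmetric] by (cases "S = 0") auto
qed

lemma weighted_coefficients:
  fixes \<phi>1 \<phi>2 :: "'d::finite cfun" and \<nu> :: "'d cfun => real"
  assumes \<phi>1: "integrable sphere_measure \<phi>1" and \<phi>2: "integrable sphere_measure \<phi>2" "integrable sphere_measure (\<lambda>z. (norm (\<phi>2 z))\<^sup>2)"
  and E: "finite E" "orthonormal E" "\<And>e. e \<in> E ==> continuous_on UNIV e"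
  and \<nu>: "\<And>e. e \<in> E ==> 0 <= \<nu> e \<and> \<nu> e <= \<nu>0"
  and V: "\<And>z. norm z = 1 ==> (\<Sum>e\<in>E. (\<nu> e)\<^sup>2 * (norm (e z))\<^sup>2) <= V" and \<nu>0: "\<nu>0 >= 0"
  shows "L2_set (\<lambda>e. \<nu> e * norm (ip (\<lambda>z. \<phi>1 z + \<phi>2 z) e)) E
  <= spint (\<lambda>z. norm (\<phi>1 z)) * sqrt V + \<nu>0 * sqrt (spint (\<lambda>z. (norm (\<phi>2 z))\<^sup>2))"
proof -
  have add: "ip (\<lambda>z. \<phi>1 z + \<phi>2 z) e = ip \<phi>1 e + ip \<phi>2 e" if "e \<in> E" for e
  unfolding ip_def distrib_right
  by (intro Bochner_Integration.integral_add integrable_mult_continuous \<phi>1 \<phi>2 continuous_intros E(3) that)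
  have "L2_set (\<lambda>e. \<nu> e * norm (ip (\<lambda>z. \<phi>1 z + \<phi>2 z) e)) E <= L2_set (\<lambda>e. \<nu> e * norm (ip \<phi>1 e) + \<nu>0 * norm (ip \<phi>2 e)) E"
  proof (rule L2_set_mono)
  fix e assume e: "e \<in> E"
  have "\<nu> e * norm (ip \<phi>1 e + ip \<phi>2 e) <= \<nu> e * (norm (ip \<phi>1 e) + norm (ip \<phi>2 e))"
   using \<nu>[OF e] by (intro mult_left_mono norm_triangle_ineq) auto
  also have "... <= \<nu> e * norm (ip \<phi>1 e) + \<nu>0 * norm (ip \<phi>2 e)"
   using \<nu>[OF e] by (simp add: distrib_left mult_right_mono)
  finally show "\<nu> e * norm (ip (\<lambda>z. \<phi>1 z + \<phi>2 z) e) <= \<nu> e * norm (ip \<phi>1 e) + \<nu>0 * norm (ip \<phi>2 e)"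
   by (simp add: add[OF e])
  show "0 <= \<nu> e * norm (ip (\<lambda>z. \<phi>1 z + \<phi>2 z) e)" using \<nu>[OF e] by simp
  qed
  also have "... <= L2_set (\<lambda>e. \<nu> e * norm (ip \<phi>1 e)) E + L2_set (\<lambda>e. \<nu>0 * norm (ip \<phi>2 e)) E"
  by (rule L2_set_triangle_ineq)
  also have "... = L2_set (\<lambda>e. \<nu> e * norm (ip \<phi>1 e)) E + \<nu>0 * L2_set (\<lambda>e. norm (ip \<phi>2 e)) E"
  by (simp only: L2_set_right_distrib[OF \<nu>0])
  also have "... <= spint (\<lambda>z. norm (\<phi>1 z)) * sqrt V + \<nu>0 * sqrt (spint (\<lambda>z. (norm (\<phi>2 z))\<^sup>2))"
  proof (rule add_mono)
  show "L2_set (\<lambda>e. \<nu> e * norm (ip \<phi>1 e)) E <= spint (\<lambda>z. norm (\<phi>1 z)) * sqrt V"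
   by (rule weighted_coefficients_L1[OF \<phi>1 E(1,3) V])
  have "L2_set (\<lambda>e. norm (ip \<phi>2 e)) E <= sqrt (spint (\<lambda>z. (norm (\<phi>2 z))\<^sup>2))"
   unfolding L2_set_def by (intro real_sqrt_le_mono bessel \<phi>2 E)
  then show "\<nu>0 * L2_set (\<lambda>e. norm (ip \<phi>2 e)) E <= \<nu>0 * sqrt (spint (\<lambda>z. (norm (\<phi>2 z))\<^sup>2))"
   by (rule mult_left_mono) (rule \<nu>0)
  qed
  finally show ?thesis .
qed

section \<open>Approximation of the multiplier series\<close>

abbreviation real_dim :: "'d::finite itself => nat" where
  "real_dim T \<equiv> 2 * CARD('d) - 1"

lemma card_level_power:
  "real (card (level l :: 'd::finite cfun set))
  <= 2 * real (real_dim TYPE('d)) ^ (real_dim TYPE('d) - 1) * (real l + 1) ^ (real_dim TYPE('d) - 1)"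
proof -
  let ?D = "real_dim TYPE('d)"
  have c: "CARD('d) > 0" by simp
  then have D: "?D >= 1" "l + 2 * CARD('d) - 2 = l + (?D - 1)" by linarith+
  have "real (card (level l :: 'd cfun set)) <= real (2 * ((l + (?D - 1)) choose l))"
  using card_level[where 'd = 'd and l = l] unfolding D(2) of_nat_le_iff .
  also have "... <= 2 * (real (l + (?D - 1)) ^ (?D - 1) / fact (?D - 1))"
  using binomial_le_power_fact[of l "?D - 1"] by simp
  also have "... <= 2 * (real (l + (?D - 1)) ^ (?D - 1) / 1)"
  by (intro mult_left_mono divide_left_mono) (auto simp: fact_ge_1)
  also have "... <= 2 * (real ?D * (real l + 1)) ^ (?D - 1)"
  proof -
  have "l + (?D - 1) <= ?D * (l + 1)" using D(1) by (cases ?D) auto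
  then have "real (l + (?D - 1)) <= real (?D * (l + 1))" by (simp only: of_nat_le_iff)
  also have "... = real ?D * (real l + 1)" by (simp only: of_nat_mult of_nat_add of_nat_1)
  finally show ?thesis unfolding div_by_1 by (intro mult_left_mono power_mono) auto
  qed
  finally show ?thesis by (simp only: power_mult_distrib mult.assoc)
qed

lemma summable_level_mass:
  assumes "\<gamma> > 0" "0 < r" "r <= 1"
  shows "summable (\<lambda>l. exp (- \<gamma> * real l powr r) * real (card (level l :: 'd::finite cfun set)))"
proof (rule summable_comparison_test'[where N = 0])
  let ?D = "real_dim TYPE('d)"
  have "CARD('d) > 0" by simp
  then have D: "?D >= 1" by linarith
  show "summable (\<lambda>l. 2 * real ?D ^ (?D - 1) * (exp (- \<gamma> * real l powr r) * (real l + 1) ^ (?D - 1)))"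
  by (intro summable_mult stretched_exp_summable assms D)
  fix l
  have "exp (- \<gamma> * real l powr r) * real (card (level l :: 'd cfun set))
  <= exp (- \<gamma> * real l powr r) * (2 * real ?D ^ (?D - 1) * (real l + 1) ^ (?D - 1))"
  by (intro mult_left_mono card_level_power) simp
  then show "norm (exp (- \<gamma> * real l powr r) * real (card (level l :: 'd cfun set)))
  <= 2 * real ?D ^ (?D - 1) * (exp (- \<gamma> * real l powr r) * (real l + 1) ^ (?D - 1))"
  by (simp only: real_norm_def abs_mult abs_exp_cancel abs_of_nat) (simp only: mult_ac)
qed

lemma unit_ball_integrable:
  fixes \<phi> :: "'d::finite cfun"
  assumes \<phi>: "\<phi> \<in> Lp_unit_ball sphere_measure p" and p: "1 <= p"
  shows "integrable sphere_measure \<phi>"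
  and "spint (\<lambda>z. norm (\<phi> z)) <= 1 + sphere_area TYPE('d) + (2 + sphere_area TYPE('d))\<^sup>2"
proof -
  let ?\<sigma> = "sphere_area TYPE('d)"
  have \<sigma>: "?\<sigma> > 0" by (rule sphere_measure_pos)
  obtain \<phi>1 \<phi>2 where i: "integrable sphere_measure \<phi>1" "integrable sphere_measure \<phi>2"
   "integrable sphere_measure (\<lambda>z. (norm (\<phi>2 z))\<^sup>2)" and eq: "\<phi> = (\<lambda>z. \<phi>1 z + \<phi>2 z)"
   and b: "spint (\<lambda>z. norm (\<phi>1 z)) * sqrt 1 <= 1 powr pos_part (enn2real (1 / p) - 1 / 2)"
    "sqrt (spint (\<lambda>z. (norm (\<phi>2 z))\<^sup>2)) <= (2 + ?\<sigma>) * 1 powr pos_part (enn2real (1 / p) - 1 / 2)"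
  using unit_ball_split[OF \<phi> p order_refl] by (elim exE conjE)
  show "integrable sphere_measure \<phi>" unfolding eq using i by simp
  have "spint (\<lambda>z. norm (\<phi> z)) <= spint (\<lambda>z. norm (\<phi>1 z) + (1 + (norm (\<phi>2 z))\<^sup>2))"
  proof (rule integral_mono)
  fix z
  have "x <= 1 + x\<^sup>2" for x :: real using zero_le_square[of "x - 1 / 2"] by (simp add: power2_eq_square algebra_simps)
  from this[of "norm (\<phi>2 z)"] show "norm (\<phi> z) <= norm (\<phi>1 z) + (1 + (norm (\<phi>2 z))\<^sup>2)"
   unfolding eq using norm_triangle_ineq[of "\<phi>1 z" "\<phi>2 z"] by linarith
  qed (use i in \<open>auto simp: eq\<close>)
  also have "... = spint (\<lambda>z. norm (\<phi>1 z)) + (?\<sigma> + spint (\<lambda>z. (norm (\<phi>2 z))\<^sup>2))"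
  using i by (simp add: space_sphere_measure)
  also have "... <= 1 + (?\<sigma> + (2 + ?\<sigma>)\<^sup>2)"
  proof -
  have "spint (\<lambda>z. (norm (\<phi>2 z))\<^sup>2) = (sqrt (spint (\<lambda>z. (norm (\<phi>2 z))\<^sup>2)))\<^sup>2"
   by simp
  also have "... <= (2 + ?\<sigma>)\<^sup>2" using b(2) by (intro power_mono) auto
  finally show ?thesis using b(1) by simp
  qed
  finally show "spint (\<lambda>z. norm (\<phi> z)) <= 1 + ?\<sigma> + (2 + ?\<sigma>)\<^sup>2" by simp
qed

lemma multiplier_series_bound:
  fixes \<phi> :: "'d::finite cfun"
  assumes \<phi>: "integrable sphere_measure \<phi>" and nn: "\<And>l. lam l >= 0"
  and sm: "summable (\<lambda>l. lam l * real (card (level l :: 'd cfun set)))" and z: "norm z = 1"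
  shows "norm (multiplier_series lam \<phi> z) <= spint (\<lambda>x. norm (\<phi> x)) / sphere_area TYPE('d)
   * (\<Sum>l. lam l * real (card (level l :: 'd cfun set)))"
  and "(\<And>L. (\<Sum>l\<in>{N<..L}. lam l * real (card (level l :: 'd cfun set))) <= B) ==>
   norm (multiplier_series lam \<phi> z - (\<Sum>l\<le>N. of_real (lam l) * level_part l \<phi> z))
    <= spint (\<lambda>x. norm (\<phi> x)) / sphere_area TYPE('d) * B"
proof -
  let ?m = "\<lambda>l. lam l * real (card (level l :: 'd cfun set))"
  let ?c = "spint (\<lambda>x. norm (\<phi> x)) / sphere_area TYPE('d)"
  let ?a = "\<lambda>l. of_real (lam l) * level_part l \<phi> z"
  have c: "?c >= 0" by simp
  have bd: "norm (?a l) <= ?c * ?m l" for l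
  proof -
  have "norm (?a l) = lam l * norm (level_part l \<phi> z)" using nn by (simp add: norm_mult)
  also have "... <= lam l * (spint (\<lambda>x. norm (\<phi> x))
    * (real (card (level l :: 'd cfun set)) / sphere_area TYPE('d)))"
   by (intro mult_left_mono level_part_bound \<phi> z nn)
  finally show ?thesis by (simp add: mult_ac)
  qed
  have "norm (suminf ?a) <= (\<Sum>l. ?c * ?m l)" by (rule norm_suminf_le[OF bd summable_mult[OF sm]])
  also have "... = ?c * suminf ?m" by (rule suminf_mult[OF sm])
  finally show "norm (multiplier_series lam \<phi> z) <= ?c * suminf ?m" unfolding multiplier_series_def .
  assume B: "\<And>L. (\<Sum>l\<in>{N<..L}. ?m l) <= B"
  have sa: "summable ?a" by (rule summable_norm_cancel[OF multiplier_series_facts(3)[OF \<phi> nn sm z]])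
  have "(\<lambda>L. norm ((\<Sum>l\<le>L. ?a l) - (\<Sum>l\<le>N. ?a l))) \<longlonglongrightarrow> norm (suminf ?a - (\<Sum>l\<le>N. ?a l))"
  by (intro tendsto_norm tendsto_diff tendsto_const summable_LIMSEQ' sa)
  then have "norm (suminf ?a - (\<Sum>l\<le>N. ?a l)) <= ?c * B"
  proof (rule LIMSEQ_le_const2, intro exI[of _ N] allI impI)
  fix L assume L: "N <= L"
  have "{..L} = {..N} \<union> {N<..L}" using L by auto
  then have "(\<Sum>l\<le>L. ?a l) = (\<Sum>l\<le>N. ?a l) + (\<Sum>l\<in>{N<..L}. ?a l)"
   by (simp only:) (rule sum.union_disjoint, auto)
  then have "norm ((\<Sum>l\<le>L. ?a l) - (\<Sum>l\<le>N. ?a l)) = norm (\<Sum>l\<in>{N<..L}. ?a l)" by simp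
  also have "... <= (\<Sum>l\<in>{N<..L}. ?c * ?m l)" by (rule sum_norm_le) (rule bd)
  also have "... = ?c * (\<Sum>l\<in>{N<..L}. ?m l)" by (simp only: sum_distrib_left)
  also have "... <= ?c * B" by (intro mult_left_mono B c)
  finally show "norm ((\<Sum>l\<le>L. ?a l) - (\<Sum>l\<le>N. ?a l)) <= ?c * B" .
  qed
  then show "norm (multiplier_series lam \<phi> z - (\<Sum>l\<le>N. ?a l)) <= ?c * B" unfolding multiplier_series_def .
qed

lemma combination_sum:
  fixes b :: "nat => 'x::real_normed_vector => complex"
  assumes "\<And>j. j \<in> J ==> \<exists>c. \<forall>z. norm z = 1 --> g j z = (\<Sum>i<k. c i * b i z)"
  shows "\<exists>c. \<forall>z. norm z = 1 --> (\<Sum>j\<in>J. a j * g j z) = (\<Sum>i<k. c i * b i z)"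
proof -
  have "\<forall>j\<in>J. \<exists>c. \<forall>z. norm z = 1 --> g j z = (\<Sum>i<k. c i * b i z)" using assms by (intro ballI)
  then have "\<exists>C. \<forall>j\<in>J. \<forall>z. norm z = 1 --> g j z = (\<Sum>i<k. C j i * b i z)" by (rule bchoice)
  then obtain C where C: "\<forall>j\<in>J. \<forall>z. norm z = 1 --> g j z = (\<Sum>i<k. C j i * b i z)" by (rule exE)
  show ?thesis
  proof (rule exI[of _ "\<lambda>i. \<Sum>j\<in>J. a j * C j i"], intro allI impI)
  fix z :: 'x assume z: "norm z = 1"
  have "(\<Sum>j\<in>J. a j * g j z) = (\<Sum>j\<in>J. \<Sum>i<k. a j * C j i * b i z)"
   by (rule sum.cong[OF refl]) (simp add: C z sum_distrib_left mult.assoc)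
  also have "... = (\<Sum>i<k. (\<Sum>j\<in>J. a j * C j i) * b i z)"
   by (subst sum.swap) (simp only: sum_distrib_right)
  finally show "(\<Sum>j\<in>J. a j * g j z) = (\<Sum>i<k. (\<Sum>j\<in>J. a j * C j i) * b i z)" .
  qed
qed

definition degree_of :: "'d::finite cfun => nat" where
  "degree_of e = (THE l. e \<in> level l)"

lemma degree_of_level: "e \<in> level l ==> degree_of e = l"
  unfolding degree_of_def using level_disjoint by (intro the_equality) blast+

lemma sum_levels:
  fixes g :: "'d::finite cfun => 'z::comm_monoid_add"
  assumes "finite S" shows "(\<Sum>e\<in>(\<Union>l\<in>S. level l). g e) = (\<Sum>l\<in>S. \<Sum>e\<in>level l. g e)"
  by (rule sum.UNION_disjoint) (use assms finite_level level_disjoint in auto)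

text \<open>The claimed order of the width without the factor that depends on
  \<open>q\<close>.\<close>
definition width_rate :: "'d::finite itself => real => real => ennreal => nat => real" where
  "width_rate T \<gamma> r p k = exp (- rate_const CARD('d) \<gamma> r * real k powr (r / real (real_dim T)))
  * real k powr ((1 - r / real (real_dim T)) * pos_part (enn2real (1 / p) - 1 / 2))"

text \<open>One \<open>k\<close>-dimensional space serves the whole unit ball. The error is a
  polynomial \<open>f1\<close>, small in the norm of order \<open>2 s\<close>, plus a uniformly small
  function \<open>f2\<close>; the bound on \<open>N\<close> is what allows the passage to the supremum
  norm of \<open>f1\<close>.\<close>
definition approximable :: "'d::finite itself => real => real => ennreal => real => nat => nat => bool" where
  "approximable T \<gamma> r p C k s \<longleftrightarrow> (\<exists>N (b :: nat => 'd cfun).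
  real N <= C * real k \<and> (\<forall>i<k. continuous_on UNIV (b i)) \<and>
  (\<forall>c :: nat => complex. (AE x in sphere_measure. (\<Sum>i<k. c i * b i x) = 0) --> (\<forall>i<k. c i = 0)) \<and>
  (\<forall>\<phi>\<in>Lp_unit_ball sphere_measure p. \<exists>c f1 f2. polydeg (2 * N) f1 \<and>
   (\<forall>z. norm z = 1 --> multiplier_series (\<lambda>l. exp (- \<gamma> * real l powr r)) \<phi> z = (\<Sum>i<k. c i * b i z) + f1 z + f2 z
    \<and> norm (f2 z) <= C * width_rate T \<gamma> r p k) \<and>
   spint (\<lambda>z. norm (f1 z) ^ (2 * s)) <= (C * sqrt (real s) * width_rate T \<gamma> r p k) ^ (2 * s)))"

text \<open>The levels up to \<open>N\<close> and the random combinations \<open>h i\<close> of the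
  block span the approximating space; \<open>f1\<close> is the error in the block and
  \<open>f2\<close> the tail.\<close>
lemma approximation_large:
  fixes \<gamma> r :: real and p :: ennreal
  assumes d: "CARD('d::finite) >= 2" and \<gamma>: "\<gamma> > 0" and r: "0 < r" "r <= 1" and p: "1 <= p"
  shows "\<exists>k0 C0. C0 > 0 \<and> (\<forall>C\<ge>C0. \<forall>k\<ge>k0. \<forall>s\<ge>1. approximable TYPE('d) \<gamma> r p C k s)"
proof -
  let ?\<sigma> = "sphere_area TYPE('d)"
  have \<sigma>: "?\<sigma> > 0" by (rule sphere_measure_pos)
  let ?card = "\<lambda>l. real (card (level l :: 'd cfun set))"
  define D where "D = real_dim TYPE('d)"
  have D: "D >= 1" "D >= 2" using d by (simp_all add: D_def)
  have Dr: "real D - r >= 0" using D r by linarith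
  define lam where "lam = (\<lambda>l::nat. exp (- \<gamma> * real l powr r))"
  have lam: "lam l > 0" for l by (simp add: lam_def)
  have sm: "summable (\<lambda>l. lam l * ?card l)" unfolding lam_def by (rule summable_level_mass[OF \<gamma> r])
  define t where "t = pos_part (enn2real (1 / p) - 1 / 2)"
  have t: "t >= 0" by (simp add: t_def pos_part_def)
  obtain C1 N1 where C1: "C1 > 0" and tail: "\<forall>N\<ge>N1. \<forall>L. (\<Sum>l\<in>{N<..L}. exp (- \<gamma> * real l powr r) * (real l + 1) ^ (D - 1))
  <= C1 * (exp (- \<gamma> * real N powr r) * real N powr (real D - r))"
  using stretched_exp_tail[OF \<gamma> r D(1)] by (elim exE conjE)
  obtain C2 where C2: "C2 > 0" and dbl: "\<forall>x\<ge>1. exp (- \<gamma> * (2 * x) powr r) * (2 * x) powr (real D - r) <= C2 * exp (- \<gamma> * x powr r)"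
  using stretched_exp_double[OF \<gamma> r(1) Dr] by (elim exE conjE)
  obtain k0 C3 where C3: "C3 > 0" and choice: "\<forall>k\<ge>k0. \<exists>N k'. N >= N1 \<and> N >= 1 \<and> k' >= 1 \<and> 2 * ((N + D) choose N) + k' <= k
  \<and> (fact D / 2) powr (r / real D) * real k powr (r / real D) <= real N powr r + C3
  \<and> real N powr (real D - r) <= C3 * real k'
  \<and> real N <= C3 * real k
  \<and> real N powr (real D - r) <= C3 * real k powr (1 - r / real D)"
  using choice_of_degree[OF r D(2), of N1] by (elim exE conjE)
  define K1 where "K1 = 2 * real D ^ (D - 1) * C1 / ?\<sigma>"
  have K1: "K1 > 0" unfolding K1_def using C1 \<sigma> D by simp
  have mass: "(\<Sum>l\<in>{N<..L}. lam l * ?card l) <= ?\<sigma> * K1 * (lam N * real N powr (real D - r))" if "N >= N1" for N L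
  proof -
  have "(\<Sum>l\<in>{N<..L}. lam l * ?card l) <= (\<Sum>l\<in>{N<..L}. 2 * real D ^ (D - 1) * (lam l * (real l + 1) ^ (D - 1)))"
  proof (rule sum_mono)
   fix l
   have "lam l * ?card l <= lam l * (2 * real D ^ (D - 1) * (real l + 1) ^ (D - 1))"
    unfolding D_def using lam[of l] by (intro mult_left_mono card_level_power) simp
   then show "lam l * ?card l <= 2 * real D ^ (D - 1) * (lam l * (real l + 1) ^ (D - 1))" by (simp only: mult_ac)
  qed
  also have "... = 2 * real D ^ (D - 1) * (\<Sum>l\<in>{N<..L}. lam l * (real l + 1) ^ (D - 1))" by (simp only: sum_distrib_left)
  also have "... <= 2 * real D ^ (D - 1) * (C1 * (lam N * real N powr (real D - r)))"
   unfolding lam_def using tail[rule_format, OF that] by (intro mult_left_mono) auto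
  also have "... = ?\<sigma> * K1 * (lam N * real N powr (real D - r))" using \<sigma> by (simp add: K1_def)
  finally show ?thesis .
  qed
  define K2 where "K2 = sqrt K1 + (2 + ?\<sigma>)"
  have K2: "K2 > 0" unfolding K2_def using K1 \<sigma> by (simp add: add_pos_pos)
  define K3 where "K3 = exp (\<gamma> * C3) * C3 powr t"
  have K3: "K3 > 0" unfolding K3_def using C3 by simp
  define I0 where "I0 = 1 + ?\<sigma> + (2 + ?\<sigma>)\<^sup>2"
  have I0: "I0 > 0" unfolding I0_def using \<sigma> by (intro add_pos_nonneg) auto
  define K4 where "K4 = 100 * (1 + ?\<sigma>) * sqrt (K1 * C3) * K2 * K3"
  define K5 where "K5 = I0 * K1 * C2 * K3"
  have K45: "K4 > 0" "K5 > 0" unfolding K4_def K5_def using \<sigma> K1 K2 K3 C2 C3 I0 by simp_all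
  define C0 where "C0 = C3 + K4 + K5"
  have C0: "C0 > 0" unfolding C0_def using C3 K45 by simp
  let ?\<rho> = "width_rate TYPE('d) \<gamma> r p"
  have \<rho>: "?\<rho> k >= 0" for k by (simp add: width_rate_def)
  show ?thesis
  proof (rule exI[of _ k0], rule exI[of _ C0], intro conjI C0 allI impI)
  fix C :: real and k s :: nat assume C0C: "C0 <= C" and k: "k0 <= k" and s: "1 <= s"
  have C: "C > 0" "C3 <= C" "K4 <= C" "K5 <= C" using C0 C0C C3 K45 unfolding C0_def by linarith+
  obtain N k' where N: "N >= N1" "N >= 1" and k': "k' >= 1" and dim: "2 * ((N + D) choose N) + k' <= k"
   and ex: "(fact D / 2) powr (r / real D) * real k powr (r / real D) <= real N powr r + C3"
   and Mk': "real N powr (real D - r) <= C3 * real k'" and Nk: "real N <= C3 * real k"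
   and Mk: "real N powr (real D - r) <= C3 * real k powr (1 - r / real D)"
   using choice[rule_format, OF k] by (elim exE conjE)
  define M where "M = real N powr (real D - r)"
  have M: "M >= 1" unfolding M_def using N Dr by (intro ge_one_powr_ge_zero) auto
  have kpos: "real k > 0" using dim k' by simp
  have rate: "lam N * M powr t <= K3 * ?\<rho> k"
  proof -
   have "lam N <= exp (\<gamma> * C3) * exp (- rate_const CARD('d) \<gamma> r * real k powr (r / real D))"
   proof -
    have "\<gamma> * ((fact D / 2) powr (r / real D) * real k powr (r / real D)) <= \<gamma> * (real N powr r + C3)"
     using ex \<gamma> by (intro mult_left_mono) auto
    then show ?thesis unfolding lam_def exp_add[symmetric] exp_le_cancel_iff rate_const_def D_def[symmetric]
     by (simp add: algebra_simps)
   qed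
   moreover have "M powr t <= C3 powr t * real k powr ((1 - r / real D) * t)"
   proof -
    have "M powr t <= (C3 * real k powr (1 - r / real D)) powr t" using Mk M t unfolding M_def by (intro powr_mono2) auto
    also have "... = C3 powr t * real k powr ((1 - r / real D) * t)" using C3 by (simp add: powr_mult powr_powr)
    finally show ?thesis .
   qed
   ultimately have "lam N * M powr t <= (exp (\<gamma> * C3) * exp (- rate_const CARD('d) \<gamma> r * real k powr (r / real D)))
     * (C3 powr t * real k powr ((1 - r / real D) * t))" by (intro mult_mono) auto
   also have "... = K3 * ?\<rho> k" unfolding K3_def width_rate_def t_def D_def by (simp only: mult_ac)
   finally show ?thesis .
  qed
  have rate1: "lam N <= K3 * ?\<rho> k"
  proof -
   have "lam N * 1 <= lam N * M powr t" using M t lam[of N] by (intro mult_left_mono ge_one_powr_ge_zero) auto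
   then show ?thesis using rate by linarith
  qed
  define E where "E = (\<Union>l\<in>{N<..2 * N}. level l :: 'd cfun set)"
  have E: "finite E" "orthonormal E" "\<And>e. e \<in> E ==> continuous_on UNIV e"
  proof -
   show "finite E" unfolding E_def by (auto simp: finite_level)
   show "orthonormal E" unfolding E_def orthonormal_def using level_ip by blast
   show "continuous_on UNIV e" if "e \<in> E" for e using that level_continuous unfolding E_def by blast
  qed
  have Epoly: "polydeg (2 * N) e" if "e \<in> E" for e using that unfolding E_def by (auto intro: polydeg_level)
  define \<nu> where "\<nu> = (\<lambda>e :: 'd cfun. sqrt (lam (degree_of e)))"
  have \<nu>l: "(\<nu> e)\<^sup>2 = lam l" if "e \<in> level l" for e l
   unfolding \<nu>_def degree_of_level[OF that] using lam[of l] by simp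
  have \<nu>0: "0 <= \<nu> e \<and> \<nu> e <= sqrt (lam N)" if e: "e \<in> E" for e
  proof -
   obtain l where l: "l > N" "e \<in> level l" using e unfolding E_def by auto
   have "lam l <= lam N" unfolding lam_def using l(1) r \<gamma> by (auto intro!: powr_mono2)
   then show ?thesis unfolding \<nu>_def degree_of_level[OF l(2)] using lam[of l] by simp
  qed
  (* By the tail estimate this bounds the weighted diagonal of the block. *)
  define V0 where "V0 = K1 * (lam N * M)"
  have V0: "V0 > 0" unfolding V0_def using K1 lam[of N] M by simp
  have V: "(\<Sum>e\<in>E. (\<nu> e)\<^sup>2 * (norm (e z))\<^sup>2) <= V0" if z: "norm z = 1" for z
  proof -
   have "(\<Sum>e\<in>E. (\<nu> e)\<^sup>2 * (norm (e z))\<^sup>2) = (\<Sum>l\<in>{N<..2 * N}. \<Sum>e\<in>level l. (\<nu> e)\<^sup>2 * (norm (e z))\<^sup>2)"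
    unfolding E_def by (rule sum_levels) simp
   also have "... = (\<Sum>l\<in>{N<..2 * N}. \<Sum>e\<in>level l. lam l * (norm (e z))\<^sup>2)"
    by (rule sum.cong[OF refl], rule sum.cong[OF refl]) (simp add: \<nu>l)
   also have "... = (\<Sum>l\<in>{N<..2 * N}. lam l * ?card l) / ?\<sigma>"
    by (simp add: sum_distrib_left[symmetric] level_diag[OF z] sum_divide_distrib)
   also have "... <= ?\<sigma> * K1 * (lam N * M) / ?\<sigma>"
    unfolding M_def using mass[OF N(1)] \<sigma> by (intro divide_right_mono) auto
   also have "... = V0" using \<sigma> by (simp add: V0_def)
   finally show ?thesis .
  qed
  have "k' > 0" using k' by simp
  from block_approximation[where \<nu> = \<nu> and E = E and k = k' and s = s, OF E(1) E(3) V0 V this s]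
  obtain \<alpha> :: "nat => 'd cfun => complex" where
   \<alpha>: "\<forall>x X. X > 0 --> (\<Sum>e\<in>E. (norm (x e))\<^sup>2) <= X\<^sup>2 -->
    (\<exists>c :: nat => complex. spint (\<lambda>z. norm ((\<Sum>e\<in>E. x e * of_real (\<nu> e) * e z)
     - (\<Sum>i<k'. c i * (\<Sum>e\<in>E. \<alpha> i e * e z))) ^ (2 * s))
    <= (100 * (1 + ?\<sigma>) * sqrt (real s * V0 / real k') * X) ^ (2 * s))" by (rule exE)
  define h where "h = (\<lambda>i z. \<Sum>e\<in>E. \<alpha> i e * e z)"
  have hpoly: "polydeg (2 * N) (h i)" for i unfolding h_def by (intro polydeg_sum polydeg_scale Epoly)
  define F where "F = upto_level N \<union> h ` {..<k'}"
  have F1: "finite F" unfolding F_def by (simp add: finite_upto_level)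
  have F2: "card F <= k"
  proof -
   have "card F <= card (upto_level N :: 'd cfun set) + card (h ` {..<k'})" unfolding F_def by (rule card_Un_le)
   moreover have "card (h ` {..<k'}) <= k'" using card_image_le[of "{..<k'}" h] by simp
   moreover have "N + 2 * CARD('d) - 1 = N + D" using d by (simp add: D_def)
   then have "card (upto_level N :: 'd cfun set) <= 2 * ((N + D) choose N)"
    using card_upto_level[where 'd = 'd and N = N] by simp
   ultimately show ?thesis using dim by linarith
  qed
  have F3: "continuous_on UNIV f" if "f \<in> F" for f
   using that unfolding F_def by (auto intro: upto_level_continuous polydeg_continuous[OF hpoly])
  from extend_to_independent[OF F1 F2 F3]
  obtain b :: "nat => 'd cfun" where b0: "(\<forall>i<k. continuous_on UNIV (b i)) \<and>
   (\<forall>c :: nat => complex. (AE x in sphere_measure. (\<Sum>i<k. c i * b i x) = 0) --> (\<forall>i<k. c i = 0)) \<and>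
   (\<forall>f\<in>F. \<exists>c. \<forall>z. norm z = 1 --> f z = (\<Sum>i<k. c i * b i z))" by (rule exE)
  note b = b0[THEN conjunct1] b0[THEN conjunct2, THEN conjunct1] b0[THEN conjunct2, THEN conjunct2]
  show "approximable TYPE('d) \<gamma> r p C k s" unfolding approximable_def
  proof (rule exI[of _ N], rule exI[of _ b], intro conjI ballI b(1) b(2))
   show "real N <= C * real k" using Nk mult_right_mono[OF C(2), of "real k"] by simp
   fix \<phi> :: "'d cfun" assume \<phi>: "\<phi> \<in> Lp_unit_ball sphere_measure p"
   note \<phi>i = unit_ball_integrable[OF \<phi> p]
   obtain \<phi>1 \<phi>2 where i: "integrable sphere_measure \<phi>1" "integrable sphere_measure \<phi>2"
     "integrable sphere_measure (\<lambda>z. (norm (\<phi>2 z))\<^sup>2)" and eq: "\<phi> = (\<lambda>z. \<phi>1 z + \<phi>2 z)"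
     and bd: "spint (\<lambda>z. norm (\<phi>1 z)) * sqrt M <= M powr pos_part (enn2real (1 / p) - 1 / 2)"
      "sqrt (spint (\<lambda>z. (norm (\<phi>2 z))\<^sup>2)) <= (2 + ?\<sigma>) * M powr pos_part (enn2real (1 / p) - 1 / 2)"
    using unit_ball_split[OF \<phi> p M] by (elim exE conjE)
   define X where "X = K2 * sqrt (lam N) * M powr t"
   have X: "X > 0" unfolding X_def using K2 lam[of N] M by simp
   have "L2_set (\<lambda>e. \<nu> e * norm (ip \<phi> e)) E
     <= spint (\<lambda>z. norm (\<phi>1 z)) * sqrt V0 + sqrt (lam N) * sqrt (spint (\<lambda>z. (norm (\<phi>2 z))\<^sup>2))"
    unfolding eq using lam[of N] by (intro weighted_coefficients i E \<nu>0 V) auto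
   also have "sqrt V0 = sqrt K1 * sqrt (lam N) * sqrt M" unfolding V0_def by (simp add: real_sqrt_mult)
   also have "spint (\<lambda>z. norm (\<phi>1 z)) * (sqrt K1 * sqrt (lam N) * sqrt M)
     + sqrt (lam N) * sqrt (spint (\<lambda>z. (norm (\<phi>2 z))\<^sup>2))
    = sqrt K1 * sqrt (lam N) * (spint (\<lambda>z. norm (\<phi>1 z)) * sqrt M)
     + sqrt (lam N) * sqrt (spint (\<lambda>z. (norm (\<phi>2 z))\<^sup>2))" by (simp only: mult_ac)
   also have "... <= sqrt K1 * sqrt (lam N) * M powr t + sqrt (lam N) * ((2 + ?\<sigma>) * M powr t)"
    unfolding t_def using K1 lam[of N] bd by (intro add_mono mult_left_mono) auto
   also have "... = X" unfolding X_def K2_def by (simp only: distrib_right distrib_left mult_ac)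
   finally have "sqrt (\<Sum>e\<in>E. (\<nu> e * norm (ip \<phi> e))\<^sup>2) <= X" unfolding L2_set_def .
   then have "(sqrt (\<Sum>e\<in>E. (\<nu> e * norm (ip \<phi> e))\<^sup>2))\<^sup>2 <= X\<^sup>2" by (intro power_mono) (auto simp: sum_nonneg)
   then have "(\<Sum>e\<in>E. (\<nu> e * norm (ip \<phi> e))\<^sup>2) <= X\<^sup>2" by (simp add: sum_nonneg)
   then have "(\<Sum>e\<in>E. (norm (of_real (\<nu> e) * ip \<phi> e))\<^sup>2) <= X\<^sup>2" by (simp add: norm_mult power_mult_distrib)
   from \<alpha>[rule_format, OF X this] obtain c0 :: "nat => complex" where
    c0: "spint (\<lambda>z. norm ((\<Sum>e\<in>E. of_real (\<nu> e) * ip \<phi> e * of_real (\<nu> e) * e z)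
     - (\<Sum>i<k'. c0 i * (\<Sum>e\<in>E. \<alpha> i e * e z))) ^ (2 * s))
    <= (100 * (1 + ?\<sigma>) * sqrt (real s * V0 / real k') * X) ^ (2 * s)" by (rule exE)
   define f1 where "f1 = (\<lambda>z. (\<Sum>e\<in>E. of_real (\<nu> e) * ip \<phi> e * of_real (\<nu> e) * e z) - (\<Sum>i<k'. c0 i * h i z))"
   define f2 where "f2 = (\<lambda>z. multiplier_series lam \<phi> z - (\<Sum>l\<le>2 * N. of_real (lam l) * level_part l \<phi> z))"
   have f1p: "polydeg (2 * N) f1"
   proof -
    have "polydeg (2 * N) (\<lambda>z. (\<Sum>e\<in>E. (of_real (\<nu> e) * ip \<phi> e * of_real (\<nu> e)) * e z) + (- 1) * (\<Sum>i<k'. c0 i * h i z))"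
     by (intro polydeg_add polydeg_sum polydeg_scale Epoly hpoly)
    then show ?thesis unfolding f1_def by simp
   qed
   have f1i: "spint (\<lambda>z. norm (f1 z) ^ (2 * s)) <= (C * sqrt (real s) * ?\<rho> k) ^ (2 * s)"
   proof -
    have "real s * V0 / real k' <= real s * (K1 * C3 * lam N)"
    proof -
     have "M / real k' <= C3" using Mk' k' unfolding M_def by (simp add: divide_le_eq)
     then have "real s * (K1 * (lam N * (M / real k'))) <= real s * (K1 * (lam N * C3))"
      using K1 lam[of N] by (intro mult_left_mono) auto
     then show ?thesis unfolding V0_def by (simp add: mult_ac)
    qed
    then have "sqrt (real s * V0 / real k') <= sqrt (real s * (K1 * C3 * lam N))" by (rule real_sqrt_le_mono)
    also have "... = sqrt (real s) * (sqrt (K1 * C3) * sqrt (lam N))" by (simp only: real_sqrt_mult)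
    finally have sq: "sqrt (real s * V0 / real k') <= sqrt (real s) * (sqrt (K1 * C3) * sqrt (lam N))" .
    have "100 * (1 + ?\<sigma>) * sqrt (real s * V0 / real k') * X
      <= 100 * (1 + ?\<sigma>) * (sqrt (real s) * (sqrt (K1 * C3) * sqrt (lam N))) * X"
     using sq \<sigma> X by (intro mult_right_mono mult_left_mono) auto
    also have "... = 100 * (1 + ?\<sigma>) * sqrt (K1 * C3) * K2 * sqrt (real s) * ((sqrt (lam N) * sqrt (lam N)) * M powr t)"
     unfolding X_def by (simp only: mult_ac)
    also have "sqrt (lam N) * sqrt (lam N) = lam N" using lam[of N] by simp
    also have "100 * (1 + ?\<sigma>) * sqrt (K1 * C3) * K2 * sqrt (real s) * (lam N * M powr t)
      <= 100 * (1 + ?\<sigma>) * sqrt (K1 * C3) * K2 * sqrt (real s) * (K3 * ?\<rho> k)"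
     using rate \<sigma> K1 C3 K2 by (intro mult_left_mono) auto
    also have "... = K4 * (sqrt (real s) * ?\<rho> k)" unfolding K4_def by (simp only: mult_ac)
    also have "... <= C * (sqrt (real s) * ?\<rho> k)" using C(3) \<rho>[of k] by (intro mult_right_mono) auto
    finally have le: "100 * (1 + ?\<sigma>) * sqrt (real s * V0 / real k') * X <= C * sqrt (real s) * ?\<rho> k" by simp
    have "spint (\<lambda>z. norm (f1 z) ^ (2 * s)) <= (100 * (1 + ?\<sigma>) * sqrt (real s * V0 / real k') * X) ^ (2 * s)"
     using c0 unfolding f1_def h_def .
    also have "... <= (C * sqrt (real s) * ?\<rho> k) ^ (2 * s)"
     using le \<sigma> X V0 by (intro power_mono) auto
    finally show ?thesis .
   qed
   have f2b: "norm (f2 z) <= C * ?\<rho> k" if z: "norm z = 1" for z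
   proof -
    have "norm (f2 z) <= spint (\<lambda>x. norm (\<phi> x)) / ?\<sigma> * (?\<sigma> * K1 * (lam (2 * N) * real (2 * N) powr (real D - r)))"
     unfolding f2_def using mass[of "2 * N"] N(1) lam
     by (intro multiplier_series_bound(2)[OF \<phi>i(1) _ sm z]) (auto intro: less_imp_le)
    also have "... = spint (\<lambda>x. norm (\<phi> x)) * K1 * (lam (2 * N) * real (2 * N) powr (real D - r))"
     using \<sigma> by simp
    also have "... <= I0 * K1 * (C2 * lam N)"
    proof (rule mult_mono)
     show "spint (\<lambda>x. norm (\<phi> x)) * K1 <= I0 * K1"
      using \<phi>i(2) K1 unfolding I0_def by (intro mult_right_mono) auto
     show "lam (2 * N) * real (2 * N) powr (real D - r) <= C2 * lam N"
      using dbl[rule_format, of "real N"] N(2) unfolding lam_def by simp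
    qed (use I0 K1 less_imp_le[OF lam] in auto)
    also have "... <= I0 * K1 * (C2 * (K3 * ?\<rho> k))" using rate1 I0 K1 C2 by (intro mult_left_mono) auto
    also have "... = K5 * ?\<rho> k" unfolding K5_def by (simp only: mult_ac)
    also have "... <= C * ?\<rho> k" using C(4) \<rho>[of k] by (intro mult_right_mono) auto
    finally show ?thesis .
   qed
   have span: "\<exists>c. \<forall>z. norm z = 1 --> f z = (\<Sum>i<k. c i * b i z)" if "f \<in> F" for f using b(3) that by (rule bspec)
   have "\<exists>c. \<forall>z. norm z = 1 --> (\<Sum>e\<in>upto_level N. of_real (lam (degree_of e)) * ip \<phi> e * e z) = (\<Sum>i<k. c i * b i z)"
    by (rule combination_sum, rule span) (simp add: F_def)
   then obtain c1 where c1: "\<forall>z. norm z = 1 --> (\<Sum>e\<in>upto_level N. of_real (lam (degree_of e)) * ip \<phi> e * e z) = (\<Sum>i<k. c1 i * b i z)"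
    by (rule exE)
   have "\<exists>c. \<forall>z. norm z = 1 --> (\<Sum>i<k'. c0 i * h i z) = (\<Sum>i<k. c i * b i z)"
    by (rule combination_sum, rule span) (simp add: F_def)
   then obtain c2 where c2: "\<forall>z. norm z = 1 --> (\<Sum>i<k'. c0 i * h i z) = (\<Sum>i<k. c2 i * b i z)"
    by (rule exE)
   have sum_eq: "multiplier_series lam \<phi> z = (\<Sum>i<k. (c1 i + c2 i) * b i z) + f1 z + f2 z" if z: "norm z = 1" for z
   proof -
    have part: "(\<Sum>e\<in>(\<Union>l\<in>S. level l). of_real (lam (degree_of e)) * ip \<phi> e * e z) = (\<Sum>l\<in>S. of_real (lam l) * level_part l \<phi> z)"
     if "finite S" for S :: "nat set" unfolding sum_levels[OF that] level_part_def sum_distrib_left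
     by (rule sum.cong[OF refl], rule sum.cong[OF refl]) (simp add: degree_of_level mult.assoc)
    have "{..2 * N} = {..N} \<union> {N<..2 * N}" by auto
    then have "(\<Sum>l\<le>2 * N. of_real (lam l) * level_part l \<phi> z)
      = (\<Sum>l\<le>N. of_real (lam l) * level_part l \<phi> z) + (\<Sum>l\<in>{N<..2 * N}. of_real (lam l) * level_part l \<phi> z)"
     by (simp only:) (rule sum.union_disjoint, auto)
    also have "(\<Sum>l\<le>N. of_real (lam l) * level_part l \<phi> z) = (\<Sum>i<k. c1 i * b i z)"
     using part[of "{..N}"] c1[rule_format, OF z] unfolding upto_level_def by simp
    also have "(\<Sum>l\<in>{N<..2 * N}. of_real (lam l) * level_part l \<phi> z) = (\<Sum>e\<in>E. of_real (lam (degree_of e)) * ip \<phi> e * e z)"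
     unfolding E_def by (rule part[symmetric]) simp
    also have "... = (\<Sum>e\<in>E. of_real (\<nu> e) * ip \<phi> e * of_real (\<nu> e) * e z)"
    proof (rule sum.cong[OF refl])
     fix e
     have "lam (degree_of e) = \<nu> e * \<nu> e" unfolding \<nu>_def using lam[of "degree_of e"] by simp
     then show "of_real (lam (degree_of e)) * ip \<phi> e * e z = of_real (\<nu> e) * ip \<phi> e * of_real (\<nu> e) * e z"
      by (simp only: of_real_mult mult_ac)
    qed
    also have "... = f1 z + (\<Sum>i<k. c2 i * b i z)" using c2[rule_format, OF z] by (simp add: f1_def)
    finally show ?thesis by (simp add: f2_def distrib_right sum.distrib)
   qed
   show "\<exists>c f1 f2. polydeg (2 * N) f1 \<and>
    (\<forall>z. norm z = 1 --> multiplier_series (\<lambda>l. exp (- \<gamma> * real l powr r)) \<phi> z = (\<Sum>i<k. c i * b i z) + f1 z + f2 z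
     \<and> norm (f2 z) <= C * ?\<rho> k) \<and>
    spint (\<lambda>z. norm (f1 z) ^ (2 * s)) <= (C * sqrt (real s) * ?\<rho> k) ^ (2 * s)"
    unfolding lam_def[symmetric]
    by (rule exI[of _ "\<lambda>i. c1 i + c2 i"], rule exI[of _ f1], rule exI[of _ f2])
     (intro conjI allI impI f1p f1i f2b sum_eq)
  qed
  qed
qed

text \<open>For the finitely many small \<open>k\<close> the rate is bounded below, and
  \<open>0\<close> is a sufficient approximation.\<close>
lemma approximation:
  fixes \<gamma> r :: real and p :: ennreal
  assumes d: "CARD('d::finite) >= 2" and \<gamma>: "\<gamma> > 0" and r: "0 < r" "r <= 1" and p: "1 <= p"
  shows "\<exists>C>0. \<forall>k\<ge>2. \<forall>s\<ge>1. approximable TYPE('d) \<gamma> r p C k s"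
proof -
  let ?\<sigma> = "sphere_area TYPE('d)"
  have \<sigma>: "?\<sigma> > 0" by (rule sphere_measure_pos)
  let ?D = "real (real_dim TYPE('d))"
  obtain k0 C1 where C1: "C1 > 0" and large: "\<forall>C\<ge>C1. \<forall>k\<ge>k0. \<forall>s\<ge>1. approximable TYPE('d) \<gamma> r p C k s"
  using approximation_large[OF d \<gamma> r p] by (elim exE conjE)
  define mass where "mass = (\<Sum>l. exp (- \<gamma> * real l powr r) * real (card (level l :: 'd cfun set)))"
  have sm: "summable (\<lambda>l. exp (- \<gamma> * real l powr r) * real (card (level l :: 'd cfun set)))"
  by (rule summable_level_mass[OF \<gamma> r])
  have mass: "mass >= 0" unfolding mass_def by (intro suminf_nonneg sm) simp
  define B where "B = (1 + ?\<sigma> + (2 + ?\<sigma>)\<^sup>2) / ?\<sigma> * mass"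
  have B: "B >= 0" unfolding B_def using \<sigma> mass by simp
  (* The rate is decreasing in k up to a power that is at least 1, so this is a lower bound for k < k0. *)
  define \<rho>0 where "\<rho>0 = exp (- rate_const CARD('d) \<gamma> r * real k0 powr (r / ?D))"
  have \<rho>0: "\<rho>0 > 0" by (simp add: \<rho>0_def)
  define C where "C = C1 + B / \<rho>0"
  have C: "C > 0" "C1 <= C" unfolding C_def using C1 B \<rho>0 by (simp_all add: add_pos_nonneg)
  show ?thesis
  proof (rule exI[of _ C], intro conjI C(1) allI impI)
  fix k s :: nat assume k: "2 <= k" and s: "1 <= s"
  show "approximable TYPE('d) \<gamma> r p C k s"
  proof (cases "k0 <= k")
   case True
   show ?thesis by (rule large[rule_format, OF C(2) True s])
  next
   case False
   let ?\<rho> = "width_rate TYPE('d) \<gamma> r p k"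
   have D: "?D >= 3" using d by simp
   have "B <= C * ?\<rho>"
   proof -
    have "rate_const CARD('d) \<gamma> r * real k powr (r / ?D) <= rate_const CARD('d) \<gamma> r * real k0 powr (r / ?D)"
     using False r D \<gamma> by (intro mult_left_mono powr_mono2) (auto simp: rate_const_def)
    then have "\<rho>0 <= exp (- rate_const CARD('d) \<gamma> r * real k powr (r / ?D))" unfolding \<rho>0_def by simp
    moreover have "1 <= real k powr ((1 - r / ?D) * pos_part (enn2real (1 / p) - 1 / 2))"
    proof (rule ge_one_powr_ge_zero)
     have "r / ?D <= 1" using r D by simp
     then show "0 <= (1 - r / ?D) * pos_part (enn2real (1 / p) - 1 / 2)" by (intro mult_nonneg_nonneg) (auto simp: pos_part_def)
    qed (use k in simp)
    ultimately have "\<rho>0 * 1 <= ?\<rho>" unfolding width_rate_def using \<rho>0 by (intro mult_mono) auto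
    then have "B / \<rho>0 * \<rho>0 <= C * ?\<rho>" unfolding C_def using B \<rho>0 C1 by (intro mult_mono) auto
    then show ?thesis using \<rho>0 by simp
   qed
   obtain b :: "nat => 'd cfun" where b: "\<forall>i<k. continuous_on UNIV (b i)"
    "\<forall>c :: nat => complex. (AE x in sphere_measure. (\<Sum>i<k. c i * b i x) = 0) --> (\<forall>i<k. c i = 0)"
   proof -
    have F: "finite {}" "card {} <= k" "\<And>f :: 'd cfun. f \<in> {} ==> continuous_on UNIV f" by simp_all
    have "\<exists>b :: nat => 'd cfun. (\<forall>i<k. continuous_on UNIV (b i)) \<and>
     (\<forall>c :: nat => complex. (AE x in sphere_measure. (\<Sum>i<k. c i * b i x) = 0) --> (\<forall>i<k. c i = 0)) \<and>
     (\<forall>f\<in>{}. \<exists>c. \<forall>z. norm z = 1 --> f z = (\<Sum>i<k. c i * b i z))"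
     by (rule extend_to_independent[OF F])
    then show thesis by (elim exE conjE) (rule that)
   qed
   show ?thesis unfolding approximable_def
   proof (rule exI[of _ 0], rule exI[of _ b], intro conjI ballI b)
    show "real 0 <= C * real k" using C(1) by simp
    fix \<phi> :: "'d cfun" assume \<phi>: "\<phi> \<in> Lp_unit_ball sphere_measure p"
    note \<phi>i = unit_ball_integrable[OF \<phi> p]
    let ?S = "multiplier_series (\<lambda>l. exp (- \<gamma> * real l powr r)) \<phi>"
    have "norm (?S z) <= C * ?\<rho>" if z: "norm z = 1" for z
    proof -
     have "norm (?S z) <= spint (\<lambda>x. norm (\<phi> x)) / ?\<sigma> * mass"
      unfolding mass_def by (rule multiplier_series_bound(1)[OF \<phi>i(1) _ sm z]) simp
     also have "... <= B" unfolding B_def using \<phi>i(2) \<sigma> mass by (intro mult_right_mono divide_right_mono) auto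
     finally show ?thesis using \<open>B <= C * ?\<rho>\<close> by linarith
    qed
    moreover have "(0::real) ^ (2 * s) <= (C * sqrt (real s) * ?\<rho>) ^ (2 * s)"
     using C(1) by (intro power_mono) (auto simp: width_rate_def)
    ultimately show "\<exists>c f1 f2. polydeg (2 * 0) f1 \<and>
     (\<forall>z. norm z = 1 --> ?S z = (\<Sum>i<k. c i * b i z) + f1 z + f2 z \<and> norm (f2 z) <= C * ?\<rho>) \<and>
     spint (\<lambda>z. norm (f1 z) ^ (2 * s)) <= (C * sqrt (real s) * ?\<rho>) ^ (2 * s)"
     using s by (intro exI[of _ "\<lambda>_::nat. 0::complex"] exI[of _ "\<lambda>_::complex^'d. 0::complex"] exI[of _ ?S])
      (auto intro: polydeg_const simp: zero_power)
   qed
  qed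
  qed
qed

section \<open>Widths\<close>

lemma kolmogorov_width_le:
  fixes b :: "nat => 'd::finite cfun"
  assumes b: "\<forall>i<k. continuous_on UNIV (b i)"
   "\<forall>c :: nat => complex. (AE x in sphere_measure. (\<Sum>i<k. c i * b i x) = 0) --> (\<forall>i<k. c i = 0)"
  and q: "q ~= 0"
  and A: "\<And>f. f \<in> A ==> \<exists>c. Lp_norm sphere_measure q (\<lambda>z. f z - (\<Sum>i<k. c i * b i z)) <= B"
  shows "kolmogorov_width k A sphere_measure q <= B"
proof -
  let ?X = "range (\<lambda>(c :: nat => complex) x. \<Sum>i<k. c i * b i x)"
  have space: "b i \<in> Lp_space sphere_measure q" if i: "i < k" for i
  proof -
  have c: "continuous_on UNIV (b i)" using b(1) i by simp
  have m: "b i \<in> borel_measurable sphere_measure"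
   by (intro borel_measurable_sphere borel_measurable_continuous_onI c)
  obtain K where K: "K >= 0" "\<And>x. norm x = 1 ==> norm (b i x) <= K" using continuous_bounded_sphere[OF c] by blast
  have "Lp_norm sphere_measure q (b i) < \<infinity>"
  proof (cases "q = \<infinity>")
   case True
   have "esssup sphere_measure (\<lambda>x. ennreal (norm (b i x))) <= ennreal K"
    by (rule esssup_I) (use m K in \<open>auto simp: space_sphere_measure intro!: AE_I2 ennreal_leI\<close>)
   also have "... < \<infinity>" by simp
   finally show ?thesis using True by (simp add: Lp_norm_def)
  next
   case False
   have "integrable sphere_measure (\<lambda>x. norm (b i x) powr enn2real q)"
   proof (rule integrable_sphere_bounded[where B = "K powr enn2real q"])
    show "norm (norm (b i x) powr enn2real q) <= K powr enn2real q" if "norm x = 1" for x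
     using K(2)[OF that] by (auto intro: powr_mono2)
   qed (use m in measurable)
   then have "(\<integral>\<^sup>+ x. ennreal (norm (b i x) powr enn2real q) \<partial>sphere_measure) < \<infinity>"
    unfolding integrable_iff_bounded by simp
   then show ?thesis using False by (auto simp: Lp_norm_def Let_def)
  qed
  then show ?thesis using m by (simp add: Lp_space_def)
  qed
  have "?X \<in> Lp_subspaces sphere_measure q k" unfolding Lp_subspaces_def mem_Collect_eq
  by (rule exI[of _ b]) (intro conjI allI impI space b(2)[rule_format] refl, assumption+)
  then have "kolmogorov_width k A sphere_measure q <= (SUP f\<in>A. INF g\<in>?X. Lp_norm sphere_measure q (\<lambda>x. f x - g x))"
  unfolding kolmogorov_width_def by (rule INF_lower)
  also have "... <= B"
  proof (rule SUP_least)
  fix f assume f: "f \<in> A"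
  obtain c where c: "Lp_norm sphere_measure q (\<lambda>z. f z - (\<Sum>i<k. c i * b i z)) <= B"
   using A[OF f] by (rule exE)
  have "(INF g\<in>?X. Lp_norm sphere_measure q (\<lambda>x. f x - g x)) <= Lp_norm sphere_measure q (\<lambda>z. f z - (\<Sum>i<k. c i * b i z))"
   by (rule INF_lower2[where i = "\<lambda>x. \<Sum>i<k. c i * b i x"]) auto
  then show "(INF g\<in>?X. Lp_norm sphere_measure q (\<lambda>x. f x - g x)) <= B" using c by (rule order_trans)
  qed
  finally show ?thesis .
qed

text \<open>After division by \<open>2 * \<beta>\<close> the power of order \<open>Q\<close> is at
  most \<open>1\<close> plus the power of order \<open>2 s\<close>, and the measure is finite.\<close>
lemma Lp_norm_le_of_even_norm:
  fixes f f1 f2 :: "'d::finite cfun"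
  assumes f: "f \<in> borel_measurable sphere_measure" "AE z in sphere_measure. f z = f1 z + f2 z"
  and f1: "continuous_on UNIV f1" "spint (\<lambda>z. norm (f1 z) ^ (2 * s)) <= \<beta> ^ (2 * s)"
  and f2: "\<And>z. norm z = 1 ==> norm (f2 z) <= \<beta>" and \<beta>: "\<beta> > 0" and Q: "1 <= Q" "Q <= 2 * real s"
  shows "Lp_norm sphere_measure (ennreal Q) f <= ennreal (2 * (1 + 2 * sphere_area TYPE('d)) * \<beta>)"
proof -
  let ?\<sigma> = "sphere_area TYPE('d)" and ?n = "2 * s"
  have \<sigma>: "?\<sigma> > 0" by (rule sphere_measure_pos)
  define I where "I = (\<integral>\<^sup>+ x. ennreal (norm (f x) powr Q) \<partial>sphere_measure)"
  define g where "g = (\<lambda>z. (2 * \<beta>) powr Q * (2 + norm (f1 z) ^ ?n / \<beta> ^ ?n))"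
  have gint: "integrable sphere_measure g"
  unfolding g_def using \<beta> by (intro integrable_sphere_continuous continuous_intros f1(1)) auto
  have pt: "norm (f1 z + f2 z) powr Q <= g z" if z: "norm z = 1" for z
  proof -
  define a where "a = norm (f1 z) / \<beta>"
  have a: "a >= 0" using \<beta> by (simp add: a_def)
  define u where "u = norm (f1 z + f2 z) / (2 * \<beta>)"
  have u: "u >= 0" using \<beta> by (simp add: u_def)
  have "norm (f1 z + f2 z) <= norm (f1 z) + \<beta>" using norm_triangle_ineq[of "f1 z" "f2 z"] f2[OF z] by linarith
  also have "norm (f1 z) + \<beta> = (a + 1) / 2 * (2 * \<beta>)" using \<beta> unfolding a_def by (simp add: field_simps)
  finally have "norm (f1 z + f2 z) <= (a + 1) / 2 * (2 * \<beta>)" .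
  then have ua: "u <= (a + 1) / 2" using \<beta> unfolding u_def by (simp add: divide_le_eq)
  have "u powr Q <= 1 + u ^ ?n"
  proof (cases "u <= 1")
   case True
   have "u powr Q <= 1 powr Q" using True u Q by (intro powr_mono2) auto
   also have "... <= 1 + u ^ ?n" by simp
   finally show ?thesis .
  next
   case False
   then have "u powr Q <= u powr real ?n" using Q by (intro powr_mono) auto
   also have "... = u ^ ?n" using False by (simp only: powr_realpow)
   finally show ?thesis by simp
  qed
  also have "u ^ ?n <= max a 1 ^ ?n" using u ua by (intro power_mono) auto
  also have "max a 1 ^ ?n <= 1 + a ^ ?n" using a by (auto simp: max_def)
  finally have "u powr Q <= 2 + a ^ ?n" by simp
  then have "(2 * \<beta>) powr Q * u powr Q <= (2 * \<beta>) powr Q * (2 + a ^ ?n)" by (intro mult_left_mono) auto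
  moreover have "(2 * \<beta>) powr Q * u powr Q = norm (f1 z + f2 z) powr Q"
  proof -
   have "(2 * \<beta>) * u = norm (f1 z + f2 z)" using \<beta> by (simp add: u_def)
   then show ?thesis using u \<beta> by (simp only: powr_mult[symmetric])
  qed
  ultimately show ?thesis unfolding g_def a_def by (simp only: power_divide)
  qed
  have gpos: "g z >= 0" for z unfolding g_def using \<beta> by simp
  have "I <= (\<integral>\<^sup>+ x. ennreal (g x) \<partial>sphere_measure)" unfolding I_def
  proof (rule nn_integral_mono_AE)
  show "AE x in sphere_measure. ennreal (norm (f x) powr Q) <= ennreal (g x)"
   using f(2) by (elim AE_mp, intro AE_I2 impI) (use pt in \<open>auto simp: space_sphere_measure intro!: ennreal_leI\<close>)
  qed
  also have "... = ennreal (spint g)" by (rule nn_integral_eq_integral[OF gint]) (use gpos in simp)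
  also have "... <= ennreal ((2 * \<beta>) powr Q * (1 + 2 * ?\<sigma>))"
  proof (rule ennreal_leI)
  have i1: "integrable sphere_measure (\<lambda>z. norm (f1 z) ^ ?n / \<beta> ^ ?n)"
   using \<beta> by (intro integrable_sphere_continuous continuous_intros f1(1)) auto
  have "spint g = (2 * \<beta>) powr Q * (spint (\<lambda>z. 2 + norm (f1 z) ^ ?n / \<beta> ^ ?n))"
   unfolding g_def by (rule integral_mult_right_zero)
  also have "... = (2 * \<beta>) powr Q * (2 * ?\<sigma> + spint (\<lambda>z. norm (f1 z) ^ ?n) / \<beta> ^ ?n)"
   by (subst Bochner_Integration.integral_add) (use i1 in \<open>auto simp: space_sphere_measure\<close>)
  also have "... <= (2 * \<beta>) powr Q * (2 * ?\<sigma> + 1)"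
   using f1(2) \<beta> by (intro mult_left_mono add_left_mono) auto
  finally show "spint g <= (2 * \<beta>) powr Q * (1 + 2 * ?\<sigma>)" by (simp add: add.commute)
  qed
  finally have I: "I <= ennreal ((2 * \<beta>) powr Q * (1 + 2 * ?\<sigma>))" .
  then have fin: "I ~= \<infinity>" by (auto simp: top_unique)
  have "enn2real I <= (2 * \<beta>) powr Q * (1 + 2 * ?\<sigma>)"
  using I \<sigma> \<beta> by (intro enn2real_leI) auto
  then have "enn2real I powr (1 / Q) <= ((2 * \<beta>) powr Q * (1 + 2 * ?\<sigma>)) powr (1 / Q)"
  using Q by (intro powr_mono2) auto
  also have "... = 2 * \<beta> * (1 + 2 * ?\<sigma>) powr (1 / Q)"
  using Q \<beta> \<sigma> by (simp add: powr_mult powr_powr)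
  also have "... <= 2 * \<beta> * (1 + 2 * ?\<sigma>) powr 1"
  using Q \<beta> \<sigma> by (intro mult_left_mono powr_mono) auto
  also have "... = 2 * (1 + 2 * ?\<sigma>) * \<beta>" using \<sigma> by simp
  finally have "ennreal (enn2real I powr (1 / Q)) <= ennreal (2 * (1 + 2 * ?\<sigma>) * \<beta>)" by (rule ennreal_leI)
  moreover have "Lp_norm sphere_measure (ennreal Q) f = ennreal (enn2real I powr (1 / Q))"
  unfolding Lp_norm_def Let_def using fin Q unfolding I_def by simp
  ultimately show ?thesis by simp
qed

text \<open>The factor from \<open>nikolskii\<close> is at most a power of \<open>k\<close>, and
  \<open>k <= exp s\<close>.\<close>
lemma sup_bound_of_even_norm:
  fixes f :: "'d::finite cfun"
  assumes d: "CARD('d) >= 2" and f: "polydeg (2 * N) f" and z: "norm z = 1" and k: "k >= 2"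
  and N: "real N <= C * real k" and C: "C > 0" and s: "s = nat \<lceil>ln (real k)\<rceil>" and \<beta>: "\<beta> >= 0"
  and int: "spint (\<lambda>z. norm (f z) ^ (2 * s)) <= \<beta> ^ (2 * s)"
  shows "norm (f z) <= (1 + 2 * (2 * C + real (real_dim TYPE('d))) ^ real_dim TYPE('d) / sphere_area TYPE('d))
  * exp (real (real_dim TYPE('d))) * \<beta>"
proof -
  let ?\<sigma> = "sphere_area TYPE('d)"
  have \<sigma>: "?\<sigma> > 0" by (rule sphere_measure_pos)
  define D where "D = real_dim TYPE('d)"
  have D1: "D >= 1" "s * (2 * N) + 2 * CARD('d) - 1 = s * (2 * N) + D" using d by (simp_all add: D_def)
  define A where "A = 1 + 2 * (2 * C + real D) ^ D / ?\<sigma>"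
  have A: "A >= 1" unfolding A_def using C \<sigma> by simp
  have lk: "ln (real k) > 0" "ln (real k) <= real k - 1" using k by (auto intro: ln_le_minus_one)
  have s1: "s >= 1" "ln (real k) <= real s" "real s <= real k" using lk unfolding s by linarith+
  have card: "real (card (upto_level (s * (2 * N)) :: 'd cfun set)) / ?\<sigma> <= A * real k ^ (2 * D)"
  proof -
  let ?m = "s * (2 * N)"
  have "real (card (upto_level ?m :: 'd cfun set)) <= real (2 * ((?m + D) choose ?m))"
   using card_upto_level[where 'd = 'd and N = ?m] unfolding D1 of_nat_le_iff .
  also have "... <= 2 * (real (?m + D) ^ D / fact D)" using binomial_le_power_fact[of ?m D] by simp
  also have "... <= 2 * (real (?m + D) ^ D / 1)" by (intro mult_left_mono divide_left_mono) (auto simp: fact_ge_1)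
  also have "... <= 2 * ((2 * C + real D) * (real k)\<^sup>2) ^ D"
  proof -
   have "real s * real N <= real k * (C * real k)" using s1(3) N by (intro mult_mono) auto
   moreover have "real D * 1 <= real D * (real k)\<^sup>2" using k by (intro mult_left_mono) auto
   ultimately have "2 * (real s * real N) + real D * 1 <= 2 * (real k * (C * real k)) + real D * (real k)\<^sup>2"
    by linarith
   moreover have "2 * (real k * (C * real k)) + real D * (real k)\<^sup>2 = (2 * C + real D) * (real k)\<^sup>2"
    by (simp add: algebra_simps power2_eq_square)
   ultimately have "real (?m + D) <= (2 * C + real D) * (real k)\<^sup>2" by (simp add: mult_ac)
   then show ?thesis unfolding div_by_1 by (intro mult_left_mono power_mono) auto
  qed
  also have "... = 2 * (2 * C + real D) ^ D * real k ^ (2 * D)" by (simp add: power_mult_distrib power_mult)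
  finally have "real (card (upto_level ?m :: 'd cfun set)) / ?\<sigma> <= 2 * (2 * C + real D) ^ D * real k ^ (2 * D) / ?\<sigma>"
   using \<sigma> by (intro divide_right_mono) auto
  also have "... = 2 * (2 * C + real D) ^ D / ?\<sigma> * real k ^ (2 * D)" by simp
  also have "... <= A * real k ^ (2 * D)" unfolding A_def by (intro mult_right_mono) auto
  finally show ?thesis .
  qed
  also have "... <= A ^ (2 * s) * exp (real D) ^ (2 * s)"
  proof (rule mult_mono)
  show "A <= A ^ (2 * s)" using A s1(1) by (intro self_le_power) auto
  have "real k <= exp (real s)" using s1(2) k by (metis exp_le_cancel_iff exp_ln of_nat_0_less_iff order_less_le_trans pos2)
  then have "real k ^ (2 * D) <= exp (real s) ^ (2 * D)" by (intro power_mono) auto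
  also have "... = exp (real D) ^ (2 * s)" by (simp add: exp_of_nat_mult[symmetric] mult_ac)
  finally show "real k ^ (2 * D) <= exp (real D) ^ (2 * s)" .
  qed (use A in auto)
  finally have card': "real (card (upto_level (s * (2 * N)) :: 'd cfun set)) / ?\<sigma> <= A ^ (2 * s) * exp (real D) ^ (2 * s)" .
  have "norm (f z) ^ (2 * s) <= real (card (upto_level (s * (2 * N)) :: 'd cfun set)) / ?\<sigma>
   * spint (\<lambda>z. norm (f z) ^ (2 * s))" by (rule nikolskii[OF f z])
  also have "... <= (A ^ (2 * s) * exp (real D) ^ (2 * s)) * \<beta> ^ (2 * s)"
  using A by (intro mult_mono card' int) auto
  also have "... = (A * exp (real D) * \<beta>) ^ (2 * s)" by (simp only: power_mult_distrib)
  finally have le: "norm (f z) ^ (2 * s) <= (A * exp (real D) * \<beta>) ^ (2 * s)" .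
  have "norm (f z) <= A * exp (real D) * \<beta>"
  proof (rule ccontr)
  assume "\<not> norm (f z) <= A * exp (real D) * \<beta>"
  then have "(A * exp (real D) * \<beta>) ^ (2 * s) < norm (f z) ^ (2 * s)"
   using A \<beta> s1(1) by (intro power_strict_mono) auto
  then show False using le by linarith
  qed
  then show ?thesis unfolding A_def D_def .
qed

theorem theorem3p8:
  fixes \<gamma> r :: real and p :: ennreal
  assumes "CARD('d::finite) \<ge> 2"
    and "\<gamma> > 0" and "0 < r" and "r \<le> 1"
    and "1 \<le> p"
  shows "\<exists>C>0. \<forall>q::ennreal. \<forall>k::nat. 2 \<le> q \<longrightarrow> 2 \<le> k \<longrightarrow>
    kolmogorov_width k
      (multiplier_operator (exp_multiplier \<gamma> r) `
         Lp_unit_ball (sphere_measure :: (complex ^ 'd) measure) p)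
      sphere_measure q
    \<le> ennreal (C
        * exp (- rate_const CARD('d) \<gamma> r * real k powr (r / real (2 * CARD('d) - 1)))
        * real k powr ((1 - r / real (2 * CARD('d) - 1)) * pos_part (enn2real (1 / p) - 1 / 2))
        * (if q = \<infinity> then (ln (real k)) powr (1 / 2) else enn2real q powr (1 / 2)))"
proof -
  let ?\<sigma> = "sphere_area TYPE('d)" and ?D = "real_dim TYPE('d)" and ?\<rho> = "width_rate TYPE('d) \<gamma> r p"
  let ?lam = "\<lambda>l::nat. exp (- \<gamma> * real l powr r)"
  have \<sigma>: "?\<sigma> > 0" by (rule sphere_measure_pos)
  obtain C0 where C0: "C0 > 0" and app: "\<forall>k\<ge>2. \<forall>s\<ge>1. approximable TYPE('d) \<gamma> r p C0 k s"
  using approximation[OF assms] by (elim exE conjE)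
  define A where "A = (1 + 2 * (2 * C0 + real ?D) ^ ?D / ?\<sigma>) * exp (real ?D)"
  have "2 * C0 + real ?D >= 0" by (rule add_nonneg_nonneg[OF _ of_nat_0_le_iff]) (use C0 in simp)
  then have A: "A > 0" unfolding A_def using \<sigma>
  by (intro mult_pos_pos add_pos_nonneg divide_nonneg_pos mult_nonneg_nonneg zero_le_power) auto
  define C where "C = 2 * (1 + 2 * ?\<sigma>) * C0 + 2 * (A + 1) * C0"
  have C: "C > 0" "2 * (1 + 2 * ?\<sigma>) * C0 <= C" "2 * (A + 1) * C0 <= C"   proof -
  have "2 * (1 + 2 * ?\<sigma>) * C0 > 0" "2 * (A + 1) * C0 > 0" using C0 A \<sigma> by (auto intro!: mult_pos_pos add_pos_pos)
  then show "C > 0" "2 * (1 + 2 * ?\<sigma>) * C0 <= C" "2 * (A + 1) * C0 <= C" unfolding C_def by linarith+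
  qed
  have sm: "summable (\<lambda>l. ?lam l * real (card (level l :: 'd cfun set)))"
  by (rule summable_level_mass[OF assms(2-4)])
  have L: "exp_multiplier \<gamma> r m n = of_real (?lam (m + n))" for m n by (simp add: exp_multiplier_def)
  have main: "kolmogorov_width k (multiplier_operator (exp_multiplier \<gamma> r) ` Lp_unit_ball (sphere_measure :: (complex ^ 'd) measure) p) sphere_measure q
   <= ennreal (C * ?\<rho> k * (if q = \<infinity> then (ln (real k)) powr (1 / 2) else enn2real q powr (1 / 2)))"
  if q: "2 <= q" and k: "2 <= k" for q :: ennreal and k :: nat
  proof -
  have \<rho>: "?\<rho> k > 0" unfolding width_rate_def using k by simp
  (* For q = \<infinity> the exponent must be of order ln k: then k^(1/s) stays bounded while s^(1/2) is affordable. *)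
  define s where "s = (if q = \<infinity> then nat \<lceil>ln (real k)\<rceil> else nat \<lceil>enn2real q / 2\<rceil>)"
  have lk: "ln (real k) >= 1 / 3"
  proof -
   have "ln 2 <= ln (real k)" using k by simp
   then show ?thesis using ln2_ge_two_thirds by simp
  qed
  have Q: "q = ennreal (enn2real q) \<and> enn2real q >= 2" if fin: "q ~= \<infinity>"
  proof -
   obtain x where x: "q = ennreal x" "x >= 0" using fin by (cases q rule: ennreal_cases) auto
   have "ennreal 2 <= ennreal x" using q x(1) by simp
   then have "2 <= x" using x(2) by (simp only: ennreal_le_iff)
   then show ?thesis using x by simp
  qed
  have s: "s >= 1" using lk Q unfolding s_def by (auto simp: le_nat_iff le_ceiling_iff)
  define \<beta> where "\<beta> = C0 * sqrt (real s) * ?\<rho> k"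
  have "sqrt (real s) >= 1" using s by simp
  then have "C0 * 1 * ?\<rho> k <= \<beta>" unfolding \<beta>_def using C0 \<rho> by (intro mult_right_mono mult_left_mono) auto
  then have \<beta>: "\<beta> > 0" "C0 * ?\<rho> k <= \<beta>" using mult_pos_pos[OF C0 \<rho>] by simp_all
  obtain N and b :: "nat => 'd cfun" where N: "real N <= C0 * real k" and b: "\<forall>i<k. continuous_on UNIV (b i)"
   "\<forall>c :: nat => complex. (AE x in sphere_measure. (\<Sum>i<k. c i * b i x) = 0) --> (\<forall>i<k. c i = 0)"
   and ap: "\<forall>\<phi>\<in>Lp_unit_ball sphere_measure p. \<exists>c f1 f2. polydeg (2 * N) f1 \<and>
    (\<forall>z. norm z = 1 --> multiplier_series ?lam \<phi> z = (\<Sum>i<k. c i * b i z) + f1 z + f2 z \<and> norm (f2 z) <= C0 * ?\<rho> k) \<and>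
    spint (\<lambda>z. norm (f1 z) ^ (2 * s)) <= \<beta> ^ (2 * s)"
   using app[rule_format, OF k s] unfolding approximable_def \<beta>_def by (elim exE conjE)
  show ?thesis
  proof (rule kolmogorov_width_le[OF b])
   show "q ~= 0" using q by auto
   fix \<psi> assume "\<psi> \<in> multiplier_operator (exp_multiplier \<gamma> r) ` Lp_unit_ball (sphere_measure :: (complex ^ 'd) measure) p"
   then obtain \<phi> where \<psi>: "\<psi> = multiplier_operator (exp_multiplier \<gamma> r) \<phi>" and \<phi>: "\<phi> \<in> Lp_unit_ball sphere_measure p" by (rule imageE)
   note \<phi>i = unit_ball_integrable(1)[OF \<phi> assms(5)]
   have nn: "?lam l >= 0" for l by simp
   have ae: "AE z in sphere_measure. \<psi> z = multiplier_series ?lam \<phi> z" and meas: "\<psi> \<in> borel_measurable sphere_measure"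
    unfolding \<psi> by (rule multiplier_operator_AE[where lam = ?lam, OF \<phi>i nn sm L])+
   obtain c f1 f2 where f1: "polydeg (2 * N) f1"
    and eq: "\<forall>z. norm z = 1 --> multiplier_series ?lam \<phi> z = (\<Sum>i<k. c i * b i z) + f1 z + f2 z \<and> norm (f2 z) <= C0 * ?\<rho> k"
    and int: "spint (\<lambda>z. norm (f1 z) ^ (2 * s)) <= \<beta> ^ (2 * s)"
    using bspec[OF ap \<phi>] by (elim exE conjE)
   define f where "f = (\<lambda>z. \<psi> z - (\<Sum>i<k. c i * b i z))"
   have fm: "f \<in> borel_measurable sphere_measure" unfolding f_def using b(1)
    by (intro borel_measurable_diff meas borel_measurable_sum borel_measurable_times borel_measurable_const
      borel_measurable_sphere borel_measurable_continuous_onI) auto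
   have fae: "AE z in sphere_measure. f z = f1 z + f2 z"
    using ae by (elim AE_mp, intro AE_I2 impI) (use eq in \<open>auto simp: f_def space_sphere_measure\<close>)
   have f2: "norm (f2 z) <= C0 * ?\<rho> k" if "norm z = 1" for z using eq that by blast
   have "Lp_norm sphere_measure q f <= ennreal (C * ?\<rho> k * (if q = \<infinity> then (ln (real k)) powr (1 / 2) else enn2real q powr (1 / 2)))"
   proof (cases "q = \<infinity>")
    case False
    let ?Q = "enn2real q"
    have sQ: "s = nat \<lceil>?Q / 2\<rceil>" unfolding s_def by (rule if_not_P[OF False])
    have Qs: "?Q <= 2 * real s" "real s <= ?Q" unfolding sQ using Q[OF False, THEN conjunct2] by linarith+
    have "Lp_norm sphere_measure (ennreal ?Q) f <= ennreal (2 * (1 + 2 * ?\<sigma>) * \<beta>)"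
     using Q[OF False] Qs(1) \<beta> f2
     by (intro Lp_norm_le_of_even_norm[OF fm fae polydeg_continuous[OF f1] int]) (auto intro: order_trans)
    also have "... <= ennreal (C * ?\<rho> k * ?Q powr (1 / 2))"
    proof (rule ennreal_leI)
     have "sqrt (real s) <= ?Q powr (1 / 2)" using Qs(2) Q[OF False] by (simp add: powr_half_sqrt)
     then have "2 * (1 + 2 * ?\<sigma>) * C0 * ?\<rho> k * sqrt (real s) <= C * ?\<rho> k * ?Q powr (1 / 2)"
      using C \<rho> by (intro mult_mono mult_right_mono) auto
     then show "2 * (1 + 2 * ?\<sigma>) * \<beta> <= C * ?\<rho> k * ?Q powr (1 / 2)" unfolding \<beta>_def by (simp only: mult_ac)
    qed
    finally show ?thesis using False Q[OF False] by simp
   next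
    case True
    let ?l = "ln (real k)"
    have "real s <= 4 * ?l" unfolding s_def if_P[OF True] using lk by linarith
    then have "sqrt (real s) <= sqrt (4 * ?l)" by (rule real_sqrt_le_mono)
    also have "... = 2 * ?l powr (1 / 2)" using lk by (simp add: real_sqrt_mult powr_half_sqrt)
    finally have sl: "sqrt (real s) <= 2 * ?l powr (1 / 2)" .
    have bound: "norm (f1 z + f2 z) <= C * ?\<rho> k * ?l powr (1 / 2)" if z: "norm z = 1" for z
    proof -
     have sk: "s = nat \<lceil>ln (real k)\<rceil>" using True by (simp add: s_def)
     have "norm (f1 z) <= A * \<beta>"
      unfolding A_def by (rule sup_bound_of_even_norm[OF assms(1) f1 z k N C0 sk _ int]) (use \<beta> in simp)
     then have "norm (f1 z + f2 z) <= (A + 1) * \<beta>"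
      using norm_triangle_ineq[of "f1 z" "f2 z"] f2[OF z] \<beta>(2) by (simp add: distrib_right)
     also have "... = (A + 1) * C0 * ?\<rho> k * sqrt (real s)" unfolding \<beta>_def by (simp only: mult_ac)
     also have "... <= (A + 1) * C0 * ?\<rho> k * (2 * ?l powr (1 / 2))"
      using sl A C0 \<rho> by (intro mult_left_mono) auto
     also have "... = 2 * (A + 1) * C0 * (?\<rho> k * ?l powr (1 / 2))" by (simp only: mult_ac)
     also have "... <= C * (?\<rho> k * ?l powr (1 / 2))" using C(3) \<rho> by (intro mult_right_mono) auto
     finally show ?thesis by (simp only: mult.assoc)
    qed
    have "esssup sphere_measure (\<lambda>x. ennreal (norm (f x))) <= ennreal (C * ?\<rho> k * ?l powr (1 / 2))"
    proof (rule esssup_I)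
     show "(\<lambda>x. ennreal (norm (f x))) \<in> borel_measurable sphere_measure" using fm by measurable
     show "AE x in sphere_measure. ennreal (norm (f x)) <= ennreal (C * ?\<rho> k * ?l powr (1 / 2))"
      using fae by (elim AE_mp, intro AE_I2 impI) (use bound in \<open>auto simp: space_sphere_measure intro!: ennreal_leI\<close>)
    qed
    then show ?thesis using True by (simp add: Lp_norm_def)
   qed
   then show "\<exists>c. Lp_norm sphere_measure q (\<lambda>z. \<psi> z - (\<Sum>i<k. c i * b i z))
     <= ennreal (C * ?\<rho> k * (if q = \<infinity> then (ln (real k)) powr (1 / 2) else enn2real q powr (1 / 2)))"
    unfolding f_def by (rule exI[of _ c])
  qed
  qed
  show ?thesis by (rule exI[of _ C], intro conjI C(1) allI impI)
   (use main in \<open>simp only: width_rate_def mult.assoc\<close>)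
qed

end
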